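(* For every integer $D\ge 1$ there is a constant $C_D>0$ such that the following holds. Let $G=(V,E)$ be a finite simple graph with maximum degree at most $D$ and genus $g\ge 1$, and let $\delta\Omega\subseteq V$ be a boundary set with $|\delta\Omega|\ge 2$. Then $$\lambda_2(G,\delta\Omega)\le C_D\,\frac{g}{|\delta\Omega|}.$$
   Context: A graph with boundary is a finite simple undirected graph $G=(V,E)$ together with a nonempty subset $\delta\Omega\subseteq V$. Its Steklov eigenvalues $0=\lambda_1(G,\delta\Omega)\le\lambda_2(G,\delta\Omega)\le\dots\le\lambda_{|\delta\Omega|}(G,\delta\Omega)$ are the numbers $\lambda$ for which there is a nonzero $f:V\to\mathbb{R}$ with $\sum_{y:\{x,y\}\in E}(f(x)-f(y))=0$ for $x\in V\setminus\delta\Omega$ and $\sum_{y:\{x,y\}\in E}(f(x)-f(y))=\lambda f(x)$ for $x\in\delta\Omega$. Equivalently, $\lambda_k(G,\delta\Omega)=\min_{W\subseteq\mathbb{R}^V,\ \dim W=k}\max_{f\in W} R(f)$, with $R(f)=\frac{\sum_{\{x,y\}\in E}(f(x)-f(y))^2}{\sum_{x\in\delta\Omega}f(x)^2}$ (the max taken over $f$ not vanishing identically on $\delta\Omega$); in particular $\lambda_2(G,\delta\Omega)=\min\{R(f): f\not\equiv 0 \text{ on }\delta\Omega,\ \sum_{x\in\delta\Omega}f(x)=0\}$. The genus of $G$ is the least $g$ such that $G$ embeds without edge crossings in the closed orientable surface of genus $g$. *)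

theory Defs
  imports "HOL-Analysis.Analysis" "HOL-Library.Function_Algebras"
begin

section \<open>Finite simple graphs\<close>

definition simple_graph :: "'a set \<Rightarrow> 'a set set \<Rightarrow> bool" where
  "simple_graph V E \<longleftrightarrow> finite V \<and> (\<forall>e\<in>E. e \<subseteq> V \<and> card e = 2)"

definition nbrs :: "'a set set \<Rightarrow> 'a \<Rightarrow> 'a set" where
  "nbrs E x = {y. {x, y} \<in> E}"

definition max_degree_le :: "'a set \<Rightarrow> 'a set set \<Rightarrow> nat \<Rightarrow> bool" where
  "max_degree_le V E D \<longleftrightarrow> (\<forall>x\<in>V. card (nbrs E x) \<le> D)"


section \<open>Steklov eigenvalues\<close>

instantiation "fun" :: (type, real_vector) real_vector
begin

definition scaleR_fun :: "real \<Rightarrow> ('a \<Rightarrow> 'b) \<Rightarrow> 'a \<Rightarrow> 'b" where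
  "scaleR_fun c f = (\<lambda>x. c *\<^sub>R f x)"

instance
  by standard (auto simp: scaleR_fun_def fun_eq_iff scaleR_add_right scaleR_add_left)

end

definition laplacian :: "'a set set \<Rightarrow> ('a \<Rightarrow> real) \<Rightarrow> 'a \<Rightarrow> real" where
  "laplacian E f x = (\<Sum>y\<in>nbrs E x. f x - f y)"

definition steklov_solution ::
    "'a set \<Rightarrow> 'a set set \<Rightarrow> 'a set \<Rightarrow> real \<Rightarrow> ('a \<Rightarrow> real) \<Rightarrow> bool" where
  "steklov_solution V E B \<mu> f \<longleftrightarrow>
     (\<forall>x\<in>V - B. laplacian E f x = 0) \<and> (\<forall>x\<in>B. laplacian E f x = \<mu> * f x)"

text \<open>
  The multiplicity of \<open>\<mu>\<close> is the dimension of the space of boundary values of solutions. On a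
  connected graph a solution vanishing on \<open>B \<noteq> {}\<close> vanishes on all of \<open>V\<close>, so this is the dimension
  of the space of solutions. If some component contains no boundary vertex, its indicator function
  solves the equations for every \<open>\<mu>\<close>; passing to boundary values discards these spurious solutions
  and leaves exactly \<open>card B\<close> eigenvalues counted with multiplicity.
\<close>

definition steklov_multiplicity :: "'a set \<Rightarrow> 'a set set \<Rightarrow> 'a set \<Rightarrow> real \<Rightarrow> nat" where
  "steklov_multiplicity V E B \<mu> =
     dim {(\<lambda>x. if x \<in> B then f x else 0) | f. steklov_solution V E B \<mu> f}"

definition steklov_spectrum :: "'a set \<Rightarrow> 'a set set \<Rightarrow> 'a set \<Rightarrow> real list" where
  "steklov_spectrum V E B =
     (THE ls. sorted ls \<and> (\<forall>\<mu>. count_list ls \<mu> = steklov_multiplicity V E B \<mu>))"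

text \<open>Eigenvalues are numbered from 1.\<close>

definition steklov_eigenvalue :: "'a set \<Rightarrow> 'a set set \<Rightarrow> 'a set \<Rightarrow> nat \<Rightarrow> real" where
  "steklov_eigenvalue V E B k = steklov_spectrum V E B ! (k - 1)"


section \<open>Closed orientable surfaces and the genus of a graph\<close>

text \<open>
  For \<open>g \<ge> 1\<close> the closed orientable surface of genus \<open>g\<close> is the closed unit disc, seen as a
  \<open>4g\<close>-gon whose corners are the \<open>4g\<close>-th roots of unity, with its sides glued according to the word
  \<open>a\<^sub>1 b\<^sub>1 a\<^sub>1\<^sup>-\<^sup>1 b\<^sub>1\<^sup>-\<^sup>1 \<dots> a\<^sub>g b\<^sub>g a\<^sub>g\<^sup>-\<^sup>1 b\<^sub>g\<^sup>-\<^sup>1\<close>. For \<open>g = 0\<close> it is the sphere, obtained from the disc by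
  collapsing the boundary circle to a point.
\<close>

definition bdry_point :: "nat \<Rightarrow> real \<Rightarrow> complex" where
  "bdry_point g t = cis (2 * pi * t / (4 * real g))"

definition side_pairs :: "nat \<Rightarrow> (complex \<times> complex) set" where
  "side_pairs g =
     (if g = 0 then sphere 0 1 \<times> sphere 0 1
      else
        {(bdry_point g (4 * real i + s), bdry_point g (4 * real i + 3 - s)) | i s.
           i < g \<and> s \<in> {0..1}} \<union>
        {(bdry_point g (4 * real i + 1 + s), bdry_point g (4 * real i + 4 - s)) | i s.
           i < g \<and> s \<in> {0..1}})"

definition gluing :: "nat \<Rightarrow> (complex \<times> complex) set" where
  "gluing g = (side_pairs g \<union> (side_pairs g)\<inverse>)\<^sup>* \<inter> (cball 0 1 \<times> cball 0 1)"

definition genus_surface :: "nat \<Rightarrow> complex set topology" where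
  "genus_surface g =
     topology (\<lambda>U. U \<subseteq> cball 0 1 // gluing g \<and> openin (top_of_set (cball 0 1)) (\<Union>U))"

lemma equiv_gluing: "equiv (cball 0 1) (gluing g)"
proof (rule equivI)
  show "refl_on (cball 0 1) (gluing g)"
    by (auto simp: refl_on_def gluing_def)
  have "sym ((side_pairs g \<union> (side_pairs g)\<inverse>)\<^sup>*)"
    by (intro sym_rtrancl sym_Un_converse)
  then show "sym (gluing g)"
    by (auto simp: gluing_def sym_def)
  show "trans (gluing g)"
    by (auto simp: gluing_def trans_def intro: rtrancl_trans)
  show "gluing g \<subseteq> cball 0 1 \<times> cball 0 1"
    by (auto simp: gluing_def)
qed

lemma openin_genus_surface:
  "openin (genus_surface g) U \<longleftrightarrow>
     U \<subseteq> cball 0 1 // gluing g \<and> openin (top_of_set (cball 0 1)) (\<Union>U)"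
proof -
  let ?Q = "cball 0 1 // gluing g"
  have int: "\<Union>(S \<inter> T) = \<Union>S \<inter> \<Union>T" if "S \<subseteq> ?Q" "T \<subseteq> ?Q" for S T
    using quotient_disj[OF equiv_gluing, of _ g] that by blast
  have un: "\<Union>(\<Union>K) = (\<Union>S\<in>K. \<Union>S)" for K :: "complex set set set"
    by blast
  have "istopology (\<lambda>U. U \<subseteq> ?Q \<and> openin (top_of_set (cball 0 1)) (\<Union>U))"
    unfolding istopology_def
  proof (intro conjI allI impI; (elim conjE)?)
    fix S T
    assume "S \<subseteq> ?Q" "T \<subseteq> ?Q" "openin (top_of_set (cball 0 1)) (\<Union>S)"
      "openin (top_of_set (cball 0 1)) (\<Union>T)"
    then show "openin (top_of_set (cball 0 1)) (\<Union>(S \<inter> T))"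
      using int by (metis openin_Int)
  next
    fix K
    assume "\<forall>S\<in>K. S \<subseteq> ?Q \<and> openin (top_of_set (cball 0 1)) (\<Union>S)"
    then show "openin (top_of_set (cball 0 1)) (\<Union>(\<Union>K))"
      unfolding un by (intro openin_Union) auto
  qed blast+
  then show ?thesis
    by (simp add: genus_surface_def)
qed

lemma topspace_genus_surface: "topspace (genus_surface g) = cball 0 1 // gluing g"
proof -
  have "openin (genus_surface g) (cball 0 1 // gluing g)"
    by (simp add: openin_genus_surface Union_quotient[OF equiv_gluing])
  moreover have "U \<subseteq> cball 0 1 // gluing g" if "openin (genus_surface g) U" for U
    using that by (simp add: openin_genus_surface)
  ultimately show ?thesis
    unfolding topspace_def by blast
qed

lemma quotient_map_genus_surface:
  "quotient_map (top_of_set (cball 0 1)) (genus_surface g) (\<lambda>z. gluing g `` {z})"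
  unfolding quotient_map_def
proof (intro conjI allI impI)
  show "(\<lambda>z. gluing g `` {z}) ` topspace (top_of_set (cball 0 1)) = topspace (genus_surface g)"
    by (auto simp: topspace_genus_surface quotient_def)
  fix U
  assume U: "U \<subseteq> topspace (genus_surface g)"
  have "{x \<in> topspace (top_of_set (cball 0 1)). gluing g `` {x} \<in> U} = \<Union>U"
  proof (intro equalityI subsetI)
    fix x
    assume "x \<in> {x \<in> topspace (top_of_set (cball 0 1)). gluing g `` {x} \<in> U}"
    then show "x \<in> \<Union>U"
      using equiv_class_self[OF equiv_gluing, of x g] by auto
  next
    fix x
    assume "x \<in> \<Union>U"
    then obtain u where u: "u \<in> U" "x \<in> u"
      by blast
    then have q: "u \<in> cball 0 1 // gluing g"
      using U by (auto simp: topspace_genus_surface)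
    then obtain z where z: "u = gluing g `` {z}"
      by (auto simp: quotient_def)
    with u have zx: "(z, x) \<in> gluing g"
      by simp
    then have "gluing g `` {x} = u"
      using z equiv_class_eq[OF equiv_gluing zx] by simp
    moreover have "x \<in> cball 0 1"
      using zx by (auto simp: gluing_def)
    ultimately show "x \<in> {x \<in> topspace (top_of_set (cball 0 1)). gluing g `` {x} \<in> U}"
      using u by simp
  qed
  then show "openin (top_of_set (cball 0 1))
      {x. x \<in> topspace (top_of_set (cball 0 1)) \<and> gluing g `` {x} \<in> U} =
    openin (genus_surface g) U"
    using U by (simp add: openin_genus_surface topspace_genus_surface)
qed

definition embeds_in :: "'a set \<Rightarrow> 'a set set \<Rightarrow> 'b topology \<Rightarrow> bool" where
  "embeds_in V E X \<longleftrightarrow>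
     (\<exists>(p :: 'a \<Rightarrow> 'b) (\<gamma> :: 'a set \<Rightarrow> real \<Rightarrow> 'b).
        p ` V \<subseteq> topspace X \<and> inj_on p V \<and>
        (\<forall>e\<in>E. pathin X (\<gamma> e) \<and> inj_on (\<gamma> e) {0..1} \<and> {\<gamma> e 0, \<gamma> e 1} = p ` e \<and>
               \<gamma> e ` {0<..<1} \<inter> p ` V = {}) \<and>
        (\<forall>e\<in>E. \<forall>e'\<in>E. e \<noteq> e' \<longrightarrow> \<gamma> e ` {0<..<1} \<inter> \<gamma> e' ` {0<..<1} = {}))"

definition has_genus :: "'a set \<Rightarrow> 'a set set \<Rightarrow> nat \<Rightarrow> bool" where
  "has_genus V E g \<longleftrightarrow>
     embeds_in V E (genus_surface g) \<and> (\<forall>h<g. \<not> embeds_in V E (genus_surface h))"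

end

theory Submission
  imports Defs
begin

text \<open>
  By the variational principle it suffices to find two functions with disjoint supports and small
  Rayleigh quotients. The only topological input is that the minors of a graph embedded in the surface of
  genus \<open>g\<close> on \<open>k\<close> vertices have at most \<open>3 * k + 6 * g\<close> edges: branch sets, thickened to cells of a fine
  polygonal mesh of the surface, give a minor of the mesh, whose faces are counted explicitly.

  Maximising the number of routed pairs of \<open>B\<close> against the quadratic congestion yields vertex weights \<open>\<nu>\<close>
  that keep most pairs of \<open>B\<close> at distance at least a fixed fraction of \<open>Q\<close>, with \<open>\<Sum>\<nu>\<^sup>2\<close> at most a
  constant times \<open>g * Q\<^sup>2\<close>; the crossing-number argument for randomly sampled demands provides the bound.
  Four rounds of chopping into annuli in the sense of Klein, Plotkin and Rao then produce clusters, none of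
  which contains many pairwise distant points, since these would form a \<open>K\<^bsub>4,N\<^esub>\<close> minor. Hence the clusters can
  be divided into two groups that both carry a quarter of \<open>B\<close>, and the truncated distances to the boundaries
  of the clusters of the two groups are the test functions.
\<close>

section \<open>Connected sets and dense minors\<close>

text \<open>The arcs of an embedding are merely continuous, so the faces of the drawing are never
  counted. What always holds is that finitely many disjoint compact sets keep a positive distance,
  and this suffices to copy them into a fine mesh. The quantitative scheme, with
  \<open>n = card B\<close>: a sample of \<open>25 * K\<close> sources and sinks, \<open>K\<close> a
  large multiple of \<open>g\<close>, would yield a minor with too many edges if more than
  \<open>n\<^sup>2 / K\<close> pairs were routed. So few pairs of \<open>B\<close> are close for the
  weights, a typical ball holds only a small multiple of \<open>n / g\<close> points, and a cluster
  covered by O(g) such balls carries at most \<open>n / 4\<close>. Weights sit on vertices because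
  congestion is counted there; edges enter only through the degree bound \<open>D\<close>. The width
  of the annuli and the height \<open>\<tau>\<close> of the test functions are fixed fractions of
  \<open>Q\<close>, so the Rayleigh quotient is of order
  \<open>D * g * Q\<^sup>2 / (\<tau>\<^sup>2 * n)\<close>, that is \<open>D * g / n\<close>.\<close>

definition conn :: "('v \<Rightarrow> 'v \<Rightarrow> bool) \<Rightarrow> 'v set \<Rightarrow> bool" where
  "conn adj U \<longleftrightarrow> (\<forall>x\<in>U. \<forall>y\<in>U. (\<lambda>a b. adj a b \<and> a \<in> U \<and> b \<in> U)\<^sup>*\<^sup>* x y)"

lemma conn_cut:
  assumes "conn adj U" "P \<subseteq> U" "x \<in> P" "y \<in> U - P"
  shows "\<exists>a\<in>P. \<exists>b\<in>U - P. adj a b"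
proof (rule ccontr)
  assume no: "\<not> ?thesis"
  have "(\<lambda>a b. adj a b \<and> a \<in> U \<and> b \<in> U)\<^sup>*\<^sup>* x y"
    using assms unfolding conn_def by blast
  then have "y \<in> P"
    by (induction rule: rtranclp_induct) (use no assms(3) in blast)+
  then show False using assms by blast
qed

lemma connI_cut:
  assumes "\<And>P. P \<subseteq> U \<Longrightarrow> P \<noteq> {} \<Longrightarrow> P \<noteq> U \<Longrightarrow> \<exists>a\<in>P. \<exists>b\<in>U - P. adj a b"
  shows "conn adj U"
  unfolding conn_def
proof (intro ballI)
  fix x y assume xy: "x \<in> U" "y \<in> U"
  define P where "P = {z \<in> U. (\<lambda>a b. adj a b \<and> a \<in> U \<and> b \<in> U)\<^sup>*\<^sup>* x z}"
  have "P = U"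
  proof (rule ccontr)
    assume "P \<noteq> U"
    moreover have "P \<subseteq> U" "P \<noteq> {}" using xy by (auto simp: P_def)
    ultimately obtain a b where "a \<in> P" "b \<in> U - P" "adj a b" using assms[of P] by blast
    then have "b \<in> P" unfolding P_def by (auto intro: rtranclp.rtrancl_into_rtrancl)
    then show False using \<open>b \<in> U - P\<close> by blast
  qed
  then show "(\<lambda>a b. adj a b \<and> a \<in> U \<and> b \<in> U)\<^sup>*\<^sup>* x y" using xy by (auto simp: P_def)
qed

lemma conn_mono_steps:
  assumes "(\<lambda>a b. adj a b \<and> a \<in> U \<and> b \<in> U)\<^sup>*\<^sup>* x y" "U \<subseteq> W"
  shows "(\<lambda>a b. adj a b \<and> a \<in> W \<and> b \<in> W)\<^sup>*\<^sup>* x y"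
  using assms(1) by (rule rtranclp_mono[THEN predicate2D, rotated]) (use assms(2) in blast)

lemma conn_empty [simp]: "conn adj {}" and conn_singleton [simp]: "conn adj {x}"
  by (auto simp: conn_def)

lemma conn_star:
  assumes "symp adj" "\<And>y. y \<in> U \<Longrightarrow> (\<lambda>a b. adj a b \<and> a \<in> U \<and> b \<in> U)\<^sup>*\<^sup>* x y"
  shows "conn adj U"
  unfolding conn_def
proof (intro ballI)
  fix y z assume "y \<in> U" "z \<in> U"
  moreover have "symp (\<lambda>a b. adj a b \<and> a \<in> U \<and> b \<in> U)"
    using assms(1) by (auto simp: symp_def)
  ultimately show "(\<lambda>a b. adj a b \<and> a \<in> U \<and> b \<in> U)\<^sup>*\<^sup>* y z"
    using assms(2) by (meson rtranclp_trans symp_rtranclp sympD)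
qed

lemma conn_UN:
  assumes "symp adj" "\<And>i. i \<in> I \<Longrightarrow> conn adj (U i)" "\<And>i. i \<in> I \<Longrightarrow> x \<in> U i"
  shows "conn adj (\<Union>i\<in>I. U i)"
proof (rule conn_star[OF assms(1), where x = x])
  fix y assume "y \<in> (\<Union>i\<in>I. U i)"
  then obtain i where i: "i \<in> I" "y \<in> U i" by blast
  then have "(\<lambda>a b. adj a b \<and> a \<in> U i \<and> b \<in> U i)\<^sup>*\<^sup>* x y"
    using assms(2,3) unfolding conn_def by blast
  then show "(\<lambda>a b. adj a b \<and> a \<in> (\<Union>i\<in>I. U i) \<and> b \<in> (\<Union>i\<in>I. U i))\<^sup>*\<^sup>* x y"
    by (rule conn_mono_steps) (use i in blast)
qed

lemma conn_Un:
  assumes "symp adj" "conn adj U" "conn adj W" "U \<inter> W \<noteq> {}"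
  shows "conn adj (U \<union> W)"
proof -
  obtain x where "x \<in> U \<inter> W" using assms(4) by blast
  then show ?thesis
    using conn_UN[of adj "{U, W}" "\<lambda>X. X" x] assms by auto
qed

lemma conn_pair: "symp adj \<Longrightarrow> adj a b \<Longrightarrow> conn adj {a, b}"
  by (auto simp: conn_def symp_def)

lemma conn_Un_edge:
  assumes "symp adj" "conn adj U" "conn adj W" "a \<in> U" "b \<in> W" "adj a b"
  shows "conn adj (U \<union> W)"
proof -
  have "conn adj (U \<union> {a, b})"
    by (rule conn_Un[OF assms(1,2) conn_pair[OF assms(1,6)]]) (use assms in auto)
  then have "conn adj (U \<union> {a, b} \<union> W)"
    by (rule conn_Un[OF assms(1) _ assms(3)]) (use assms in auto)
  moreover have "U \<union> {a, b} \<union> W = U \<union> W" using assms by auto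
  ultimately show ?thesis by simp
qed

definition component :: "('v \<Rightarrow> 'v \<Rightarrow> bool) \<Rightarrow> 'v set \<Rightarrow> 'v \<Rightarrow> 'v set" where
  "component adj S x = {y \<in> S. (\<lambda>a b. adj a b \<and> a \<in> S \<and> b \<in> S)\<^sup>*\<^sup>* x y}"

lemma component_self: "x \<in> S \<Longrightarrow> x \<in> component adj S x"
  by (simp add: component_def)

lemma component_subset: "component adj S x \<subseteq> S"
  by (auto simp: component_def)

lemma component_step:
  "y \<in> component adj S x \<Longrightarrow> adj y z \<Longrightarrow> z \<in> S \<Longrightarrow> z \<in> component adj S x"
  unfolding component_def by (auto intro: rtranclp.rtrancl_into_rtrancl)

lemma conn_component:
  assumes "symp adj" shows "conn adj (component adj S x)"
proof (cases "x \<in> S")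
  case True
  show ?thesis
  proof (rule conn_star[OF assms, where x = x])
    fix y assume "y \<in> component adj S x"
    then have "(\<lambda>a b. adj a b \<and> a \<in> S \<and> b \<in> S)\<^sup>*\<^sup>* x y" by (simp add: component_def)
    then show "(\<lambda>a b. adj a b \<and> a \<in> component adj S x \<and> b \<in> component adj S x)\<^sup>*\<^sup>* x y"
    proof (induction rule: rtranclp_induct)
      case (step y z)
      have "y \<in> component adj S x" using step by (auto simp: component_def)
      moreover have "z \<in> component adj S x" using calculation step component_step by metis
      ultimately show ?case using step by (auto intro: rtranclp.rtrancl_into_rtrancl)
    qed simp
  qed
next
  case False
  have "component adj S x = {}"
  proof -
    have "y \<notin> S" if "(\<lambda>a b. adj a b \<and> a \<in> S \<and> b \<in> S)\<^sup>*\<^sup>* x y" for y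
      using that by (cases rule: converse_rtranclpE) (use False in auto)
    then show ?thesis unfolding component_def by blast
  qed
  then show ?thesis by simp
qed

lemma component_eq:
  assumes "symp adj" "y \<in> component adj S x"
  shows "component adj S y = component adj S x"
proof -
  let ?r = "(\<lambda>a b. adj a b \<and> a \<in> S \<and> b \<in> S)\<^sup>*\<^sup>*"
  have s: "symp ?r" by (rule symp_rtranclp) (use assms(1) in \<open>auto simp: symp_def\<close>)
  have "?r x y" using assms(2) by (simp add: component_def)
  moreover have "?r y x" using calculation s by (simp add: symp_def)
  ultimately have "?r y z \<longleftrightarrow> ?r x z" for z by (blast intro: rtranclp_trans)
  then show ?thesis unfolding component_def by blast
qed

section \<open>Vertex-weighted distances in a connected set\<close>

text \<open>A walk is charged for every vertex it enters, so the root is free; the weight of the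
  root therefore returns as an extra term whenever the distance is compared with the weight of a
  set.\<close>

inductive wreach :: "('v \<Rightarrow> 'v \<Rightarrow> bool) \<Rightarrow> ('v \<Rightarrow> nat) \<Rightarrow> 'v set \<Rightarrow> 'v \<Rightarrow> 'v \<Rightarrow> nat \<Rightarrow> bool"
  for adj \<nu> U r where
  wreach_root: "wreach adj \<nu> U r r 0"
| wreach_step: "wreach adj \<nu> U r x L \<Longrightarrow> adj x y \<Longrightarrow> y \<in> U \<Longrightarrow> wreach adj \<nu> U r y (L + \<nu> y)"

text \<open>\<open>\<rho>\<close> is the least weight of a walk from \<open>r\<close> inside
  \<open>U\<close>, and the parent of a vertex is the last but one vertex of an optimal walk. All
  later arguments about distances use these three properties alone.\<close>

lemma conn_dist:
  fixes adj :: "'v \<Rightarrow> 'v \<Rightarrow> bool"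
  assumes "conn adj U" "r \<in> U"
  obtains \<rho> :: "'v \<Rightarrow> nat" where "\<rho> r = 0"
    "\<And>x y. x \<in> U \<Longrightarrow> y \<in> U \<Longrightarrow> adj x y \<Longrightarrow> \<rho> y \<le> \<rho> x + \<nu> y"
    "\<And>x. x \<in> U \<Longrightarrow> x \<noteq> r \<Longrightarrow> \<exists>y\<in>U. adj y x \<and> \<rho> x = \<rho> y + \<nu> x"
proof -
  define \<rho> where "\<rho> x = (LEAST L. wreach adj \<nu> U r x L)" for x
  have ex: "\<exists>L. wreach adj \<nu> U r x L" if "x \<in> U" for x
  proof -
    have "(\<lambda>a b. adj a b \<and> a \<in> U \<and> b \<in> U)\<^sup>*\<^sup>* r x" using assms that unfolding conn_def by blast
    then show ?thesis
    proof (induction rule: rtranclp_induct)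
      case base
      show ?case using wreach_root by fast
    next
      case (step y z)
      then obtain L where "wreach adj \<nu> U r y L" by blast
      then have "wreach adj \<nu> U r z (L + \<nu> z)" by (rule wreach_step) (use step in auto)
      then show ?case by blast
    qed
  qed
  have w: "wreach adj \<nu> U r x (\<rho> x)" if "x \<in> U" for x
    using ex[OF that] unfolding \<rho>_def by (rule LeastI_ex)
  have le: "\<rho> x \<le> L" if "wreach adj \<nu> U r x L" for x L
    unfolding \<rho>_def using that by (rule Least_le)
  have lip: "\<rho> y \<le> \<rho> x + \<nu> y" if "x \<in> U" "y \<in> U" "adj x y" for x y
    using le[OF wreach_step[OF w[OF that(1)] that(3,2)]] .
  have par: "\<exists>y\<in>U. adj y x \<and> \<rho> x = \<rho> y + \<nu> x" if x: "x \<in> U" "x \<noteq> r" for x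
    using w[OF x(1)]
  proof (cases rule: wreach.cases)
    case wreach_root then show ?thesis using x by simp
  next
    case (wreach_step y L)
    have yU: "y \<in> U" using wreach_step(2) assms(2) by (cases rule: wreach.cases) auto
    have "\<rho> y \<le> L" by (rule le) (rule wreach_step)
    moreover have "\<rho> x \<le> \<rho> y + \<nu> x" by (rule lip) (use yU x wreach_step in auto)
    ultimately have "\<rho> x = \<rho> y + \<nu> x" using wreach_step(1) by linarith
    then show ?thesis using wreach_step(3) yU by blast
  qed
  have "\<rho> r = 0" using le[OF wreach_root] by simp
  then show thesis by (rule that[OF _ lip par])
qed

text \<open>Two points of \<open>U\<close> are joined by a walk that repeats no vertex, hence costs
  at most the weight of \<open>U\<close>. In place of such walks the proof uses sublevel sets of the
  distance \<open>d\<close> from \<open>x\<close>: weights are positive, so passing from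
  \<open>y\<close> to its parent leaves a sublevel set in which \<open>y\<close> is missing, and the
  weight of \<open>y\<close> pays for the step.\<close>

lemma conn_lipschitz_le_sum:
  fixes adj :: "'v \<Rightarrow> 'v \<Rightarrow> bool" and \<rho> :: "'v \<Rightarrow> nat"
  assumes "conn adj U" "finite U" "x \<in> U" "y \<in> U" "\<And>x. x \<in> U \<Longrightarrow> \<nu> x \<ge> (1::nat)"
    and lip: "\<And>x y. x \<in> U \<Longrightarrow> y \<in> U \<Longrightarrow> adj x y \<Longrightarrow> \<rho> y \<le> \<rho> x + \<nu> y"
  shows "\<rho> y + \<nu> x \<le> \<rho> x + sum \<nu> U"
proof -
  obtain d where d: "d x = 0" "\<And>a b. a \<in> U \<Longrightarrow> b \<in> U \<Longrightarrow> adj a b \<Longrightarrow> d b \<le> d a + \<nu> b"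
    "\<And>y. y \<in> U \<Longrightarrow> y \<noteq> x \<Longrightarrow> \<exists>z\<in>U. adj z y \<and> d y = d z + \<nu> y"
    by (rule conn_dist[OF assms(1,3), of \<nu>]) blast
  have "\<rho> y + \<nu> x \<le> \<rho> x + sum \<nu> {z \<in> U. d z \<le> d y}" if "y \<in> U" for y
    using that
  proof (induction "d y" arbitrary: y rule: less_induct)
    case less
    show ?case
    proof (cases "y = x")
      case True
      have "\<nu> x \<le> sum \<nu> {z \<in> U. d z \<le> d y}"
        by (rule member_le_sum) (use True assms in auto)
      then show ?thesis using True by simp
    next
      case False
      obtain z where z: "z \<in> U" "adj z y" "d y = d z + \<nu> y" using d(3) less False by blast
      then have lt: "d z < d y" using assms(5)[OF less.prems] by simp
      have "\<rho> y \<le> \<rho> z + \<nu> y" using lip z less by blast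
      moreover have "\<rho> z + \<nu> x \<le> \<rho> x + sum \<nu> {w \<in> U. d w \<le> d z}" using less z lt by blast
      moreover have "sum \<nu> {w \<in> U. d w \<le> d z} + \<nu> y \<le> sum \<nu> {w \<in> U. d w \<le> d y}"
      proof -
        have "sum \<nu> {w \<in> U. d w \<le> d z} + \<nu> y = sum \<nu> (insert y {w \<in> U. d w \<le> d z})"
          using assms(2) lt by (subst sum.insert) auto
        also have "\<dots> \<le> sum \<nu> {w \<in> U. d w \<le> d y}"
          by (rule sum_mono2) (use assms(2) lt less in auto)
        finally show ?thesis .
      qed
      ultimately show ?thesis by linarith
    qed
  qed
  from this[OF assms(4)] have "\<rho> y + \<nu> x \<le> \<rho> x + sum \<nu> {z \<in> U. d z \<le> d y}" .
  also have "sum \<nu> {z \<in> U. d z \<le> d y} \<le> sum \<nu> U" by (rule sum_mono2) (use assms(2) in auto)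
  finally show ?thesis by simp
qed

section \<open>The edge bound for minors\<close>

text \<open>Euler's bound for a simple graph on \<open>k \<ge> 3\<close> vertices in genus
  \<open>g\<close> is \<open>3 * k - 6 + 6 * g\<close>; without the \<open>- 6\<close> the
  inequality is correct for every \<open>k\<close>. \<open>M\<close> consists of unordered pairs of
  branch sets, so parallel edges of the contraction count once.\<close>

definition minor_bounded :: "('v \<Rightarrow> 'v \<Rightarrow> bool) \<Rightarrow> 'v set \<Rightarrow> nat \<Rightarrow> bool" where
  "minor_bounded adj V g \<longleftrightarrow>
     (\<forall>\<U> M. (\<forall>U\<in>\<U>. U \<noteq> {} \<and> U \<subseteq> V \<and> conn adj U) \<and> pairwise disjnt \<U> \<and>
        (\<forall>e\<in>M. \<exists>U\<in>\<U>. \<exists>W\<in>\<U>. U \<noteq> W \<and> e = {U, W} \<and> (\<exists>a\<in>U. \<exists>b\<in>W. adj a b)) \<longrightarrow>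
        card M \<le> 3 * card \<U> + 6 * g)"

lemma minor_boundedD:
  assumes "minor_bounded adj V g" "\<And>U. U \<in> \<U> \<Longrightarrow> U \<noteq> {} \<and> U \<subseteq> V \<and> conn adj U"
    "pairwise disjnt \<U>"
    "\<And>e. e \<in> M \<Longrightarrow> \<exists>U\<in>\<U>. \<exists>W\<in>\<U>. U \<noteq> W \<and> e = {U, W} \<and> (\<exists>a\<in>U. \<exists>b\<in>W. adj a b)"
  shows "card M \<le> 3 * card \<U> + 6 * g"
proof (rule assms(1)[unfolded minor_bounded_def, rule_format], intro conjI)
  show "\<forall>U\<in>\<U>. U \<noteq> {} \<and> U \<subseteq> V \<and> conn adj U" using assms(2) by simp
  show "pairwise disjnt \<U>" by (rule assms(3))
  show "\<forall>e\<in>M. \<exists>U\<in>\<U>. \<exists>W\<in>\<U>. U \<noteq> W \<and> e = {U, W} \<and> (\<exists>a\<in>U. \<exists>b\<in>W. adj a b)"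
    by (intro ballI assms(4))
qed

text \<open>The form in which the bound is applied: two indexed families of branch sets and a set
  \<open>H\<close> of required adjacencies. Nonempty disjoint branch sets determine their indices,
  so different elements of \<open>H\<close> give different edges of the minor.\<close>

lemma minor_bounded_bipartite:
  assumes "minor_bounded adj V g" and fin: "finite I" "finite J"
    and A: "\<And>i. i \<in> I \<Longrightarrow> A i \<noteq> {} \<and> A i \<subseteq> V \<and> conn adj (A i)"
    and Y: "\<And>j. j \<in> J \<Longrightarrow> Y j \<noteq> {} \<and> Y j \<subseteq> V \<and> conn adj (Y j)"
    and AA: "\<And>i i'. i \<in> I \<Longrightarrow> i' \<in> I \<Longrightarrow> i \<noteq> i' \<Longrightarrow> A i \<inter> A i' = {}"
    and YY: "\<And>j j'. j \<in> J \<Longrightarrow> j' \<in> J \<Longrightarrow> j \<noteq> j' \<Longrightarrow> Y j \<inter> Y j' = {}"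
    and AY: "\<And>i j. i \<in> I \<Longrightarrow> j \<in> J \<Longrightarrow> A i \<inter> Y j = {}"
    and H: "H \<subseteq> I \<times> J" "\<And>i j. (i, j) \<in> H \<Longrightarrow> \<exists>a\<in>A i. \<exists>b\<in>Y j. adj a b"
  shows "card H \<le> 3 * (card I + card J) + 6 * g"
proof -
  let ?U = "A ` I \<union> Y ` J"
  let ?M = "(\<lambda>(i, j). {A i, Y j}) ` H"
  have "pairwise disjnt ?U"
  proof (rule pairwiseI)
    fix X Z assume "X \<in> ?U" "Z \<in> ?U" "X \<noteq> Z"
    then consider i i' where "i \<in> I" "i' \<in> I" "X = A i" "Z = A i'"
      | j j' where "j \<in> J" "j' \<in> J" "X = Y j" "Z = Y j'"
      | i j where "i \<in> I" "j \<in> J" "X = A i" "Z = Y j"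
      | i j where "i \<in> I" "j \<in> J" "X = Y j" "Z = A i" by blast
    then show "disjnt X Z" unfolding disjnt_def
    proof cases
      case 1 then show "X \<inter> Z = {}" using AA[of i i'] \<open>X \<noteq> Z\<close> by auto
    next
      case 2 then show "X \<inter> Z = {}" using YY[of j j'] \<open>X \<noteq> Z\<close> by auto
    next
      case 3 then show "X \<inter> Z = {}" using AY by auto
    next
      case 4 then show "X \<inter> Z = {}" using AY[of i j] by auto
    qed
  qed
  then have "card ?M \<le> 3 * card ?U + 6 * g"
  proof (rule minor_boundedD[OF assms(1), rotated])
    show "U \<noteq> {} \<and> U \<subseteq> V \<and> conn adj U" if "U \<in> ?U" for U using that A Y by blast
    show "\<exists>U\<in>?U. \<exists>W\<in>?U. U \<noteq> W \<and> e = {U, W} \<and> (\<exists>a\<in>U. \<exists>b\<in>W. adj a b)" if "e \<in> ?M" for e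
  proof -
    obtain i j where ij: "(i, j) \<in> H" "e = {A i, Y j}" using \<open>e \<in> ?M\<close> by auto
    then have "i \<in> I" "j \<in> J" using H by auto
    moreover have "A i \<noteq> Y j" using calculation AY[of i j] A[of i] by force
    ultimately show ?thesis using ij H(2)[OF ij(1)] by blast
  qed
  qed
  moreover have "card ?U \<le> card I + card J"
    using card_Un_le[of "A ` I" "Y ` J"] card_image_le[OF fin(1), of A] card_image_le[OF fin(2),
        of Y]
    by linarith
  moreover have "inj_on (\<lambda>(i, j). {A i, Y j}) H"
  proof (rule inj_onI, clarify)
    fix i j i' j' assume *: "(i, j) \<in> H" "(i', j') \<in> H" "{A i, Y j} = {A i', Y j'}"
    then have m: "i \<in> I" "j \<in> J" "i' \<in> I" "j' \<in> J" using H by auto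
    have "A i \<noteq> Y j'" using AY[OF m(1,4)] A[OF m(1)] by force
    then have "A i = A i'" "Y j = Y j'" using *(3) by (simp_all add: doubleton_eq_iff)
    then show "i = i' \<and> j = j'"
      using AA[OF m(1,3)] YY[OF m(2,4)] A[OF m(1)] Y[OF m(2)] by auto
  qed
  ultimately show ?thesis by (simp add: card_image)
qed

section \<open>Minors of cellular maps\<close>

text \<open>Deleting an edge identifies the faces on its two sides. Each identification redirects
  one class onto another and therefore loses at most one class.\<close>

lemma merge_classes:
  assumes "finite R" "finite Z" "\<And>e. e \<in> R \<Longrightarrow> p e \<in> Z \<and> q e \<in> Z"
  shows "\<exists>\<kappa> :: 'z \<Rightarrow> 'z. (\<forall>e\<in>R. \<kappa> (p e) = \<kappa> (q e)) \<and> card Z \<le> card (\<kappa> ` Z) + card R"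
  using assms(1,3)
proof (induction R rule: finite_induct)
  case empty
  show ?case by (rule exI[of _ id]) simp
next
  case (insert e R)
  then obtain \<kappa> :: "'z \<Rightarrow> 'z" where k: "\<forall>e\<in>R. \<kappa> (p e) = \<kappa> (q e)" "card Z \<le> card (\<kappa> ` Z) + card R"
    by blast
  define \<kappa>' where "\<kappa>' z = (if \<kappa> z = \<kappa> (p e) then \<kappa> (q e) else \<kappa> z)" for z
  have "\<kappa> ` Z - {\<kappa> (p e)} \<subseteq> \<kappa>' ` Z"
  proof
    fix y assume "y \<in> \<kappa> ` Z - {\<kappa> (p e)}"
    then obtain z where "z \<in> Z" "y = \<kappa> z" "\<kappa> z \<noteq> \<kappa> (p e)" by blast
    then show "y \<in> \<kappa>' ` Z" by (intro image_eqI[of _ _ z]) (auto simp: \<kappa>'_def)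
  qed
  then have "card (\<kappa> ` Z - {\<kappa> (p e)}) \<le> card (\<kappa>' ` Z)" using assms(2) by (intro card_mono) auto
  moreover have "card (\<kappa> ` Z) \<le> card (\<kappa> ` Z - {\<kappa> (p e)}) + 1"
    by (simp add: card_Diff_singleton_if) linarith
  ultimately have "card Z \<le> card (\<kappa>' ` Z) + card (insert e R)" using k insert by simp
  moreover have "\<forall>d\<in>insert e R. \<kappa>' (p d) = \<kappa>' (q d)" using k by (auto simp: \<kappa>'_def)
  ultimately show ?case by blast
qed

text \<open>Modulo 2 an edge with both sides, or both ends, in the given set cancels.\<close>

lemma even_sum_of_bool_xor:
  fixes w :: "'l \<Rightarrow> nat"
  assumes "finite L"
  shows "even (\<Sum>e\<in>L. (of_bool (P e) + of_bool (Q e)) * w e) \<longleftrightarrow> even (\<Sum>e\<in>{e \<in> L. P e \<noteq> Q e}. w e)"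
proof -
  have "(\<Sum>e\<in>{e \<in> L. P e \<noteq> Q e}. w e) = (\<Sum>e\<in>L. if P e \<noteq> Q e then w e else 0)"
    using assms by (simp add: sum.inter_filter)
  moreover have "(\<Sum>e\<in>L. (of_bool (P e) + of_bool (Q e)) * w e) =
     (\<Sum>e\<in>L. if P e \<noteq> Q e then w e else 0) + (\<Sum>e\<in>L. if P e \<and> Q e then 2 * w e else 0)"
    unfolding sum.distrib[symmetric] by (rule sum.cong) auto
  moreover have "even (\<Sum>e\<in>L. if P e \<and> Q e then 2 * w e else 0)"
    by (rule dvd_sum) simp
  ultimately show ?thesis by simp
qed

text \<open>Every class gets a root, and the parent edge of a node comes from the unit-weight
  distance to that root. Since \<open>dp\<close> drops strictly towards the parent, a forest edge
  determines its lower node, which makes \<open>par\<close> injective; the depth also singles out a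
  leaf of any set of forest edges.\<close>

lemma spanning_forest:
  fixes a b :: "'l \<Rightarrow> 'n" and c :: "'n \<Rightarrow> 'i"
  assumes "finite Nd"
    and cl: "\<And>x. x \<in> Nd \<Longrightarrow> conn (\<lambda>x y. \<exists>e\<in>Lb. {a e, b e} = {x, y}) {y \<in> Nd. c y = c x}"
  obtains N' par and dp :: "'n \<Rightarrow> nat" where "N' \<subseteq> Nd" "card Nd = card N' + card (c ` Nd)"
    "\<And>x. x \<in> N' \<Longrightarrow> par x \<in> Lb" "inj_on par N'"
    "\<And>x. x \<in> N' \<Longrightarrow> \<exists>y\<in>Nd. c y = c x \<and> dp y < dp x \<and> {a (par x), b (par x)} = {y, x}"
proof -
  let ?adj = "\<lambda>x y. \<exists>e\<in>Lb. {a e, b e} = {x, y}"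
  have "\<forall>i\<in>c ` Nd. \<exists>r. r \<in> Nd \<and> c r = i" by blast
  then obtain rt where rt: "\<And>i. i \<in> c ` Nd \<Longrightarrow> rt i \<in> Nd \<and> c (rt i) = i" by metis
  have "\<exists>\<rho> :: 'n \<Rightarrow> nat. \<forall>x\<in>Nd. c x = i \<longrightarrow> x \<noteq> rt i \<longrightarrow> (\<exists>y\<in>Nd. c y = i \<and> ?adj y x \<and> \<rho> x = \<rho> y + 1)"
    if i: "i \<in> c ` Nd" for i
  proof -
    have "conn ?adj {y \<in> Nd. c y = i}" using cl[of "rt i"] rt[OF i] by simp
    moreover have "rt i \<in> {y \<in> Nd. c y = i}" using rt[OF i] by simp
    ultimately obtain \<rho> :: "'n \<Rightarrow> nat" where
      "\<And>x. x \<in> {y \<in> Nd. c y = i} \<Longrightarrow> x \<noteq> rt i \<Longrightarrow> \<exists>y\<in>{y \<in> Nd. c y = i}. ?adj y x \<and> \<rho> x = \<rho> y +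
          (\<lambda>_. 1) x"
      by (rule conn_dist[where \<nu> = "\<lambda>_. 1"]) blast
    then show ?thesis by (intro exI[of _ \<rho>]) fastforce
  qed
  then obtain \<rho> :: "'i \<Rightarrow> 'n \<Rightarrow> nat" where \<rho>: "\<And>i x. i \<in> c ` Nd \<Longrightarrow> x \<in> Nd \<Longrightarrow> c x = i \<Longrightarrow> x \<noteq> rt i \<Longrightarrow>
      \<exists>y\<in>Nd. c y = i \<and> ?adj y x \<and> \<rho> i x = \<rho> i y + 1" by metis
  define dp where "dp x = \<rho> (c x) x" for x
  define N' where "N' = Nd - rt ` (c ` Nd)"
  have "\<forall>x\<in>N'. \<exists>e. e \<in> Lb \<and> (\<exists>y\<in>Nd. c y = c x \<and> dp y < dp x \<and> {a e, b e} = {y, x})"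
  proof
    fix x assume x: "x \<in> N'"
    then have "x \<in> Nd" "x \<noteq> rt (c x)" by (auto simp: N'_def)
    then obtain y where "y \<in> Nd" "c y = c x" "?adj y x" "\<rho> (c x) x = \<rho> (c x) y + 1"
      using \<rho>[of "c x" x] by blast
    then show "\<exists>e. e \<in> Lb \<and> (\<exists>y\<in>Nd. c y = c x \<and> dp y < dp x \<and> {a e, b e} = {y, x})"
      unfolding dp_def by (metis less_add_one)
  qed
  then obtain par where par: "\<And>x. x \<in> N' \<Longrightarrow> par x \<in> Lb"
    "\<And>x. x \<in> N' \<Longrightarrow> \<exists>y\<in>Nd. c y = c x \<and> dp y < dp x \<and> {a (par x), b (par x)} = {y, x}" by metis
  have "inj_on par N'"
  proof (rule inj_onI)
    fix x x' assume x: "x \<in> N'" "x' \<in> N'" "par x = par x'"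
    obtain y where y: "dp y < dp x" "{a (par x), b (par x)} = {y, x}" using par(2)[OF x(1)] by blast
    obtain y' where y': "dp y' < dp x'" "{a (par x), b (par x)} = {y', x'}"
        using par(2)[OF x(2)] x(3) by auto
    have "{y, x} = {y', x'}" using y(2) y'(2) by simp
    then show "x = x'" using y(1) y'(1) unfolding doubleton_eq_iff by auto
  qed
  moreover have "card Nd = card N' + card (c ` Nd)"
  proof -
    have "inj_on rt (c ` Nd)" using rt by (metis inj_onI)
    then have "card (rt ` c ` Nd) = card (c ` Nd)" by (rule card_image)
    moreover have "rt ` c ` Nd \<subseteq> Nd" using rt by blast
    moreover have "card (rt ` c ` Nd) \<le> card Nd" using calculation assms(1) by (intro card_mono)
    ultimately show ?thesis using assms(1) by (simp add: N'_def card_Diff_subset finite_subset)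
  qed
  moreover have "N' \<subseteq> Nd" by (auto simp: N'_def)
  ultimately show thesis using par by (intro that[of N' par dp]) auto
qed

text \<open>An Euler-type bound for minors of a cellular map: \<open>s1\<close> and \<open>s2\<close> are the faces on the two sides of an
  edge, with \<open>None\<close> for one distinguished outer face. The minor is the contraction of the classes of \<open>c\<close>.
  Contracting a spanning forest of the classes and deleting all edges outside \<open>M\<close>
  merges the faces into at least \<open>card M - card (c ` Nd) - 2 * g + 1\<close> regions besides the outer one,
  and the boundary of each is a nonempty even subgraph, hence contains three edges of \<open>M\<close>.\<close>

lemma map_minor_bound:
  fixes a b :: "'l \<Rightarrow> 'n" and s1 s2 :: "'l \<Rightarrow> 'f option" and c :: "'n \<Rightarrow> 'i"
  assumes fin: "finite Nd" "finite Lb" "finite F"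
    and ends: "\<And>e. e \<in> Lb \<Longrightarrow> a e \<in> Nd \<and> b e \<in> Nd"
    and sides: "\<And>e. e \<in> Lb \<Longrightarrow> s1 e \<in> insert None (Some ` F) \<and> s2 e \<in> insert None (Some ` F)"
    and ev: "\<And>f v. f \<in> F \<Longrightarrow> v \<in> Nd \<Longrightarrow> even (\<Sum>e\<in>Lb. (of_bool (s1 e = Some f) + of_bool (s2 e =
        Some f)) *
               (of_bool (a e = v) + of_bool (b e = v)) :: nat)"
    and dual: "\<And>X. X \<subseteq> F \<Longrightarrow> X \<noteq> {} \<Longrightarrow> \<exists>e\<in>Lb. (s1 e \<in> Some ` X) \<noteq> (s2 e \<in> Some ` X)"
    and count: "card Lb + 1 \<le> card Nd + card F + 2 * g"
    and cl: "\<And>x. x \<in> Nd \<Longrightarrow> conn (\<lambda>x y. \<exists>e\<in>Lb. {a e, b e} = {x, y}) {y \<in> Nd. c y = c x}"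
    and M: "M \<subseteq> Lb" "\<And>e. e \<in> M \<Longrightarrow> c (a e) \<noteq> c (b e)" "inj_on (\<lambda>e. {c (a e), c (b e)}) M"
  shows "card M \<le> 3 * card (c ` Nd) + 6 * g"
proof -
  obtain N' par and dp :: "'n \<Rightarrow> nat" where N': "N' \<subseteq> Nd" "card Nd = card N' + card (c ` Nd)"
    and par: "\<And>x. x \<in> N' \<Longrightarrow> par x \<in> Lb" "inj_on par N'"
    "\<And>x. x \<in> N' \<Longrightarrow> \<exists>y\<in>Nd. c y = c x \<and> dp y < dp x \<and> {a (par x), b (par x)} = {y, x}"
    using spanning_forest[OF fin(1) cl] by metis
  define P where "P = par ` N'"
  have PL: "P \<subseteq> Lb" using par(1) by (auto simp: P_def)
  have Pc: "c (a e) = c (b e)" if eP: "e \<in> P" for e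
  proof -
    obtain x where x: "x \<in> N'" "e = par x" using eP by (auto simp: P_def)
    obtain y where "c y = c x" "{a e, b e} = {y, x}" using par(3)[OF x(1)] x(2) by blast
    then show ?thesis by (metis doubleton_eq_iff)
  qed
  have PM: "P \<inter> M = {}" using Pc M(2) by blast
  have finPM: "finite P" "finite M" using PL M(1) fin(2) finite_subset by blast+
  define R where "R = Lb - (P \<union> M)"
  have cardR: "card R + card P + card M = card Lb"
  proof -
    have "card (P \<union> M) = card P + card M" using PM finPM by (simp add: card_Un_disjoint)
    moreover have "card (P \<union> M) \<le> card Lb" using fin(2) PL M(1) by (intro card_mono) auto
    moreover have "card R = card Lb - card (P \<union> M)"
      unfolding R_def using finPM PL M(1) by (intro card_Diff_subset) auto
    ultimately show ?thesis by linarith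
  qed
  let ?Z = "insert None (Some ` F)"
  have "\<exists>\<kappa> :: 'f option \<Rightarrow> 'f option. (\<forall>e\<in>R. \<kappa> (s1 e) = \<kappa> (s2 e)) \<and> card ?Z \<le> card (\<kappa> ` ?Z) + card R"
    by (rule merge_classes) (use fin sides in \<open>auto simp: R_def\<close>)
  then obtain \<kappa> :: "'f option \<Rightarrow> 'f option" where \<kappa>: "\<And>e. e \<in> R \<Longrightarrow> \<kappa> (s1 e) = \<kappa> (s2 e)"
    "card ?Z \<le> card (\<kappa> ` ?Z) + card R" by blast
  have cZ: "card ?Z = card F + 1" using fin by (simp add: card_image)
  \<comment> \<open>The regions left after deleting \<open>R\<close>, without the one that contains
    the outer face: evenness is known only for boundaries of sets of faces in
    \<open>F\<close>.\<close>
  define Q where "Q = \<kappa> ` ?Z - {\<kappa> None}"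
  define X where "X l = {f \<in> F. \<kappa> (Some f) = l}" for l
  define T where "T l = {e \<in> Lb. (s1 e \<in> Some ` X l) \<noteq> (s2 e \<in> Some ` X l)}" for l
  have finQ: "finite Q" using fin by (simp add: Q_def)
  have cQ: "card (\<kappa> ` ?Z) \<le> card Q + 1"
    unfolding Q_def using fin by (simp add: card_Diff_singleton_if del: image_insert)
  have Xne: "X l \<noteq> {}" if "l \<in> Q" for l using that by (auto simp: Q_def X_def)
  have XF: "X l \<subseteq> F" for l by (auto simp: X_def)
  have inX: "s \<in> Some ` X l \<longleftrightarrow> \<kappa> s = l" if "s \<in> ?Z" "l \<in> Q" for s l
    using that by (auto simp: X_def Q_def)
  have Tsub: "T l \<subseteq> P \<union> M" if "l \<in> Q" for l
  proof
    fix e assume e: "e \<in> T l"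
    then have "e \<in> Lb" by (simp add: T_def)
    then have "\<kappa> (s1 e) \<noteq> \<kappa> (s2 e)" using e sides[of e] inX[OF _ that] by (auto simp: T_def)
    then show "e \<in> P \<union> M" using \<kappa>(1)[of e] \<open>e \<in> Lb\<close> by (auto simp: R_def)
  qed
  have evT: "even (\<Sum>e\<in>T l. of_bool (a e = v) + of_bool (b e = v) :: nat)" if v: "v \<in> Nd" for l v
  proof -
    let ?w = "\<lambda>e. of_bool (a e = v) + of_bool (b e = v) :: nat"
    have "even (\<Sum>f\<in>X l. \<Sum>e\<in>Lb. (of_bool (s1 e = Some f) + of_bool (s2 e = Some f)) * ?w e)"
      by (rule dvd_sum) (use ev v XF in blast)
    also have "(\<Sum>f\<in>X l. \<Sum>e\<in>Lb. (of_bool (s1 e = Some f) + of_bool (s2 e = Some f)) * ?w e) =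
       (\<Sum>e\<in>Lb. (of_bool (s1 e \<in> Some ` X l) + of_bool (s2 e \<in> Some ` X l)) * ?w e)"
    proof -
      have fX: "finite (X l)" using XF fin finite_subset by blast
      have *: "(\<Sum>f\<in>X l. of_bool (s = Some f) :: nat) = of_bool (s \<in> Some ` X l)" for s
      proof (cases s)
        case (Some f')
        then have "(\<Sum>f\<in>X l. of_bool (s = Some f) :: nat) = (\<Sum>f\<in>X l. if f = f' then 1 else 0)"
          by (intro sum.cong) auto
        then show ?thesis using fX Some by (simp add: image_iff)
      qed auto
      show ?thesis
        by (subst sum.swap) (simp only: sum_distrib_right[symmetric] sum.distrib *)
    qed
    finally show ?thesis unfolding T_def
      by (simp only: even_sum_of_bool_xor[OF fin(2)])
  qed
  have T3: "3 \<le> card (T l \<inter> M)" if l: "l \<in> Q" for l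
  proof -
    have Tne: "T l \<noteq> {}" using dual[OF XF Xne[OF l]] by (auto simp: T_def)
    have finT: "finite (T l)" using fin by (simp add: T_def)
    have TLb: "T l \<subseteq> Lb" by (auto simp: T_def)
    have TM: "T l \<inter> M \<noteq> {}"
    proof
      assume "T l \<inter> M = {}"
      then have TP: "T l \<subseteq> P" using Tsub[OF l] by blast
      \<comment> \<open>If only forest edges bounded the region, the deepest nonroot node among them
        would be incident to exactly one of them, against evenness.\<close>
      define Y where "Y = {x \<in> N'. par x \<in> T l}"
      have "Y \<noteq> {}" using Tne TP by (auto simp: Y_def P_def)
      moreover have "finite Y" unfolding Y_def using finite_subset[OF N'(1) fin(1)] by simp
      ultimately obtain x where x: "x \<in> Y" "\<And>z. z \<in> Y \<Longrightarrow> dp z \<le> dp x"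
        using Max_in[of "dp ` Y"] Max_ge[of "dp ` Y"]
            by (metis (no_types, lifting) finite_imageI imageE image_eqI image_is_empty)
      have xN: "x \<in> N'" "par x \<in> T l" using x by (auto simp: Y_def)
      have "(\<Sum>e\<in>T l - {par x}. of_bool (a e = x) + of_bool (b e = x) :: nat) = 0"
      proof (rule sum.neutral, rule ballI)
        fix e assume e: "e \<in> T l - {par x}"
        then obtain z where z: "z \<in> N'" "e = par z" using TP by (auto simp: P_def)
        then have "z \<in> Y" using e by (auto simp: Y_def)
        then have "dp z \<le> dp x" using x by blast
        moreover have "z \<noteq> x" using e z by blast
        moreover obtain y where "dp y < dp z" "{a e, b e} = {y, z}" using par(3)[OF z(1)] z by blast
        ultimately have "x \<notin> {a e, b e}" by auto
        then show "of_bool (a e = x) + of_bool (b e = x) = (0::nat)" by auto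
      qed
      moreover have "of_bool (a (par x) = x) + of_bool (b (par x) = x) = (1::nat)"
      proof -
        obtain y where y: "dp y < dp x" "{a (par x), b (par x)} = {y, x}" using par(3)[OF xN(1)]
            by blast
        then have "(a (par x) = y \<and> b (par x) = x) \<or> (a (par x) = x \<and> b (par x) = y)"
          by (simp add: doubleton_eq_iff)
        moreover have "y \<noteq> x" using y by auto
        ultimately show ?thesis by auto
      qed
      ultimately have "(\<Sum>e\<in>T l. of_bool (a e = x) + of_bool (b e = x) :: nat) = 1"
        using sum.remove[OF finT xN(2), of "\<lambda>e. of_bool (a e = x) + of_bool (b e = x) :: nat"]
            by simp
      then show False using evT[of x l] xN(1) N'(1) by auto
    qed
    \<comment> \<open>Evenness survives contraction: summing degrees over a class counts inner edges
      twice, and all forest edges are inner.\<close>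
    have evc: "even (card {e \<in> T l \<inter> M. c (a e) = i \<or> c (b e) = i})" for i
    proof -
      let ?C = "{v \<in> Nd. c v = i}"
      have fC: "finite ?C" using fin by simp
      have "even (\<Sum>v\<in>?C. \<Sum>e\<in>T l. of_bool (a e = v) + of_bool (b e = v) :: nat)"
        by (rule dvd_sum) (use evT in blast)
      also have "(\<Sum>v\<in>?C. \<Sum>e\<in>T l. of_bool (a e = v) + of_bool (b e = v) :: nat) =
          (\<Sum>e\<in>T l. (of_bool (c (a e) = i) + of_bool (c (b e) = i)) * 1)"
      proof (subst sum.swap, rule sum.cong[OF refl])
        fix e assume "e \<in> T l"
        then have e: "a e \<in> Nd" "b e \<in> Nd" using TLb ends by blast+
        have *: "(\<Sum>v\<in>?C. of_bool (x = v) :: nat) = of_bool (c x = i)" if "x \<in> Nd" for x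
        proof -
          have "(\<Sum>v\<in>?C. of_bool (x = v) :: nat) = (\<Sum>v\<in>?C. if v = x then 1 else 0)"
            by (intro sum.cong) auto
          then show ?thesis using fC that by simp
        qed
        show "(\<Sum>v\<in>?C. of_bool (a e = v) + of_bool (b e = v) :: nat) =
            (of_bool (c (a e) = i) + of_bool (c (b e) = i)) * 1"
          using *[OF e(1)] *[OF e(2)] by (simp add: sum.distrib)
      qed
      finally have "even (\<Sum>e\<in>{e \<in> T l. (c (a e) = i) \<noteq> (c (b e) = i)}. 1 :: nat)"
        using even_sum_of_bool_xor[OF finT, of "\<lambda>e. c (a e) = i" "\<lambda>e. c (b e) = i" "\<lambda>_. 1"] by simp
      moreover have "{e \<in> T l. (c (a e) = i) \<noteq> (c (b e) = i)} = {e \<in> T l \<inter> M. c (a e) = i \<or>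
          c (b e) = i}"
      proof (intro Collect_cong iffI)
        fix e assume "e \<in> T l \<and> (c (a e) = i) \<noteq> (c (b e) = i)"
        then show "e \<in> T l \<inter> M \<and> (c (a e) = i \<or> c (b e) = i)" using Tsub[OF l] Pc[of e] by auto
      next
        fix e assume "e \<in> T l \<inter> M \<and> (c (a e) = i \<or> c (b e) = i)"
        then show "e \<in> T l \<and> (c (a e) = i) \<noteq> (c (b e) = i)" using M(2)[of e] by auto
      qed
      ultimately show ?thesis by simp
    qed
    have other: "\<exists>e'\<in>T l \<inter> M. e' \<noteq> e \<and> (c (a e') = i \<or> c (b e') = i)"
      if "e \<in> T l \<inter> M" "c (a e) = i \<or> c (b e) = i" for e i
    proof (rule ccontr)
      assume "\<not> ?thesis"
      then have "{e \<in> T l \<inter> M. c (a e) = i \<or> c (b e) = i} = {e}" using that by blast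
      then show False using evc[of i] by simp
    qed
    obtain e where e: "e \<in> T l \<inter> M" using TM by blast
    obtain e1 where e1: "e1 \<in> T l \<inter> M" "e1 \<noteq> e" "c (a e1) = c (a e) \<or> c (b e1) = c (a e)"
      using other[OF e, of "c (a e)"] by blast
    obtain e2 where e2: "e2 \<in> T l \<inter> M" "e2 \<noteq> e" "c (a e2) = c (b e) \<or> c (b e2) = c (b e)"
      using other[OF e, of "c (b e)"] by blast
    \<comment> \<open>A single edge meeting both end classes of \<open>e\<close> would be parallel
      to \<open>e\<close>.\<close>
    have "e1 \<noteq> e2"
    proof
      assume "e1 = e2"
      then have "{c (a e1), c (b e1)} = {c (a e), c (b e)}" using e1(3) e2(3) M(2)[of e] e by auto
      then show False using M(3) e1 e by (auto simp: inj_on_def)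
    qed
    then have "card {e, e1, e2} = 3" using e1 e2 by auto
    moreover have "card {e, e1, e2} \<le> card (T l \<inter> M)" using e e1 e2 finT by (intro card_mono) auto
    ultimately show ?thesis by simp
  qed
  \<comment> \<open>Double counting: a region is bounded by at least three edges of
    \<open>M\<close>, and an edge bounds at most two regions.\<close>
  have "3 * card Q \<le> (\<Sum>l\<in>Q. card (T l \<inter> M))"
    using sum_mono[of Q "\<lambda>_. 3" "\<lambda>l. card (T l \<inter> M)"] T3 by simp
  also have "\<dots> = (\<Sum>l\<in>Q. \<Sum>e\<in>M. of_bool (e \<in> T l))"
    using finPM by (intro sum.cong refl) (simp add: Int_commute)
  also have "\<dots> = (\<Sum>e\<in>M. \<Sum>l\<in>Q. of_bool (e \<in> T l))" by (rule sum.swap)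
  also have "\<dots> \<le> (\<Sum>e\<in>M. 2)"
  proof (rule sum_mono)
    fix e assume "e \<in> M"
    then have e: "e \<in> Lb" using M by blast
    have "(\<Sum>l\<in>Q. of_bool (e \<in> T l) :: nat) = card {l \<in> Q. e \<in> T l}"
      using finQ by (simp add: Int_def)
    also have "\<dots> \<le> card {\<kappa> (s1 e), \<kappa> (s2 e)}"
    proof (rule card_mono)
      show "{l \<in> Q. e \<in> T l} \<subseteq> {\<kappa> (s1 e), \<kappa> (s2 e)}"
        using inX sides[OF e] by (auto simp: T_def)
    qed simp
    also have "\<dots> \<le> 2" by (simp add: card_insert_if)
    finally show "(\<Sum>l\<in>Q. of_bool (e \<in> T l) :: nat) \<le> 2" .
  qed
  finally have "3 * card Q \<le> 2 * card M" by simp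
  moreover have "card P = card N'" unfolding P_def using par(2) by (rule card_image)
  ultimately show ?thesis using cQ \<kappa>(2) cZ cardR count N'(2) by linarith
qed

section \<open>The polygonal mesh on the surface\<close>

text \<open>As long as nodes are left over, connectedness yields an edge leaving the union of the
  sets, and its outer end can join the set it touches. Adjacent sets remain adjacent, so every minor
  of the mesh arises by contracting a partition of all its nodes.\<close>

lemma extend_to_partition:
  assumes "finite Nd" "symp adj" "conn adj Nd" "I \<noteq> {}"
    and "\<And>i. i \<in> I \<Longrightarrow> X i \<noteq> {} \<and> X i \<subseteq> Nd \<and> conn adj (X i)"
    and "\<And>i j. i \<in> I \<Longrightarrow> j \<in> I \<Longrightarrow> i \<noteq> j \<Longrightarrow> X i \<inter> X j = {}"
  shows "\<exists>c. c ` Nd = I \<and> (\<forall>x\<in>Nd. conn adj {y \<in> Nd. c y = c x}) \<and> (\<forall>i\<in>I. \<forall>x\<in>X i. c x = i)"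
  using assms(5,6)
proof (induction "card (Nd - (\<Union>i\<in>I. X i))" arbitrary: X rule: less_induct)
  case less
  show ?case
  proof (cases "Nd \<subseteq> (\<Union>i\<in>I. X i)")
    case True
    have "\<forall>x\<in>Nd. \<exists>i. i \<in> I \<and> x \<in> X i" using True by blast
    then obtain c where c: "\<And>x. x \<in> Nd \<Longrightarrow> c x \<in> I \<and> x \<in> X (c x)" by metis
    have ci: "c x = i" if "i \<in> I" "x \<in> X i" for x i
    proof (rule ccontr)
      assume ne: "c x \<noteq> i"
      have "x \<in> Nd" using less.prems(1)[OF that(1)] that by blast
      then have "x \<in> X (c x) \<inter> X i" "c x \<in> I" using c that by auto
      then show False using less.prems(2)[of "c x" i] that ne by blast
    qed
    have "{y \<in> Nd. c y = i} = X i" if "i \<in> I" for i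
      using ci[OF that] c less.prems(1)[OF that] by blast
    then have "\<forall>x\<in>Nd. conn adj {y \<in> Nd. c y = c x}" using c less.prems(1) by auto
    moreover have "c ` Nd = I"
    proof
      show "c ` Nd \<subseteq> I" using c by blast
      show "I \<subseteq> c ` Nd"
      proof
        fix i assume i: "i \<in> I"
        then obtain x where "x \<in> X i" "x \<in> Nd" using less.prems(1)[OF i] by blast
        then show "i \<in> c ` Nd" using ci[OF i] by blast
      qed
    qed
    ultimately show ?thesis using ci by blast
  next
    case False
    let ?U = "\<Union>i\<in>I. X i"
    have sub: "?U \<subseteq> Nd" using less.prems(1) by blast
    obtain i0 where "i0 \<in> I" using assms(4) by blast
    then obtain x0 where x0: "x0 \<in> ?U" using less.prems(1) by blast
    obtain y0 where y0: "y0 \<in> Nd - ?U" using False by blast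
    have "\<exists>a\<in>?U. \<exists>b\<in>Nd - ?U. adj a b" by (rule conn_cut[OF assms(3) sub x0 y0])
    then obtain a b where ab: "a \<in> ?U" "b \<in> Nd - ?U" "adj a b" by (elim bexE)
    then obtain i where i: "i \<in> I" "a \<in> X i" by blast
    define Y where "Y = X(i := insert b (X i))"
    have U: "(\<Union>i\<in>I. Y i) = insert b ?U" using i by (auto simp: Y_def)
    have "card (Nd - insert b ?U) < card (Nd - ?U)"
      using ab assms(1) by (intro psubset_card_mono) auto
    then have "\<exists>c. c ` Nd = I \<and> (\<forall>x\<in>Nd. conn adj {y \<in> Nd. c y = c x}) \<and> (\<forall>i\<in>I. \<forall>x\<in>Y i. c x = i)"
    proof (rule less.hyps[of Y, unfolded U])
      show "Y k \<noteq> {} \<and> Y k \<subseteq> Nd \<and> conn adj (Y k)" if k: "k \<in> I" for k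
      proof (cases "k = i")
        case True
        have "conn adj (X i \<union> {b})"
          using conn_Un_edge[OF assms(2) _ conn_singleton i(2) _ ab(3), of b] less.prems(1)[OF i(1)]
              by simp
        then show ?thesis using True less.prems(1)[OF i(1)] ab by (simp add: Y_def)
      qed (use less.prems(1)[OF k] in \<open>simp add: Y_def\<close>)
      show "Y k \<inter> Y l = {}" if kl: "k \<in> I" "l \<in> I" "k \<noteq> l" for k l
        using less.prems(2)[OF kl] ab kl by (auto simp: Y_def)
    qed
    moreover have "X k \<subseteq> Y k" for k by (auto simp: Y_def)
    ultimately show ?thesis by blast
  qed
qed

text \<open>\<open>Rad i j\<close> leads from ring \<open>i\<close> outwards,
  \<open>Circ i j\<close> runs along ring \<open>i\<close>, and \<open>Glue \<beta> s\<close> is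
  rung \<open>s\<close> of the strip at side \<open>\<beta>\<close>; a strip of \<open>N\<close>
  squares has \<open>N + 1\<close> rungs.\<close>

datatype mesh_edge = Rad nat nat | Circ nat nat | Glue nat nat
datatype mesh_face = Square nat nat | Center | Strip nat nat

text \<open>The mesh has \<open>R\<close> concentric rings of \<open>4 * g * N\<close> nodes, that is \<open>N\<close> per side of the polygon. Side \<open>\<beta>\<close>
  of the outermost ring, for \<open>\<beta>\<close> in \<open>glue_sides g\<close>, is joined to side \<open>\<beta> + 2\<close> by a
  strip of squares. The \<open>8 * g\<close>-gon that the strips leave open at the corners of the polygon is the outer face.\<close>

definition glue_sides :: "nat \<Rightarrow> nat set" where
  "glue_sides g = {\<beta>. \<beta> < 4 * g \<and> \<beta> mod 4 < 2}"

definition mesh_nodes :: "nat \<Rightarrow> nat \<Rightarrow> nat \<Rightarrow> (nat \<times> nat) set" where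
  "mesh_nodes g N R = {..<R} \<times> {..<4 * g * N}"

definition mesh_edges :: "nat \<Rightarrow> nat \<Rightarrow> nat \<Rightarrow> mesh_edge set" where
  "mesh_edges g N R = (\<lambda>(i, j). Rad i j) ` ({..<R - 1} \<times> {..<4 * g * N}) \<union>
     (\<lambda>(i, j). Circ i j) ` ({..<R} \<times> {..<4 * g * N}) \<union> (\<lambda>(\<beta>, s). Glue \<beta> s) ` (glue_sides g \<times> {..N})"

definition mesh_faces :: "nat \<Rightarrow> nat \<Rightarrow> nat \<Rightarrow> mesh_face set" where
  "mesh_faces g N R = (\<lambda>(i, j). Square i j) ` ({..<R - 1} \<times> {..<4 * g * N}) \<union> {Center} \<union>
     (\<lambda>(\<beta>, s). Strip \<beta> s) ` (glue_sides g \<times> {..<N})"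

fun mesh_src :: "nat \<Rightarrow> nat \<Rightarrow> nat \<Rightarrow> mesh_edge \<Rightarrow> nat \<times> nat" where
  "mesh_src g N R (Rad i j) = (i, j)"
| "mesh_src g N R (Circ i j) = (i, j)"
| "mesh_src g N R (Glue \<beta> s) = (R - 1, \<beta> * N + s)"

text \<open>Sides are glued with reversed direction: the point \<open>s\<close> steps into side
  \<open>\<beta>\<close> meets the point \<open>s\<close> steps before the end of side
  \<open>\<beta> + 2\<close>, which has index \<open>(\<beta> + 3) * N - s\<close>.\<close>

fun mesh_tgt :: "nat \<Rightarrow> nat \<Rightarrow> nat \<Rightarrow> mesh_edge \<Rightarrow> nat \<times> nat" where
  "mesh_tgt g N R (Rad i j) = (i + 1, j)"
| "mesh_tgt g N R (Circ i j) = (i, (j + 1) mod (4 * g * N))"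
| "mesh_tgt g N R (Glue \<beta> s) = (R - 1, ((\<beta> + 3) * N - s) mod (4 * g * N))"

text \<open>Left and right merely name the two sides of an edge, without a consistent orientation;
  incidences are used modulo 2. The outer face \<open>None\<close> is met by the first and the last
  rung of every strip.\<close>

fun mesh_left :: "nat \<Rightarrow> nat \<Rightarrow> nat \<Rightarrow> mesh_edge \<Rightarrow> mesh_face option" where
  "mesh_left g N R (Rad i j) = Some (Square i j)"
| "mesh_left g N R (Circ i j) = (if i = 0 then Some Center else Some (Square (i - 1) j))"
| "mesh_left g N R (Glue \<beta> s) = (if s < N then Some (Strip \<beta> s) else None)"

text \<open>An outermost ring edge on a side of index 2 or 3 modulo 4 borders the strip of its
  partner side, which it meets in reversed order.\<close>

fun mesh_right :: "nat \<Rightarrow> nat \<Rightarrow> nat \<Rightarrow> mesh_edge \<Rightarrow> mesh_face option" where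
  "mesh_right g N R (Rad i j) = Some (Square i ((j + 4 * g * N - 1) mod (4 * g * N)))"
| "mesh_right g N R (Circ i j) = Some (if i + 1 < R then Square i j
      else if (j div N) mod 4 < 2 then Strip (j div N) (j mod N)
      else Strip (j div N - 2) (N - 1 - j mod N))"
| "mesh_right g N R (Glue \<beta> s) = (if s = 0 then None else Some (Strip \<beta> (s - 1)))"

definition mesh_adj :: "nat \<Rightarrow> nat \<Rightarrow> nat \<Rightarrow> nat \<times> nat \<Rightarrow> nat \<times> nat \<Rightarrow> bool" where
  "mesh_adj g N R x y \<longleftrightarrow> (\<exists>e\<in>mesh_edges g N R. {mesh_src g N R e, mesh_tgt g N R e} = {x, y})"

lemma glue_sides_bound: "\<beta> \<in> glue_sides g \<Longrightarrow> \<beta> + 3 \<le> 4 * g"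
  unfolding glue_sides_def by auto presburger

lemma glue_index_bounds:
  assumes "\<beta> \<in> glue_sides g" "s \<le> N" "N \<ge> 1"
  shows "\<beta> * N + s < 4 * g * N" "(\<beta> + 3) * N - s \<le> 4 * g * N" "s < (\<beta> + 3) * N"
    "s \<ge> 1 \<Longrightarrow> (\<beta> + 3) * N - s < 4 * g * N"
proof -
  have b: "(\<beta> + 3) * N \<le> 4 * g * N" using glue_sides_bound[OF assms(1)] by (rule mult_le_mono1)
  then show "\<beta> * N + s < 4 * g * N" "(\<beta> + 3) * N - s \<le> 4 * g * N" "s < (\<beta> + 3) * N"
    using assms(2,3) by (auto simp: algebra_simps)
  show "(\<beta> + 3) * N - s < 4 * g * N" if "s \<ge> 1"
    using b that assms(2,3) by (simp add: algebra_simps)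
qed

lemma card_glue_sides: "card (glue_sides g) = 2 * g"
proof -
  have "glue_sides g = (\<lambda>(i, a). 4 * i + a) ` ({..<g} \<times> {..<2})"
  proof (intro equalityI subsetI)
    fix \<beta> assume "\<beta> \<in> glue_sides g"
    then have "(\<beta> div 4, \<beta> mod 4) \<in> {..<g} \<times> {..<2}" by (auto simp: glue_sides_def)
    moreover have "\<beta> = (\<lambda>(i, a). 4 * i + a) (\<beta> div 4, \<beta> mod 4)" by simp
    ultimately show "\<beta> \<in> (\<lambda>(i, a). 4 * i + a) ` ({..<g} \<times> {..<2})" by blast
  qed (auto simp: glue_sides_def)
  moreover have "inj_on (\<lambda>(i, a). 4 * i + a) ({..<g} \<times> {..<2::nat})"
    by (rule inj_on_inverseI[where g = "\<lambda>b. (b div 4, b mod 4)"]) auto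
  ultimately show ?thesis by (simp add: card_image)
qed

lemma finite_glue_sides [simp]: "finite (glue_sides g)"
  by (simp add: glue_sides_def)

lemma finite_mesh [simp]:
  "finite (mesh_nodes g N R)" "finite (mesh_edges g N R)" "finite (mesh_faces g N R)"
  by (auto simp: mesh_nodes_def mesh_edges_def mesh_faces_def)

text \<open>Nodes minus edges plus faces is \<open>2 - 2 * g\<close> once the outer face is counted
  along with \<open>mesh_faces\<close>.\<close>

lemma card_mesh:
  assumes "R \<ge> 1"
  shows "card (mesh_edges g N R) + 1 = card (mesh_nodes g N R) + card (mesh_faces g N R) + 2 * g"
proof -
  let ?n = "4 * g * N"
  let ?r = "(\<lambda>(i, j). Rad i j) ` ({..<R - 1} \<times> {..<?n})"
      and ?c = "(\<lambda>(i, j). Circ i j) ` ({..<R} \<times> {..<?n})"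
    and ?g = "(\<lambda>(\<beta>, s). Glue \<beta> s) ` (glue_sides g \<times> {..N})"
    and ?q = "(\<lambda>(i, j). Square i j) ` ({..<R - 1} \<times> {..<?n})"
    and ?s = "(\<lambda>(\<beta>, s). Strip \<beta> s) ` (glue_sides g \<times> {..<N})"
  have c: "card ?r = (R - 1) * ?n" "card ?c = R * ?n" "card ?g = 2 * g * (N + 1)"
    "card ?q = (R - 1) * ?n" "card ?s = 2 * g * N"
    by (subst card_image, auto simp: inj_on_def card_glue_sides)+
  have "card (mesh_edges g N R) = card (?r \<union> ?c) + card ?g" unfolding mesh_edges_def
    by (rule card_Un_disjoint) auto
  also have "card (?r \<union> ?c) = card ?r + card ?c" by (rule card_Un_disjoint) auto
  finally have e: "card (mesh_edges g N R) = (R - 1) * ?n + R * ?n + 2 * g * (N + 1)" using c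
      by simp
  have "card (mesh_faces g N R) = card (?q \<union> {Center}) + card ?s" unfolding mesh_faces_def
    by (rule card_Un_disjoint) auto
  also have "card (?q \<union> {Center}) = card ?q + card {Center}" by (rule card_Un_disjoint) auto
  finally have f: "card (mesh_faces g N R) = (R - 1) * ?n + 1 + 2 * g * N" using c by simp
  show ?thesis unfolding e f by (simp add: mesh_nodes_def algebra_simps)
qed

lemma mesh_edges_iff [simp]:
  "Rad i j \<in> mesh_edges g N R \<longleftrightarrow> i < R - 1 \<and> j < 4 * g * N"
  "Circ i j \<in> mesh_edges g N R \<longleftrightarrow> i < R \<and> j < 4 * g * N"
  "Glue \<beta> s \<in> mesh_edges g N R \<longleftrightarrow> \<beta> \<in> glue_sides g \<and> s \<le> N"
  by (auto simp: mesh_edges_def)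

lemma mesh_faces_iff [simp]:
  "Square i j \<in> mesh_faces g N R \<longleftrightarrow> i < R - 1 \<and> j < 4 * g * N"
  "Center \<in> mesh_faces g N R"
  "Strip \<beta> s \<in> mesh_faces g N R \<longleftrightarrow> \<beta> \<in> glue_sides g \<and> s < N"
  by (auto simp: mesh_faces_def)

lemma mesh_ends:
  assumes "g \<ge> 1" "N \<ge> 1" "R \<ge> 1" "e \<in> mesh_edges g N R"
  shows "mesh_src g N R e \<in> mesh_nodes g N R \<and> mesh_tgt g N R e \<in> mesh_nodes g N R"
  using assms glue_index_bounds(1)[of _ g _ N] by (auto simp: mesh_edges_def mesh_nodes_def)

lemma side_cases:
  assumes "j < 4 * g * N" "N \<ge> 1"
  shows "(j div N) mod 4 < 2 \<Longrightarrow> j div N \<in> glue_sides g"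
    "\<not> (j div N) mod 4 < 2 \<Longrightarrow> j div N - 2 \<in> glue_sides g \<and> j div N \<ge> 2"
proof -
  have two: "(q - 2) mod 4 < 2 \<and> q \<ge> 2" if "\<not> q mod 4 < 2" for q :: nat
  proof -
    have r: "q mod 4 = 2 \<or> q mod 4 = 3" using that mod_less_divisor[of 4 q] by linarith
    have "q - 2 = 4 * (q div 4) + (q mod 4 - 2)" using r mult_div_mod_eq[of 4 q] by linarith
    then have "(q - 2) mod 4 = (q mod 4 - 2) mod 4" by (simp only: mod_mult_self4)
    moreover have "(q mod 4 - 2) mod 4 < 2" using r by (elim disjE) simp_all
    moreover have "q mod 4 \<le> q" by (rule mod_less_eq_dividend)
    ultimately show ?thesis using r by linarith
  qed
  have "j div N < 4 * g" using assms by (simp add: less_mult_imp_div_less)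
  then show "(j div N) mod 4 < 2 \<Longrightarrow> j div N \<in> glue_sides g"
    "\<not> (j div N) mod 4 < 2 \<Longrightarrow> j div N - 2 \<in> glue_sides g \<and> j div N \<ge> 2"
    unfolding glue_sides_def using two[of "j div N"] by simp_all
qed

lemma mesh_sides:
  assumes "g \<ge> 1" "N \<ge> 1" "R \<ge> 1" "e \<in> mesh_edges g N R"
  shows "mesh_left g N R e \<in> insert None (Some ` mesh_faces g N R)"
    "mesh_right g N R e \<in> insert None (Some ` mesh_faces g N R)"
proof -
  have n: "0 < 4 * g * N" using assms by simp
  show "mesh_left g N R e \<in> insert None (Some ` mesh_faces g N R)"
  proof (cases e)
    case (Circ i j)
    then show ?thesis using assms(4) by (cases "i = 0") auto
  qed (use assms(4) in auto)
  show "mesh_right g N R e \<in> insert None (Some ` mesh_faces g N R)"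
  proof (cases e)
    case (Rad i j)
    then show ?thesis using assms(4) n by auto
  next
    case (Circ i j)
    then have ij: "i < R" "j < 4 * g * N" using assms(4) by auto
    have "N - 1 - j mod N < N" "j mod N < N" using assms(2) by auto
    then have "(if i + 1 < R then Square i j else if (j div N) mod 4 < 2 then Strip (j div N) (j mod
        N)
      else Strip (j div N - 2) (N - 1 - j mod N)) \<in> mesh_faces g N R"
      using ij side_cases[OF ij(2) assms(2)] by (auto simp del: One_nat_def)
    then show ?thesis unfolding Circ mesh_right.simps by blast
  next
    case (Glue \<beta> s)
    then show ?thesis using assms(4) by auto
  qed
qed

text \<open>A strip square has one outer ring edge on each of the two glued sides; reversal puts
  them at opposite offsets.\<close>

lemma mesh_right_Strip:
  assumes "N \<ge> 1" "\<beta> \<in> glue_sides g" "s < N" "j < 4 * g * N"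
  shows "mesh_right g N R (Circ i j) = Some (Strip \<beta> s) \<longleftrightarrow>
    \<not> i + 1 < R \<and> (j = \<beta> * N + s \<or> j = (\<beta> + 3) * N - s - 1)"
proof -
  have b4: "\<beta> mod 4 < 2" using assms by (simp add: glue_sides_def)
  have eq: "(\<beta> + 3) * N - s - 1 = (\<beta> + 2) * N + (N - 1 - s)" using assms
      by (simp add: algebra_simps)
  have h: "(q * N + r) div N = q \<and> (q * N + r) mod N = r" if "r < N" for q r using that by simp
  have d1: "(\<beta> * N + s) div N = \<beta>" "(\<beta> * N + s) mod N = s" using assms by auto
  have d2: "((\<beta> + 3) * N - s - 1) div N = \<beta> + 2" "((\<beta> + 3) * N - s - 1) mod N = N - 1 - s"
    unfolding eq using h[of "N - 1 - s" "\<beta> + 2"] assms by auto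
  have m2: "\<not> (\<beta> + 2) mod 4 < 2"
  proof -
    have "\<beta> mod 4 = 0 \<or> \<beta> mod 4 = 1" using b4 by linarith
    then have "(\<beta> mod 4 + 2) mod 4 \<ge> 2"
    proof
      assume "\<beta> mod 4 = 0" then show ?thesis by (simp only:) simp
    next
      assume "\<beta> mod 4 = 1" then show ?thesis by (simp only:) simp
    qed
    then show ?thesis unfolding mod_add_left_eq by linarith
  qed
  show ?thesis
  proof
    assume L: "mesh_right g N R (Circ i j) = Some (Strip \<beta> s)"
    then have i: "\<not> i + 1 < R" by (auto split: if_splits)
    have j: "j = (j div N) * N + j mod N" by simp
    consider "(j div N) mod 4 < 2" "j div N = \<beta>" "j mod N = s"
      | "\<not> (j div N) mod 4 < 2" "j div N - 2 = \<beta>" "N - 1 - j mod N = s"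
      using L i by (auto split: if_splits)
    then show "\<not> i + 1 < R \<and> (j = \<beta> * N + s \<or> j = (\<beta> + 3) * N - s - 1)"
    proof cases
      case 1 then show ?thesis using i j by auto
    next
      case 2
      have "j div N = \<beta> + 2" using 2 by (cases "j div N < 2") auto
      moreover have "j mod N = N - 1 - s" using 2 assms mod_less_divisor[of N j] by linarith
      ultimately show ?thesis using i j eq by metis
    qed
  next
    assume "\<not> i + 1 < R \<and> (j = \<beta> * N + s \<or> j = (\<beta> + 3) * N - s - 1)"
    then consider "\<not> i + 1 < R" "j = \<beta> * N + s" | "\<not> i + 1 < R" "j = (\<beta> + 3) * N - s - 1" by blast
    then show "mesh_right g N R (Circ i j) = Some (Strip \<beta> s)"
    proof cases
      case 1 then show ?thesis using d1 b4 by simp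
    next
      case 2 then show ?thesis using d2 m2 assms by simp
    qed
  qed
qed

lemma mod_pred_eq_iff:
  assumes "(j::nat) < n" "k < n"
  shows "(k + n - 1) mod n = j \<longleftrightarrow> k = (j + 1) mod n"
proof -
  have "k = 0 \<or> k \<ge> 1" by linarith
  then show ?thesis
  proof
    assume "k = 0"
    then show ?thesis using assms by (cases "j + 1 = n") auto
  next
    assume k: "k \<ge> 1"
    then have "k + n - 1 = (k - 1) + n" by simp
    then have "(k + n - 1) mod n = (k - 1 + n) mod n" by (simp only:)
    then have "(k + n - 1) mod n = k - 1" using assms by (simp only: mod_add_self2) simp
    then show ?thesis using k assms by (cases "j + 1 = n") auto
  qed
qed

lemma sum_shift_mod:
  fixes f :: "nat \<Rightarrow> nat"
  assumes "n \<ge> 1"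
  shows "(\<Sum>j<n. f ((j + 1) mod n)) = (\<Sum>j<n. f j)"
proof -
  obtain m where m: "n = Suc m" using assms by (cases n) auto
  have "(\<Sum>j<n. f ((j + 1) mod n)) = (\<Sum>j<m. f ((j + 1) mod n)) + f 0" unfolding m by simp
  also have "(\<Sum>j<m. f ((j + 1) mod n)) = (\<Sum>j<m. f (Suc j))" unfolding m by (rule sum.cong) auto
  also have "(\<Sum>j<m. f (Suc j)) + f 0 = (\<Sum>j<n. f j)" unfolding m sum.lessThan_Suc_shift by simp
  finally show ?thesis .
qed

lemma sum_of_bool_filter:
  fixes w :: "'l \<Rightarrow> nat"
  assumes "finite E"
  shows "(\<Sum>e\<in>E. of_bool (P e) * w e) = sum w {e \<in> E. P e}"
proof -
  have "(\<Sum>e\<in>E. of_bool (P e) * w e) = (\<Sum>e\<in>E. if P e then w e else 0)"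
    by (rule sum.cong) auto
  then show ?thesis using assms by (simp add: sum.inter_filter)
qed

text \<open>The boundary of a face is a closed walk, which enters a node as often as it leaves it.
  The walks are written out: four edges around a square, the innermost ring around the centre, two
  rungs and two ring edges around a strip square.\<close>

lemma mesh_even:
  assumes gNR: "g \<ge> 1" "N \<ge> 1" "R \<ge> 1" and f: "f \<in> mesh_faces g N R"
  shows "even (\<Sum>e\<in>mesh_edges g N R.
     (of_bool (mesh_left g N R e = Some f) + of_bool (mesh_right g N R e = Some f)) *
     (of_bool (mesh_src g N R e = v) + of_bool (mesh_tgt g N R e = v)) :: nat)" (is "even ?S")
proof -
  let ?E = "mesh_edges g N R" and ?n = "4 * g * N"
  have n4: "?n \<ge> 4" using mult_le_mono[OF gNR(1,2)] by simp
  let ?w = "\<lambda>e. of_bool (mesh_src g N R e = v) + of_bool (mesh_tgt g N R e = v) :: nat"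
  have "?S = (\<Sum>e\<in>?E. of_bool (mesh_left g N R e = Some f) * ?w e) +
      (\<Sum>e\<in>?E. of_bool (mesh_right g N R e = Some f) * ?w e)"
    by (simp add: sum.distrib distrib_right)
  also have "(\<Sum>e\<in>?E. of_bool (mesh_left g N R e = Some f) * ?w e) =
      sum ?w {e \<in> ?E. mesh_left g N R e = Some f}"
    by (rule sum_of_bool_filter) simp
  also have "(\<Sum>e\<in>?E. of_bool (mesh_right g N R e = Some f) * ?w e) =
      sum ?w {e \<in> ?E. mesh_right g N R e = Some f}"
    by (rule sum_of_bool_filter) simp
  finally have S: "?S = sum ?w {e \<in> ?E. mesh_left g N R e = Some f} +
      sum ?w {e \<in> ?E. mesh_right g N R e = Some f}" .
  consider i j where "f = Square i j" "i < R - 1" "j < ?n" | "f = Center"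
    | \<beta> s where "f = Strip \<beta> s" "\<beta> \<in> glue_sides g" "s < N"
    using f by (auto simp: mesh_faces_def)
  then show ?thesis
  proof cases
    case (1 i j)
    have l: "{e \<in> ?E. mesh_left g N R e = Some f} = {Rad i j, Circ (i + 1) j}"
      using 1 by (auto simp: mesh_edges_def split: if_splits)
    have r: "{e \<in> ?E. mesh_right g N R e = Some f} = {Rad i ((j + 1) mod ?n), Circ i j}"
    proof (intro equalityI subsetI)
      fix e assume e: "e \<in> {e \<in> ?E. mesh_right g N R e = Some f}"
      show "e \<in> {Rad i ((j + 1) mod ?n), Circ i j}"
      proof (cases e)
        case (Rad i' j')
        then have j': "j' < ?n" using e by simp
        have "i' = i \<and> (j' + ?n - 1) mod ?n = j" using e 1(1) Rad by simp
        then show ?thesis using mod_pred_eq_iff[OF 1(3) j'] Rad by simp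
      next
        case (Circ i' j')
        then show ?thesis using e 1(1) by (simp split: if_splits)
      next
        case (Glue \<beta> s)
        then show ?thesis using e 1(1) by (simp split: if_splits)
      qed
    next
      fix e assume e: "e \<in> {Rad i ((j + 1) mod ?n), Circ i j}"
      have lt: "(j + 1) mod ?n < ?n" using n4 by (intro mod_less_divisor) linarith
      have "((j + 1) mod ?n + ?n - 1) mod ?n = j" using mod_pred_eq_iff[OF 1(3) lt] by blast
      then have "mesh_right g N R (Rad i ((j + 1) mod ?n)) = Some f" unfolding 1(1) mesh_right.simps
          by simp
      moreover have "mesh_right g N R (Circ i j) = Some f" using 1 by simp
      moreover have "Rad i ((j + 1) mod ?n) \<in> ?E" using lt 1 unfolding mesh_edges_iff by blast
      moreover have "Circ i j \<in> ?E" using 1 by simp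
      ultimately show "e \<in> {e \<in> ?E. mesh_right g N R e = Some f}" using e by blast
    qed
    have sum2: "sum h {x, y} = h x + h y" if "x \<noteq> y" for h :: "mesh_edge \<Rightarrow> nat" and x y using that
        by simp
    have s: "sum ?w {Rad i j, Circ (i + 1) j} = ?w (Rad i j) + ?w (Circ (i + 1) j)"
      "sum ?w {Rad i ((j + 1) mod ?n), Circ i j} = ?w (Rad i ((j + 1) mod ?n)) + ?w (Circ i j)"
      by (rule sum2, blast)+
    have ev4: "even ((o1 + o2) + (o2 + o3) + ((o4 + o3) + (o1 + o4)))" for o1 o2 o3 o4 :: nat
      by (rule dvdI[of _ _ "o1 + o2 + o3 + o4"]) simp
    show ?thesis unfolding S l r s mesh_src.simps mesh_tgt.simps by (rule ev4)
  next
    case 2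
    have l: "{e \<in> ?E. mesh_left g N R e = Some f} = Circ 0 ` {..<?n}"
      using 2 gNR by (auto simp: mesh_edges_def split: if_splits)
    have r: "{e \<in> ?E. mesh_right g N R e = Some f} = {}"
      using 2 by (auto simp: mesh_edges_def split: if_splits)
    have "sum ?w (Circ 0 ` {..<?n}) = (\<Sum>j<?n. of_bool ((0, j) = v)) + (\<Sum>j<?n. of_bool ((0, (j +
        1) mod ?n) = v))"
      by (subst sum.reindex) (auto simp: inj_on_def sum.distrib)
    also have "(\<Sum>j<?n. of_bool ((0, (j + 1) mod ?n) = v)) = (\<Sum>j<?n. of_bool ((0, j) = v) :: nat)"
      by (rule sum_shift_mod[where f = "\<lambda>j. of_bool ((0, j) = v)"]) (use n4 in linarith)
    finally show ?thesis unfolding S l r by simp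
  next
    case (3 \<beta> s)
    have l: "{e \<in> ?E. mesh_left g N R e = Some f} = {Glue \<beta> s}"
      using 3 by (auto simp: mesh_edges_def split: if_splits)
    let ?j = "\<beta> * N + s" and ?k = "(\<beta> + 3) * N - s - 1"
    have k1: "?k + 1 = (\<beta> + 3) * N - s" using glue_index_bounds(3)[OF 3(2), of s N] 3 gNR by simp
    have jk: "?j < ?n" "?k < ?n" "?j \<noteq> ?k" "(?j + 1) mod ?n = \<beta> * N + (s + 1)"
        "?k = (\<beta> + 3) * N - (s + 1)"
      using glue_index_bounds[OF 3(2), of s N] glue_index_bounds[OF 3(2), of "s + 1" N] 3 gNR
      by (auto simp: algebra_simps)
    have r: "{e \<in> ?E. mesh_right g N R e = Some f} = {Glue \<beta> (s +
        1), Circ (R - 1) ?j, Circ (R - 1) ?k}"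
    proof (intro equalityI subsetI)
      fix e assume e: "e \<in> {e \<in> ?E. mesh_right g N R e = Some f}"
      show "e \<in> {Glue \<beta> (s + 1), Circ (R - 1) ?j, Circ (R - 1) ?k}"
      proof (cases e)
        case (Circ i j)
        then have ij: "i < R" "j < ?n" using e by (auto simp: mesh_edges_def)
        have "mesh_right g N R (Circ i j) = Some (Strip \<beta> s)" using e 3 Circ by blast
        then have "\<not> i + 1 < R \<and> (j = ?j \<or> j = ?k)"
          by (rule iffD1[OF mesh_right_Strip[OF gNR(2) 3(2,3) ij(2)]])
        then show ?thesis using Circ ij by auto
      qed (use e 3 in \<open>auto split: if_splits\<close>)
    next
      fix e assume e: "e \<in> {Glue \<beta> (s + 1), Circ (R - 1) ?j, Circ (R - 1) ?k}"
      have "mesh_right g N R (Circ (R - 1) ?j) = Some f"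
          "mesh_right g N R (Circ (R - 1) ?k) = Some f"
        using mesh_right_Strip[OF gNR(2) 3(2,3) jk(1)] mesh_right_Strip[OF gNR(2) 3(2,3) jk(2)] 3(1)
            gNR
        by (auto simp del: mesh_right.simps)
      moreover have "mesh_right g N R (Glue \<beta> (s + 1)) = Some f" using 3 by simp
      moreover have "Glue \<beta> (s + 1) \<in> ?E" "Circ (R - 1) ?j \<in> ?E" "Circ (R - 1) ?k \<in> ?E"
        using 3 jk gNR by (auto simp: mesh_edges_def)
      ultimately show "e \<in> {e \<in> ?E. mesh_right g N R e = Some f}" using e by blast
    qed
    have k': "((\<beta> + 3) * N - (s + 1)) mod ?n = ?k" using jk(2,5) by (metis mod_less)
    define o1 where "o1 = (of_bool ((R - 1, ?j) = v) :: nat)"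
    define o2 where "o2 = (of_bool ((R - 1, ((\<beta> + 3) * N - s) mod ?n) = v) :: nat)"
    define o3 where "o3 = (of_bool ((R - 1, \<beta> * N + (s + 1)) = v) :: nat)"
    define o4 where "o4 = (of_bool ((R - 1, ?k) = v) :: nat)"
    have w: "?w (Glue \<beta> s) = o1 + o2" "?w (Glue \<beta> (s + 1)) = o3 + o4"
        "?w (Circ (R - 1) ?j) = o1 + o3"
      "?w (Circ (R - 1) ?k) = o4 + o2"
      unfolding mesh_src.simps mesh_tgt.simps jk(4) k1 k' o1_def o2_def o3_def o4_def
          by (rule refl)+
    have s1: "sum ?w {Glue \<beta> s} = ?w (Glue \<beta> s)" by (simp del: mesh_src.simps mesh_tgt.simps)
    have s2: "sum ?w {Glue \<beta> (s + 1), Circ (R - 1) ?j, Circ (R - 1) ?k} =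
      ?w (Glue \<beta> (s + 1)) + (?w (Circ (R - 1) ?j) + ?w (Circ (R - 1) ?k))"
    proof -
      have sum3: "sum h {x, y, z} = h x + (h y + h z)" if "x \<noteq> y" "x \<noteq> z" "y \<noteq> z"
        for h :: "mesh_edge \<Rightarrow> nat" and x y z using that by simp
      show ?thesis by (rule sum3) (use jk(3) in auto)
    qed
    have "even ((o1 + o2) + (o3 + o4 + (o1 + o3 + (o4 + o2))))"
      by (rule dvdI[of _ _ "o1 + o2 + o3 + o4"]) simp
    then show ?thesis unfolding S l r s1 s2 w .
  qed
qed

text \<open>If no edge separates \<open>X\<close> from its complement, then both sides of every edge
  agree about membership in \<open>X\<close>. The outer face is not in \<open>X\<close>, and it
  reaches every other face: through the last rung of each strip down the strip, then ring by ring
  inwards, finally the centre.\<close>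

lemma mesh_dual:
  assumes gNR: "g \<ge> 1" "N \<ge> 1" "R \<ge> 1" and X: "X \<subseteq> mesh_faces g N R" "X \<noteq> {}"
  shows "\<exists>e\<in>mesh_edges g N R. (mesh_left g N R e \<in> Some ` X) \<noteq> (mesh_right g N R e \<in> Some ` X)"
proof (rule ccontr)
  assume "\<not> ?thesis"
  then have eq: "mesh_left g N R e \<in> Some ` X \<longleftrightarrow> mesh_right g N R e \<in> Some ` X"
      if "e \<in> mesh_edges g N R" for e
    using that by blast
  let ?n = "4 * g * N"
  have strip: "Strip \<beta> s \<notin> X" if "\<beta> \<in> glue_sides g" "s < N" for \<beta> s
    using that
  proof (induction "N - s" arbitrary: s rule: less_induct)
    case less
    have "Glue \<beta> (s + 1) \<in> mesh_edges g N R" using less by (auto simp: mesh_edges_def)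
    from eq[OF this] have *: "Strip \<beta> s \<in> X \<longleftrightarrow> s + 1 < N \<and> Strip \<beta> (s + 1) \<in> X"
      by (cases "s + 1 < N") auto
    have "Strip \<beta> (s + 1) \<notin> X" if "s + 1 < N"
      by (rule less.hyps) (use less.prems that in auto)
    then show ?case unfolding * by blast
  qed
  have rstrip: "mesh_right g N R (Circ (R - 1) j) \<notin> Some ` X" if "j < ?n" for j
    using side_cases[OF that gNR(2)] strip gNR(2) by auto
  have sq: "Square i j \<notin> X" if "i < R - 1" "j < ?n" for i j
    using that
  proof (induction "R - i" arbitrary: i rule: less_induct)
    case less
    have "Circ (i + 1) j \<in> mesh_edges g N R" using less by (auto simp: mesh_edges_def)
    from eq[OF this] have *: "Square i j \<in> X \<longleftrightarrow> mesh_right g N R (Circ (i + 1) j) \<in> Some ` X" by auto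
    show ?case
    proof (cases "i + 1 < R - 1")
      case True
      have "Square (i + 1) j \<notin> X" by (rule less.hyps) (use less.prems True in auto)
      moreover have "mesh_right g N R (Circ (i + 1) j) = Some (Square (i + 1) j)" using True by simp
      ultimately show ?thesis using * by (simp only: *) blast
    next
      case False
      then have "i + 1 = R - 1" using less by simp
      then show ?thesis using * rstrip[OF less.prems(2)] by metis
    qed
  qed
  have "Center \<notin> X"
  proof -
    have n: "0 < ?n" using gNR by simp
    then have "Circ 0 0 \<in> mesh_edges g N R" using gNR by (auto simp: mesh_edges_def)
    from eq[OF this] have *: "Center \<in> X \<longleftrightarrow> mesh_right g N R (Circ 0 0) \<in> Some ` X" by auto
    show ?thesis
    proof (cases "R = 1")
      case True then show ?thesis using * rstrip[OF n] by (metis diff_self_eq_0)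
    next
      case False
      then have "Square 0 0 \<notin> X" using sq n gNR by auto
      then show ?thesis using * False gNR by auto
    qed
  qed
  then show False using X sq strip by (auto simp: mesh_faces_def)
qed

section \<open>Connectedness of the mesh and its minors\<close>

lemma symp_mesh_adj: "symp (mesh_adj g N R)"
  by (auto simp: symp_def mesh_adj_def insert_commute)

lemma mesh_adj_Circ: "i < R \<Longrightarrow> j < 4 * g * N \<Longrightarrow> mesh_adj g N R (i, j) (i, (j + 1) mod (4 * g * N))"
  unfolding mesh_adj_def by (rule bexI[of _ "Circ i j"]) (auto simp: mesh_edges_def)

lemma mesh_adj_Rad: "i + 1 < R \<Longrightarrow> j < 4 * g * N \<Longrightarrow> mesh_adj g N R (i, j) (i + 1, j)"
  unfolding mesh_adj_def by (rule bexI[of _ "Rad i j"]) (auto simp: mesh_edges_def)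

lemma mesh_adj_Glue: "\<beta> \<in> glue_sides g \<Longrightarrow> s \<le> N \<Longrightarrow>
    mesh_adj g N R (R - 1, \<beta> * N + s) (R - 1, ((\<beta> + 3) * N - s) mod (4 * g * N))"
  unfolding mesh_adj_def by (rule bexI[of _ "Glue \<beta> s"]) (auto simp: mesh_edges_def)

lemma conn_mesh_ring:
  assumes "i < R"
  shows "conn (mesh_adj g N R) ({i} \<times> {..<4 * g * N})"
proof (rule conn_star[OF symp_mesh_adj, where x = "(i, 0)"])
  fix y assume "y \<in> {i} \<times> {..<4 * g * N}"
  then obtain j where y: "y = (i, j)" and j: "j < 4 * g * N" by auto
  show "(\<lambda>a b. mesh_adj g N R a b \<and> a \<in> {i} \<times> {..<4 * g * N} \<and>
      b \<in> {i} \<times> {..<4 * g * N})\<^sup>*\<^sup>* (i, 0) y"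
    unfolding y using j
  proof (induction j)
    case (Suc j)
    have "mesh_adj g N R (i, j) (i, Suc j)" using mesh_adj_Circ[OF assms, of j g N] Suc.prems
        by simp
    then show ?case using Suc by (intro rtranclp.rtrancl_into_rtrancl[OF Suc.IH]) auto
  qed simp
qed

lemma conn_mesh: "conn (mesh_adj g N R) (mesh_nodes g N R)"
proof (cases "R = 0 \<or> 4 * g * N = 0")
  case True
  then have "mesh_nodes g N R = {}" by (auto simp: mesh_nodes_def)
  then show ?thesis by simp
next
  case False
  have "conn (mesh_adj g N R) ({..<r} \<times> {..<4 * g * N})" if "r \<le> R" for r
    using that
  proof (induction r)
    case (Suc r)
    show ?case
    proof (cases "r = 0")
      case True
      then have "{..<Suc r} = {0}" by auto
      then show ?thesis using conn_mesh_ring[of 0 R g N] Suc by simp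
    next
      case r: False
      have "conn (mesh_adj g N R) ({..<r} \<times> {..<4 * g * N} \<union> {r} \<times> {..<4 * g * N})"
      proof (rule conn_Un_edge[OF symp_mesh_adj])
        show "conn (mesh_adj g N R) ({..<r} \<times> {..<4 * g * N})" using Suc by simp
        show "conn (mesh_adj g N R) ({r} \<times> {..<4 * g * N})" using conn_mesh_ring Suc by simp
        show "(r - 1, 0) \<in> {..<r} \<times> {..<4 * g * N}" "(r, 0) \<in> {r} \<times> {..<4 * g * N}" using False r
            by auto
        show "mesh_adj g N R (r - 1, 0) (r, 0)" using mesh_adj_Rad[of "r - 1" R 0 g N] Suc False r
            by simp
      qed
      moreover have "{..<r} \<times> {..<4 * g * N} \<union> {r} \<times> {..<4 * g * N} = {..<Suc r} \<times> {..<4 * g * N}"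
        by (auto simp: less_Suc_eq)
      ultimately show ?thesis by simp
    qed
  qed simp
  from this[of R] show ?thesis by (simp add: mesh_nodes_def)
qed

text \<open>After the branch sets are enlarged to a partition, one mesh edge is selected for every
  edge of the minor; selected edges have different pairs of end classes.\<close>

lemma mesh_minor_bound:
  assumes gNR: "g \<ge> 1" "N \<ge> 1" "R \<ge> 1"
    and X: "\<And>i. i \<in> I \<Longrightarrow> X i \<noteq> {} \<and> X i \<subseteq> mesh_nodes g N R \<and> conn (mesh_adj g N R) (X i)"
    and dis: "\<And>i j. i \<in> I \<Longrightarrow> j \<in> I \<Longrightarrow> i \<noteq> j \<Longrightarrow> X i \<inter> X j = {}"
    and M: "\<And>e. e \<in> M \<Longrightarrow> \<exists>i\<in>I. \<exists>j\<in>I. i \<noteq> j \<and> e = {i, j} \<and> (\<exists>a\<in>X i. \<exists>b\<in>X j. mesh_adj g N R a b)"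
  shows "card M \<le> 3 * card I + 6 * g"
proof (cases "I = {}")
  case True
  then have "M = {}" using M by blast
  then show ?thesis by simp
next
  case False
  let ?E = "mesh_edges g N R" and ?a = "mesh_src g N R" and ?b = "mesh_tgt g N R"
      and ?V = "mesh_nodes g N R"
  have "\<exists>c. c ` ?V = I \<and> (\<forall>x\<in>?V. conn (mesh_adj g N R) {y \<in> ?V. c y = c x}) \<and> (\<forall>i\<in>I. \<forall>x\<in>X i. c x =
      i)"
    by (rule extend_to_partition[OF _ symp_mesh_adj conn_mesh False X dis]) auto
  then obtain c where c: "c ` ?V = I" "\<And>x. x \<in> ?V \<Longrightarrow> conn (mesh_adj g N R) {y \<in> ?V. c y = c x}"
    "\<And>i x. i \<in> I \<Longrightarrow> x \<in> X i \<Longrightarrow> c x = i" by blast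
  have "\<forall>e\<in>M. \<exists>l\<in>?E. {c (?a l), c (?b l)} = e \<and> c (?a l) \<noteq> c (?b l)"
  proof
    fix e assume "e \<in> M"
    from M[OF this] obtain i j a b where ij: "i \<in> I" "j \<in> I" "i \<noteq> j" "e = {i, j}" "a \<in> X i"
        "b \<in> X j"
      "mesh_adj g N R a b" by blast
    then obtain l where l: "l \<in> ?E" "{?a l, ?b l} = {a, b}" unfolding mesh_adj_def by blast
    then have "{c (?a l), c (?b l)} = {c a, c b}" by (metis image_empty image_insert)
    moreover have "c a = i" "c b = j" using c(3) ij by auto
    ultimately show "\<exists>l\<in>?E. {c (?a l), c (?b l)} = e \<and> c (?a l) \<noteq> c (?b l)"
      using l(1) ij by (intro bexI[of _ l]) (auto simp: doubleton_eq_iff)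
  qed
  then obtain l where l: "\<And>e. e \<in> M \<Longrightarrow> l e \<in> ?E \<and> {c (?a (l e)), c (?b (l e))} = e \<and>
      c (?a (l e)) \<noteq> c (?b (l e))"
    by metis
  have "inj_on l M" using l by (metis inj_onI)
  then have "card (l ` M) = card M" by (rule card_image)
  moreover have "card (l ` M) \<le> 3 * card (c ` ?V) + 6 * g"
  proof (rule map_minor_bound[where a = ?a and b = ?b and ?s1.0 = "mesh_left g N R"
      and ?s2.0 = "mesh_right g N R"
        and Lb = ?E and F = "mesh_faces g N R"])
    show "conn (\<lambda>x y. \<exists>e\<in>?E. {?a e, ?b e} = {x, y}) {y \<in> ?V. c y = c x}" if "x \<in> ?V" for x
      using c(2)[OF that] unfolding mesh_adj_def .
    show "inj_on (\<lambda>e. {c (?a e), c (?b e)}) (l ` M)"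
      by (rule inj_onI) (use l in auto)
  qed (use mesh_ends[OF gNR] mesh_sides[OF gNR] mesh_even[OF gNR] mesh_dual[OF gNR]
      card_mesh[OF gNR(3)] l in auto)
  ultimately show ?thesis using c(1) by simp
qed

section \<open>Topology of the glued disc\<close>

lemma bdry_point_eq_iff:
  assumes "g \<ge> 1"
  shows "bdry_point g t = bdry_point g u \<longleftrightarrow> (\<exists>k::int. t = u + 4 * real g * of_int k)"
proof -
  have g: "real g > 0" using assms by simp
  have "bdry_point g t = bdry_point g u \<longleftrightarrow>
      sin (2 * pi * t / (4 * real g)) = sin (2 * pi * u / (4 * real g)) \<and>
      cos (2 * pi * t / (4 * real g)) = cos (2 * pi * u / (4 * real g))"
    by (auto simp: bdry_point_def complex_eq_iff)
  also have "\<dots> \<longleftrightarrow> (\<exists>k::int. 2 * pi * t / (4 * real g) = 2 * pi * u / (4 * real g) +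
      2 * pi * of_int k)"
    by (rule sin_cos_eq_iff)
  also have "\<dots> \<longleftrightarrow> (\<exists>k::int. t = u + 4 * real g * of_int k)"
  proof (intro ex_cong1)
    fix k :: int
    have "2 * pi * t / (4 * real g) = 2 * pi * u / (4 * real g) + 2 * pi * of_int k \<longleftrightarrow>
       (2 * pi / (4 * real g)) * t = (2 * pi / (4 * real g)) * (u + 4 * real g * of_int k)"
      using g by (simp add: field_simps)
    also have "\<dots> \<longleftrightarrow> t = u + 4 * real g * of_int k" using g by simp
    finally show "2 * pi * t / (4 * real g) = 2 * pi * u / (4 * real g) + 2 * pi * of_int k \<longleftrightarrow>
       t = u + 4 * real g * of_int k" .
  qed
  finally show ?thesis .
qed

lemma norm_bdry_point [simp]: "norm (bdry_point g t) = 1"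
  by (simp add: bdry_point_def)

lemma continuous_bdry_point [continuous_intros]:
  "continuous_on S f \<Longrightarrow> continuous_on S (\<lambda>x. bdry_point g (f x))"
  unfolding bdry_point_def divide_inverse by (intro continuous_intros continuous_on_cis)

lemma side_pairs_glue_sides:
  assumes "g \<ge> 1"
  shows "side_pairs g = {(bdry_point g (real \<beta> + s), bdry_point g (real \<beta> + 3 - s)) | \<beta> s.
     \<beta> \<in> glue_sides g \<and> s \<in> {0..1}}" (is "_ = ?R")
proof -
  have "side_pairs g = {(bdry_point g (4 * real i + s), bdry_point g (4 * real i + 3 - s)) | i s.
           i < g \<and> s \<in> {0..1}} \<union>
        {(bdry_point g (4 * real i + 1 + s), bdry_point g (4 * real i + 4 - s)) | i s.
           i < g \<and> s \<in> {0..1}}" (is "_ = ?A \<union> ?B")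
    using assms by (simp add: side_pairs_def)
  also have "\<dots> = ?R"
  proof (intro equalityI subsetI)
    fix x assume "x \<in> ?A \<union> ?B"
    then consider i s where "x = (bdry_point g (4 * real i + s), bdry_point g (4 * real i + 3 - s))"
        "i < g" "s \<in> {0..1}"
      | i s where "x = (bdry_point g (4 * real i + 1 + s), bdry_point g (4 * real i + 4 - s))"
          "i < g" "s \<in> {0..1}"
      by blast
    then show "x \<in> ?R"
    proof cases
      case 1
      then have "4 * i \<in> glue_sides g" "x = (bdry_point g (real (4 * i) +
          s), bdry_point g (real (4 * i) + 3 - s))"
        by (auto simp: glue_sides_def)
      then show ?thesis using 1 by blast
    next
      case 2
      have "(4 * i + 1) mod 4 = 1 mod 4" by (simp only: mod_mult_self4)
      then have "4 * i + 1 \<in> glue_sides g" using 2 by (auto simp: glue_sides_def)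
      moreover have
        "x = (bdry_point g (real (4 * i + 1) + s), bdry_point g (real (4 * i + 1) + 3 - s))"
        using 2 by (simp add: algebra_simps)
      ultimately show ?thesis using 2 by blast
    qed
  next
    fix x assume "x \<in> ?R"
    then obtain \<beta> s where x: "x = (bdry_point g (real \<beta> + s), bdry_point g (real \<beta> + 3 - s))"
      "\<beta> \<in> glue_sides g" "s \<in> {0..1}" by blast
    define i where "i = \<beta> div 4"
    have i: "i < g" using x(2) by (auto simp: glue_sides_def i_def)
    have "\<beta> = 4 * i + \<beta> mod 4" by (simp add: i_def)
    moreover have "\<beta> mod 4 = 0 \<or> \<beta> mod 4 = 1" using x(2) unfolding glue_sides_def by auto
    ultimately consider "\<beta> = 4 * i" | "\<beta> = 4 * i + 1" by linarith
    then show "x \<in> ?A \<union> ?B"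
    proof cases
      case 1 then show ?thesis using x i by auto
    next
      case 2
      then have "x = (bdry_point g (4 * real i + 1 + s), bdry_point g (4 * real i + 4 - s))"
        using x by (simp add: algebra_simps)
      then show ?thesis using x(3) i by blast
    qed
  qed
  finally show ?thesis .
qed

text \<open>A boundary point with noninteger parameter is interior to exactly one side and has
  exactly one partner, so two steps lead back to the start. Only corners can have several
  partners.\<close>

lemma gluing_step_unique:
  assumes g: "g \<ge> 1"
    and xy: "(x, y) \<in> side_pairs g \<union> (side_pairs g)\<inverse>"
        and yz: "(y, z) \<in> side_pairs g \<union> (side_pairs g)\<inverse>"
  shows "x = z \<or> (x \<in> bdry_point g ` \<int> \<and> y \<in> bdry_point g ` \<int> \<and> z \<in> bdry_point g ` \<int>)"
proof -
  let ?b = "bdry_point g"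
  have form: "\<exists>u \<beta>. \<beta> \<in> glue_sides g \<and> y = ?b u \<and> w = ?b (2 * real \<beta> + 3 - u) \<and>
      ((real \<beta> \<le> u \<and> u \<le> real \<beta> + 1) \<or> (real \<beta> + 2 \<le> u \<and> u \<le> real \<beta> + 3))"
    if w: "(w, y) \<in> side_pairs g \<union> (side_pairs g)\<inverse>" for w
  proof -
    consider \<beta> s where "\<beta> \<in> glue_sides g" "s \<in> {0..1}" "w = ?b (real \<beta> + s)"
        "y = ?b (real \<beta> + 3 - s)"
      | \<beta> s where "\<beta> \<in> glue_sides g" "s \<in> {0..1}" "y = ?b (real \<beta> + s)" "w = ?b (real \<beta> + 3 - s)"
      using w unfolding side_pairs_glue_sides[OF g] by blast
    then show ?thesis
    proof cases
      case 1
      then show ?thesis by (intro exI[of _ "real \<beta> + 3 - s"] exI[of _ \<beta>]) (auto simp: algebra_simps)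
    next
      case 2
      then show ?thesis by (intro exI[of _ "real \<beta> + s"] exI[of _ \<beta>]) (auto simp: algebra_simps)
    qed
  qed
  obtain u \<beta> where u: "\<beta> \<in> glue_sides g" "y = ?b u" "x = ?b (2 * real \<beta> + 3 - u)"
    "(real \<beta> \<le> u \<and> u \<le> real \<beta> + 1) \<or> (real \<beta> + 2 \<le> u \<and> u \<le> real \<beta> + 3)" using form[OF xy] by blast
  have "(z, y) \<in> side_pairs g \<union> (side_pairs g)\<inverse>" using yz by blast
  from form[OF this] obtain v \<beta>' where v: "\<beta>' \<in> glue_sides g" "y = ?b v"
      "z = ?b (2 * real \<beta>' + 3 - v)"
    "(real \<beta>' \<le> v \<and> v \<le> real \<beta>' + 1) \<or> (real \<beta>' + 2 \<le> v \<and> v \<le> real \<beta>' + 3)" by blast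
  obtain k :: int where k: "u = v + 4 * real g * of_int k"
    using u(2) v(2) bdry_point_eq_iff[OF g] by metis
  show ?thesis
  proof (cases "u \<in> \<int>")
    case True
    then have "v \<in> \<int>" using k by (metis Ints_add Ints_diff Ints_mult Ints_numeral Ints_of_int
        Ints_of_nat add_diff_cancel_right')
    then have "2 * real \<beta> + 3 - u \<in> \<int>" "2 * real \<beta>' + 3 - v \<in> \<int>" using True
        by (auto intro!: Ints_diff Ints_add Ints_mult)
    then show ?thesis using u v True by blast
  next
    case False
    have vn: "v \<notin> \<int>" using k False by (metis Ints_add Ints_mult Ints_numeral Ints_of_int
        Ints_of_nat)
    \<comment> \<open>The floor of the parameter is the number of the side. Both numbers lie between
      0 and \<open>4 * g\<close>, so congruence modulo \<open>4 * g\<close> forces them to be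
      equal.\<close>
    define m where "m = \<lfloor>u\<rfloor>"
    define m' where "m' = \<lfloor>v\<rfloor>"
    have strict: "w \<noteq> real c" "w \<noteq> real c + 1" "w \<noteq> real c + 2" "w \<noteq> real c + 3" if "w \<notin> \<int>" for w c
      using that by (auto intro: Ints_add)
    have m: "m = int \<beta> \<or> m = int \<beta> + 2" unfolding m_def
      using u(4) strict[OF False, of \<beta>] by (auto simp: floor_eq_iff)
    have m': "m' = int \<beta>' \<or> m' = int \<beta>' + 2" unfolding m'_def
      using v(4) strict[OF vn, of \<beta>'] by (auto simp: floor_eq_iff)
    have "u = v + of_int (4 * int g * k)" using k by simp
    then have mm: "m = m' + 4 * int g * k" unfolding m_def m'_def by (metis floor_add_int)
    have b: "0 \<le> m" "m < 4 * int g" using m glue_sides_bound[OF u(1)] by auto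
    have b': "0 \<le> m'" "m' < 4 * int g" using m' glue_sides_bound[OF v(1)] by auto
    have "m = m'"
      using mm b b' by (metis mod_mult_self2 mod_pos_pos_trivial)
    then have "k = 0" using mm g by simp
    then have uv: "u = v" using k by simp
    have bm: "\<beta> mod 4 < 2" "\<beta>' mod 4 < 2" using u(1) v(1) by (auto simp: glue_sides_def)
    have "\<beta> = \<beta>'"
    proof -
      have no: False if "a = b + 2" "a mod 4 < 2" "b mod 4 < 2" for a b :: nat
        using that by presburger
      consider "\<beta> = \<beta>'" | "\<beta> = \<beta>' + 2" | "\<beta>' = \<beta> + 2" using m m' \<open>m = m'\<close> by linarith
      then show ?thesis using no bm by cases auto
    qed
    then show ?thesis using u v uv by simp
  qed
qed

text \<open>Makes the transitive closure explicit: besides the identity and single steps it contains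
  only pairs of corners, of which there are finitely many.\<close>

lemma gluing_cases:
  assumes g: "g \<ge> 1" and "(x, y) \<in> (side_pairs g \<union> (side_pairs g)\<inverse>)\<^sup>*"
  shows "x = y \<or> (x, y) \<in> side_pairs g \<union> (side_pairs g)\<inverse> \<or> (x \<in> bdry_point g ` \<int> \<and>
      y \<in> bdry_point g ` \<int>)"
  using assms(2)
proof (induction rule: rtrancl_induct)
  case (step y z)
  from step.IH consider "x = y" | "(x, y) \<in> side_pairs g \<union> (side_pairs g)\<inverse>"
    | "x \<in> bdry_point g ` \<int>" "y \<in> bdry_point g ` \<int>" by blast
  then show ?case
  proof cases
    case 1 then show ?thesis using step by blast
  next
    case 2 then show ?thesis using gluing_step_unique[OF g 2 step(2)] by blast
  next
    case 3
    have "(z, y) \<in> side_pairs g \<union> (side_pairs g)\<inverse>" using step by blast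
    moreover have "(y, z) \<in> side_pairs g \<union> (side_pairs g)\<inverse>" using step by blast
    ultimately have z: "z \<in> bdry_point g ` \<int>" if "z \<notin> bdry_point g ` \<int>"
      using that 3(2)
    proof -
      consider \<beta> s where "\<beta> \<in> glue_sides g" "z = bdry_point g (real \<beta> + s)"
          "y = bdry_point g (real \<beta> + 3 - s)"
        | \<beta> s where "\<beta> \<in> glue_sides g" "y = bdry_point g (real \<beta> + s)"
            "z = bdry_point g (real \<beta> + 3 - s)"
        using step(2) unfolding side_pairs_glue_sides[OF g] by blast
      then have "\<exists>\<beta> u. y = bdry_point g u \<and> z = bdry_point g (2 * real \<beta> + 3 - u)"
      proof cases
        case 1 then show ?thesis by (intro exI[of _ \<beta>] exI[of _ "real \<beta> + 3 - s"]) (auto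
            simp: algebra_simps)
      next
        case 2 then show ?thesis by (intro exI[of _ \<beta>] exI[of _ "real \<beta> + s"]) (auto
            simp: algebra_simps)
      qed
      then obtain \<beta> u where u: "y = bdry_point g u" "z = bdry_point g (2 * real \<beta> + 3 - u)" by blast
      obtain j where j: "j \<in> \<int>" "y = bdry_point g j" using 3(2) by blast
      then obtain k :: int where "u = j + 4 * real g * of_int k" using u(1) bdry_point_eq_iff[OF g]
          by metis
      then have "u \<in> \<int>" using j by (auto intro!: Ints_add Ints_mult)
      then show ?thesis using u(2) by (auto intro!: imageI Ints_diff Ints_add Ints_mult)
    qed
    then show ?thesis using 3 by blast
  qed
qed simp

lemma side_pairs_subset: "g \<ge> 1 \<Longrightarrow> side_pairs g \<subseteq> cball 0 1 \<times> cball 0 1"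
  by (auto simp: side_pairs_glue_sides)

lemma finite_corners:
  assumes "g \<ge> 1" shows "finite (bdry_point g ` \<int>)"
proof (rule finite_subset)
  show "bdry_point g ` \<int> \<subseteq> (\<lambda>m. bdry_point g (real m)) ` {..<4 * g}"
  proof
    fix z assume "z \<in> bdry_point g ` \<int>"
    then obtain j :: int where z: "z = bdry_point g (of_int j)" by (auto elim: Ints_cases)
    let ?m = "nat (j mod (4 * int g))"
    have m: "0 \<le> j mod (4 * int g)" "j mod (4 * int g) < 4 * int g" using assms by auto
    have "of_int j = real ?m + 4 * real g * of_int (j div (4 * int g))"
    proof -
      have "j = int ?m + 4 * int g * (j div (4 * int g))" using m by simp
      then have "real_of_int j = real_of_int (int ?m + 4 * int g * (j div (4 * int g)))"
          by (simp only:)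
      then show ?thesis by simp
    qed
    then have "z = bdry_point g (real ?m)" unfolding z bdry_point_eq_iff[OF assms] by blast
    moreover have "?m < 4 * g" using m by linarith
    ultimately show "z \<in> (\<lambda>m. bdry_point g (real m)) ` {..<4 * g}" by blast
  qed
qed simp

text \<open>The relation is a union of compact pieces: the diagonal, the curves of side pairs and
  their converses, and a finite set of corner pairs.\<close>

lemma compact_gluing:
  assumes g: "g \<ge> 1" shows "compact (gluing g)"
proof -
  let ?C = "bdry_point g ` \<int>" and ?S = "side_pairs g"
  have eq: "gluing g = (\<lambda>z. (z, z)) ` cball 0 1 \<union> (?S \<union> ?S\<inverse>) \<union> (gluing g \<inter> ?C \<times> ?C)"
  proof (intro equalityI subsetI)
    fix w assume w: "w \<in> gluing g"
    obtain x y where xy: "w = (x, y)" by (cases w)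
    then have "(x, y) \<in> (?S \<union> ?S\<inverse>)\<^sup>*" "x \<in> cball 0 1" using w by (auto simp: gluing_def)
    from gluing_cases[OF g this(1)] this(2) show "w \<in> (\<lambda>z. (z, z)) ` cball 0 1 \<union> (?S \<union> ?S\<inverse>) \<union>
        (gluing g \<inter> ?C \<times> ?C)"
      using w xy by blast
  next
    fix w assume "w \<in> (\<lambda>z. (z, z)) ` cball 0 1 \<union> (?S \<union> ?S\<inverse>) \<union> (gluing g \<inter> ?C \<times> ?C)"
    then show "w \<in> gluing g" using side_pairs_subset[OF g] by (auto simp: gluing_def)
  qed
  have "?S = (\<Union>\<beta>\<in>glue_sides g. (\<lambda>s. (bdry_point g (real \<beta> + s), bdry_point g (real \<beta> +
      3 - s))) ` {0..1})"
    unfolding side_pairs_glue_sides[OF g] by blast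
  moreover have "compact \<dots>"
    by (intro compact_UN ballI compact_continuous_image continuous_intros) auto
  ultimately have S: "compact ?S" by simp
  have "?S\<inverse> = (\<lambda>(x, y). (y, x)) ` ?S" by auto
  then have S': "compact (?S\<inverse>)" using S by (auto intro!: compact_continuous_image continuous_intros
      simp: case_prod_unfold)
  have "compact ((\<lambda>z. (z, z)) ` cball (0::complex) 1)"
    by (intro compact_continuous_image continuous_intros) auto
  moreover have "compact (gluing g \<inter> ?C \<times> ?C)" using finite_corners[OF g]
      by (simp add: finite_imp_compact)
  ultimately show ?thesis using S S' by (subst eq) (intro compact_Un)
qed

text \<open>The saturation of a closed set is the projection of a compact part of the relation,
  hence closed. From this follow the Hausdorff property and the closedness of images of unions of
  cells.\<close>

lemma closed_map_genus_surface:
  assumes g: "g \<ge> 1"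
  shows "closed_map (top_of_set (cball 0 1)) (genus_surface g) (\<lambda>z. gluing g `` {z})"
  unfolding closed_map_def
proof (intro allI impI)
  fix C :: "complex set" assume C: "closedin (top_of_set (cball 0 1)) C"
  let ?q = "\<lambda>z. gluing g `` {z}"
  have CD: "C \<subseteq> cball 0 1" using C by (auto dest: closedin_imp_subset)
  have Cc: "closed C" using C by (metis closed_cball closedin_closed_eq)
  have cc: "compact (snd ` (gluing g \<inter> C \<times> UNIV))"
    by (intro compact_continuous_image compact_Int_closed compact_gluing[OF g] continuous_intros
      closed_Times Cc closed_UNIV)
  have eq: "{z \<in> topspace (top_of_set (cball 0 1)). ?q z \<in> ?q ` C} = snd ` (gluing g \<inter> C \<times> UNIV)"
  proof (intro equalityI subsetI)
    fix z assume "z \<in> {z \<in> topspace (top_of_set (cball 0 1)). ?q z \<in> ?q ` C}"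
    then obtain c where c: "z \<in> cball 0 1" "c \<in> C" "?q z = ?q c" by auto
    then have "(c, z) \<in> gluing g" using equiv_class_self[OF equiv_gluing, of z g] by blast
    then show "z \<in> snd ` (gluing g \<inter> C \<times> UNIV)" using c by force
  next
    fix z assume "z \<in> snd ` (gluing g \<inter> C \<times> UNIV)"
    then obtain c where c: "(c, z) \<in> gluing g" "c \<in> C" by auto
    then have "?q c = ?q z" using equiv_class_eq[OF equiv_gluing] by blast
    moreover have "z \<in> cball 0 1" using c by (auto simp: gluing_def)
    ultimately show "z \<in> {z \<in> topspace (top_of_set (cball 0 1)). ?q z \<in> ?q ` C}" using c by auto
  qed
  have "closed {z \<in> topspace (top_of_set (cball 0 1)). ?q z \<in> ?q ` C}"
    unfolding eq using cc by (rule compact_imp_closed)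
  then have "closedin (top_of_set (cball 0 1)) {z \<in> topspace (top_of_set (cball 0 1)). ?q z \<in> ?q `
      C}"
    by (rule closed_subset[rotated]) auto
  moreover have "?q ` C \<subseteq> topspace (genus_surface g)" using CD
      by (auto simp: topspace_genus_surface quotient_def)
  ultimately show "closedin (genus_surface g) (?q ` C)"
    using quotient_map_genus_surface[of g] unfolding quotient_map_closedin by blast
qed

lemma Hausdorff_genus_surface:
  assumes g: "g \<ge> 1" shows "Hausdorff_space (genus_surface g)"
proof -
  have h: "Hausdorff_space (top_of_set (cball (0::complex) 1))"
      by (simp add: Hausdorff_space_subtopology)
  moreover have "normal_space (top_of_set (cball (0::complex) 1))"
    using h by (intro compact_Hausdorff_or_regular_imp_normal_space) (auto
        simp: compact_space_subtopology)
  ultimately show ?thesis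
    using normal_Hausdorff_space_closed_continuous_map_image[OF _ _ closed_map_genus_surface[OF g]]
      quotient_imp_continuous_map[OF quotient_map_genus_surface]
          quotient_imp_surjective_map[OF quotient_map_genus_surface]
    by blast
qed

definition disc_part :: "nat \<Rightarrow> complex set set \<Rightarrow> complex set" where
  "disc_part g A = {z \<in> cball 0 1. gluing g `` {z} \<in> A}"

lemma compact_disc_part:
  assumes "closedin (genus_surface g) A"
  shows "compact (disc_part g A)"
proof -
  have "closedin (top_of_set (cball 0 1)) {z \<in> topspace (top_of_set (cball 0 1)). gluing g `` {z} \<in>
      A}"
    by (rule closedin_continuous_map_preimage[OF quotient_imp_continuous_map[OF
      quotient_map_genus_surface] assms])
  then have "closedin (top_of_set (cball 0 1)) (disc_part g A)" by (simp add: disc_part_def)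
  then have "closed (disc_part g A)" by (metis closed_cball closedin_closed_eq)
  moreover have "disc_part g A \<subseteq> cball 0 1" by (auto simp: disc_part_def)
  ultimately show ?thesis using bounded_cball bounded_subset compact_eq_bounded_closed by blast
qed

lemma disc_part_glued:
  assumes "z \<in> disc_part g A" "(z, w) \<in> gluing g"
  shows "w \<in> disc_part g A"
  using assms equiv_class_eq[OF equiv_gluing assms(2)] by (auto simp: disc_part_def gluing_def)

lemma disc_part_meets:
  assumes "x \<in> A" "x \<in> topspace (genus_surface g)"
  obtains z where "z \<in> disc_part g A" "gluing g `` {z} = x"
  using assms by (auto simp: topspace_genus_surface quotient_def disc_part_def)

section \<open>Mesh cells and traces of closed sets\<close>

definition ring_point :: "nat \<Rightarrow> nat \<Rightarrow> nat \<Rightarrow> nat \<times> nat \<Rightarrow> complex" where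
  "ring_point g N R v = of_real (real (fst v + 1) / real R) * bdry_point g (real (snd v) / real N)"

text \<open>Ring \<open>i\<close> has radius \<open>(i + 1) / R\<close>, which leaves the disc of
  radius \<open>1 / R\<close> as the centre cell. Strips have no area in the disc; they stand for
  the identification of two sides.\<close>

fun cell :: "nat \<Rightarrow> nat \<Rightarrow> nat \<Rightarrow> mesh_face \<Rightarrow> complex set" where
  "cell g N R (Square i j) = (\<lambda>(r, t). of_real r * bdry_point g t) `
     ({real (i + 1) / real R..real (i + 2) / real R} \<times> {real j / real N..real (j + 1) / real N})"
| "cell g N R Center = cball 0 (1 / real R)"
| "cell g N R (Strip \<beta> s) = {}"

fun cell_corners :: "nat \<Rightarrow> nat \<Rightarrow> nat \<Rightarrow> mesh_face \<Rightarrow> (nat \<times> nat) set" where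
  "cell_corners g N R (Square i j) = {(i, j), (i + 1, j), (i, (j + 1) mod (4 * g * N)), (i + 1, (j +
      1) mod (4 * g * N))}"
| "cell_corners g N R Center = {0} \<times> {..<4 * g * N}"
| "cell_corners g N R (Strip \<beta> s) = {}"

text \<open>Discrete copy of a set, taken from all cells that meet it; thickening to whole cells is
  what lets connectedness survive.\<close>

definition trace :: "nat \<Rightarrow> nat \<Rightarrow> nat \<Rightarrow> complex set \<Rightarrow> (nat \<times> nat) set" where
  "trace g N R A = (\<Union>f\<in>{f \<in> mesh_faces g N R. cell g N R f \<inter> A \<noteq> {}}. cell_corners g N R f)"

lemma compact_cell: "compact (cell g N R f)"
proof (cases f)
  case (Square i j)
  have "continuous_on X (\<lambda>p. of_real (fst p) * bdry_point g (snd p))" for X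
    by (intro continuous_intros)
  then show ?thesis unfolding Square cell.simps
    by (intro compact_continuous_image compact_Times compact_Icc) (simp add: case_prod_unfold)
qed auto

lemma cell_subset:
  assumes "f \<in> mesh_faces g N R" "R \<ge> 1"
  shows "cell g N R f \<subseteq> cball 0 1"
proof (cases f)
  case (Square i j)
  then have R: "real (i + 2) / real R \<le> 1" using assms by (auto simp: field_simps)
  show ?thesis
  proof
    fix z assume "z \<in> cell g N R f"
    then obtain r t where r: "z = of_real r * bdry_point g t" "real (i + 1) / real R \<le> r"
        "r \<le> real (i + 2) / real R"
      unfolding Square by auto
    have "0 \<le> real (i + 1) / real R" by simp
    then have "0 \<le> r" "r \<le> 1" using r R by linarith+
    then show "z \<in> cball 0 1" unfolding r(1) by (simp add: norm_mult)
  qed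
next
  case Center
  have "1 / real R \<le> 1" using assms(2) by simp
  then show ?thesis unfolding Center by auto
qed auto

lemma cells_cover:
  assumes g: "g \<ge> 1" "N \<ge> 1" "R \<ge> 1" and z: "z \<in> cball 0 1"
  shows "\<exists>f\<in>mesh_faces g N R. z \<in> cell g N R f"
proof (cases "norm z \<le> 1 / real R")
  case True
  then show ?thesis by (intro bexI[of _ Center]) auto
next
  case False
  define r where "r = norm z"
  define t where "t = 4 * real g * Arg2pi z / (2 * pi)"
  have r1: "r \<le> 1" "r * R > 1" using z False g by (auto simp: r_def field_simps)
  have z0: "z = of_real r * bdry_point g t"
  proof -
    have "2 * pi * t / (4 * real g) = Arg2pi z" using g by (simp add: t_def)
    then show ?thesis using Arg2pi_eq[of z] by (simp add: r_def bdry_point_def cis_conv_exp)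
  qed
  have t: "0 \<le> t" "t < 4 * real g"
  proof -
    show "0 \<le> t" using Arg2pi_ge_0[of z] by (simp add: t_def)
    have "4 * real g * Arg2pi z < 4 * real g * (2 * pi)" using Arg2pi_lt_2pi[of z] g by simp
    then show "t < 4 * real g" unfolding t_def by (simp add: field_simps)
  qed
  define j where "j = nat \<lfloor>t * N\<rfloor>"
  have jr: "real j \<le> t * N" "t * N \<le> real j + 1" using t g by (auto simp: j_def)
  have "t * N < 4 * real g * real N" using t g by simp
  then have jn: "j < 4 * g * N" using jr(1) by (metis le_less_trans of_nat_less_iff of_nat_mult
      of_nat_numeral)
  \<comment> \<open>\<open>Square i j\<close> spans the radii from \<open>(i + 1) / R\<close> to
    \<open>(i + 2) / R\<close>. The ceiling is at least 2, as \<open>r * R \<le> 1\<close> belongs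
    to the centre cell.\<close>
  define i where "i = nat \<lceil>r * R\<rceil> - 2"
  have c: "\<lceil>r * R\<rceil> \<ge> 2" "\<lceil>r * R\<rceil> \<le> int R"
  proof -
    show "\<lceil>r * R\<rceil> \<ge> 2" using r1 by linarith
    have "r * R \<le> 1 * real R" using r1 by (intro mult_right_mono) auto
    then show "\<lceil>r * R\<rceil> \<le> int R" by (simp add: ceiling_le_iff)
  qed
  have i2: "int i + 2 = \<lceil>r * R\<rceil>"
  proof -
    have "nat \<lceil>r * R\<rceil> \<ge> 2" using c(1) by linarith
    then have "int i = int (nat \<lceil>r * R\<rceil>) - 2" by (simp add: i_def of_nat_diff)
    also have "int (nat \<lceil>r * R\<rceil>) = \<lceil>r * R\<rceil>" using c(1) by (intro nat_0_le) linarith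
    finally show ?thesis by simp
  qed
  have ir: "real i + 1 \<le> r * R" "r * R \<le> real i + 2"
  proof -
    have "real i + 2 = of_int \<lceil>r * R\<rceil>" using i2
        by (metis of_int_add of_int_numeral of_int_of_nat_eq)
    then show "real i + 1 \<le> r * R" "r * R \<le> real i + 2" by linarith+
  qed
  have "i < R - 1" using i2 c by linarith
  then have "Square i j \<in> mesh_faces g N R" using jn by simp
  moreover have "z \<in> cell g N R (Square i j)"
  proof -
    have "(r, t) \<in> {real (i + 1) / real R..real (i + 2) / real R} \<times> {real j / real N..real (j +
        1) / real N}"
      using ir jr g by (auto simp: field_simps)
    moreover have "z = (\<lambda>(r, t). of_real r * bdry_point g t) (r, t)" using z0 by simp
    ultimately show ?thesis unfolding cell.simps by blast
  qed
  ultimately show ?thesis by blast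
qed

lemma cell_corners_nodes:
  assumes "f \<in> mesh_faces g N R" "R \<ge> 1"
  shows "cell_corners g N R f \<subseteq> mesh_nodes g N R"
proof (cases f)
  case (Square i j)
  have "(j + 1) mod (4 * g * N) < 4 * g * N"
  proof (rule mod_less_divisor)
    have "j < 4 * g * N" using assms Square by simp
    then show "0 < 4 * g * N" by linarith
  qed
  then show ?thesis using assms Square by (auto simp: mesh_nodes_def)
qed (use assms in \<open>auto simp: mesh_nodes_def\<close>)

lemma conn_cell_corners:
  assumes "f \<in> mesh_faces g N R" "R \<ge> 1"
  shows "conn (mesh_adj g N R) (cell_corners g N R f)"
proof (cases f)
  case (Square i j)
  let ?j = "(j + 1) mod (4 * g * N)"
  have ij: "i + 1 < R" "j < 4 * g * N" using assms Square by auto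
  moreover have "?j < 4 * g * N" by (rule mod_less_divisor) (use ij(2) in linarith)
  ultimately have ij: "i + 1 < R" "j < 4 * g * N" "?j < 4 * g * N" by auto
  have "conn (mesh_adj g N R) {(i, j), (i + 1, j)}" "conn (mesh_adj g N R) {(i, ?j), (i + 1, ?j)}"
    using mesh_adj_Rad[OF ij(1,2)] mesh_adj_Rad[OF ij(1,3)]
        by (simp_all add: conn_pair symp_mesh_adj)
  moreover have "mesh_adj g N R (i, j) (i, ?j)" using mesh_adj_Circ[of i R j g N] ij by simp
  ultimately have "conn (mesh_adj g N R) ({(i, j), (i + 1, j)} \<union> {(i, ?j), (i + 1, ?j)})"
    by (intro conn_Un_edge[OF symp_mesh_adj]) auto
  moreover have "{(i, j), (i + 1, j)} \<union> {(i, ?j), (i + 1, ?j)} = cell_corners g N R f"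
      unfolding Square by auto
  ultimately show ?thesis by simp
next
  case Center
  then show ?thesis using conn_mesh_ring[of 0 R g N] assms by simp
qed auto

text \<open>Squares with a common point have ring numbers that differ by at most one, and angular
  numbers that differ by at most one modulo \<open>4 * g * N\<close>; choosing the larger of the two
  in either coordinate gives a common corner.\<close>

lemma cells_share_corner:
  assumes g: "g \<ge> 1" "N \<ge> 1" "R \<ge> 1" and f: "f \<in> mesh_faces g N R" "f' \<in> mesh_faces g N R"
    and z: "z \<in> cell g N R f" "z \<in> cell g N R f'"
  shows "cell_corners g N R f \<inter> cell_corners g N R f' \<noteq> {}"
proof -
  let ?n = "4 * g * N"
  have n: "?n > 0" using g by simp
  have cs: "cell_corners g N R Center \<inter> cell_corners g N R (Square i j) \<noteq> {}"
    if sq: "Square i j \<in> mesh_faces g N R" "z \<in> cell g N R (Square i j)" "z \<in> cell g N R Center"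
        for i j
  proof -
    obtain r t where r: "z = of_real r * bdry_point g t" "real (i + 1) / real R \<le> r" using sq(2)
        by auto
    have "0 \<le> r" using r(2) by (meson divide_nonneg_nonneg of_nat_0_le_iff order_trans)
    then have "r \<le> 1 / real R" using sq(3) r(1) by (simp add: norm_mult)
    then have "real (i + 1) / real R \<le> 1 / real R" using r(2) by linarith
    then have "real (i + 1) \<le> 1" using g by (simp add: divide_le_cancel)
    then have "i = 0" by simp
    then show ?thesis using sq(1) by auto
  qed
  show ?thesis
  proof (cases f)
    case (Square i j)
    show ?thesis
    proof (cases f')
      case S': (Square i' j')
      obtain r t where r: "z = of_real r * bdry_point g t" "real (i + 1) / real R \<le> r"
          "r \<le> real (i + 2) / real R"
        "real j / real N \<le> t" "t \<le> real (j + 1) / real N" using z(1) Square by auto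
      obtain r' t' where r': "z = of_real r' * bdry_point g t'" "real (i' + 1) / real R \<le> r'"
          "r' \<le> real (i' + 2) / real R"
        "real j' / real N \<le> t'" "t' \<le> real (j' + 1) / real N" using z(2) S' by auto
      have pos: "r > 0" "r' > 0" using r(2) r'(2) g by (auto intro: less_le_trans[rotated])
      then have "r = r'" using arg_cong[of _ _ norm, OF trans[OF r(1)[symmetric] r'(1)]]
          by (simp add: norm_mult)
      then have "bdry_point g t = bdry_point g t'" using r(1) r'(1) pos by simp
      then obtain k :: int where k: "t = t' + 4 * real g * of_int k"
          using bdry_point_eq_iff[OF g(1)] by blast
      have ii: "i = i' \<or> i = i' + 1 \<or> i' = i + 1"
      proof -
        have "real (i + 1) / real R \<le> real (i' + 2) / real R"
            "real (i' + 1) / real R \<le> real (i + 2) / real R"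
          using r r' \<open>r = r'\<close> by linarith+
        then have "i \<le> i' + 1" "i' \<le> i + 1" using g by (auto simp: divide_le_cancel)
        then show ?thesis by linarith
      qed
      have tN: "t * N = t' * N + of_int (int ?n * k)" using k by (simp add: algebra_simps)
      have "real j \<le> t * N" "t * N \<le> real (j + 1)" "real j' \<le> t' * N" "t' * N \<le> real (j' + 1)"
        using r r' g by (auto simp: field_simps)
      then have "real j \<le> real (j' + 1) + of_int (int ?n * k)"
          "real j' + of_int (int ?n * k) \<le> real (j + 1)"
        using tN by linarith+
      then have "real_of_int (int j) \<le> of_int (int j' + 1 + int ?n * k)"
          "real_of_int (int j' + int ?n * k) \<le> of_int (int j + 1)"
        by simp_all
      then have "int j \<le> int j' + 1 + int ?n * k" "int j' + int ?n * k \<le> int j + 1"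
        by (simp_all only: of_int_le_iff)
      then consider "int j = int j' + int ?n * k" | "int j = int (j' + 1) + int ?n * k" |
          "int j' + int ?n * k = int (j + 1)"
        by fastforce
      then have jj: "j = j' \<or> j = (j' + 1) mod ?n \<or> j' = (j + 1) mod ?n"
      proof cases
        case 1
        then have "int j mod int ?n = int j' mod int ?n" by simp
        then have "j mod ?n = j' mod ?n" by (metis of_nat_eq_iff of_nat_mod)
        then show ?thesis using f Square S' by simp
      next
        case 2
        then have "int j mod int ?n = int (j' + 1) mod int ?n" by simp
        then have "j mod ?n = (j' + 1) mod ?n" by (metis of_nat_eq_iff of_nat_mod)
        then show ?thesis using f Square by simp
      next
        case 3
        then have "int j' mod int ?n = int (j + 1) mod int ?n" by (metis mod_mult_self2)
        then have "j' mod ?n = (j + 1) mod ?n" by (metis of_nat_eq_iff of_nat_mod)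
        then show ?thesis using f S' by simp
      qed
      define a where "a = (if i = i' + 1 then i else i')"
      define b where "b = (if j = (j' + 1) mod ?n then j else j')"
      have "a = i \<or> a = i + 1" "a = i' \<or> a = i' + 1" using ii by (auto simp: a_def)
      moreover have "b = j \<or> b = (j + 1) mod ?n" "b = j' \<or> b = (j' + 1) mod ?n" using jj
          by (auto simp: b_def)
      ultimately have "(a, b) \<in> cell_corners g N R f \<inter> cell_corners g N R f'"
        unfolding Square S' cell_corners.simps by blast
      then show ?thesis by blast
    next
      case Center
      then show ?thesis using cs[of i j] f z Square by blast
    qed (use z in auto)
  next
    case Center
    show ?thesis
    proof (cases f')
      case (Square i j)
      then show ?thesis using cs[of i j] f z Center by blast
    next
      case C': Center
      have "(0, 0) \<in> cell_corners g N R f \<inter> cell_corners g N R f'" using Center C' n by simp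
      then show ?thesis by blast
    qed (use z in auto)
  qed (use z in auto)
qed

lemma dist_bdry_point: "norm (bdry_point g t - bdry_point g u) \<le> 2 * pi * \<bar>t - u\<bar> / (4 * real g)"
proof -
  let ?a = "2 * pi * t / (4 * real g)" and ?b = "2 * pi * u / (4 * real g)"
  have "bdry_point g t - bdry_point g u = cis ?b * (cis (?a - ?b) - 1)"
    by (simp add: bdry_point_def cis_mult algebra_simps)
  then have "norm (bdry_point g t - bdry_point g u) = norm (exp (\<i> * of_real (?a - ?b)) - 1)"
    by (simp add: norm_mult cis_conv_exp)
  also have "\<dots> = 2 * \<bar>sin ((?a - ?b) / 2)\<bar>" by (rule dist_exp_i_1)
  also have "\<dots> \<le> \<bar>?a - ?b\<bar>" using abs_sin_x_le_abs_x[of "(?a - ?b) / 2"] by simp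
  also have "?a - ?b = 2 * pi * (t - u) / (4 * real g)"
      by (simp add: algebra_simps diff_divide_distrib)
  finally show ?thesis by (simp add: abs_mult)
qed

lemma cell_near_corner:
  assumes g: "g \<ge> 1" "N \<ge> 1" "R \<ge> 1" and f: "f \<in> mesh_faces g N R" "z \<in> cell g N R f"
      "v \<in> cell_corners g N R f"
  shows "dist z (ring_point g N R v) \<le> 2 / real R + 2 / real N"
proof (cases f)
  case (Square i j)
  let ?n = "4 * g * N"
  obtain r t where r: "z = of_real r * bdry_point g t" "real (i + 1) / real R \<le> r"
      "r \<le> real (i + 2) / real R"
        "real j / real N \<le> t" "t \<le> real (j + 1) / real N" using f(2) Square by auto
  obtain a j' where v: "v = (a, j' mod ?n)" "a = i \<or> a = i + 1" "j' = j \<or> j' = j + 1"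
  proof -
    have "j mod ?n = j" using f(1) Square by simp
    moreover from f(3) Square consider "v = (i, j)" | "v = (i + 1, j)" | "v = (i, (j + 1) mod ?n)" |
        "v = (i + 1, (j + 1) mod ?n)"
      by auto
    ultimately show thesis using that[of i j] that[of "i + 1" j] that[of i "j + 1"] that[of "i + 1"
        "j + 1"]
      by cases auto
  qed
  define \<rho> where "\<rho> = real (a + 1) / real R"
  define u where "u = real j' / real N"
  have "bdry_point g (real (j' mod ?n) / real N) = bdry_point g u"
  proof -
    have "real j' = real (j' mod ?n) + real ?n * real (j' div ?n)"
      by (metis add.commute mult_div_mod_eq of_nat_add of_nat_mult)
    then have "u = real (j' mod ?n) / real N + 4 * real g * of_int (int (j' div ?n))"
      unfolding u_def using g by (simp add: field_simps)
    then show ?thesis using bdry_point_eq_iff[OF g(1)] by metis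
  qed
  then have p: "ring_point g N R v = of_real \<rho> * bdry_point g u"
      by (simp add: ring_point_def v(1) \<rho>_def)
  have rr: "\<bar>r - \<rho>\<bar> \<le> 1 / real R" using r(2,3) v(2) unfolding \<rho>_def
      by (auto simp: add_divide_distrib field_simps)
  have tt: "\<bar>t - u\<bar> \<le> 1 / real N" using r(4,5) v(3) unfolding u_def
      by (auto simp: add_divide_distrib field_simps)
  have \<rho>1: "0 \<le> \<rho>" "\<rho> \<le> 1"
  proof -
    have "a + 1 \<le> R" using v(2) f(1) Square by auto
    then show "0 \<le> \<rho>" "\<rho> \<le> 1" using g by (auto simp: \<rho>_def)
  qed
  have "z - ring_point g N R v = of_real (r - \<rho>) * bdry_point g t +
      of_real \<rho> * (bdry_point g t - bdry_point g u)"
    unfolding r(1) p by (simp add: algebra_simps)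
  then have "norm (z - ring_point g N R v) \<le> \<bar>r - \<rho>\<bar> + \<bar>\<rho>\<bar> * norm (bdry_point g t - bdry_point g u)"
    by (metis norm_triangle_ineq norm_mult norm_of_real norm_bdry_point mult.right_neutral)
  also have "\<dots> \<le> 1 / real R + 1 * (2 * (1 / real N))"
  proof (intro add_mono rr mult_mono)
    have "norm (bdry_point g t - bdry_point g u) \<le> 2 * pi * \<bar>t - u\<bar> / (4 * real g)"
        by (rule dist_bdry_point)
    also have "\<dots> = (pi / (2 * real g)) * \<bar>t - u\<bar>" by simp
    also have "\<dots> \<le> 2 * (1 / real N)"
    proof (intro mult_mono tt)
      have "pi \<le> 4" using pi_less_4 by simp
      also have "4 \<le> 2 * (2 * real g)" using g by simp
      finally show "pi / (2 * real g) \<le> 2" using g by (simp add: field_simps)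
    qed auto
    finally show "norm (bdry_point g t - bdry_point g u) \<le> 2 * (1 / real N)" .
  qed (use \<rho>1 in auto)
  also have "\<dots> \<le> 2 / real R + 2 / real N" using g by (simp add: field_simps)
  finally show ?thesis by (simp add: dist_norm)
next
  case Center
  have "norm z \<le> 1 / real R" using f(2) Center by simp
  moreover have "norm (ring_point g N R v) = 1 / real R"
    using f(3) Center by (auto simp: ring_point_def norm_mult norm_divide)
  ultimately have "dist z (ring_point g N R v) \<le> 2 / real R"
    using norm_triangle_ineq4[of z "ring_point g N R v"] by (simp add: dist_norm)
  then show ?thesis by (simp add: add_increasing2)
qed (use f in auto)

text \<open>The cells at two glued boundary points may lie far apart in the disc, but a rung joins a
  corner of one to a corner of the other. This carries connectedness across the gluing.\<close>

lemma cells_glued: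
  assumes g: "g \<ge> 1" "N \<ge> 1" "R \<ge> 2" and b: "\<beta> \<in> glue_sides g" and s: "s \<in> {0..1}"
  shows "\<exists>f\<in>mesh_faces g N R. \<exists>f'\<in>mesh_faces g N R. bdry_point g (real \<beta> + s) \<in> cell g N R f \<and>
    bdry_point g (real \<beta> + 3 - s) \<in> cell g N R f' \<and>
    (\<exists>a\<in>cell_corners g N R f. \<exists>b\<in>cell_corners g N R f'. mesh_adj g N R a b)"
proof -
  let ?n = "4 * g * N"
  \<comment> \<open>The minimum takes care of \<open>s = 1\<close>, which belongs to the last square
    of the side.\<close>
  define s' where "s' = min (nat \<lfloor>s * N\<rfloor>) (N - 1)"
  have s': "s' < N" "real s' \<le> s * N" "s * N \<le> real s' + 1"
  proof -
    show "s' < N" using g by (simp add: s'_def)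
    have sN: "0 \<le> s * N" "s * N \<le> N" using s g by (auto simp: mult_left_le_one_le)
    have "real (nat \<lfloor>s * N\<rfloor>) \<le> s * N" "s * N \<le> real (nat \<lfloor>s * N\<rfloor>) + 1" using sN by auto
    moreover have "real N - 1 \<le> s * N" if "\<not> nat \<lfloor>s * N\<rfloor> \<le> N - 1"
    proof -
      have "real (N - 1) \<le> real (nat \<lfloor>s * N\<rfloor>)" using that by simp
      then show ?thesis using \<open>real (nat \<lfloor>s * N\<rfloor>) \<le> s * N\<close> g by (simp add: of_nat_diff)
    qed
    ultimately show "real s' \<le> s * N" "s * N \<le> real s' + 1" using sN g
        by (auto simp: s'_def min_def of_nat_diff)
  qed
  let ?j = "\<beta> * N + s'" and ?k = "(\<beta> + 3) * N - (s' + 1)"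
  have bounds: "?j < ?n" "?k < ?n" "s' + 1 < (\<beta> + 3) * N"
    using glue_index_bounds[OF b, of s' N] glue_index_bounds[OF b, of "s' + 1" N] s' g by auto
  have k1: "?k + 1 = (\<beta> + 3) * N - s'" using bounds(3) by linarith
  have kr: "real ?k = (real \<beta> + 3) * real N - real s' - 1"
    using bounds(3) by (subst of_nat_diff) (auto simp: algebra_simps)
  have cellI: "bdry_point g t \<in> cell g N R (Square (R - 2) j)"
      if "real j \<le> t * N" "t * N \<le> real j + 1" for t :: real and j
  proof -
    have "(1, t) \<in> {real (R - 2 + 1) / real R..real (R - 2 +
        2) / real R} \<times> {real j / real N..real (j + 1) / real N}"
      using that g by (auto simp: field_simps)
    moreover have "bdry_point g t = (\<lambda>(r, t). of_real r * bdry_point g t) (1, t)" by simp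
    ultimately show ?thesis unfolding cell.simps by blast
  qed
  have "bdry_point g (real \<beta> + s) \<in> cell g N R (Square (R - 2) ?j)"
    by (rule cellI) (use s' in \<open>auto simp: algebra_simps\<close>)
  moreover have "bdry_point g (real \<beta> + 3 - s) \<in> cell g N R (Square (R - 2) ?k)"
    by (rule cellI) (use s' in \<open>auto simp: kr algebra_simps\<close>)
  moreover have "Square (R - 2) ?j \<in> mesh_faces g N R" "Square (R - 2) ?k \<in> mesh_faces g N R"
    using bounds g by auto
  moreover have "(R - 1, ?j) \<in> cell_corners g N R (Square (R - 2) ?j)" using g by auto
  moreover have "(R - 1, ((\<beta> + 3) * N - s') mod ?n) \<in> cell_corners g N R (Square (R - 2) ?k)"
    using g unfolding k1[symmetric] by auto
  moreover have "mesh_adj g N R (R - 1, ?j) (R - 1, ((\<beta> + 3) * N - s') mod ?n)"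
    by (rule mesh_adj_Glue[OF b]) (use s' in simp)
  ultimately show ?thesis by blast
qed

section \<open>Disjointness and connectedness of traces\<close>

lemma trace_nodes: "R \<ge> 1 \<Longrightarrow> trace g N R A \<subseteq> mesh_nodes g N R"
  unfolding trace_def using cell_corners_nodes by blast

lemma trace_Int_nonempty:
  assumes g: "g \<ge> 1" "N \<ge> 1" "R \<ge> 1" and z: "z \<in> A" "z \<in> B" "z \<in> cball 0 1"
  shows "trace g N R A \<inter> trace g N R B \<noteq> {}"
proof -
  obtain f where f: "f \<in> mesh_faces g N R" "z \<in> cell g N R f" using cells_cover[OF g z(3)] by blast
  then have "cell_corners g N R f \<noteq> {}" using cells_share_corner[OF g f(1) f(1) f(2) f(2)] by blast
  moreover have "cell_corners g N R f \<subseteq> trace g N R A \<inter> trace g N R B"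
    using f z unfolding trace_def by blast
  ultimately show ?thesis by blast
qed

text \<open>A common corner would lie within \<open>2 / R + 2 / N\<close> of a point of either
  set.\<close>

lemma trace_disjoint:
  assumes g: "g \<ge> 1" "N \<ge> 1" "R \<ge> 1"
    and d: "\<And>a b. a \<in> A \<Longrightarrow> b \<in> B \<Longrightarrow> \<delta> \<le> dist a b" and N: "2 * (2 / real R + 2 / real N) < \<delta>"
  shows "trace g N R A \<inter> trace g N R B = {}"
proof (rule ccontr)
  assume "trace g N R A \<inter> trace g N R B \<noteq> {}"
  then obtain v where v: "v \<in> trace g N R A" "v \<in> trace g N R B" by blast
  from v(1) obtain f a where f: "f \<in> mesh_faces g N R" "a \<in> cell g N R f" "a \<in> A"
      "v \<in> cell_corners g N R f"
    unfolding trace_def by blast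
  from v(2) obtain f' b where f': "f' \<in> mesh_faces g N R" "b \<in> cell g N R f'" "b \<in> B"
      "v \<in> cell_corners g N R f'"
    unfolding trace_def by blast
  define \<epsilon> where "\<epsilon> = 2 / real R + 2 / real N"
  have "dist a b \<le> dist a (ring_point g N R v) + dist b (ring_point g N R v)"
      by (rule dist_triangle2)
  moreover have "dist a (ring_point g N R v) \<le> \<epsilon>" "dist b (ring_point g N R v) \<le> \<epsilon>"
    using cell_near_corner[OF g f(1,2,4)] cell_near_corner[OF g f'(1,2,4)] by (simp_all add: \<epsilon>_def)
  moreover have "2 * \<epsilon> < \<delta>" using N by (simp only: \<epsilon>_def)
  ultimately show False using d[OF f(3) f'(3)] by linarith
qed

text \<open>A cut of the trace without crossing edges divides the cells meeting \<open>A\<close>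
  into two groups, since the corners of one cell are connected. The images of the groups are closed
  and cover \<open>A\<close>, and they do not meet inside \<open>A\<close>: cells with a common
  point share a corner, and cells at glued points are joined by a rung. This contradicts the
  connectedness of \<open>A\<close>.\<close>

lemma conn_trace:
  assumes g: "g \<ge> 1" "N \<ge> 1" "R \<ge> 2" and A: "connectedin (genus_surface g) A"
  shows "conn (mesh_adj g N R) (trace g N R (disc_part g A))"
proof (rule connI_cut, rule ccontr)
  let ?T = "trace g N R (disc_part g A)" and ?c = "cell g N R" and ?k = "cell_corners g N R"
  have R1: "R \<ge> 1" using g by simp
  fix P assume P: "P \<subseteq> ?T" "P \<noteq> {}" "P \<noteq> ?T" "\<not> (\<exists>a\<in>P. \<exists>b\<in>?T - P. mesh_adj g N R a b)"
  define F where "F = {f \<in> mesh_faces g N R. ?c f \<inter> disc_part g A \<noteq> {}}"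
  have T: "?T = (\<Union>f\<in>F. ?k f)" by (simp add: trace_def F_def)
  have kne: "?k f \<noteq> {}" if fF: "f \<in> F" for f
  proof -
    obtain z where "z \<in> ?c f" using fF by (auto simp: F_def)
    moreover have "f \<in> mesh_faces g N R" using fF by (simp add: F_def)
    ultimately show ?thesis using cells_share_corner[OF g(1,2) R1, of f f z] by blast
  qed
  have side: "?k f \<subseteq> P \<or> ?k f \<inter> P = {}" if f: "f \<in> F" for f
  proof (rule ccontr)
    assume "\<not> ?thesis"
    then obtain a b where ab: "a \<in> ?k f \<inter> P" "b \<in> ?k f - ?k f \<inter> P" by blast
    have "conn (mesh_adj g N R) (?k f)" using f conn_cell_corners[OF _ R1] by (simp add: F_def)
    from conn_cut[OF this Int_lower1 ab] obtain a' b'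
        where "a' \<in> ?k f \<inter> P" "b' \<in> ?k f - ?k f \<inter> P" "mesh_adj g N R a' b'"
      by blast
    moreover have "?k f \<subseteq> ?T" using f T by blast
    ultimately show False using P(4) by blast
  qed
  define FP where "FP = {f \<in> F. ?k f \<subseteq> P}"
  define FQ where "FQ = {f \<in> F. ?k f \<inter> P = {}}"
  have F_cases: "f \<in> FP \<or> f \<in> FQ" if "f \<in> F" for f using side[OF that] that
      by (auto simp: FP_def FQ_def)
  have not_both: "f \<notin> FQ" if "f \<in> FP" for f using that kne[of f] by (auto simp: FP_def FQ_def)
  have no_adj: False if "f \<in> FP" "f' \<in> FQ" "a \<in> ?k f" "b \<in> ?k f'" "mesh_adj g N R a b" for f f' a b
  proof -
    have "a \<in> P" using that by (auto simp: FP_def)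
    moreover have "b \<in> ?T - P" using that T by (auto simp: FQ_def)
    ultimately show False using P(4) that by blast
  qed
  have no_share: False if "f \<in> FP" "f' \<in> FQ" "?k f \<inter> ?k f' \<noteq> {}" for f f'
    using that by (auto simp: FP_def FQ_def)
  let ?q = "\<lambda>z. gluing g `` {z}"
  have fin: "finite F" by (simp add: F_def)
  have clo: "closedin (genus_surface g) (?q ` (\<Union>f\<in>G. ?c f))" if "G \<subseteq> F" for G
  proof -
    have "finite G" using that fin finite_subset by blast
    then have "compact (\<Union>f\<in>G. ?c f)" by (intro compact_UN ballI compact_cell)
    moreover have "(\<Union>f\<in>G. ?c f) \<subseteq> cball 0 1" using that cell_subset[OF _ R1] unfolding F_def
        by blast
    ultimately have "closedin (top_of_set (cball 0 1)) (\<Union>f\<in>G. ?c f)"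
        by (intro closed_subset compact_imp_closed)
    then show ?thesis using closed_map_genus_surface[OF g(1)] unfolding closed_map_def by blast
  qed
  let ?EP = "?q ` (\<Union>f\<in>FP. ?c f)" and ?EQ = "?q ` (\<Union>f\<in>FQ. ?c f)"
  have AS: "A \<subseteq> topspace (genus_surface g)" using A connectedin_subset_topspace by blast
  have "A \<subseteq> ?EP \<union> ?EQ"
  proof
    fix x assume x: "x \<in> A"
    then obtain z where z: "z \<in> disc_part g A" "?q z = x" using AS disc_part_meets by blast
    then have "z \<in> cball 0 1" by (simp add: disc_part_def)
    then obtain f where f: "f \<in> mesh_faces g N R" "z \<in> ?c f" using cells_cover[OF g(1,2) R1]
        by blast
    then have "f \<in> F" using z by (auto simp: F_def)
    then show "x \<in> ?EP \<union> ?EQ" using F_cases f z(2) by blast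
  qed
  moreover have "?EP \<inter> ?EQ \<inter> A = {}"
  proof (rule ccontr)
    assume "?EP \<inter> ?EQ \<inter> A \<noteq> {}"
    then obtain z w f f' where zw: "f \<in> FP" "z \<in> ?c f" "f' \<in> FQ" "w \<in> ?c f'" "?q z = ?q w"
        "?q z \<in> A" by auto
    have fm: "f \<in> mesh_faces g N R" "f' \<in> mesh_faces g N R" using zw
        by (auto simp: FP_def FQ_def F_def)
    have zD: "z \<in> cball 0 1" "w \<in> cball 0 1" using cell_subset[OF fm(1) R1] cell_subset[OF fm(2) R1]
        zw by blast+
    have zA: "z \<in> disc_part g A" using zD zw by (simp add: disc_part_def)
    have all: "\<forall>h\<in>F. u \<in> ?c h \<longrightarrow> h \<in> FP" if "u \<in> ?c h'" "h' \<in> FP" for u h'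
    proof (intro ballI impI)
      fix h assume h: "h \<in> F" "u \<in> ?c h"
      have "?k h' \<inter> ?k h \<noteq> {}"
        by (rule cells_share_corner[OF g(1,2) R1 _ _ that(1) h(2)]) (use h that in \<open>auto
          simp: FP_def F_def\<close>)
      then show "h \<in> FP" using F_cases[OF h(1)] no_share[OF that(2)] by blast
    qed
    have "(z, w) \<in> gluing g" using zw(5) zD equiv_class_self[OF equiv_gluing, of w g] by blast
    then have "(z, w) \<in> (side_pairs g \<union> (side_pairs g)\<inverse>)\<^sup>*" by (simp add: gluing_def)
    \<comment> \<open>Corners may be identified through several gluing steps, so the group of the
      cells is followed along the whole chain from \<open>z\<close> to \<open>w\<close>.\<close>
    then have "w \<in> disc_part g A \<and> (\<forall>h\<in>F. w \<in> ?c h \<longrightarrow> h \<in> FP)"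
    proof (induction rule: rtrancl_induct)
      case base
      then show ?case using zA all[OF zw(2,1)] by blast
    next
      case (step u v)
      have uv: "(u, v) \<in> gluing g"
        using step(2) side_pairs_subset[OF g(1)] by (auto simp: gluing_def)
      then have vA: "v \<in> disc_part g A" using step.IH disc_part_glued by blast
      have "\<exists>h\<in>mesh_faces g N R. \<exists>h'\<in>mesh_faces g N R. u \<in> ?c h \<and> v \<in> ?c h' \<and>
          (\<exists>a\<in>?k h. \<exists>b\<in>?k h'. mesh_adj g N R a b)"
      proof -
        consider \<beta> s where "\<beta> \<in> glue_sides g" "s \<in> {0..1}" "u = bdry_point g (real \<beta> + s)"
            "v = bdry_point g (real \<beta> + 3 - s)"
          | \<beta> s where "\<beta> \<in> glue_sides g" "s \<in> {0..1}" "v = bdry_point g (real \<beta> + s)"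
              "u = bdry_point g (real \<beta> + 3 - s)"
          using step(2) unfolding side_pairs_glue_sides[OF g(1)] by blast
        then show ?thesis
        proof cases
          case 1 then show ?thesis using cells_glued[OF g 1(1,2)] by blast
        next
          case 2
          then obtain h h' a b where "h \<in> mesh_faces g N R" "h' \<in> mesh_faces g N R" "v \<in> ?c h"
              "u \<in> ?c h'"
            "a \<in> ?k h" "b \<in> ?k h'" "mesh_adj g N R a b" using cells_glued[OF g 2(1,2)] by blast
          moreover have "mesh_adj g N R b a" using calculation symp_mesh_adj by (meson sympD)
          ultimately show ?thesis by blast
        qed
      qed
      then obtain h h' a b where h: "h \<in> mesh_faces g N R" "h' \<in> mesh_faces g N R" "u \<in> ?c h"
          "v \<in> ?c h'"
        "a \<in> ?k h" "b \<in> ?k h'" "mesh_adj g N R a b" by blast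
      have "h \<in> F" using h step.IH by (auto simp: F_def)
      then have "h \<in> FP" using step.IH h by blast
      moreover have "h' \<in> F" using h vA by (auto simp: F_def)
      ultimately have "h' \<in> FP" using F_cases no_adj h by blast
      then show ?case using vA all[OF h(4)] by blast
    qed
    then have "f' \<in> FP" using zw by (auto simp: FQ_def)
    then show False using not_both zw by blast
  qed
  moreover have "?EP \<inter> A \<noteq> {}"
  proof -
    obtain v where "v \<in> P" using P by blast
    then obtain f where f: "f \<in> F" "v \<in> ?k f" using P(1) T by blast
    then have "f \<in> FP" using side[OF f(1)] \<open>v \<in> P\<close> by (auto simp: FP_def)
    moreover obtain z where "z \<in> ?c f" "z \<in> disc_part g A" using f by (auto simp: F_def)
    ultimately show ?thesis by (auto simp: disc_part_def)
  qed
  moreover have "?EQ \<inter> A \<noteq> {}"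
  proof -
    obtain v where "v \<in> ?T - P" using P by blast
    then obtain f where f: "f \<in> F" "v \<in> ?k f" "v \<notin> P" using T by blast
    then have "f \<in> FQ" using side[OF f(1)] by (auto simp: FQ_def)
    moreover obtain z where "z \<in> ?c f" "z \<in> disc_part g A" using f by (auto simp: F_def)
    ultimately show ?thesis by (auto simp: disc_part_def)
  qed
  moreover have "closedin (genus_surface g) ?EP" "closedin (genus_surface g) ?EQ"
    by (rule clo, auto simp: FP_def FQ_def)+
  ultimately show False using A unfolding connectedin_closedin by blast
qed

section \<open>From disjoint closed sets to branch sets of the mesh\<close>

lemma connectedin_UN_conn:
  assumes K: "conn (\<lambda>k k'. C k \<inter> C k' \<noteq> {}) K" and C: "\<And>k. k \<in> K \<Longrightarrow> connectedin X (C k)"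
    "\<And>k. k \<in> K \<Longrightarrow> C k \<noteq> {}"
  shows "connectedin X (\<Union>k\<in>K. C k)"
proof (cases "K = {}")
  case False
  then obtain k0 where k0: "k0 \<in> K" by blast
  have "\<exists>S. connectedin X S \<and> C k0 \<subseteq> S \<and> C k \<subseteq> S \<and> S \<subseteq> (\<Union>k\<in>K. C k)" if "k \<in> K" for k
  proof -
    have "(\<lambda>a b. C a \<inter> C b \<noteq> {} \<and> a \<in> K \<and> b \<in> K)\<^sup>*\<^sup>* k0 k" using K k0 that by (simp add: conn_def)
    then show ?thesis
    proof (induction rule: rtranclp_induct)
      case base
      show ?case using C(1)[OF k0] k0 by blast
    next
      case (step a b)
      then obtain S where S: "connectedin X S" "C k0 \<subseteq> S" "C a \<subseteq> S" "S \<subseteq> (\<Union>k\<in>K. C k)" by blast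
      have "connectedin X (S \<union> C b)" by (rule connectedin_Un[OF S(1)]) (use S step C(1) in auto)
      moreover have "C k0 \<subseteq> S \<union> C b" "C b \<subseteq> S \<union> C b" "S \<union> C b \<subseteq> (\<Union>k\<in>K. C k)" using S step by blast+
      ultimately show ?case by blast
    qed
  qed
  then obtain S where S: "\<And>k. k \<in> K \<Longrightarrow> connectedin X (S k) \<and> C k0 \<subseteq> S k \<and> C k \<subseteq> S k \<and>
      S k \<subseteq> (\<Union>k\<in>K. C k)"
    by metis
  have "connectedin X (\<Union>(S ` K))"
  proof (rule connectedin_Union)
    show "\<Inter>(S ` K) \<noteq> {}" using S C(2)[OF k0] by blast
  qed (use S in blast)
  moreover have "\<Union>(S ` K) = (\<Union>k\<in>K. C k)" using S by blast
  ultimately show ?thesis by simp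
qed simp

lemma finite_compact_separated:
  fixes \<F> :: "'a::heine_borel set set"
  assumes "finite \<F>" "\<And>X. X \<in> \<F> \<Longrightarrow> compact X"
  shows "\<exists>\<delta>>0. \<forall>X\<in>\<F>. \<forall>Y\<in>\<F>. X \<inter> Y = {} \<longrightarrow> (\<forall>x\<in>X. \<forall>y\<in>Y. \<delta> \<le> dist x y)"
proof -
  have "\<exists>d>0. X \<inter> Y = {} \<longrightarrow> (\<forall>x\<in>X. \<forall>y\<in>Y. d \<le> dist x y)" if "X \<in> \<F>" "Y \<in> \<F>" for X Y
  proof (cases "X \<inter> Y = {}")
    case True
    then show ?thesis
      using separate_compact_closed[of X Y] assms(2) that compact_imp_closed by blast
  next
    case False then show ?thesis by (intro exI[of _ 1]) simp
  qed
  then obtain d where d: "\<And>X Y. X \<in> \<F> \<Longrightarrow> Y \<in> \<F> \<Longrightarrow> d X Y > 0 \<and> (X \<inter> Y = {} \<longrightarrow> (\<forall>x\<in>X. \<forall>y\<in>Y. d X Y \<le>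
      dist x y))"
    by metis
  define \<delta> where "\<delta> = Min (insert 1 ((\<lambda>(X, Y). d X Y) ` (\<F> \<times> \<F>)))"
  have fin: "finite (insert 1 ((\<lambda>(X, Y). d X Y) ` (\<F> \<times> \<F>)))" using assms(1) by simp
  have "\<delta> \<in> insert 1 ((\<lambda>(X, Y). d X Y) ` (\<F> \<times> \<F>))" unfolding \<delta>_def by (rule Min_in[OF fin]) simp
  then have "\<delta> > 0" using d by auto
  moreover have "\<delta> \<le> d X Y" if "X \<in> \<F>" "Y \<in> \<F>" for X Y
    unfolding \<delta>_def by (rule Min_le[OF fin]) (use that in force)
  ultimately show ?thesis using d by (intro exI[of _ \<delta>]) (meson order_trans)
qed

text \<open>The connected set \<open>r\<close> links \<open>X\<close> to \<open>Y\<close> but may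
  overlap both. Growing \<open>X\<close> within \<open>r - Y\<close> and keeping the component that
  contains \<open>X\<close> stops just short of \<open>Y\<close>, so the result is disjoint from
  \<open>Y\<close> and adjacent to it.\<close>

lemma conn_bridge:
  assumes sym: "symp adj" and r: "conn adj r" and X: "conn adj X" and XY: "X \<inter> Y = {}"
    and rX: "r \<inter> X \<noteq> {}" and rY: "r \<inter> Y \<noteq> {}"
  shows "\<exists>Z. X \<subseteq> Z \<and> Z \<subseteq> X \<union> (r - Y) \<and> conn adj Z \<and> (\<exists>a\<in>Z. \<exists>b\<in>Y. adj a b)"
proof -
  obtain x0 where x0: "x0 \<in> r" "x0 \<in> X" using rX by blast
  obtain y0 where y0: "y0 \<in> r" "y0 \<in> Y" using rY by blast
  define S where "S = X \<union> (r - Y)"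
  define Z where "Z = component adj S x0"
  have ZS: "Z \<subseteq> S" by (simp add: Z_def component_subset)
  have XZ: "X \<subseteq> Z"
  proof
    fix x assume "x \<in> X"
    then have "(\<lambda>a b. adj a b \<and> a \<in> X \<and> b \<in> X)\<^sup>*\<^sup>* x0 x" using X x0 by (simp add: conn_def)
    then have "(\<lambda>a b. adj a b \<and> a \<in> S \<and> b \<in> S)\<^sup>*\<^sup>* x0 x"
        by (rule conn_mono_steps) (auto simp: S_def)
    then show "x \<in> Z" using \<open>x \<in> X\<close> by (simp add: Z_def component_def S_def)
  qed
  have "y0 \<in> r - r \<inter> Z" using y0 ZS XY by (auto simp: S_def)
  moreover have "x0 \<in> r \<inter> Z" using x0 XZ by blast
  ultimately have "\<exists>a\<in>r \<inter> Z. \<exists>b\<in>r - r \<inter> Z. adj a b" by (intro conn_cut[OF r]) auto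
  then obtain a b where ab: "a \<in> r \<inter> Z" "b \<in> r - r \<inter> Z" "adj a b" by (elim bexE)
  have "b \<in> Y"
  proof (rule ccontr)
    assume "b \<notin> Y"
    then have "b \<in> S" using ab by (simp add: S_def)
    then have "b \<in> Z" using component_step[of a adj S x0 b] ab by (simp add: Z_def)
    then show False using ab by blast
  qed
  then have "\<exists>a\<in>Z. \<exists>b\<in>Y. adj a b" using ab by blast
  moreover have "conn adj Z" unfolding Z_def by (rule conn_component[OF sym])
  ultimately show ?thesis using XZ ZS unfolding S_def by blast
qed

text \<open>In every sufficiently fine mesh the traces of the given sets are again connected and disjoint.\<close>

lemma surface_minor_bound:
  assumes g: "g \<ge> 1" and fin: "finite I" "finite M"
    and A: "\<And>i. i \<in> I \<Longrightarrow> connectedin (genus_surface g) (A i) \<and> closedin (genus_surface g) (A i) \<and>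
        A i \<noteq> {}"
    and C: "\<And>e. e \<in> M \<Longrightarrow> connectedin (genus_surface g) (C e) \<and> closedin (genus_surface g) (C e)"
    and AA: "\<And>i j. i \<in> I \<Longrightarrow> j \<in> I \<Longrightarrow> i \<noteq> j \<Longrightarrow> A i \<inter> A j = {}"
    and CC: "\<And>e e'. e \<in> M \<Longrightarrow> e' \<in> M \<Longrightarrow> e \<noteq> e' \<Longrightarrow> C e \<inter> C e' = {}"
    and ends: "\<And>e. e \<in> M \<Longrightarrow> s e \<in> I \<and> t e \<in> I \<and> s e \<noteq> t e \<and> e = {s e, t e}"
    and CA: "\<And>e i. e \<in> M \<Longrightarrow> i \<in> I \<Longrightarrow> i \<noteq> s e \<Longrightarrow> i \<noteq> t e \<Longrightarrow> C e \<inter> A i = {}"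
    and meet: "\<And>e. e \<in> M \<Longrightarrow> C e \<inter> A (s e) \<noteq> {} \<and> C e \<inter> A (t e) \<noteq> {}"
  shows "card M \<le> 3 * card I + 6 * g"
proof -
  let ?S = "genus_surface g"
  define \<F> where "\<F> = disc_part g ` (A ` I \<union> C ` M)"
  have "finite \<F>" using fin by (simp add: \<F>_def)
  moreover have "compact X" if "X \<in> \<F>" for X using that A C compact_disc_part unfolding \<F>_def
      by blast
  ultimately obtain \<delta> where \<delta>: "\<delta> > 0" "\<And>X Y x y. X \<in> \<F> \<Longrightarrow> Y \<in> \<F> \<Longrightarrow> X \<inter> Y = {} \<Longrightarrow> x \<in> X \<Longrightarrow> y \<in> Y \<Longrightarrow> \<delta> \<le>
      dist x y"
    using finite_compact_separated[of \<F>] by metis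
  \<comment> \<open>A corner is within \<open>4 / N\<close> of the cells around it; two such errors
    have to stay below \<open>\<delta>\<close>.\<close>
  obtain N0 :: nat where N0: "8 / \<delta> < real N0" using reals_Archimedean2 by blast
  define N where "N = N0 + 2"
  have N: "N \<ge> 1" "N \<ge> 2" by (auto simp: N_def)
  have fine: "2 * (2 / real N + 2 / real N) < \<delta>"
  proof -
    have "8 / \<delta> < real N" using N0 by (simp add: N_def)
    then have "8 < \<delta> * real N" using \<delta>(1) by (simp add: field_simps)
    then show ?thesis using N by (simp add: field_simps)
  qed
  let ?T = "\<lambda>X. trace g N N (disc_part g X)" and ?adj = "mesh_adj g N N"
  have Tdis: "?T X \<inter> ?T Y = {}" if XY: "X \<in> A ` I \<union> C ` M" "Y \<in> A ` I \<union> C ` M" "X \<inter> Y = {}" for X Y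
  proof (rule trace_disjoint[OF g N(1) N(1) _ fine])
    fix a b assume ab: "a \<in> disc_part g X" "b \<in> disc_part g Y"
    have "disc_part g X \<inter> disc_part g Y = {}" using XY(3) by (auto simp: disc_part_def)
    then show "\<delta> \<le> dist a b" by (rule \<delta>(2)[OF _ _ _ ab, rotated 2]) (use XY in \<open>auto simp: \<F>_def\<close>)
  qed
  have Tconn: "conn ?adj (?T X)" if "connectedin ?S X" for X by (rule conn_trace[OF g N that])
  have Tmeet: "?T X \<inter> ?T Y \<noteq> {}" if XY: "X \<inter> Y \<noteq> {}" "connectedin ?S X" for X Y
  proof -
    obtain x where x: "x \<in> X" "x \<in> Y" using XY by blast
    then have "x \<in> topspace ?S" using connectedin_subset_topspace[OF XY(2)] by blast
    then obtain z where "z \<in> disc_part g X" "gluing g `` {z} = x" using disc_part_meets[OF x(1)]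
        by blast
    then have "z \<in> disc_part g X" "z \<in> disc_part g Y" "z \<in> cball 0 1" using x
        by (auto simp: disc_part_def)
    then show ?thesis by (rule trace_Int_nonempty[OF g N(1) N(1)])
  qed
  have "\<exists>Z. ?T (A (s e)) \<subseteq> Z \<and> Z \<subseteq> ?T (A (s e)) \<union> (?T (C e) - ?T (A (t e))) \<and> conn ?adj Z \<and>
      (\<exists>a\<in>Z. \<exists>b\<in>?T (A (t e)). ?adj a b)" if e: "e \<in> M" for e
  proof (rule conn_bridge[OF symp_mesh_adj])
    show "conn ?adj (?T (C e))" "conn ?adj (?T (A (s e)))" using Tconn C[OF e] A ends[OF e]
        by blast+
    show "?T (A (s e)) \<inter> ?T (A (t e)) = {}" using ends[OF e] AA[of "s e" "t e"] by (intro Tdis) auto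
    show "?T (C e) \<inter> ?T (A (s e)) \<noteq> {}" "?T (C e) \<inter> ?T (A (t e)) \<noteq> {}"
        using Tmeet meet[OF e] C[OF e] by blast+
  qed
  then obtain Z where Z: "\<And>e. e \<in> M \<Longrightarrow> ?T (A (s e)) \<subseteq> Z e"
    "\<And>e. e \<in> M \<Longrightarrow> Z e \<subseteq> ?T (A (s e)) \<union> (?T (C e) - ?T (A (t e)))" "\<And>e. e \<in> M \<Longrightarrow> conn ?adj (Z e)"
    "\<And>e. e \<in> M \<Longrightarrow> \<exists>a\<in>Z e. \<exists>b\<in>?T (A (t e)). ?adj a b" by metis
  \<comment> \<open>A connection is given entirely to its source. Off the trace of its target it
    meets no foreign branch set and no other connection.\<close>
  define X where "X i = ?T (A i) \<union> (\<Union>e\<in>{e \<in> M. s e = i}. Z e)" for i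
  have Xsub: "X i \<subseteq> ?T (A i) \<union> (\<Union>e\<in>{e \<in> M. s e = i}. ?T (C e) - ?T (A (t e)))" for i
    using Z(2) unfolding X_def by blast
  show ?thesis
  proof (rule mesh_minor_bound[OF g N(1) N(1), where X = X and I = I])
    fix i assume i: "i \<in> I"
    have "A i \<noteq> {}" "connectedin ?S (A i)" using A[OF i] by auto
    then have ne: "?T (A i) \<noteq> {}" using Tmeet[of "A i" "A i"] by auto
    then obtain v where v: "v \<in> ?T (A i)" by blast
    have "X i = (\<Union>Y\<in>insert (?T (A i)) (Z ` {e \<in> M. s e = i}). Y)" by (auto simp: X_def)
    moreover have "conn ?adj \<dots>"
    proof (rule conn_UN[OF symp_mesh_adj])
      fix Y assume Y: "Y \<in> insert (?T (A i)) (Z ` {e \<in> M. s e = i})"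
      then show "conn ?adj Y" using Z(3) Tconn[OF \<open>connectedin ?S (A i)\<close>] by auto
      show "v \<in> Y" using Y v Z(1) by auto
    qed
    moreover have "X i \<subseteq> mesh_nodes g N N" using Xsub trace_nodes[OF N(1)] by blast
    ultimately show "X i \<noteq> {} \<and> X i \<subseteq> mesh_nodes g N N \<and> conn ?adj (X i)" using ne
        by (auto simp: X_def)
  next
    fix i j assume ij: "i \<in> I" "j \<in> I" "i \<noteq> j"
    have half: False if "v \<in> ?T (A i)" "e \<in> M" "s e = j" "v \<in> ?T (C e) - ?T (A (t e))" "i \<in> I"
        "i \<noteq> j" for v e i j
    proof (cases "i = t e")
      case False
      then have "C e \<inter> A i = {}" using CA that by blast
      then have "?T (C e) \<inter> ?T (A i) = {}" using that by (intro Tdis) auto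
      then show False using that by blast
    qed (use that in blast)
    have CCe: False if "e \<in> M" "s e = i" "e' \<in> M" "s e' = j" "v \<in> ?T (C e)" "v \<in> ?T (C e')"
        for v e e'
    proof -
      have "C e \<inter> C e' = {}" using CC[of e e'] that ij by blast
      then have "?T (C e) \<inter> ?T (C e') = {}" using that by (intro Tdis) auto
      then show False using that by blast
    qed
    have AAe: "?T (A i) \<inter> ?T (A j) = {}" using ij AA by (intro Tdis) auto
    show "X i \<inter> X j = {}"
    proof (rule ccontr)
      assume "X i \<inter> X j \<noteq> {}"
      then obtain v where v: "v \<in> X i" "v \<in> X j" by blast
      have vi: "v \<in> ?T (A i) \<or> (\<exists>e\<in>M. s e = i \<and> v \<in> ?T (C e) - ?T (A (t e)))"
        using subsetD[OF Xsub v(1)] by (elim UnE UN_E) auto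
      have vj: "v \<in> ?T (A j) \<or> (\<exists>e\<in>M. s e = j \<and> v \<in> ?T (C e) - ?T (A (t e)))"
        using subsetD[OF Xsub v(2)] by (elim UnE UN_E) auto
      from vi vj consider "v \<in> ?T (A i)" "v \<in> ?T (A j)"
        | e where "v \<in> ?T (A i)" "e \<in> M" "s e = j" "v \<in> ?T (C e) - ?T (A (t e))"
        | e where "v \<in> ?T (A j)" "e \<in> M" "s e = i" "v \<in> ?T (C e) - ?T (A (t e))"
        | e e' where "e \<in> M" "s e = i" "e' \<in> M" "s e' = j" "v \<in> ?T (C e)" "v \<in> ?T (C e')"
        by (metis DiffD1)
      then show False
      proof cases
        case 1 then show ?thesis using AAe by blast
      next
        case 2 then show ?thesis using half ij by blast
      next
        case 3 then show ?thesis using half ij by blast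
      next
        case 4 then show ?thesis by (rule CCe)
      qed
    qed
  next
    fix e assume e: "e \<in> M"
    obtain a b where ab: "a \<in> Z e" "b \<in> ?T (A (t e))" "?adj a b" using Z(4)[OF e] by blast
    have "a \<in> X (s e)" "b \<in> X (t e)" using ab e by (auto simp: X_def)
    then show "\<exists>i\<in>I. \<exists>j\<in>I. i \<noteq> j \<and> e = {i, j} \<and> (\<exists>a\<in>X i. \<exists>b\<in>X j. ?adj a b)"
      using ends[OF e] ab(3) by blast
  qed
qed

section \<open>Embedded graphs have no dense minors\<close>

text \<open>Edges of the minor may share a vertex of the graph, where their arcs touch, while the
  connections have to be disjoint closed sets. So every connecting arc is cut into thirds: the outer
  thirds are added to the two branch sets and the middle third is the connection.\<close>

theorem embeds_minor_bounded:
  fixes V :: "'a set"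
  assumes G: "simple_graph V E" and emb: "embeds_in V E (genus_surface g)" and g: "g \<ge> 1"
  shows "minor_bounded (\<lambda>x y. {x, y} \<in> E) V g"
  unfolding minor_bounded_def
proof (intro allI impI, elim conjE)
  let ?S = "genus_surface g" and ?adj = "\<lambda>x y. {x, y} \<in> E"
  fix \<U> and M :: "'a set set set"
  assume U: "\<forall>U\<in>\<U>. U \<noteq> {} \<and> U \<subseteq> V \<and> conn ?adj U" and dis: "pairwise disjnt \<U>"
    and M: "\<forall>e\<in>M. \<exists>U\<in>\<U>. \<exists>W\<in>\<U>. U \<noteq> W \<and> e = {U, W} \<and> (\<exists>a\<in>U. \<exists>b\<in>W. {a, b} \<in> E)"
  obtain p :: "'a \<Rightarrow> complex set" and \<gamma> where p: "p ` V \<subseteq> topspace ?S" "inj_on p V"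
    and \<gamma>: "\<And>e. e \<in> E \<Longrightarrow> pathin ?S (\<gamma> e) \<and> inj_on (\<gamma> e) {0..1} \<and> {\<gamma> e 0, \<gamma> e 1} = p ` e \<and>
               \<gamma> e ` {0<..<1} \<inter> p ` V = {}"
    and \<gamma>\<gamma>: "\<And>e e'. e \<in> E \<Longrightarrow> e' \<in> E \<Longrightarrow> e \<noteq> e' \<Longrightarrow> \<gamma> e ` {0<..<1} \<inter> \<gamma> e' ` {0<..<1} = {}"
    using emb unfolding embeds_in_def by metis
  have finV: "finite V" and EV: "\<And>e. e \<in> E \<Longrightarrow> e \<subseteq> V \<and> card e = 2" using G
      by (auto simp: simple_graph_def)
  have finE: "finite E" using finite_subset[of E "Pow V"] finV EV by blast
  have finU: "finite \<U>" using finite_subset[of \<U> "Pow V"] finV U by blast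
  have finM: "finite M" by (rule finite_subset[of M "Pow \<U>"]) (use finU M in auto)
  have same: "U = W" if "U \<in> \<U>" "W \<in> \<U>" "x \<in> U" "x \<in> W" for U W x
    using dis that unfolding pairwise_def disjnt_def by blast
  have "\<forall>e\<in>M. \<exists>q. fst q \<in> \<U> \<and> fst (snd q) \<in> \<U> \<and> fst q \<noteq> fst (snd q) \<and> e = {fst q, fst (snd q)} \<and>
     fst (snd (snd q)) \<in> fst q \<and> snd (snd (snd q)) \<in> fst (snd q) \<and>
         {fst (snd (snd q)), snd (snd (snd q))} \<in> E"
  proof
    fix e assume "e \<in> M"
    then have "\<exists>U\<in>\<U>. \<exists>W\<in>\<U>. U \<noteq> W \<and> e = {U, W} \<and> (\<exists>a\<in>U. \<exists>b\<in>W. {a, b} \<in> E)" using M by simp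
    then obtain U W a b where "U \<in> \<U>" "W \<in> \<U>" "U \<noteq> W" "e = {U, W}" "a \<in> U" "b \<in> W" "{a, b} \<in> E"
      by (elim bexE conjE)
    then show "\<exists>q. fst q \<in> \<U> \<and> fst (snd q) \<in> \<U> \<and> fst q \<noteq> fst (snd q) \<and> e = {fst q, fst (snd q)} \<and>
     fst (snd (snd q)) \<in> fst q \<and> snd (snd (snd q)) \<in> fst (snd q) \<and>
         {fst (snd (snd q)), snd (snd (snd q))} \<in> E"
      by (intro exI[of _ "(U, W, a, b)"]) simp
  qed
  then obtain q where q: "\<And>e. e \<in> M \<Longrightarrow> fst (q e) \<in> \<U> \<and> fst (snd (q e)) \<in> \<U> \<and>
      fst (q e) \<noteq> fst (snd (q e)) \<and>
     e = {fst (q e), fst (snd (q e))} \<and> fst (snd (snd (q e))) \<in> fst (q e) \<and>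
         snd (snd (snd (q e))) \<in> fst (snd (q e)) \<and>
     {fst (snd (snd (q e))), snd (snd (snd (q e)))} \<in> E" by metis
  define s where "s e = fst (q e)" for e
  define t where "t e = fst (snd (q e))" for e
  define a where "a e = fst (snd (snd (q e)))" for e
  define b where "b e = snd (snd (snd (q e)))" for e
  have st: "s e \<in> \<U>" "t e \<in> \<U>" "s e \<noteq> t e" "e = {s e, t e}" "a e \<in> s e" "b e \<in> t e" "{a e, b e} \<in> E"
      if "e \<in> M" for e
    using q[OF that] by (auto simp: s_def t_def a_def b_def)
  define \<epsilon> where "\<epsilon> e = {a e, b e}" for e
  have \<epsilon>E: "\<epsilon> e \<in> E" if "e \<in> M" for e using st(7)[OF that] by (simp add: \<epsilon>_def)
  have \<epsilon>U: "\<not> \<epsilon> e \<subseteq> U" if "e \<in> M" "U \<in> \<U>" for e U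
    using same[OF st(1)[OF that(1)] that(2)] same[OF st(2)[OF that(1)] that(2)] st[OF that(1)]
        by (auto simp: \<epsilon>_def)
  have \<epsilon>inj: "e = e'" if e: "e \<in> M" "e' \<in> M" "\<epsilon> e = \<epsilon> e'" for e e'
  proof -
    from e(3) consider "a e = a e'" "b e = b e'" | "a e = b e'" "b e = a e'"
        by (auto simp: \<epsilon>_def doubleton_eq_iff)
    then have "{s e, t e} = {s e', t e'}"
    proof cases
      case 1
      have "s e = s e'" by (rule same[of _ _ "a e"]) (use st[OF e(1)] st[OF e(2)] 1 in auto)
      moreover have "t e = t e'" by (rule same[of _ _ "b e"]) (use st[OF e(1)] st[OF e(2)] 1
          in auto)
      ultimately show ?thesis by simp
    next
      case 2
      have "s e = t e'" by (rule same[of _ _ "a e"]) (use st[OF e(1)] st[OF e(2)] 2 in auto)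
      moreover have "t e = s e'" by (rule same[of _ _ "b e"]) (use st[OF e(1)] st[OF e(2)] 2
          in auto)
      ultimately show ?thesis by auto
    qed
    then show ?thesis using st(4)[OF e(1)] st(4)[OF e(2)] by simp
  qed
  \<comment> \<open>Makes the arc run from \<open>a e\<close> to \<open>b e\<close>; the embedding
    prescribes no direction.\<close>
  define \<delta> where "\<delta> e = (\<lambda>x. \<gamma> (\<epsilon> e) (if \<gamma> (\<epsilon> e) 0 = p (a e) then x else 1 - x))" for e
  have \<delta>01: "\<delta> e 0 = p (a e)" "\<delta> e 1 = p (b e)" if e: "e \<in> M" for e
  proof -
    have ab: "{\<gamma> (\<epsilon> e) 0, \<gamma> (\<epsilon> e) 1} = {p (a e), p (b e)}" using \<gamma>[OF \<epsilon>E[OF e]] by (simp add: \<epsilon>_def)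
    show "\<delta> e 0 = p (a e)" "\<delta> e 1 = p (b e)" using ab by (auto simp: \<delta>_def doubleton_eq_iff)
  qed
  have \<delta>path: "pathin ?S (\<delta> e)" if e: "e \<in> M" for e
  proof (cases "\<gamma> (\<epsilon> e) 0 = p (a e)")
    case True
    then show ?thesis using \<gamma>[OF \<epsilon>E[OF e]] by (simp add: \<delta>_def)
  next
    case False
    have "continuous_map (top_of_set {0..1}) (top_of_set {0..1}) (\<lambda>x. 1 - x :: real)"
      by (auto intro!: continuous_intros simp: image_subset_iff)
    then have "continuous_map (top_of_set {0..1}) ?S (\<gamma> (\<epsilon> e) \<circ> (\<lambda>x. 1 - x))"
      using \<gamma>[OF \<epsilon>E[OF e]] unfolding pathin_def by (blast intro: continuous_map_compose)
    then show ?thesis using False by (simp add: \<delta>_def pathin_def o_def)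
  qed
  have \<delta>inj: "x = y" if "e \<in> M" "\<delta> e x = \<delta> e y" "x \<in> {0..1}" "y \<in> {0..1}" for e x y
  proof -
    have inj: "inj_on (\<gamma> (\<epsilon> e)) {0..1}" using \<gamma>[OF \<epsilon>E[OF that(1)]] by blast
    have m: "1 - x \<in> {0..1}" "1 - y \<in> {0..1}" using that by auto
    show ?thesis
    proof (cases "\<gamma> (\<epsilon> e) 0 = p (a e)")
      case True
      then have "\<gamma> (\<epsilon> e) x = \<gamma> (\<epsilon> e) y" using that(2) by (simp add: \<delta>_def)
      then show ?thesis using inj_onD[OF inj _ that(3,4)] by blast
    next
      case False
      then have "\<gamma> (\<epsilon> e) (1 - x) = \<gamma> (\<epsilon> e) (1 - y)" using that(2) by (simp add: \<delta>_def)
      then have "1 - x = 1 - y" using inj_onD[OF inj _ m] by blast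
      then show ?thesis by simp
    qed
  qed
  define I where "I e = \<gamma> e ` {0<..<1}" for e
  have \<delta>I: "\<delta> e x \<in> I (\<epsilon> e)" if "0 < x" "x < 1" for e x
    using that by (auto simp: \<delta>_def I_def)
  have II: "e = e'" if "e \<in> E" "e' \<in> E" "x \<in> I e" "x \<in> I e'" for e e' x using \<gamma>\<gamma>[OF that(1,2)] that
      unfolding I_def by blast
  have Ip: "x \<notin> p ` V" if "e \<in> E" "x \<in> I e" for e x using \<gamma>[OF that(1)] that unfolding I_def
      by blast
  have arc: "\<gamma> e ` {0..1} \<subseteq> p ` e \<union> I e" if "e \<in> E" for e
  proof
    fix x assume "x \<in> \<gamma> e ` {0..1}"
    then obtain r where r: "x = \<gamma> e r" "0 \<le> r" "r \<le> 1" by auto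
    have "\<gamma> e 0 \<in> p ` e" "\<gamma> e 1 \<in> p ` e" using \<gamma>[OF that] by blast+
    then show "x \<in> p ` e \<union> I e" using r by (cases "r = 0 \<or> r = 1") (auto simp: I_def)
  qed
  have sub_path: "connectedin ?S (h ` {l..u}) \<and> compactin ?S (h ` {l..u})"
    if "pathin ?S h" "0 \<le> l" "u \<le> 1" for h and l u :: real
  proof -
    have "continuous_map (top_of_set {0..1}) ?S h" using that by (simp add: pathin_def)
    moreover have "connectedin (top_of_set {0..1}) {l..u}" "compactin (top_of_set {0..1}) {l..u}"
      using that by (auto simp: connectedin_subtopology compactin_subtopology)
    ultimately show ?thesis using connectedin_continuous_map_image image_compactin by blast
  qed
  \<comment> \<open>Compact connected pieces through the point of \<open>u\<close>. Neighbours
    inside \<open>W\<close> share the arc of their edge, which connects \<open>A W\<close>, and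
    there are finitely many pieces, which keeps \<open>A W\<close> closed.\<close>
  define Cv where "Cv W u = {{p u}} \<union> {\<gamma> e ` {0..1} | e. e \<in> E \<and> u \<in> e \<and> e \<subseteq> W} \<union>
     {\<delta> e ` {0..1/3} | e. e \<in> M \<and> s e = W \<and> a e = u} \<union> {\<delta> e ` {2/3..1} | e. e \<in> M \<and> t e = W \<and> b e =
         u}" for W u
  have Cv_iff: "X \<in> Cv W u \<longleftrightarrow> X = {p u} \<or> (\<exists>e. X = \<gamma> e ` {0..1} \<and> e \<in> E \<and> u \<in> e \<and> e \<subseteq> W) \<or>
      (\<exists>e. X = \<delta> e ` {0..1/3} \<and> e \<in> M \<and> s e = W \<and> a e = u) \<or>
      (\<exists>e. X = \<delta> e ` {2/3..1} \<and> e \<in> M \<and> t e = W \<and> b e = u)" for X W u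
    by (simp only: Cv_def Un_iff mem_Collect_eq singleton_iff disj_assoc)
  define A where "A W = (\<Union>u\<in>W. \<Union>(Cv W u))" for W
  define C where "C e = \<delta> e ` {1/3..2/3}" for e
  have H: "Hausdorff_space ?S" by (rule Hausdorff_genus_surface[OF g])
  have Cv_conn: "connectedin ?S X \<and> compactin ?S X \<and> p u \<in> X" if X: "X \<in> Cv W u"
      and W: "W \<in> \<U>" "u \<in> W" for X W u
  proof -
    have uV: "u \<in> V" using U W by blast
    from X consider "X = {p u}" | e where "X = \<gamma> e ` {0..1}" "e \<in> E" "u \<in> e"
      | e where "X = \<delta> e ` {0..1/3}" "e \<in> M" "a e = u" | e
          where "X = \<delta> e ` {2/3..1}" "e \<in> M" "b e = u"
      unfolding Cv_iff by (elim disjE exE conjE) fast+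
    then show ?thesis
    proof cases
      case 1
      then show ?thesis using p(1) uV by (auto simp: connectedin_sing finite_imp_compactin)
    next
      case (2 e)
      have "p u \<in> {\<gamma> e 0, \<gamma> e 1}" using \<gamma>[OF 2(2)] 2(3) by blast
      then have "p u \<in> X" using 2(1) by force
      then show ?thesis using sub_path[of "\<gamma> e" 0 1] \<gamma>[OF 2(2)] 2(1) by simp
    next
      case (3 e)
      have "p u \<in> X" using \<delta>01(1)[OF 3(2)] 3 by (metis atLeastAtMost_iff image_eqI order_refl
          zero_le_divide_1_iff zero_le_numeral)
      then show ?thesis using sub_path[OF \<delta>path[OF 3(2)], of 0 "1/3"] 3(1) by simp
    next
      case (4 e)
      have "(1::real) \<in> {2/3..1}" by simp
      then have "p u \<in> X" using \<delta>01(2)[OF 4(2)] 4 by (metis image_eqI)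
      then show ?thesis using sub_path[OF \<delta>path[OF 4(2)], of "2/3" 1] 4(1) by simp
    qed
  qed
  have finCv: "finite (Cv W u)" for W u unfolding Cv_def using finE finM by auto
  \<comment> \<open>Sorts the points of a branch set into vertex points, interior points of arcs
    inside \<open>W\<close>, and points of outer thirds. Disjointness claims then reduce to the
    disjointness of open arcs.\<close>
  have Apt: "(\<exists>u\<in>W. x = p u) \<or> (\<exists>e\<in>E. e \<subseteq> W \<and> x \<in> I e) \<or>
     (\<exists>e\<in>M. \<exists>r. x = \<delta> e r \<and> 0 < r \<and> r < 1 \<and> (W = s e \<and> r \<le> 1/3 \<or> W = t e \<and> 2/3 \<le> r))" (is
         "?P1 \<or> ?P2 \<or> ?P3")
    if x: "x \<in> A W" for x W
  proof -
    obtain u X where uX: "u \<in> W" "X \<in> Cv W u" "x \<in> X" using x unfolding A_def by blast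
    from uX(2) show ?thesis unfolding Cv_iff
    proof (elim disjE exE conjE)
      assume "X = {p u}" then have ?P1 using uX by blast then show ?thesis by (rule disjI1)
    next
      fix e assume e: "X = \<gamma> e ` {0..1}" "e \<in> E" "e \<subseteq> W"
      then have "x \<in> p ` e \<union> I e" using arc[OF e(2)] uX by blast
      then have "?P1 \<or> ?P2"
      proof
        assume "x \<in> p ` e" then have ?P1 using e by blast then show ?thesis ..
      next
        assume "x \<in> I e" then have ?P2 using e by blast then show ?thesis ..
      qed
      then show ?thesis by (elim disjE) (intro disjI1, assumption, intro disjI2 disjI1, assumption)
    next
      fix e assume e: "X = \<delta> e ` {0..1/3}" "e \<in> M" "s e = W" "a e = u"
      then obtain r where r: "x = \<delta> e r" "0 \<le> r" "r \<le> 1/3" using uX(3) by auto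
      show ?thesis
      proof (cases "r = 0")
        case True
        then have "x = p u" using r e \<delta>01(1)[OF e(2)] by simp
        then have ?P1 using uX(1) by blast then show ?thesis by (rule disjI1)
      next
        case False
        then have "x = \<delta> e r \<and> 0 < r \<and> r < 1 \<and> (W = s e \<and> r \<le> 1/3 \<or> W = t e \<and> 2/3 \<le> r)" using r e
            by simp
        then have ?P3 using e(2) by blast
        then show ?thesis by simp
      qed
    next
      fix e assume e: "X = \<delta> e ` {2/3..1}" "e \<in> M" "t e = W" "b e = u"
      then obtain r where r: "x = \<delta> e r" "2/3 \<le> r" "r \<le> 1" using uX(3) by auto
      show ?thesis
      proof (cases "r = 1")
        case True
        then have "x = p u" using r e \<delta>01(2)[OF e(2)] by simp
        then have ?P1 using uX(1) by blast then show ?thesis by (rule disjI1)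
      next
        case False
        then have "x = \<delta> e r \<and> 0 < r \<and> r < 1 \<and> (W = s e \<and> r \<le> 1/3 \<or> W = t e \<and> 2/3 \<le> r)" using r e
            by simp
        then have ?P3 using e(2) by blast
        then show ?thesis by simp
      qed
    qed
  qed
  have Mpt: "e = e' \<and> r = r'" if "e \<in> M" "e' \<in> M" "\<delta> e r = \<delta> e' r'" "0 < r" "r < 1" "0 < r'"
      "r' < 1" for e e' r r'
  proof -
    have "\<epsilon> e = \<epsilon> e'" using II[OF \<epsilon>E[OF that(1)] \<epsilon>E[OF that(2)] \<delta>I[OF that(4,5)]] \<delta>I[OF that(6,7),
        of e'] that(3) by metis
    then have "e = e'" using \<epsilon>inj that by blast
    then show ?thesis using \<delta>inj[of e r r'] that by auto
  qed
  have mid: False if e: "e \<in> M" "0 < r" "r < 1"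
      and W: "W \<in> \<U>" "(\<exists>u\<in>W. \<delta> e r = p u) \<or> (\<exists>e'\<in>E. e' \<subseteq> W \<and> \<delta> e r \<in> I e')" for e r W
  proof -
    have x: "\<delta> e r \<in> I (\<epsilon> e)" using \<delta>I e by blast
    from W(2) show False
    proof (elim disjE bexE conjE)
      fix u assume "u \<in> W" "\<delta> e r = p u"
      then show False using Ip[OF \<epsilon>E[OF e(1)] x] U W(1) by blast
    next
      fix e' assume "e' \<in> E" "e' \<subseteq> W" "\<delta> e r \<in> I e'"
      then have "\<epsilon> e = e'" using II[OF \<epsilon>E[OF e(1)] _ x] by blast
      then show False using \<epsilon>U[OF e(1) W(1)] \<open>e' \<subseteq> W\<close> by blast
    qed
  qed
  show "card M \<le> 3 * card \<U> + 6 * g"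
  proof (rule surface_minor_bound[OF g finU finM, where A = A and C = C and s = s and t = t])
    fix W assume W: "W \<in> \<U>"
    have "connectedin ?S (\<Union>u\<in>W. \<Union>(Cv W u))"
    proof (rule connectedin_UN_conn)
      have "(\<Union>(Cv W u)) \<inter> (\<Union>(Cv W v)) \<noteq> {}" if "{u, v} \<in> E" "u \<in> W" "v \<in> W" for u v
      proof -
        have "\<gamma> {u, v} ` {0..1} \<in> Cv W u" "\<gamma> {u, v} ` {0..1} \<in> Cv W v"
          unfolding Cv_iff using that by (intro disjI2 disjI1 exI[of _ "{u, v}"], simp)+
        moreover have "\<gamma> {u, v} 0 \<in> \<gamma> {u, v} ` {0..1}" by simp
        ultimately show ?thesis by blast
      qed
      then have le: "(\<lambda>x y. {x, y} \<in> E \<and> x \<in> W \<and> y \<in> W) \<le> (\<lambda>x y. \<Union>(Cv W x) \<inter> \<Union>(Cv W y) \<noteq> {} \<and>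
          x \<in> W \<and> y \<in> W)"
        by blast
      show "conn (\<lambda>k k'. \<Union>(Cv W k) \<inter> \<Union>(Cv W k') \<noteq> {}) W"
        unfolding conn_def
      proof (intro ballI)
        fix x y assume "x \<in> W" "y \<in> W"
        then have "(\<lambda>x y. {x, y} \<in> E \<and> x \<in> W \<and> y \<in> W)\<^sup>*\<^sup>* x y" using U W by (simp add: conn_def)
        then show "(\<lambda>a b. \<Union>(Cv W a) \<inter> \<Union>(Cv W b) \<noteq> {} \<and> a \<in> W \<and> b \<in> W)\<^sup>*\<^sup>* x y"
          using predicate2D[OF rtranclp_mono[OF le]] by blast
      qed
      fix u assume u: "u \<in> W"
      have "p u \<in> \<Inter>(Cv W u)" using Cv_conn[OF _ W u] by blast
      then show "connectedin ?S (\<Union>(Cv W u))" using Cv_conn[OF _ W u]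
          by (intro connectedin_Union) blast+
      have "{p u} \<in> Cv W u" unfolding Cv_iff by simp
      then show "\<Union>(Cv W u) \<noteq> {}" by blast
    qed
    moreover have "compactin ?S (\<Union>u\<in>W. \<Union>(Cv W u))"
    proof -
      have "finite W" using U W finV finite_subset by blast
      then have fin: "finite (\<Union>u\<in>W. Cv W u)" using finCv by blast
      have "compactin ?S (\<Union>(\<Union>u\<in>W. Cv W u))"
        by (rule compactin_Union[OF fin]) (use Cv_conn[OF _ W] in blast)
      moreover have "\<Union>(\<Union>u\<in>W. Cv W u) = (\<Union>u\<in>W. \<Union>(Cv W u))" by blast
      ultimately show ?thesis by (simp only:)
    qed
    moreover have "(\<Union>u\<in>W. \<Union>(Cv W u)) \<noteq> {}"
    proof -
      obtain u where "u \<in> W" using U W by blast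
      moreover have "{p u} \<in> Cv W u" unfolding Cv_iff by simp
      ultimately show ?thesis by blast
    qed
    ultimately show "connectedin ?S (A W) \<and> closedin ?S (A W) \<and> A W \<noteq> {}"
      using compactin_imp_closedin[OF H] by (simp add: A_def)
  next
    fix e assume e: "e \<in> M"
    show "connectedin ?S (C e) \<and> closedin ?S (C e)"
      using sub_path[OF \<delta>path[OF e], of "1/3" "2/3"] compactin_imp_closedin[OF H]
          by (simp add: C_def)
    show "s e \<in> \<U> \<and> t e \<in> \<U> \<and> s e \<noteq> t e \<and> e = {s e, t e}" using st[OF e] by blast
    have "\<delta> e (1/3) \<in> C e" "\<delta> e (2/3) \<in> C e" by (auto simp: C_def)
    moreover have "\<delta> e (1/3) \<in> A (s e)"
    proof -
      have "\<delta> e ` {0..1/3} \<in> Cv (s e) (a e)" unfolding Cv_iff using e by fast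
      moreover have "\<delta> e (1/3) \<in> \<delta> e ` {0..1/3}" by simp
      ultimately show ?thesis using st(5)[OF e] unfolding A_def by blast
    qed
    moreover have "\<delta> e (2/3) \<in> A (t e)"
    proof -
      have "\<delta> e ` {2/3..1} \<in> Cv (t e) (b e)" unfolding Cv_iff using e by fast
      moreover have "\<delta> e (2/3) \<in> \<delta> e ` {2/3..1}" by simp
      ultimately show ?thesis using st(6)[OF e] unfolding A_def by blast
    qed
    ultimately show "C e \<inter> A (s e) \<noteq> {} \<and> C e \<inter> A (t e) \<noteq> {}" by blast
  next
    fix W W' assume W: "W \<in> \<U>" "W' \<in> \<U>" "W \<noteq> W'"
    show "A W \<inter> A W' = {}"
    proof (rule ccontr)
      assume "A W \<inter> A W' \<noteq> {}"
      then obtain x where x: "x \<in> A W" "x \<in> A W'" by blast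
      show False
      proof (cases "\<exists>e\<in>M. \<exists>r. x = \<delta> e r \<and> 0 < r \<and> r < 1")
        case True
        then obtain e r where e: "e \<in> M" "x = \<delta> e r" "0 < r" "r < 1" by blast
        have "X = s e \<and> r \<le> 1/3 \<or> X = t e \<and> 2/3 \<le> r" if X: "x \<in> A X" "X \<in> \<U>" for X
        proof -
          have "\<not> ((\<exists>u\<in>X. x = p u) \<or> (\<exists>e\<in>E. e \<subseteq> X \<and> x \<in> I e))" using mid[OF e(1,3,4) X(2)] e(2)
              by blast
          then obtain e' r' where r': "e' \<in> M" "x = \<delta> e' r'" "0 < r'" "r' < 1"
              "X = s e' \<and> r' \<le> 1/3 \<or> X = t e' \<and> 2/3 \<le> r'"
            using Apt[OF X(1)] by blast
          then show ?thesis using Mpt[OF e(1) r'(1) _ e(3,4) r'(3,4)] e(2) by auto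
        qed
        from this[OF x(1) W(1)] this[OF x(2) W(2)] show False using W(3) by auto
      next
        case False
        then have "(\<exists>u\<in>W. x = p u) \<or> (\<exists>e\<in>E. e \<subseteq> W \<and> x \<in> I e)"
            "(\<exists>u\<in>W'. x = p u) \<or> (\<exists>e\<in>E. e \<subseteq> W' \<and> x \<in> I e)"
          using Apt[OF x(1)] Apt[OF x(2)] by blast+
        then consider u u' where "u \<in> W" "u' \<in> W'" "p u = p u'" | e e'
            where "e \<in> E" "e' \<in> E" "e \<subseteq> W" "e' \<subseteq> W'" "x \<in> I e" "x \<in> I e'"
          | u e where "u \<in> W \<union> W'" "e \<in> E" "x = p u" "x \<in> I e"
          by (elim disjE bexE conjE) (blast+)
        then show False
        proof cases
          case 1
          then have "u = u'" using p(2) U W unfolding inj_on_def by blast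
          then show False using same W 1 by blast
        next
          case 2
          then have "e = e'" using II by blast
          moreover have "e \<noteq> {}" using EV[OF 2(1)] by auto
          ultimately show False using same W 2 by blast
        next
          case 3
          then show False using Ip[OF 3(2,4)] U W by blast
        qed
      qed
    qed
  next
    fix e e' assume e: "e \<in> M" "e' \<in> M" "e \<noteq> e'"
    show "C e \<inter> C e' = {}"
    proof (rule ccontr)
      assume "C e \<inter> C e' \<noteq> {}"
      then obtain r r' where "\<delta> e r = \<delta> e' r'" "1/3 \<le> r" "r \<le> 2/3" "1/3 \<le> r'" "r' \<le> 2/3"
          unfolding C_def by auto
      then show False using Mpt[OF e(1,2), of r r'] e(3) by simp
    qed
  next
    fix e W assume e: "e \<in> M" "W \<in> \<U>" "W \<noteq> s e" "W \<noteq> t e"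
    show "C e \<inter> A W = {}"
    proof (rule ccontr)
      assume "C e \<inter> A W \<noteq> {}"
      then obtain r where r: "\<delta> e r \<in> A W" "1/3 \<le> r" "r \<le> 2/3" unfolding C_def by auto
      have r01: "0 < r" "r < 1" using r by auto
      have "\<not> ((\<exists>u\<in>W. \<delta> e r = p u) \<or> (\<exists>e'\<in>E. e' \<subseteq> W \<and> \<delta> e r \<in> I e'))" using mid[OF e(1) r01 e(2)]
          by blast
      then obtain e' r' where r': "e' \<in> M" "\<delta> e r = \<delta> e' r'" "0 < r'" "r' < 1" "W = s e' \<or> W = t e'"
        using Apt[OF r(1)] by blast
      then show False using Mpt[OF e(1) r'(1,2) r01 r'(3,4)] e by auto
    qed
  qed
qed

section \<open>Eigenbases for the Steklov problem\<close>

definition energy :: "'a set \<Rightarrow> 'a set set \<Rightarrow> ('a \<Rightarrow> real) \<Rightarrow> ('a \<Rightarrow> real) \<Rightarrow> real" where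
  "energy V E f h = (\<Sum>x\<in>V. \<Sum>y\<in>nbrs E x. (f x - f y) * (h x - h y)) / 2"

definition inner_on :: "'a set \<Rightarrow> ('a \<Rightarrow> real) \<Rightarrow> ('a \<Rightarrow> real) \<Rightarrow> real" where
  "inner_on B f h = (\<Sum>x\<in>B. f x * h x)"

section \<open>Energy, Laplacian and harmonic extension\<close>

lemma nbrs_subset: "simple_graph V E \<Longrightarrow> nbrs E x \<subseteq> V"
  by (auto simp: simple_graph_def nbrs_def)

lemma nbrs_sym: "y \<in> nbrs E x \<longleftrightarrow> x \<in> nbrs E y"
  by (simp add: nbrs_def insert_commute)

lemma finite_nbrs: "simple_graph V E \<Longrightarrow> finite (nbrs E x)"
  using nbrs_subset finite_subset unfolding simple_graph_def by metis

lemma sum_nbrs_swap: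
  assumes G: "simple_graph V E"
  shows "(\<Sum>x\<in>V. \<Sum>y\<in>nbrs E x. F x y) = (\<Sum>x\<in>V. \<Sum>y\<in>nbrs E x. F y x :: real)"
proof -
  have fin: "finite V" using G by (simp add: simple_graph_def)
  have eq: "(\<Sum>x\<in>V. \<Sum>y\<in>nbrs E x. K x y) = (\<Sum>p\<in>Sigma V (nbrs E). K (fst p) (snd p))"
      for K :: "'a \<Rightarrow> 'a \<Rightarrow> real"
    using fin finite_nbrs[OF G] by (simp add: sum.Sigma case_prod_unfold)
  have sw: "prod.swap ` Sigma V (nbrs E) = Sigma V (nbrs E)"
  proof -
    have "prod.swap ` Sigma V (nbrs E) \<subseteq> Sigma V (nbrs E)" using nbrs_subset[OF G] nbrs_sym
        by fastforce
    moreover have "prod.swap ` (prod.swap ` Sigma V (nbrs E)) = Sigma V (nbrs E)"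
        by (simp add: image_image)
    ultimately show ?thesis by (metis image_mono subset_antisym)
  qed
  have "(\<Sum>p\<in>Sigma V (nbrs E). F (fst p) (snd p)) = (\<Sum>p\<in>prod.swap ` Sigma V (nbrs E). F (fst p) (snd
      p))" by (simp only: sw)
  also have "\<dots> = (\<Sum>p\<in>Sigma V (nbrs E). F (snd p) (fst p))"
      by (subst sum.reindex) (auto simp: inj_on_def)
  finally show ?thesis unfolding eq[of F] eq[of "\<lambda>x y. F y x"] .
qed

text \<open>Summation by parts: the two orientations of each edge are combined.\<close>

lemma energy_laplacian:
  assumes G: "simple_graph V E"
  shows "energy V E f h = (\<Sum>x\<in>V. h x * laplacian E f x)"
proof -
  have "(\<Sum>x\<in>V. \<Sum>y\<in>nbrs E x. (f x - f y) * (h x - h y)) =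
     (\<Sum>x\<in>V. \<Sum>y\<in>nbrs E x. (f x - f y) * h x) - (\<Sum>x\<in>V. \<Sum>y\<in>nbrs E x. (f x - f y) * h y)"
    by (simp add: right_diff_distrib sum_subtractf)
  also have "(\<Sum>x\<in>V. \<Sum>y\<in>nbrs E x. (f x - f y) * h y) = (\<Sum>x\<in>V. \<Sum>y\<in>nbrs E x. (f y - f x) * h x)"
    by (rule sum_nbrs_swap[OF G])
  also have "\<dots> = - (\<Sum>x\<in>V. \<Sum>y\<in>nbrs E x. (f x - f y) * h x)"
    by (simp add: sum_negf[symmetric] minus_mult_left)
  finally have "energy V E f h = (\<Sum>x\<in>V. \<Sum>y\<in>nbrs E x. (f x - f y) * h x)" by (simp add: energy_def)
  then show ?thesis by (simp add: laplacian_def sum_distrib_left mult.commute)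
qed

lemma energy_commute: "energy V E f h = energy V E h f"
  by (simp add: energy_def mult.commute)

lemma energy_nonneg: "energy V E f f \<ge> 0"
  unfolding energy_def by (intro divide_nonneg_nonneg sum_nonneg) auto

lemma energy_zero_imp:
  assumes G: "simple_graph V E" and 0: "energy V E f f = 0" and x: "x \<in> V" "y \<in> nbrs E x"
  shows "f x = f y"
proof -
  have fin: "finite V" using G by (simp add: simple_graph_def)
  have "(\<Sum>x\<in>V. \<Sum>y\<in>nbrs E x. (f x - f y) * (f x - f y)) = 0" using 0 by (simp add: energy_def)
  then have "(\<Sum>y\<in>nbrs E x. (f x - f y) * (f x - f y)) = 0"
    using sum_nonneg_eq_0_iff[OF fin, of "\<lambda>x. \<Sum>y\<in>nbrs E x. (f x - f y) * (f x - f y)"] x(1)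
        by (simp add: sum_nonneg)
  then have "(f x - f y) * (f x - f y) = 0"
    using sum_nonneg_eq_0_iff[OF finite_nbrs[OF G, of x], of "\<lambda>y. (f x - f y) * (f x - f y)"] x(2)
        by simp
  then show ?thesis by simp
qed

lemma laplacian_add: "laplacian E (\<lambda>x. f x + c * h x) x = laplacian E f x + c * laplacian E h x"
  by (simp add: laplacian_def sum.distrib[symmetric] sum_distrib_left algebra_simps)

lemma laplacian_sum: "laplacian E (\<lambda>x. \<Sum>i\<in>I. c i * h i x) x = (\<Sum>i\<in>I. c i * laplacian E (h i) x)"
proof -
  have "laplacian E (\<lambda>x. \<Sum>i\<in>I. c i * h i x) x = (\<Sum>y\<in>nbrs E x. \<Sum>i\<in>I. c i * (h i x - h i y))"
    by (simp add: laplacian_def sum_subtractf right_diff_distrib)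
  also have "\<dots> = (\<Sum>i\<in>I. c i * laplacian E (h i) x)"
    by (subst sum.swap) (simp add: laplacian_def sum_distrib_left)
  finally show ?thesis .
qed

text \<open>Equations are added one vertex at a time. The correction \<open>e\<close> is harmonic on
  \<open>S\<close> and equals the indicator of \<open>s\<close> off \<open>S\<close>; a multiple of
  it settles the equation at \<open>s\<close> unless its Laplacian vanishes there. In that case
  \<open>e\<close> has energy 0 and is constant along edges, so its mixed energy with
  \<open>h0\<close> is 0, and this energy is the Laplacian of \<open>h0\<close> at \<open>s\<close>.
  Components without boundary vertices fall under this case.\<close>

lemma harmonic_extension:
  assumes G: "simple_graph V E" and S: "finite S" "S \<subseteq> V"
  shows "\<exists>h. (\<forall>x. x \<notin> S \<longrightarrow> h x = u x) \<and> (\<forall>s\<in>S. laplacian E h s = 0)"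
  using S
proof (induction S arbitrary: u rule: finite_induct)
  case empty
  show ?case by (intro exI[of _ u]) simp
next
  case (insert s S)
  have fin: "finite V" using G by (simp add: simple_graph_def)
  obtain h0 where h0: "\<And>x. x \<notin> S \<Longrightarrow> h0 x = u x" "\<And>t. t \<in> S \<Longrightarrow> laplacian E h0 t = 0"
    using insert.IH[of u] insert.prems by blast
  obtain e where e: "\<And>x. x \<notin> S \<Longrightarrow> e x = of_bool (x = s)" "\<And>t. t \<in> S \<Longrightarrow> laplacian E e t = 0"
    using insert.IH[of "\<lambda>x. of_bool (x = s)"] insert.prems by blast
  have es: "e s = 1" using e(1)[of s] insert.hyps by simp
  have en: "energy V E k e = laplacian E k s" if "\<And>t. t \<in> S \<Longrightarrow> laplacian E k t = 0" for k
  proof -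
    have "energy V E k e = (\<Sum>x\<in>V. if x = s then laplacian E k s else 0)"
      unfolding energy_laplacian[OF G]
    proof (rule sum.cong[OF refl])
      fix x
      show "e x * laplacian E k x = (if x = s then laplacian E k s else 0)"
        using that[of x] e(1)[of x] es by (cases "x \<in> S") (use insert.hyps in auto)
    qed
    then show ?thesis using fin insert.prems by simp
  qed
  have "\<exists>c. laplacian E h0 s + c * laplacian E e s = 0"
  proof (cases "laplacian E e s = 0")
    case False
    then show ?thesis by (intro exI[of _ "- laplacian E h0 s / laplacian E e s"]) simp
  next
    case True
    then have z: "energy V E e e = 0" using en[of e] e(2) by simp
    have "energy V E h0 e = 0"
      unfolding energy_def using energy_zero_imp[OF G z] by (simp add: sum.neutral)
    then have "laplacian E h0 s = 0" using en[of h0] h0(2) by simp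
    then show ?thesis by (intro exI[of _ 0]) simp
  qed
  then obtain c where c: "laplacian E h0 s + c * laplacian E e s = 0" by blast
  show ?case
  proof (intro exI[of _ "\<lambda>x. h0 x + c * e x"] conjI allI impI ballI)
    fix x assume "x \<notin> insert s S" then show "h0 x + c * e x = u x" using h0(1) e(1) by simp
  next
    fix t assume "t \<in> insert s S"
    then show "laplacian E (\<lambda>x. h0 x + c * e x) t = 0" using h0(2) e(2) c
        by (auto simp: laplacian_add)
  qed
qed

text \<open>Subtracting its projections from a coordinate vector: averaging over the coordinates shows that fewer than
  \<open>card B\<close> orthonormal vectors do not span, and that \<open>card B\<close> of them do.\<close>

lemma projection_residue:
  assumes B: "finite B" "b \<in> B"
    and on: "\<And>i j. i < k \<Longrightarrow> j < k \<Longrightarrow> inner_on B (u i) (u j) = of_bool (i = (j::nat))"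
  defines "w \<equiv> \<lambda>x. of_bool (x = b) - (\<Sum>i<k. u i b * u i x)"
  shows "j < k \<Longrightarrow> inner_on B w (u j) = 0" "inner_on B w w = 1 - (\<Sum>i<k. (u i b)\<^sup>2)"
proof -
  have ib: "inner_on B (\<lambda>x. of_bool (x = b)) f = f b" for f
    using B by (simp add: inner_on_def of_bool_def if_distrib[of "\<lambda>z. z * _"] cong: if_cong)
  have lin: "inner_on B w f = f b - (\<Sum>i<k. u i b * inner_on B (u i) f)" for f
  proof -
    have "inner_on B w f = inner_on B (\<lambda>x. of_bool (x = b)) f - (\<Sum>x\<in>B. \<Sum>i<k. u i b * (u i x * f x))"
      unfolding inner_on_def w_def by (simp add: left_diff_distrib sum_subtractf sum_distrib_right
          mult.assoc)
    also have "(\<Sum>x\<in>B. \<Sum>i<k. u i b * (u i x * f x)) = (\<Sum>i<k. u i b * inner_on B (u i) f)"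
      unfolding inner_on_def by (subst sum.swap) (simp add: sum_distrib_left)
    finally show ?thesis by (simp add: ib)
  qed
  have orth: "inner_on B w (u j) = 0" if j: "j < k" for j
  proof -
    have "(\<Sum>i<k. u i b * inner_on B (u i) (u j)) = (\<Sum>i<k. if i = j then u j b else 0)"
      by (rule sum.cong) (use on j in auto)
    then show ?thesis using lin[of "u j"] j by simp
  qed
  then show "j < k \<Longrightarrow> inner_on B w (u j) = 0" by simp
  have "inner_on B w w = w b - (\<Sum>i<k. u i b * inner_on B (u i) w)" by (rule lin)
  also have "(\<Sum>i<k. u i b * inner_on B (u i) w) = 0"
    using orth by (intro sum.neutral) (auto simp: inner_on_def mult.commute)
  finally show "inner_on B w w = 1 - (\<Sum>i<k. (u i b)\<^sup>2)" by (simp add: w_def power2_eq_square)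
qed

lemma orthonormal_trace:
  assumes on: "\<And>i j. i < k \<Longrightarrow> j < k \<Longrightarrow> inner_on B (u i) (u j) = of_bool (i = (j::nat))"
  shows "(\<Sum>b\<in>B. \<Sum>i<k. (u i b)\<^sup>2) = real k"
proof -
  have "(\<Sum>b\<in>B. \<Sum>i<k. (u i b)\<^sup>2) = (\<Sum>i<k. inner_on B (u i) (u i))"
    by (subst sum.swap) (simp add: inner_on_def power2_eq_square)
  also have "\<dots> = (\<Sum>i<k. 1)" by (rule sum.cong) (use on in auto)
  finally show ?thesis by simp
qed

lemma orthonormal_complete:
  assumes B: "finite B"
    and on: "\<And>i j. i < card B \<Longrightarrow> j < card B \<Longrightarrow> inner_on B (u i) (u j) = of_bool (i = (j::nat))"
    and x: "x \<in> B"
  shows "f x = (\<Sum>i<card B. inner_on B f (u i) * u i x)"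
proof -
  let ?w = "\<lambda>b x. of_bool (x = b) - (\<Sum>i<card B. u i b * u i x)"
  have ww: "inner_on B (?w b) (?w b) = 1 - (\<Sum>i<card B. (u i b)\<^sup>2)" if "b \<in> B" for b
    by (rule projection_residue(2)[OF B that on])
  have nn: "inner_on B (?w b) (?w b) \<ge> 0" for b unfolding inner_on_def by (intro sum_nonneg) auto
  have "(\<Sum>b\<in>B. inner_on B (?w b) (?w b)) = (\<Sum>b\<in>B. 1 - (\<Sum>i<card B. (u i b)\<^sup>2))"
    by (rule sum.cong) (use ww in auto)
  also have "\<dots> = 0" using orthonormal_trace[of "card B" B u, OF on] by (simp add: sum_subtractf)
  finally have "inner_on B (?w b) (?w b) = 0" if "b \<in> B" for b
    using sum_nonneg_eq_0_iff[OF B, of "\<lambda>b. inner_on B (?w b) (?w b)"] nn that by simp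
  then have w0: "?w b x = 0" if "b \<in> B" for b
    using sum_nonneg_eq_0_iff[OF B, of "\<lambda>x. ?w b x * ?w b x"] that x unfolding inner_on_def by auto
  have "f x = (\<Sum>b\<in>B. f b * of_bool (x = b))"
    using B x by (simp add: of_bool_def if_distrib[of "\<lambda>z. _ * z"] cong: if_cong)
  also have "\<dots> = (\<Sum>b\<in>B. f b * (\<Sum>i<card B. u i b * u i x))"
    by (rule sum.cong) (use w0 in auto)
  also have "\<dots> = (\<Sum>i<card B. inner_on B f (u i) * u i x)"
    unfolding inner_on_def sum_distrib_left sum_distrib_right
        by (subst sum.swap) (simp add: mult_ac)
  finally show ?thesis .
qed

section \<open>Diagonalising a symmetric matrix indexed by the boundary\<close>

text \<open>Unit vectors are sought among functions supported on \<open>B\<close> with values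
  between -1 and 1, where the product topology provides a minimum.\<close>

lemma compact_box_functions:
  "compact {u :: 'a \<Rightarrow> real. \<forall>x. u x \<in> (if x \<in> B then {-1..1} else {0})}"
proof -
  let ?K = "\<lambda>x. if x \<in> B then {-1..1} else {0::real}"
  have "compactin (product_topology (\<lambda>_. euclidean) UNIV) (PiE UNIV ?K)"
    unfolding compactin_PiE by auto
  moreover have "PiE UNIV ?K = {u. \<forall>x. u x \<in> ?K x}" by (auto simp: PiE_def Pi_def)
  ultimately show ?thesis by (simp add: euclidean_product_topology)
qed

text \<open>A minimiser of the quadratic form on the unit sphere of the complement of the earlier
  vectors is stationary in all directions of the complement. The complement is invariant, as
  \<open>m\<close> is symmetric and the earlier vectors are eigenvectors, so stationarity is the
  eigenvalue equation.\<close>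

lemma next_eigenvector:
  fixes m :: "'a \<Rightarrow> 'a \<Rightarrow> real"
  assumes B: "finite B" and sym: "\<And>b c. m b c = m c b" and k: "k < card B"
    and on: "\<And>i j. i < k \<Longrightarrow> j < k \<Longrightarrow> inner_on B (u i) (u j) = of_bool (i = (j::nat))"
    and eig: "\<And>i b. i < k \<Longrightarrow> b \<in> B \<Longrightarrow> (\<Sum>c\<in>B. m b c * u i c) = \<mu> i * u i b"
  shows "\<exists>v \<nu>. (\<forall>x. x \<notin> B \<longrightarrow> v x = 0) \<and> inner_on B v v = 1 \<and> (\<forall>i<k. inner_on B v (u i) = 0) \<and>
     (\<forall>b\<in>B. (\<Sum>c\<in>B. m b c * v c) = \<nu> * v b)"
proof -
  define q where "q v w = (\<Sum>b\<in>B. v b * (\<Sum>c\<in>B. m b c * w c))" for v w :: "'a \<Rightarrow> real"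
  define S where "S = {v. (\<forall>x. v x \<in> (if x \<in> B then {-1..1} else {0::real})) \<and> inner_on B v v = 1 \<and>
      (\<forall>i<k. inner_on B v (u i) = 0)}"
  have coord [continuous_intros]: "continuous_on T (\<lambda>v :: 'a \<Rightarrow> real. v x)" for T x
    by (rule continuous_on_subset[OF continuous_on_product_coordinates]) simp
  have cin: "continuous_on T (\<lambda>v. inner_on B v v)" "continuous_on T (\<lambda>v. inner_on B v w)"
      "continuous_on T (\<lambda>v. q v v)" for T w
    unfolding inner_on_def q_def by (intro continuous_intros)+
  have S_eq: "S = {v. \<forall>x. v x \<in> (if x \<in> B then {-1..1} else {0::real})} \<inter>
     ({v. inner_on B v v = 1} \<inter> (\<Inter>i\<in>{..<k}. {v. inner_on B v (u i) = 0}))" by (auto simp: S_def)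
  have "closed ({v. inner_on B v v = 1} \<inter> (\<Inter>i\<in>{..<k}. {v. inner_on B v (u i) = 0}))"
    by (intro closed_Int closed_INT ballI closed_Collect_eq cin continuous_on_const)
  then have cS: "compact S" unfolding S_eq by (rule compact_Int_closed[OF compact_box_functions])
  have norm1: "\<bar>v x\<bar> \<le> 1" if "inner_on B v v = 1" "x \<in> B" for v x
  proof -
    have "v x * v x \<le> inner_on B v v" unfolding inner_on_def using B that
        by (intro member_le_sum) auto
    then show ?thesis using that abs_le_square_iff[of "v x" 1] by (simp add: power2_eq_square)
  qed
  have normalise: "\<exists>v\<in>S. \<exists>c>0. \<forall>x\<in>B. w x = c * v x"
      if w: "inner_on B w w > 0" "\<And>i. i < k \<Longrightarrow> inner_on B w (u i) = 0" for w
  proof -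
    define c where "c = sqrt (inner_on B w w)"
    define v where "v x = (if x \<in> B then w x / c else 0)" for x
    have c: "c > 0" "c * c = inner_on B w w" using w(1) by (auto simp: c_def)
    have "inner_on B v v = (\<Sum>x\<in>B. w x * w x / (c * c))" unfolding inner_on_def v_def
        by (rule sum.cong) auto
    also have "\<dots> = inner_on B w w / (c * c)" by (simp add: inner_on_def sum_divide_distrib)
    finally have v1: "inner_on B v v = 1" using c w(1) by simp
    have "inner_on B v f = inner_on B w f / c" for f
    proof -
      have "inner_on B v f = (\<Sum>x\<in>B. w x * f x / c)" unfolding inner_on_def v_def
          by (rule sum.cong) auto
      then show ?thesis by (simp add: inner_on_def sum_divide_distrib)
    qed
    then have "\<forall>i<k. inner_on B v (u i) = 0" using w(2) by simp
    moreover have "v x \<in> (if x \<in> B then {-1..1} else {0})" for x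
    proof (cases "x \<in> B")
      case True
      then show ?thesis using norm1[OF v1 True] by (simp add: abs_le_iff)
    qed (simp add: v_def)
    ultimately have "v \<in> S" using v1 by (simp add: S_def)
    moreover have "\<forall>x\<in>B. w x = c * v x" using c by (simp add: v_def)
    ultimately show ?thesis using c(1) by blast
  qed
  have "S \<noteq> {}"
  proof -
    have "\<exists>b\<in>B. (\<Sum>i<k. (u i b)\<^sup>2) < 1"
    proof (rule ccontr)
      assume "\<not> ?thesis"
      then have "(\<Sum>b\<in>B. 1) \<le> (\<Sum>b\<in>B. \<Sum>i<k. (u i b)\<^sup>2)" by (intro sum_mono) auto
      then show False using orthonormal_trace[of k B u, OF on] k by simp
    qed
    then obtain b where b: "b \<in> B" "(\<Sum>i<k. (u i b)\<^sup>2) < 1" by blast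
    let ?w = "\<lambda>x. of_bool (x = b) - (\<Sum>i<k. u i b * u i x)"
    have "inner_on B ?w ?w = 1 - (\<Sum>i<k. (u i b)\<^sup>2)" by (rule projection_residue(2)[OF B b(1) on])
    moreover have "inner_on B ?w (u i) = 0" if "i < k" for i
        by (rule projection_residue(1)[OF B b(1) on that])
    ultimately show ?thesis using normalise[of ?w] b by auto
  qed
  then obtain v where v: "v \<in> S" "\<And>w. w \<in> S \<Longrightarrow> q v v \<le> q w w"
    using continuous_attains_inf[OF cS _ cin(3)] by blast
  define \<nu> where "\<nu> = q v v"
  have v1: "inner_on B v v = 1" "\<And>i. i < k \<Longrightarrow> inner_on B v (u i) = 0" "\<And>x. x \<notin> B \<Longrightarrow> v x = 0"
    using v(1) by (auto simp: S_def split: if_splits)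
  have qadd: "q (\<lambda>x. f x + c * h x) (\<lambda>x. f x + c * h x) = q f f + 2 * c * q f h + c\<^sup>2 * q h h"
      for f h c
  proof -
    have "q h f = q f h"
    proof -
      have "q h f = (\<Sum>b\<in>B. \<Sum>c\<in>B. h b * (m b c * f c))" by (simp add: q_def sum_distrib_left)
      also have "\<dots> = (\<Sum>c\<in>B. \<Sum>b\<in>B. h b * (m b c * f c))" by (rule sum.swap)
      also have "\<dots> = q f h" unfolding q_def sum_distrib_left
        by (intro sum.cong refl) (simp add: sym mult_ac)
      finally show ?thesis .
    qed
    moreover have "q (\<lambda>x. f x + c * h x) (\<lambda>x. f x + c * h x) = q f f + c * q f h + c * q h f +
        c\<^sup>2 * q h h"
      by (simp add: q_def sum.distrib sum_distrib_left algebra_simps power2_eq_square)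
    ultimately show ?thesis by simp
  qed
  have iadd: "inner_on B (\<lambda>x. f x + c * h x) (\<lambda>x. f x + c * h x) = inner_on B f f +
      2 * c * inner_on B f h + c\<^sup>2 * inner_on B h h" for f h c
    by (simp add: inner_on_def sum.distrib sum_distrib_left algebra_simps power2_eq_square)
  have ge: "\<nu> * inner_on B w w \<le> q w w" if w: "\<And>i. i < k \<Longrightarrow> inner_on B w (u i) = 0" for w
  proof (cases "inner_on B w w = 0")
    case True
    then have "w x = 0" if "x \<in> B" for x
      using sum_nonneg_eq_0_iff[OF B, of "\<lambda>x. w x * w x"] that unfolding inner_on_def by auto
    then show ?thesis using True by (simp add: q_def)
  next
    case False
    moreover have "inner_on B w w \<ge> 0" unfolding inner_on_def by (intro sum_nonneg) auto
    ultimately obtain z c where z: "z \<in> S" "c > 0" "\<And>x. x \<in> B \<Longrightarrow> w x = c * z x"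
        using normalise[of w] w by force
    have "q w w = c\<^sup>2 * q z z" unfolding q_def using z(3)
        by (simp add: sum_distrib_left power2_eq_square mult_ac)
    moreover have "inner_on B w w = c\<^sup>2 * inner_on B z z"
      unfolding inner_on_def using z(3) by (simp add: sum_distrib_left power2_eq_square mult_ac)
    moreover have "inner_on B z z = 1" using z(1) by (simp add: S_def)
    ultimately show ?thesis using mult_right_mono[OF v(2)[OF z(1)] zero_le_power2[of c]]
      by (simp add: \<nu>_def mult.commute)
  qed
  have stat: "q v w = \<nu> * inner_on B v w" if w: "\<And>i. i < k \<Longrightarrow> inner_on B w (u i) = 0" for w
  proof -
    let ?d = "q v w - \<nu> * inner_on B v w" and ?e = "q w w - \<nu> * inner_on B w w"
    have ineq: "0 \<le> 2 * c * ?d + c\<^sup>2 * ?e" for c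
    proof -
      have lin: "inner_on B (\<lambda>x. v x + c * w x) (u i) = inner_on B v (u i) + c * inner_on B w (u i)"
          for i
        by (simp add: inner_on_def sum.distrib sum_distrib_left algebra_simps)
      have "\<nu> * inner_on B (\<lambda>x. v x + c * w x) (\<lambda>x. v x + c * w x) \<le> q (\<lambda>x. v x +
          c * w x) (\<lambda>x. v x + c * w x)"
        by (rule ge) (simp add: lin v1(2) w)
      then show ?thesis unfolding qadd iadd using v1(1) by (simp add: \<nu>_def algebra_simps)
    qed
    have e: "?e \<ge> 0" using ge[of w] w by simp
    show ?thesis
    proof (rule ccontr)
      assume "q v w \<noteq> \<nu> * inner_on B v w"
      then have d: "?d \<noteq> 0" by simp
      \<comment> \<open>With the step \<open>c = - t * d\<close> the right-hand side of
        \<open>ineq\<close> is \<open>t * d\<^sup>2 * (t * e - 2)\<close>, which is negative once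
        \<open>t * e \<le> 1\<close>.\<close>
      define t where "t = 1 / (?e + 1)"
      have t: "t > 0" "t * ?e \<le> 1" using e by (auto simp: t_def field_simps)
      have "2 * (- (t * d)) * d + (- (t * d))\<^sup>2 * e = (t * d\<^sup>2) * (t * e - 2)" for d e :: real
        by (simp add: power2_eq_square algebra_simps)
      moreover have "(t * ?d\<^sup>2) * (t * ?e - 2) < 0" using t d by (intro mult_pos_neg) auto
      ultimately show False using ineq[of "- (t * ?d)"] by simp
    qed
  qed
  have "(\<Sum>c\<in>B. m b c * v c) = \<nu> * v b" if b: "b \<in> B" for b
  proof -
    \<comment> \<open>Stationarity is tested with the projection of the coordinate vector at
      \<open>b\<close>, which yields the equation at \<open>b\<close>.\<close>
    let ?w = "\<lambda>x. of_bool (x = b) - (\<Sum>i<k. u i b * u i x)"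
    have wo: "inner_on B ?w (u i) = 0" if "i < k" for i
        by (rule projection_residue(1)[OF B b on that])
    have qu: "q v (u i) = 0" if i: "i < k" for i
    proof -
      have "q v (u i) = (\<Sum>b\<in>B. v b * (\<mu> i * u i b))" unfolding q_def
          by (rule sum.cong) (use eig[OF i] in auto)
      also have "\<dots> = \<mu> i * inner_on B v (u i)" by (simp add: inner_on_def sum_distrib_left mult_ac)
      finally show ?thesis using v1(2)[OF i] by simp
    qed
    have split: "q v (\<lambda>x. f x - (\<Sum>i<k. u i b * u i x)) = q v f - (\<Sum>i<k. u i b * q v (u i))" for f
    proof -
      have "(\<Sum>x\<in>B. v x * (\<Sum>c\<in>B. m x c * (\<Sum>i<k. u i b * u i c))) = (\<Sum>i<k. u i b * q v (u i))"
      proof -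
        have "(\<Sum>x\<in>B. v x * (\<Sum>c\<in>B. m x c * (\<Sum>i<k. u i b * u i c))) =
           (\<Sum>x\<in>B. \<Sum>c\<in>B. \<Sum>i<k. u i b * (v x * (m x c * u i c)))"
          by (simp add: sum_distrib_left mult_ac)
        also have "\<dots> = (\<Sum>x\<in>B. \<Sum>i<k. \<Sum>c\<in>B. u i b * (v x * (m x c * u i c)))"
          by (intro sum.cong refl sum.swap)
        also have "\<dots> = (\<Sum>i<k. \<Sum>x\<in>B. \<Sum>c\<in>B. u i b * (v x * (m x c * u i c)))" by (rule sum.swap)
        finally show ?thesis by (simp add: q_def sum_distrib_left)
      qed
      then show ?thesis by (simp add: q_def right_diff_distrib sum_subtractf)
    qed
    have "q v (\<lambda>x. of_bool (x = b)) = (\<Sum>x\<in>B. v x * m x b)"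
      unfolding q_def using B b by (simp add: of_bool_def if_distrib[of "\<lambda>z. _ * z"] cong: if_cong)
    also have "\<dots> = (\<Sum>c\<in>B. m b c * v c)" by (intro sum.cong refl) (simp add: sym[of _ b]
        mult.commute)
    finally have "(\<Sum>c\<in>B. m b c * v c) = q v ?w" using split[of "\<lambda>x. of_bool (x = b)"] qu by simp
    also have "\<dots> = \<nu> * inner_on B v ?w" by (rule stat) (rule wo)
    also have "inner_on B v ?w = v b"
    proof -
      have "(\<Sum>x\<in>B. v x * (\<Sum>i<k. u i b * u i x)) = (\<Sum>i<k. u i b * inner_on B v (u i))"
        unfolding inner_on_def sum_distrib_left by (subst sum.swap) (simp add: mult_ac)
      also have "\<dots> = 0" using v1(2) by (simp add: sum.neutral)
      finally have "inner_on B v ?w = (\<Sum>x\<in>B. v x * of_bool (x = b))"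
        by (simp add: inner_on_def right_diff_distrib sum_subtractf)
      then show ?thesis using B b by (simp add: of_bool_def if_distrib[of "\<lambda>z. _ * z"] cong:
          if_cong)
    qed
    finally show ?thesis .
  qed
  then show ?thesis using v1 by blast
qed

lemma symmetric_eigenbasis:
  fixes m :: "'a \<Rightarrow> 'a \<Rightarrow> real"
  assumes B: "finite B" and sym: "\<And>b c. m b c = m c b"
  obtains u \<mu> where "\<And>i x. i < card B \<Longrightarrow> x \<notin> B \<Longrightarrow> u i x = 0"
    "\<And>i j. i < card B \<Longrightarrow> j < card B \<Longrightarrow> inner_on B (u i) (u j) = of_bool (i = (j::nat))"
    "\<And>i b. i < card B \<Longrightarrow> b \<in> B \<Longrightarrow> (\<Sum>c\<in>B. m b c * u i c) = \<mu> i * u i b"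
proof -
  have "\<exists>u \<mu>. (\<forall>i<k. \<forall>x. x \<notin> B \<longrightarrow> u i x = 0) \<and>
     (\<forall>i<k. \<forall>j<k. inner_on B (u i) (u j) = of_bool (i = (j::nat))) \<and>
     (\<forall>i<k. \<forall>b\<in>B. (\<Sum>c\<in>B. m b c * u i c) = \<mu> i * u i b)" if "k \<le> card B" for k
    using that
  proof (induction k)
    case (Suc k)
    then have "\<exists>u \<mu>. (\<forall>i<k. \<forall>x. x \<notin> B \<longrightarrow> u i x = 0) \<and>
     (\<forall>i<k. \<forall>j<k. inner_on B (u i) (u j) = of_bool (i = (j::nat))) \<and>
     (\<forall>i<k. \<forall>b\<in>B. (\<Sum>c\<in>B. m b c * u i c) = \<mu> i * u i b)" by simp
    then obtain u \<mu> where u: "\<And>i x. i < k \<Longrightarrow> x \<notin> B \<Longrightarrow> u i x = 0"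
     "\<And>i j. i < k \<Longrightarrow> j < k \<Longrightarrow> inner_on B (u i) (u j) = of_bool (i = (j::nat))"
     "\<And>i b. i < k \<Longrightarrow> b \<in> B \<Longrightarrow> (\<Sum>c\<in>B. m b c * u i c) = \<mu> i * u i b" by (elim exE conjE) blast
    have "k < card B" using Suc.prems by simp
    from next_eigenvector[OF B sym this u(2,3)] obtain v \<nu>
        where v: "\<And>x. x \<notin> B \<Longrightarrow> v x = 0" "inner_on B v v = 1"
      "\<And>i. i < k \<Longrightarrow> inner_on B v (u i) = 0" "\<And>b. b \<in> B \<Longrightarrow> (\<Sum>c\<in>B. m b c * v c) = \<nu> * v b" by blast
    have v': "inner_on B (u i) v = 0" if "i < k" for i using v(3)[OF that]
        by (simp add: inner_on_def mult.commute)
    show ?case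
    proof (intro exI[of _ "u(k := v)"] exI[of _ "\<mu>(k := \<nu>)"] conjI allI impI ballI)
      show "(u(k := v)) i x = 0" if "i < Suc k" "x \<notin> B" for i x using that u(1) v(1)
          by (auto simp: less_Suc_eq)
      show "inner_on B ((u(k := v)) i) ((u(k := v)) j) = of_bool (i = j)" if "i < Suc k" "j < Suc k"
          for i j
        using that u(2) v(2,3) v' by (auto simp: less_Suc_eq)
      show "(\<Sum>c\<in>B. m b c * (u(k := v)) i c) = (\<mu>(k := \<nu>)) i * (u(k := v)) i b"
          if "i < Suc k" "b \<in> B" for i b
        using that u(3) v(4) by (auto simp: less_Suc_eq)
    qed
  qed simp
  from this[OF order_refl] obtain u \<mu> where "\<forall>i<card B. \<forall>x. x \<notin> B \<longrightarrow> u i x = 0"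
     "\<forall>i<card B. \<forall>j<card B. inner_on B (u i) (u j) = of_bool (i = (j::nat))"
     "\<forall>i<card B. \<forall>b\<in>B. (\<Sum>c\<in>B. m b c * u i c) = \<mu> i * u i b" by (elim exE conjE)
  then show thesis by (intro that[of u \<mu>]) blast+
qed

section \<open>The sorted list of Steklov eigenvalues and its second entry\<close>

lemma sorted_count_list_unique:
  assumes "sorted xs" "sorted ys" "\<And>x. count_list xs x = count_list ys (x::real)"
  shows "xs = ys"
proof -
  have "mset xs = mset ys" by (rule multiset_eqI) (simp add: count_mset assms(3))
  then show ?thesis using assms(1,2) by (metis properties_for_sort)
qed

lemma count_list_map_upt: "count_list (map \<mu> [0..<n]) x = card {i. i < n \<and> \<mu> i = x}"
proof -
  have "count_list (map \<mu> [0..<n]) x = length (filter (\<lambda>i. \<mu> i = x) [0..<n])"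
    by (induction n) (auto simp: count_list_append)
  also have "\<dots> = card {i. i < n \<and> \<mu> i = x}" by (subst length_filter_conv_card) (auto intro!:
      arg_cong[where f = card])
  finally show ?thesis .
qed

lemma card_below_second:
  fixes ls :: "real list"
  assumes "sorted ls" "length ls \<ge> 2"
  shows "length (filter (\<lambda>x. x < ls ! 1) ls) \<le> 1"
proof -
  have "{i. i < length ls \<and> ls ! i < ls ! 1} \<subseteq> {0}"
  proof
    fix i assume i: "i \<in> {i. i < length ls \<and> ls ! i < ls ! 1}"
    have "i = 0"
    proof (rule ccontr)
      assume "i \<noteq> 0"
      then have "ls ! 1 \<le> ls ! i" using i assms by (intro sorted_nth_mono) auto
      then show False using i by simp
    qed
    then show "i \<in> {0}" by simp
  qed
  then have "card {i. i < length ls \<and> ls ! i < ls ! 1} \<le> card {0::nat}" by (intro card_mono) auto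
  then show ?thesis by (simp add: length_filter_conv_card)
qed

text \<open>Extending boundary data harmonically turns the problem into the eigenvalue problem of
  the symmetric matrix \<open>m\<close>, the Dirichlet-to-Neumann map. The energy inequality is
  Dirichlet's principle: the harmonic extension has the least energy for its boundary
  values.\<close>

lemma steklov_eigenbasis:
  fixes V :: "'a set"
  assumes G: "simple_graph V E" and B: "B \<subseteq> V"
  obtains u \<mu> where
    "\<And>i j. i < card B \<Longrightarrow> j < card B \<Longrightarrow> inner_on B (u i) (u j) = of_bool (i = (j::nat))"
    "\<And>f. (\<Sum>i<card B. \<mu> i * (inner_on B f (u i))\<^sup>2) \<le> energy V E f f"
    "steklov_spectrum V E B = sort (map \<mu> [0..<card B])"
proof -
  have finV: "finite V" using G by (simp add: simple_graph_def)
  then have finB: "finite B" using B finite_subset by blast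
  let ?n = "card B"
  have "\<exists>h. (\<forall>x. x \<notin> V - B \<longrightarrow> h x = of_bool (x = b)) \<and> (\<forall>s\<in>V - B. laplacian E h s = 0)" for b
    by (rule harmonic_extension[OF G]) (use finV in auto)
  then obtain h where h: "\<And>b x. x \<notin> V - B \<Longrightarrow> h b x = of_bool (x = b)"
      "\<And>b s. s \<in> V - B \<Longrightarrow> laplacian E (h b) s = 0"
    by metis
  define ext where "ext f x = (\<Sum>b\<in>B. f b * h b x)" for f x
  define m where "m b c = energy V E (h b) (h c)" for b c
  have sumB: "(\<Sum>x\<in>V. F x) = (\<Sum>x\<in>B. F x)" if "\<And>x. x \<in> V - B \<Longrightarrow> F x = 0" for F :: "'a \<Rightarrow> real"
    using sum.mono_neutral_right[OF finV B, of F] that by blast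
  have m_lap: "m b c = laplacian E (h b) c" if "c \<in> B" for b c
  proof -
    have "m b c = (\<Sum>x\<in>B. h c x * laplacian E (h b) x)"
      unfolding m_def energy_laplacian[OF G] by (rule sumB) (simp add: h(2))
    also have "\<dots> = (\<Sum>x\<in>B. if x = c then laplacian E (h b) c else 0)"
      by (rule sum.cong) (auto simp: h(1))
    finally show ?thesis using finB that by simp
  qed
  have msym: "m b c = m c b" for b c by (simp add: m_def energy_commute)
  have extB: "ext f x = f x" if "x \<in> B" for f x
  proof -
    have "ext f x = (\<Sum>b\<in>B. if b = x then f x else 0)" unfolding ext_def
        by (rule sum.cong) (use that h(1) in auto)
    then show ?thesis using finB that by simp
  qed
  have lap_ext: "laplacian E (ext f) x = (\<Sum>b\<in>B. f b * laplacian E (h b) x)" for f x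
    unfolding ext_def by (rule laplacian_sum)
  have ext_harm: "laplacian E (ext f) x = 0" if "x \<in> V - B" for f x unfolding lap_ext
      by (simp add: h(2)[OF that])
  have lap_extB: "laplacian E (ext f) b = (\<Sum>c\<in>B. m b c * f c)" if "b \<in> B" for f b
    unfolding lap_ext by (intro sum.cong refl) (simp add: m_lap[OF that, symmetric] msym[of _ b]
        mult.commute)
  obtain u \<mu> where u0: "\<And>i x. i < ?n \<Longrightarrow> x \<notin> B \<Longrightarrow> u i x = 0"
    and on: "\<And>i j. i < ?n \<Longrightarrow> j < ?n \<Longrightarrow> inner_on B (u i) (u j) = of_bool (i = (j::nat))"
    and eig: "\<And>i b. i < ?n \<Longrightarrow> b \<in> B \<Longrightarrow> (\<Sum>c\<in>B. m b c * u i c) = \<mu> i * u i b"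
    by (rule symmetric_eigenbasis[of B m, OF finB msym]) blast
  have complete: "f x = (\<Sum>i<?n. inner_on B f (u i) * u i x)" if "x \<in> B" for f x
    by (rule orthonormal_complete[OF finB on that])
  have m_apply: "(\<Sum>c\<in>B. m b c * f c) = (\<Sum>i<?n. inner_on B f (u i) * (\<mu> i * u i b))" if b: "b \<in> B"
      for f b
  proof -
    have "(\<Sum>c\<in>B. m b c * f c) = (\<Sum>c\<in>B. m b c * (\<Sum>i<?n. inner_on B f (u i) * u i c))"
      by (intro sum.cong refl arg_cong2[where f = "(*)"] complete)
    also have "\<dots> = (\<Sum>i<?n. inner_on B f (u i) * (\<Sum>c\<in>B. m b c * u i c))"
      unfolding sum_distrib_left by (subst sum.swap) (simp add: mult_ac)
    also have "\<dots> = (\<Sum>i<?n. inner_on B f (u i) * (\<mu> i * u i b))"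
        by (rule sum.cong) (use eig b in auto)
    finally show ?thesis .
  qed
  have en: "(\<Sum>i<?n. \<mu> i * (inner_on B f (u i))\<^sup>2) \<le> energy V E f f" for f
  proof -
    let ?F = "ext f" and ?d = "\<lambda>x. f x - ext f x"
    \<comment> \<open>\<open>?d\<close> vanishes on \<open>B\<close>, and the Laplacian of
      \<open>?F\<close> vanishes on the rest of \<open>V\<close>.\<close>
    have z: "energy V E ?F ?d = 0" unfolding energy_laplacian[OF G]
      by (rule sum.neutral) (use extB ext_harm in force)
    have "energy V E f f = energy V E ?F ?F + 2 * energy V E ?F ?d + energy V E ?d ?d"
      unfolding energy_def by (simp add: sum.distrib[symmetric] sum_distrib_left
          add_divide_distrib[symmetric] algebra_simps)
    then have "energy V E ?F ?F \<le> energy V E f f" using z energy_nonneg[of V E ?d] by simp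
    moreover have "energy V E ?F ?F = (\<Sum>b\<in>B. f b * (\<Sum>c\<in>B. m b c * f c))"
    proof -
      have "energy V E ?F ?F = (\<Sum>x\<in>B. ?F x * laplacian E ?F x)"
        unfolding energy_laplacian[OF G] by (rule sumB) (simp add: ext_harm)
      also have "\<dots> = (\<Sum>b\<in>B. f b * (\<Sum>c\<in>B. m b c * f c))"
          by (rule sum.cong) (simp_all add: extB lap_extB)
      finally show ?thesis .
    qed
    moreover have "(\<Sum>b\<in>B. f b * (\<Sum>c\<in>B. m b c * f c)) = (\<Sum>i<?n. \<mu> i * (inner_on B f (u i))\<^sup>2)"
    proof -
      have "(\<Sum>b\<in>B. f b * (\<Sum>c\<in>B. m b c * f c)) = (\<Sum>b\<in>B. f b * (\<Sum>i<?n. inner_on B f (u i) * (\<mu> i * u i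
          b)))"
        by (rule sum.cong) (simp_all add: m_apply)
      also have "\<dots> = (\<Sum>i<?n. \<Sum>b\<in>B. \<mu> i * inner_on B f (u i) * (f b * u i b))"
        unfolding sum_distrib_left by (subst sum.swap) (simp add: mult_ac)
      also have "\<dots> = (\<Sum>i<?n. \<mu> i * inner_on B f (u i) * inner_on B f (u i))"
        by (simp add: inner_on_def sum_distrib_left)
      finally show ?thesis by (simp add: power2_eq_square mult.assoc)
    qed
    ultimately show ?thesis by simp
  qed
  have mult: "steklov_multiplicity V E B \<nu> = card {i. i < ?n \<and> \<mu> i = \<nu>}" for \<nu>
  proof -
    let ?I = "{i. i < ?n \<and> \<mu> i = \<nu>}"
    let ?X = "{(\<lambda>x. if x \<in> B then f x else 0) | f. steklov_solution V E B \<nu> f}"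
    have inj: "inj_on u ?I"
    proof (rule inj_onI)
      fix i j assume ij: "i \<in> ?I" "j \<in> ?I" "u i = u j"
      then have "inner_on B (u i) (u j) = 1" using on[of i i] by simp
      then show "i = j" using on[of i j] ij by (cases "i = j") auto
    qed
    have uX: "u i \<in> ?X" if i: "i \<in> ?I" for i
    proof -
      have "steklov_solution V E B \<nu> (ext (u i))"
        unfolding steklov_solution_def using i eig ext_harm lap_extB extB by auto
      moreover have "u i = (\<lambda>x. if x \<in> B then ext (u i) x else 0)" using u0 i extB by auto
      ultimately show ?thesis by blast
    qed
    have ind: "independent (u ` ?I)"
    proof (rule ccontr)
      assume "\<not> ?thesis"
      then have "\<exists>c. (\<exists>v\<in>u ` ?I. c v \<noteq> 0) \<and> (\<Sum>v\<in>u ` ?I. c v *\<^sub>R v) = 0"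
        by (subst (asm) real_vector.dependent_finite) auto
      then obtain c i where c: "i \<in> ?I" "c (u i) \<noteq> 0" "(\<Sum>v\<in>u ` ?I. c v *\<^sub>R v) = 0" by auto
      have ap: "(\<Sum>j\<in>J. c (u j) *\<^sub>R u j) x = (\<Sum>j\<in>J. c (u j) * u j x)" if "finite J" for x J
        using that by (induction J rule: finite_induct) (auto simp: scaleR_fun_def)
      have z: "(\<Sum>j\<in>?I. c (u j) * u j x) = 0" for x
      proof -
        have "(\<Sum>j\<in>?I. c (u j) *\<^sub>R u j) = 0" using c(3) by (simp add: sum.reindex[OF inj])
        then show ?thesis using ap[of ?I x] by simp
      qed
      have "0 = (\<Sum>x\<in>B. u i x * (\<Sum>j\<in>?I. c (u j) * u j x))" by (simp add: z)
      also have "\<dots> = (\<Sum>j\<in>?I. c (u j) * inner_on B (u i) (u j))"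
        unfolding inner_on_def sum_distrib_left by (subst sum.swap) (simp add: mult_ac)
      also have "\<dots> = (\<Sum>j\<in>?I. if j = i then c (u i) else 0)" by (rule sum.cong) (use on c(1) in auto)
      also have "\<dots> = c (u i)" using c(1) by simp
      finally show False using c(2) by simp
    qed
    have span: "?X \<subseteq> span (u ` ?I)"
    proof
      fix w assume "w \<in> ?X"
      then obtain f where f: "steklov_solution V E B \<nu> f" "w = (\<lambda>x. if x \<in> B then f x else 0)"
          by blast
      \<comment> \<open>Evaluating the mixed energy through either argument gives
        \<open>\<nu>\<close> times and \<open>\<mu> i\<close> times the same inner product.\<close>
      have coef: "inner_on B f (u i) = 0" if i: "i < ?n" "\<mu> i \<noteq> \<nu>" for i
      proof -
        have "energy V E f (ext (u i)) = \<nu> * inner_on B f (u i)"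
        proof -
          have "energy V E f (ext (u i)) = (\<Sum>x\<in>B. ext (u i) x * laplacian E f x)"
            unfolding energy_laplacian[OF G] by (rule sumB) (use f(1) in \<open>simp
                add: steklov_solution_def\<close>)
          also have "\<dots> = (\<Sum>x\<in>B. \<nu> * (f x * u i x))"
            by (rule sum.cong) (use f(1) extB in \<open>auto simp: steklov_solution_def\<close>)
          finally show ?thesis by (simp add: inner_on_def sum_distrib_left)
        qed
        moreover have "energy V E f (ext (u i)) = \<mu> i * inner_on B f (u i)"
        proof -
          have "energy V E (ext (u i)) f = (\<Sum>x\<in>B. f x * laplacian E (ext (u i)) x)"
            unfolding energy_laplacian[OF G] by (rule sumB) (simp add: ext_harm)
          also have "\<dots> = (\<Sum>x\<in>B. \<mu> i * (f x * u i x))"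
            by (rule sum.cong) (use lap_extB eig i in auto)
          finally show ?thesis by (simp add: inner_on_def sum_distrib_left energy_commute)
        qed
        ultimately show ?thesis using i by simp
      qed
      have "w = (\<Sum>i\<in>?I. inner_on B f (u i) *\<^sub>R u i)"
      proof
        fix x
        have ap: "(\<Sum>j\<in>J. inner_on B f (u j) *\<^sub>R u j) x = (\<Sum>j\<in>J. inner_on B f (u j) * u j x)"
            if "finite J" for J
          using that by (induction J rule: finite_induct) (auto simp: scaleR_fun_def)
        show "w x = (\<Sum>i\<in>?I. inner_on B f (u i) *\<^sub>R u i) x"
        proof (cases "x \<in> B")
          case True
          have "w x = (\<Sum>i<?n. inner_on B f (u i) * u i x)" using complete[OF True] f(2) True by simp
          also have "\<dots> = (\<Sum>i\<in>?I. inner_on B f (u i) * u i x)"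
            by (rule sum.mono_neutral_right) (use coef in auto)
          finally show ?thesis using ap[of ?I] by simp
        next
          case False
          then show ?thesis using f(2) ap[of ?I] u0 by (simp add: sum.neutral)
        qed
      qed
      moreover have "(\<Sum>i\<in>?I. inner_on B f (u i) *\<^sub>R u i) \<in> span (u ` ?I)"
        by (intro span_sum span_scale span_base) auto
      ultimately show "w \<in> span (u ` ?I)" by simp
    qed
    have "u ` ?I \<subseteq> ?X" using uX by blast
    then have "dim ?X = card (u ` ?I)" using span ind by (intro real_vector.dim_unique) auto
    then show ?thesis unfolding steklov_multiplicity_def using card_image[OF inj] by simp
  qed
  have "steklov_spectrum V E B = sort (map \<mu> [0..<?n])"
    unfolding steklov_spectrum_def
  proof (rule the_equality)
    have c: "count_list (sort (map \<mu> [0..<?n])) x = steklov_multiplicity V E B x" for x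
    proof -
      have "count_list (sort (map \<mu> [0..<?n])) x = count_list (map \<mu> [0..<?n]) x"
        by (metis count_mset mset_sort)
      then show ?thesis by (simp add: count_list_map_upt mult)
    qed
    then show "sorted (sort (map \<mu> [0..<?n])) \<and> (\<forall>x. count_list (sort (map \<mu> [0..<?n])) x =
        steklov_multiplicity V E B x)"
      by simp
    fix ls assume "sorted ls \<and> (\<forall>x. count_list ls x = steklov_multiplicity V E B x)"
    then show "ls = sort (map \<mu> [0..<?n])" using c by (intro sorted_count_list_unique) auto
  qed
  with on en show thesis by (rule that)
qed

text \<open>At most one vector of the eigenbasis has an eigenvalue below the second one. A
  two-dimensional test space contains a nonzero function orthogonal to it on \<open>B\<close>, and
  the Rayleigh quotient of that function is at least the second eigenvalue.\<close>

lemma steklov_second_le: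
  fixes V :: "'a set"
  assumes G: "simple_graph V E" and B: "B \<subseteq> V" "card B \<ge> 2"
    and test: "\<And>c d. c \<noteq> 0 \<or> d \<noteq> 0 \<Longrightarrow> inner_on B (\<lambda>x. c * f1 x + d * f2 x) (\<lambda>x. c * f1 x +
        d * f2 x) > 0 \<and>
       energy V E (\<lambda>x. c * f1 x + d * f2 x) (\<lambda>x. c * f1 x + d * f2 x) \<le>
       r * inner_on B (\<lambda>x. c * f1 x + d * f2 x) (\<lambda>x. c * f1 x + d * f2 x)"
  shows "steklov_eigenvalue V E B 2 \<le> r"
proof (rule ccontr)
  have finB: "finite B" using B by (metis card.infinite not_numeral_le_zero)
  obtain u \<mu> where on: "\<And>i j. i < card B \<Longrightarrow> j < card B \<Longrightarrow> inner_on B (u i) (u j) = of_bool (i =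
      (j::nat))"
    and en: "\<And>f. (\<Sum>i<card B. \<mu> i * (inner_on B f (u i))\<^sup>2) \<le> energy V E f f"
    and sp: "steklov_spectrum V E B = sort (map \<mu> [0..<card B])"
    by (rule steklov_eigenbasis[OF G B(1)]) blast
  define l where "l = steklov_eigenvalue V E B 2"
  assume "\<not> steklov_eigenvalue V E B 2 \<le> r"
  then have lr: "l > r" by (simp add: l_def)
  let ?ls = "sort (map \<mu> [0..<card B])"
  have l: "l = ?ls ! 1" by (simp add: l_def steklov_eigenvalue_def sp)
  have "length (filter (\<lambda>x. x < l) ?ls) \<le> 1" unfolding l by (rule card_below_second) (use B in auto)
  moreover have "length (filter (\<lambda>x. x < l) ?ls) = length (filter (\<lambda>x. x < l) (map \<mu> [0..<card B]))"
    by (metis mset_filter mset_sort size_mset)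
  moreover have "length (filter (\<lambda>x. x < l) (map \<mu> [0..<card B])) = card {i. i < card B \<and> \<mu> i < l}"
    by (subst length_filter_conv_card) (auto intro!: arg_cong[where f = card])
  ultimately have c1: "card {i. i < card B \<and> \<mu> i < l} \<le> 1" by simp
  obtain i0 where i0: "i0 < card B" "\<And>i. i < card B \<Longrightarrow> i \<noteq> i0 \<Longrightarrow> \<mu> i \<ge> l"
  proof (cases "{i. i < card B \<and> \<mu> i < l} = {}")
    case True
    then show thesis using that[of 0] B by fastforce
  next
    case False
    then obtain i where i: "i < card B" "\<mu> i < l" by blast
    moreover have "\<mu> j \<ge> l" if j: "j < card B" "j \<noteq> i" for j
    proof (rule ccontr)
      assume "\<not> \<mu> j \<ge> l"
      then have "{i, j} \<subseteq> {i. i < card B \<and> \<mu> i < l}" using i j by auto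
      then have "card {i, j} \<le> 1" using c1 card_mono[of "{i. i < card B \<and> \<mu> i < l}" "{i, j}"]
          by simp
      then show False using j by simp
    qed
    ultimately show thesis using that by blast
  qed
  obtain c d where cd: "c \<noteq> 0 \<or> d \<noteq> 0" "c * inner_on B f1 (u i0) + d * inner_on B f2 (u i0) = 0"
  proof (cases "inner_on B f1 (u i0) = 0")
    case True then show thesis using that[of 1 0] by simp
  next
    case False
    then show thesis using that[of "inner_on B f2 (u i0)" "- inner_on B f1 (u i0)"]
        by (simp add: mult.commute)
  qed
  let ?h = "\<lambda>x. c * f1 x + d * f2 x"
  have "inner_on B ?h (u i0) = c * inner_on B f1 (u i0) + d * inner_on B f2 (u i0)"
    by (simp add: inner_on_def sum.distrib sum_distrib_left algebra_simps)
  then have z: "inner_on B ?h (u i0) = 0" using cd by simp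
  have "l * inner_on B ?h ?h = (\<Sum>i<card B. l * (inner_on B ?h (u i))\<^sup>2)"
  proof -
    have "inner_on B ?h ?h = (\<Sum>x\<in>B. ?h x * (\<Sum>i<card B. inner_on B ?h (u i) * u i x))"
      unfolding inner_on_def[of B ?h ?h]
      by (intro sum.cong refl arg_cong2[where f = "(*)"] orthonormal_complete[OF finB on])
    also have "\<dots> = (\<Sum>i<card B. \<Sum>x\<in>B. inner_on B ?h (u i) * (?h x * u i x))"
      unfolding sum_distrib_left by (subst sum.swap) (simp add: mult_ac)
    also have "\<dots> = (\<Sum>i<card B. (inner_on B ?h (u i))\<^sup>2)"
      by (intro sum.cong refl) (simp add: sum_distrib_left[symmetric] inner_on_def[symmetric]
        power2_eq_square)
    finally show ?thesis by (simp add: sum_distrib_left)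
  qed
  also have "\<dots> \<le> (\<Sum>i<card B. \<mu> i * (inner_on B ?h (u i))\<^sup>2)"
  proof (rule sum_mono)
    fix i assume "i \<in> {..<card B}"
    then show "l * (inner_on B ?h (u i))\<^sup>2 \<le> \<mu> i * (inner_on B ?h (u i))\<^sup>2"
      using i0(2)[of i] z by (cases "i = i0") (auto intro: mult_right_mono)
  qed
  also have "\<dots> \<le> energy V E ?h ?h" by (rule en)
  also have "\<dots> \<le> r * inner_on B ?h ?h" using test[OF cd(1)] by blast
  finally have "l * inner_on B ?h ?h \<le> r * inner_on B ?h ?h" .
  moreover have "inner_on B ?h ?h > 0" using test[OF cd(1)] by blast
  ultimately show False using lr by simp
qed

section \<open>Fans of paths and spreading weights\<close>

definition avg :: "'s set \<Rightarrow> ('s \<Rightarrow> real) \<Rightarrow> real" where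
  "avg A f = (\<Sum>a\<in>A. f a) / real (card A)"

lemma avg_diff: "avg A (\<lambda>a. f a - h a) = avg A f - avg A h"
  by (simp add: avg_def sum_subtractf diff_divide_distrib)

lemma avg_sum: "avg A (\<lambda>a. \<Sum>i\<in>I. f i a) = (\<Sum>i\<in>I. avg A (f i))"
  unfolding avg_def by (subst sum.swap) (simp add: sum_divide_distrib)

lemma avg_cmult: "avg A (\<lambda>a. c * f a) = c * avg A f" "avg A (\<lambda>a. f a * c) = avg A f * c"
  by (simp_all add: avg_def sum_distrib_left sum_distrib_right)

lemma avg_nonneg: "(\<And>a. a \<in> A \<Longrightarrow> f a \<ge> 0) \<Longrightarrow> avg A f \<ge> 0"
  unfolding avg_def by (intro divide_nonneg_nonneg sum_nonneg) auto

lemma avg_const: "finite A \<Longrightarrow> A \<noteq> {} \<Longrightarrow> avg A (\<lambda>_. c) = c"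
  by (simp add: avg_def)

lemma avg_cong: "(\<And>a. a \<in> A \<Longrightarrow> f a = h a) \<Longrightarrow> avg A f = avg A h"
  unfolding avg_def by (metis (no_types, lifting) sum.cong)

lemma avg_swap: "avg A (\<lambda>a. avg B (\<lambda>b. f a b)) = avg B (\<lambda>b. avg A (\<lambda>a. f a b))"
  unfolding avg_def by (simp add: sum_divide_distrib[symmetric] sum.swap[of _ A B] mult.commute)

lemma exists_ge_avg:
  assumes "finite A" "A \<noteq> {}"
  shows "\<exists>a\<in>A. avg A f \<le> f a"
proof (rule ccontr)
  assume "\<not> ?thesis"
  then have "(\<Sum>a\<in>A. f a) < (\<Sum>a\<in>A. avg A f)" using assms by (intro sum_strict_mono) auto
  then show False using assms by (simp add: avg_def)
qed

text \<open>Fubini for a finite power of \<open>S\<close>: the coordinates of a uniformly chosen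
  function are independent.\<close>

lemma avg_PiE_insert:
  assumes "finite I" "finite S" "i \<notin> I"
  shows "avg (PiE (insert i I) (\<lambda>_. S)) F = avg S (\<lambda>a. avg (PiE I (\<lambda>_. S)) (\<lambda>s. F (s(i := a))))"
proof -
  have inj: "inj_on (\<lambda>(y, g). g(i := y)) (S \<times> PiE I (\<lambda>_. S))"
    using inj_combinator[OF assms(3), of "\<lambda>_. S"] by simp
  have eq: "PiE (insert i I) (\<lambda>_. S) = (\<lambda>(y, g). g(i := y)) ` (S \<times> PiE I (\<lambda>_. S))"
    by (rule PiE_insert_eq)
  have "(\<Sum>s\<in>PiE (insert i I) (\<lambda>_. S). F s) = (\<Sum>(a, s)\<in>S \<times> PiE I (\<lambda>_. S). F (s(i := a)))"
    unfolding eq by (subst sum.reindex[OF inj]) (simp add: case_prod_unfold)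
  also have "\<dots> = (\<Sum>a\<in>S. \<Sum>s\<in>PiE I (\<lambda>_. S). F (s(i := a)))"
    by (simp add: sum.cartesian_product)
  finally have 1: "(\<Sum>s\<in>PiE (insert i I) (\<lambda>_. S). F s) = (\<Sum>a\<in>S. \<Sum>s\<in>PiE I (\<lambda>_. S). F (s(i := a)))" .
  have 2: "card (PiE (insert i I) (\<lambda>_. S)) = card S * card (PiE I (\<lambda>_. S))"
    unfolding eq by (subst card_image[OF inj]) (rule card_cartesian_product)
  show ?thesis unfolding avg_def 1 2 by (simp add: sum_divide_distrib[symmetric] mult.commute)
qed

lemma avg_coord:
  assumes "finite I" "finite S" "S \<noteq> {}" "i \<in> I"
  shows "avg (PiE I (\<lambda>_. S)) (\<lambda>s. f (s i)) = avg S f"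
proof -
  have I: "I = insert i (I - {i})" using assms by blast
  have "avg (PiE (insert i (I - {i})) (\<lambda>_. S)) (\<lambda>s. f (s i)) =
      avg S (\<lambda>a. avg (PiE (I - {i}) (\<lambda>_. S)) (\<lambda>s. f a))"
    by (subst avg_PiE_insert) (use assms in auto)
  also have "\<dots> = avg S f" by (subst avg_const) (use assms in \<open>auto simp: finite_PiE
      PiE_eq_empty_iff\<close>)
  finally show ?thesis using I by simp
qed

lemma avg_coord2:
  assumes "finite I" "finite S" "S \<noteq> {}" "i \<in> I" "j \<in> I" "i \<noteq> j"
  shows "avg (PiE I (\<lambda>_. S)) (\<lambda>s. f (s i) (s j)) = avg S (\<lambda>a. avg S (\<lambda>b. f a b))"
proof -
  have I: "I = insert i (I - {i})" using assms by blast
  have "avg (PiE (insert i (I - {i})) (\<lambda>_. S)) (\<lambda>s. f (s i) (s j)) =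
     avg S (\<lambda>a. avg (PiE (I - {i}) (\<lambda>_. S)) (\<lambda>s. f a (s j)))"
    by (subst avg_PiE_insert) (use assms in auto)
  also have "\<dots> = avg S (\<lambda>a. avg S (\<lambda>b. f a b))"
    by (rule avg_cong, rule avg_coord) (use assms in auto)
  finally show ?thesis using I by simp
qed

text \<open>A fan models the paths \<open>snd \<phi> y\<close> from \<open>x\<close> to the points \<open>y \<in> fst \<phi>\<close> in a tree rooted at \<open>x\<close>, reduced
  to the connectedness properties that turn crossing-free fans into a minor.\<close>

definition fan :: "('v \<Rightarrow> 'v \<Rightarrow> bool) \<Rightarrow> 'v set \<Rightarrow> 'v set \<Rightarrow> 'v \<Rightarrow> 'v set \<times> ('v \<Rightarrow> 'v set) \<Rightarrow> bool" where
  "fan adj V B x \<phi> \<longleftrightarrow> fst \<phi> \<subseteq> B - {x} \<and> (\<forall>y. y \<notin> fst \<phi> \<longrightarrow> snd \<phi> y = {}) \<and>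
     (\<forall>y\<in>fst \<phi>. snd \<phi> y \<subseteq> V \<and> x \<in> snd \<phi> y \<and> y \<in> snd \<phi> y) \<and>
     (\<forall>y\<in>fst \<phi>. \<forall>y'\<in>fst \<phi>. conn adj (snd \<phi> y \<inter> snd \<phi> y')) \<and>
     (\<forall>y\<in>fst \<phi>. \<forall>Z\<subseteq>fst \<phi>. y \<notin> (\<Union>z\<in>Z. snd \<phi> z) \<longrightarrow> conn adj (snd \<phi> y - ({x} \<union> (\<Union>z\<in>Z. snd \<phi> z))))"

lemma finite_fans:
  assumes "finite V" "finite B"
  shows "finite {\<phi>. fan adj V B x \<phi>}"
proof (rule finite_subset)
  show "{\<phi>. fan adj V B x \<phi>} \<subseteq> Pow B \<times> {f. \<forall>y. (y \<in> B \<longrightarrow> f y \<in> Pow V) \<and> (y \<notin> B \<longrightarrow> f y = {})}"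
  proof
    fix \<phi> assume "\<phi> \<in> {\<phi>. fan adj V B x \<phi>}"
    then have f: "fst \<phi> \<subseteq> B" "\<And>y. y \<notin> fst \<phi> \<Longrightarrow> snd \<phi> y = {}" "\<And>y. y \<in> fst \<phi> \<Longrightarrow> snd \<phi> y \<subseteq> V"
      by (auto simp: fan_def)
    then have "snd \<phi> y \<subseteq> V" for y by (cases "y \<in> fst \<phi>") auto
    moreover have "snd \<phi> y = {}" if "y \<notin> B" for y using f(1,2) that by blast
    ultimately show "\<phi> \<in> Pow B \<times> {f. \<forall>y. (y \<in> B \<longrightarrow> f y \<in> Pow V) \<and> (y \<notin> B \<longrightarrow> f y = {})}"
      unfolding mem_Times_iff using f(1) by simp
  qed
  show "finite (Pow B \<times> {f. \<forall>y. (y \<in> B \<longrightarrow> f y \<in> Pow V) \<and> (y \<notin> B \<longrightarrow> f y = {})})"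
    using assms by (intro finite_cartesian_product finite_set_of_finite_funs) auto
qed

lemma empty_fan: "fan adj V B x ({}, \<lambda>_. {})"
  by (simp add: fan_def)

text \<open>\<open>Ot y\<close> is the path from \<open>y\<close> to \<open>x\<close> in a tree of
  lightest paths, and any set of sinks may be served by it. With each of its vertices the
  intersection of two such paths contains the path onwards to the root, hence is connected; what
  other paths leave of \<open>Ot y\<close> is an initial stretch starting at
  \<open>y\<close>.\<close>

lemma shortest_path_fan:
  assumes V: "finite V" "symp adj" "conn adj V" "x \<in> V" "\<And>v. v \<in> V \<Longrightarrow> \<nu> v \<ge> (1::nat)" and B: "B \<subseteq> V"
  obtains Ot :: "'v \<Rightarrow> 'v set" where
    "\<And>Y. Y \<subseteq> B - {x} \<Longrightarrow> fan adj V B x (Y, \<lambda>y. if y \<in> Y then Ot y else {})"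
    "\<And>y. y \<in> V \<Longrightarrow> Ot y \<subseteq> V"
    "\<And>y U. y \<in> V \<Longrightarrow> U \<subseteq> V \<Longrightarrow> conn adj U \<Longrightarrow> x \<in> U \<Longrightarrow> y \<in> U \<Longrightarrow> sum \<nu> (Ot y) \<le> sum \<nu> U"
proof -
  obtain \<rho> where \<rho>: "\<rho> x = 0" "\<And>a b. a \<in> V \<Longrightarrow> b \<in> V \<Longrightarrow> adj a b \<Longrightarrow> \<rho> b \<le> \<rho> a + \<nu> b"
    "\<And>y. y \<in> V \<Longrightarrow> y \<noteq> x \<Longrightarrow> \<exists>z\<in>V. adj z y \<and> \<rho> y = \<rho> z + \<nu> y"
    by (rule conn_dist[OF V(3,4), of \<nu>]) blast
  have "\<exists>par. \<forall>y. y \<in> V \<longrightarrow> (if y = x then par y = x else par y \<in> V \<and> adj (par y) y \<and> \<rho> y =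
      \<rho> (par y) + \<nu> y)"
    by (rule choice) (use \<rho>(3) in auto)
  then obtain par where par: "par x = x" "\<And>y. y \<in> V \<Longrightarrow> y \<noteq> x \<Longrightarrow> par y \<in> V \<and> adj (par y) y \<and> \<rho> y =
      \<rho> (par y) + \<nu> y"
    using V(4) by metis
  have parV: "par y \<in> V" if "y \<in> V" for y using par that V(4) by (cases "y = x") auto
  have iterV: "(par ^^ i) y \<in> V" if "y \<in> V" for i y using that parV by (induction i) auto
  have iterx: "(par ^^ i) x = x" for i using par(1) by (induction i) auto
  define Ot where "Ot y = range (\<lambda>i. (par ^^ i) y)" for y
  have self: "y \<in> Ot y" for y unfolding Ot_def by (rule range_eqI[of _ _ 0]) simp
  have anc: "Ot v \<subseteq> Ot y" if v: "v \<in> Ot y" for v y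
  proof
    fix w assume "w \<in> Ot v"
    then obtain i where "w = (par ^^ i) v" by (auto simp: Ot_def)
    moreover obtain j where "v = (par ^^ j) y" using v by (auto simp: Ot_def)
    ultimately have "w = (par ^^ (i + j)) y" by (simp add: funpow_add)
    then show "w \<in> Ot y" by (auto simp: Ot_def)
  qed
  have OtV: "Ot y \<subseteq> V" if "y \<in> V" for y using iterV[OF that] by (auto simp: Ot_def)
  have Ot_step: "Ot y = insert y (Ot (par y))" for y
  proof (intro equalityI subsetI)
    fix w assume "w \<in> Ot y"
    then obtain i where i: "w = (par ^^ i) y" by (auto simp: Ot_def)
    show "w \<in> insert y (Ot (par y))"
    proof (cases i)
      case (Suc k)
      then have "w = (par ^^ k) (par y)" using i by (simp add: funpow_swap1)
      then show ?thesis by (auto simp: Ot_def)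
    qed (use i in simp)
  next
    fix w assume w: "w \<in> insert y (Ot (par y))"
    have "par y \<in> Ot y" unfolding Ot_def by (rule range_eqI[of _ _ 1]) simp
    then show "w \<in> Ot y" using w self anc by blast
  qed
  have main: "x \<in> Ot y \<and> sum \<nu> (Ot y) = \<rho> y + \<nu> x \<and> (\<forall>v\<in>Ot y. \<rho> v \<le> \<rho> y)" if "y \<in> V" for y
    using that
  proof (induction "\<rho> y" arbitrary: y rule: less_induct)
    case less
    show ?case
    proof (cases "y = x")
      case True
      then have "Ot y = {x}" using iterx by (auto simp: Ot_def)
      then show ?thesis using True \<rho>(1) by simp
    next
      case False
      have p: "par y \<in> V" "\<rho> y = \<rho> (par y) + \<nu> y" using par(2)[OF less.prems False] by auto
      then have lt: "\<rho> (par y) < \<rho> y" using V(5)[OF less.prems] by simp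
      have IH: "x \<in> Ot (par y)" "sum \<nu> (Ot (par y)) = \<rho> (par y) + \<nu> x"
          "\<forall>v\<in>Ot (par y). \<rho> v \<le> \<rho> (par y)"
        using less.hyps[OF lt p(1)] by auto
      have "y \<notin> Ot (par y)" using IH(3) lt by force
      moreover have "finite (Ot (par y))" using OtV[OF p(1)] V(1) finite_subset by blast
      ultimately have "sum \<nu> (Ot y) = \<nu> y + sum \<nu> (Ot (par y))" by (subst Ot_step) simp
      moreover have "\<forall>v\<in>Ot y. \<rho> v \<le> \<rho> y" using IH(3) lt by (subst Ot_step) auto
      moreover have "x \<in> Ot y" using IH(1) by (subst Ot_step) simp
      ultimately show ?thesis using IH(2) p(2) by simp
    qed
  qed
  have reach: "(\<lambda>a b. adj a b \<and> a \<in> T \<and> b \<in> T)\<^sup>*\<^sup>* v x" if "v \<in> V" "Ot v \<subseteq> T" for v T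
    using that
  proof (induction "\<rho> v" arbitrary: v rule: less_induct)
    case less
    show ?case
    proof (cases "v = x")
      case False
      have p: "par v \<in> V" "adj (par v) v" "\<rho> v = \<rho> (par v) + \<nu> v"
          using par(2)[OF less.prems(1) False] by auto
      then have lt: "\<rho> (par v) < \<rho> v" using V(5)[OF less.prems(1)] by simp
      have "Ot (par v) \<subseteq> T" using less.prems(2) by (subst (asm) Ot_step) simp
      then have "(\<lambda>a b. adj a b \<and> a \<in> T \<and> b \<in> T)\<^sup>*\<^sup>* (par v) x" using less.hyps[OF lt p(1)] by blast
      moreover have "adj v (par v) \<and> v \<in> T \<and> par v \<in> T"
        using p(2) V(2) self[of v] self[of "par v"] less.prems(2) \<open>Ot (par v) \<subseteq> T\<close>
            by (auto simp: symp_def)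
      ultimately show ?thesis by (rule converse_rtranclp_into_rtranclp[rotated])
    qed simp
  qed
  show thesis
  proof (rule that[of Ot])
    fix Y assume Y: "Y \<subseteq> B - {x}"
    then have YV: "Y \<subseteq> V" using B by blast
    have c1: "conn adj (Ot y \<inter> Ot y')" if "y \<in> Y" "y' \<in> Y" for y y'
    proof (rule conn_star[OF V(2), of _ x])
      fix v assume v: "v \<in> Ot y \<inter> Ot y'"
      let ?r = "\<lambda>a b. adj a b \<and> a \<in> Ot y \<inter> Ot y' \<and> b \<in> Ot y \<inter> Ot y'"
      have "v \<in> V" using v that YV OtV by blast
      then have "?r\<^sup>*\<^sup>* v x" by (rule reach) (use v anc in blast)
      moreover have "symp ?r\<^sup>*\<^sup>*" by (rule symp_rtranclp) (use V(2) in \<open>auto simp: symp_def\<close>)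
      ultimately show "?r\<^sup>*\<^sup>* x v" by (simp add: symp_def)
    qed
    have c2: "conn adj (Ot y - ({x} \<union> (\<Union>z\<in>Z. Ot z)))" (is "conn adj ?T")
      if y: "y \<in> Y" "y \<notin> (\<Union>z\<in>Z. Ot z)" for y Z
    proof (rule conn_star[OF V(2), of _ y])
      fix v assume v: "v \<in> ?T"
      then obtain i where i: "v = (par ^^ i) y" by (auto simp: Ot_def)
      let ?r = "\<lambda>a b. adj a b \<and> a \<in> ?T \<and> b \<in> ?T"
      have yV: "y \<in> V" using y YV by blast
      have inT: "(par ^^ j) y \<in> ?T" if "j \<le> i" for j
      proof -
        have vj: "v = (par ^^ (i - j)) ((par ^^ j) y)"
          using i that funpow_add[of "i - j" j par] by simp
        have "(par ^^ j) y \<noteq> x" using v vj iterx by auto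
        moreover have "(par ^^ j) y \<notin> Ot z" if "z \<in> Z" for z
        proof
          assume "(par ^^ j) y \<in> Ot z"
          then have "Ot ((par ^^ j) y) \<subseteq> Ot z" by (rule anc)
          moreover have "v \<in> Ot ((par ^^ j) y)" using vj by (auto simp: Ot_def)
          ultimately show False using v that by blast
        qed
        moreover have "(par ^^ j) y \<in> Ot y" by (auto simp: Ot_def)
        ultimately show ?thesis by blast
      qed
      have "?r\<^sup>*\<^sup>* y ((par ^^ j) y)" if "j \<le> i" for j
        using that
      proof (induction j)
        case (Suc j)
        have a: "(par ^^ j) y \<in> ?T" "(par ^^ Suc j) y \<in> ?T"
            using inT[of j] inT[of "Suc j"] Suc.prems by auto
        have "adj (par ((par ^^ j) y)) ((par ^^ j) y)" using par(2)[OF iterV[OF yV]] a(1) by blast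
        then have "?r ((par ^^ j) y) ((par ^^ Suc j) y)" using a V(2) by (auto simp: symp_def)
        moreover have "?r\<^sup>*\<^sup>* y ((par ^^ j) y)" using Suc by simp
        ultimately show ?case by (rule rtranclp.rtrancl_into_rtrancl[rotated])
      qed simp
      then show "?r\<^sup>*\<^sup>* y v" using i by blast
    qed
    show "fan adj V B x (Y, \<lambda>y. if y \<in> Y then Ot y else {})"
      unfolding fan_def fst_conv snd_conv
    proof (intro conjI ballI allI impI)
      fix y Z assume y: "y \<in> Y" "Z \<subseteq> Y" "y \<notin> (\<Union>z\<in>Z. if z \<in> Y then Ot z else {})"
      have eq: "(\<Union>z\<in>Z. if z \<in> Y then Ot z else {}) = (\<Union>z\<in>Z. Ot z)" using y(2) by auto
      show "conn adj ((if y \<in> Y then Ot y else {}) - ({x} \<union> (\<Union>z\<in>Z. if z \<in> Y then Ot z else {})))"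
        using c2[of y Z] y(1) y(3)[unfolded eq] unfolding eq by (simp only: if_True simp_thms)
    qed (use Y YV OtV main self c1 in auto)
  next
    fix y assume "y \<in> V" then show "Ot y \<subseteq> V" by (rule OtV)
  next
    fix y U assume U: "y \<in> V" "U \<subseteq> V" "conn adj U" "x \<in> U" "y \<in> U"
    have "\<rho> y + \<nu> x \<le> \<rho> x + sum \<nu> U"
    proof (rule conn_lipschitz_le_sum[OF U(3) _ U(4,5)])
      show "finite U" using U(2) V(1) finite_subset by blast
      show "\<nu> v \<ge> 1" if "v \<in> U" for v using V(5) U(2) that by blast
      show "\<rho> b \<le> \<rho> a + \<nu> b" if "a \<in> U" "b \<in> U" "adj a b" for a b using \<rho>(2) U(2) that by blast
    qed
    then show "sum \<nu> (Ot y) \<le> sum \<nu> U" using main[OF U(1)] \<rho>(1) by simp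
  qed
qed

section \<open>From fans to minors, and the crossing bound\<close>

text \<open>Two of the paths may meet only if they share the source or the sink. Meetings of paths
  with common source \<open>i\<close> go into \<open>A i\<close>, and what is left of the paths to
  sink \<open>j\<close> forms \<open>Y j\<close>. A point of \<open>A i\<close> other than
  \<open>z i\<close> lies on two paths from \<open>i\<close> with different sinks; a path from
  another source through it would avoid the sink of one of them, which is excluded. So all these
  sets are disjoint, and each pair in \<open>H\<close> gives an edge of the minor.\<close>

lemma fan_minor_bound:
  assumes mb: "minor_bounded adj V g" and sym: "symp adj"
    and fan: "\<And>i. i < m \<Longrightarrow> fan adj V B (z i) (\<Phi> i)" and zV: "\<And>i. i < m \<Longrightarrow> z i \<in> V"
    and H: "H \<subseteq> {..<m} \<times> {..<(m::nat)}" "\<And>i j. (i, j) \<in> H \<Longrightarrow> w j \<in> fst (\<Phi> i)"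
    and cross: "\<And>i j i' j'. (i, j) \<in> H \<Longrightarrow> (i', j') \<in> H \<Longrightarrow> i \<noteq> i' \<Longrightarrow> j \<noteq> j' \<Longrightarrow>
        snd (\<Phi> i) (w j) \<inter> snd (\<Phi> i') (w j') = {}"
    and vw: "\<And>i j l. (i, j) \<in> H \<Longrightarrow> l < m \<Longrightarrow> l \<noteq> j \<Longrightarrow> w l \<notin> snd (\<Phi> i) (w j)"
    and vz: "\<And>i j l. (i, j) \<in> H \<Longrightarrow> l < m \<Longrightarrow> l \<noteq> i \<Longrightarrow> z l \<notin> snd (\<Phi> i) (w j)"
  shows "card H \<le> 6 * m + 6 * g"
proof -
  define P where "P i j = snd (\<Phi> i) (w j)" for i j
  define A where "A i = insert (z i) (\<Union>(j, j')\<in>{(j, j'). (i, j) \<in> H \<and> (i, j') \<in> H \<and>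
      j \<noteq> j'}. P i j \<inter> P i j')" for i
  define Y where "Y j = (\<Union>i\<in>{i. (i, j) \<in> H}. P i j - A i)" for j
  have A_iff: "v \<in> A i \<longleftrightarrow> v = z i \<or> (\<exists>j j'. (i, j) \<in> H \<and> (i, j') \<in> H \<and> j \<noteq> j' \<and> v \<in> P i j \<and>
      v \<in> P i j')" for v i
    by (auto simp: A_def)
  have lt: "i < m" "j < m" if "(i, j) \<in> H" for i j using H(1) that by auto
  have fP: "P i j \<subseteq> V" "z i \<in> P i j" "w j \<in> P i j" "w j \<noteq> z i" if h: "(i, j) \<in> H" for i j
    using fan[OF lt(1)[OF h]] H(2)[OF h] unfolding fan_def P_def by blast+
  have fC: "conn adj (P i j \<inter> P i j')" if h: "(i, j) \<in> H" "(i, j') \<in> H" for i j j'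
    using fan[OF lt(1)[OF h(1)]] H(2)[OF h(1)] H(2)[OF h(2)] unfolding fan_def P_def by blast
  have wA: "w j \<notin> A i" if h: "(i, j) \<in> H" for i j
  proof
    assume "w j \<in> A i"
    then obtain a b where ab: "(i, a) \<in> H" "(i, b) \<in> H" "a \<noteq> b" "w j \<in> P i a" "w j \<in> P i b"
      using fP(4)[OF h] unfolding A_iff by blast
    have "a \<noteq> j \<or> b \<noteq> j" using ab(3) by blast
    then show False using vw[OF ab(1) lt(2)[OF h]] vw[OF ab(2) lt(2)[OF h]] ab(4,5)
        by (auto simp: P_def)
  qed
  have rest: "conn adj (P i j - A i)" if h: "(i, j) \<in> H" for i j
  proof -
    \<comment> \<open>The other sinks of source \<open>i\<close>; removing their paths and
      \<open>z i\<close> leaves exactly the part of the path outside \<open>A i\<close>, to which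
      the last property of a fan applies.\<close>
    define Z where "Z = {w j' | j'. (i, j') \<in> H \<and> j' \<noteq> j}"
    have Zsub: "Z \<subseteq> fst (\<Phi> i)" using H(2) by (auto simp: Z_def)
    have U: "(\<Union>y\<in>Z. snd (\<Phi> i) y) = (\<Union>j'\<in>{j'. (i, j') \<in> H \<and> j' \<noteq> j}. P i j')"
        by (auto simp: Z_def P_def)
    have "w j \<notin> (\<Union>y\<in>Z. snd (\<Phi> i) y)"
    proof
      assume "w j \<in> (\<Union>y\<in>Z. snd (\<Phi> i) y)"
      then obtain j' where "(i, j') \<in> H" "j' \<noteq> j" "w j \<in> P i j'" unfolding U by blast
      then show False using vw[of i j' j] lt(2)[OF h] by (auto simp: P_def)
    qed
    then have "conn adj (snd (\<Phi> i) (w j) - ({z i} \<union> (\<Union>y\<in>Z. snd (\<Phi> i) y)))"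
      using fan[OF lt(1)[OF h]] H(2)[OF h] Zsub unfolding fan_def by blast
    moreover have "P i j - A i = snd (\<Phi> i) (w j) - ({z i} \<union> (\<Union>y\<in>Z. snd (\<Phi> i) y))"
    proof (intro equalityI subsetI)
      fix v assume v: "v \<in> P i j - A i"
      have "v \<notin> P i j'" if "(i, j') \<in> H" "j' \<noteq> j" for j'
      proof
        assume "v \<in> P i j'"
        then have "v \<in> A i" unfolding A_iff using h that v by blast
        then show False using v by blast
      qed
      then show "v \<in> snd (\<Phi> i) (w j) - ({z i} \<union> (\<Union>y\<in>Z. snd (\<Phi> i) y))"
        unfolding U using v by (auto simp: A_iff P_def)
    next
      fix v assume v: "v \<in> snd (\<Phi> i) (w j) - ({z i} \<union> (\<Union>y\<in>Z. snd (\<Phi> i) y))"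
      have "v \<notin> A i"
      proof
        assume "v \<in> A i"
        then obtain a b where ab: "(i, a) \<in> H" "(i, b) \<in> H" "a \<noteq> b" "v \<in> P i a" "v \<in> P i b"
          using v unfolding A_iff by blast
        then have "\<exists>c. (i, c) \<in> H \<and> c \<noteq> j \<and> v \<in> P i c" by metis
        then show False using v unfolding U by blast
      qed
      then show "v \<in> P i j - A i" using v by (simp add: P_def)
    qed
    ultimately show ?thesis by simp
  qed
  have xing: False if "(i, j) \<in> H" "(i', j') \<in> H" "i \<noteq> i'" "j \<noteq> j'" "v \<in> P i j" "v \<in> P i' j'"
      for i j i' j' v
    using cross[OF that(1-4)] that(5,6) by (auto simp: P_def)
  have zP: False if "(i, j) \<in> H" "l < m" "l \<noteq> i" "z l \<in> P i j" for i j l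
    using vz[OF that(1-3)] that(4) by (auto simp: P_def)
  have "card H \<le> 3 * (card (fst ` H) + card (snd ` H)) + 6 * g"
  proof (rule minor_bounded_bipartite[OF mb, where A = A and Y = Y])
    have finH: "finite H" using H(1) finite_subset by blast
    then show "finite (fst ` H)" "finite (snd ` H)" by auto
    show "H \<subseteq> fst ` H \<times> snd ` H" by force
  next
    fix i assume "i \<in> fst ` H"
    then obtain j0 where h0: "(i, j0) \<in> H" by auto
    have "A i = (\<Union>X\<in>insert {z i} {P i j \<inter> P i j' | j j'. (i, j) \<in> H \<and> (i, j') \<in> H \<and> j \<noteq> j'}. X)"
      by (auto simp: A_def)
    moreover have "conn adj \<dots>"
    proof (rule conn_UN[OF sym])
      fix X assume X: "X \<in> insert {z i} {P i j \<inter> P i j' | j j'. (i, j) \<in> H \<and> (i, j') \<in> H \<and> j \<noteq> j'}"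
      then show "conn adj X" using fC by auto
      show "z i \<in> X" using X fP(2) by auto
    qed
    moreover have "A i \<subseteq> V"
    proof
      fix v assume "v \<in> A i"
      then show "v \<in> V" unfolding A_iff using zV[OF lt(1)[OF h0]] fP(1) by blast
    qed
    ultimately show "A i \<noteq> {} \<and> A i \<subseteq> V \<and> conn adj (A i)" unfolding A_def by simp
  next
    fix j assume "j \<in> snd ` H"
    then obtain i0 where h0: "(i0, j) \<in> H" by auto
    have "Y j = (\<Union>X\<in>(\<lambda>i. P i j - A i) ` {i. (i, j) \<in> H}. X)" by (auto simp: Y_def)
    moreover have "conn adj \<dots>"
    proof (rule conn_UN[OF sym])
      fix X assume "X \<in> (\<lambda>i. P i j - A i) ` {i. (i, j) \<in> H}"
      then obtain i where i: "(i, j) \<in> H" "X = P i j - A i" by blast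
      show "conn adj X" using rest[OF i(1)] i(2) by simp
      show "w j \<in> X" using fP(3)[OF i(1)] wA[OF i(1)] i(2) by blast
    qed
    moreover have "w j \<in> Y j" unfolding Y_def using h0 fP(3)[OF h0] wA[OF h0] by blast
    moreover have "Y j \<subseteq> V" unfolding Y_def using fP(1) by blast
    ultimately show "Y j \<noteq> {} \<and> Y j \<subseteq> V \<and> conn adj (Y j)" by auto
  next
    fix i i' assume i: "i \<in> fst ` H" "i' \<in> fst ` H" "i \<noteq> i'"
    then have im: "i < m" "i' < m" using lt by auto
    show "A i \<inter> A i' = {}"
    proof (rule ccontr)
      assume "A i \<inter> A i' \<noteq> {}"
      then obtain v where v: "v \<in> A i" "v \<in> A i'" by blast
      obtain j j' where jj: "(i, j) \<in> H" "(i', j') \<in> H" using i by auto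
      have no_z: "v \<noteq> z i"
      proof
        assume vz: "v = z i"
        then have "v = z i' \<or> (\<exists>a. (i', a) \<in> H \<and> v \<in> P i' a)" using v(2) unfolding A_iff by blast
        then show False
        proof
          assume "v = z i'"
          then have "z i' \<in> P i j" using vz fP(2)[OF jj(1)] by simp
          then show False using zP[OF jj(1) im(2)] i(3) by simp
        next
          assume "\<exists>a. (i', a) \<in> H \<and> v \<in> P i' a"
          then show False using zP[OF _ im(1) i(3)] vz by blast
        qed
      qed
      then obtain a b where ab: "(i, a) \<in> H" "(i, b) \<in> H" "a \<noteq> b" "v \<in> P i a" "v \<in> P i b" using v(1)
          unfolding A_iff by blast
      have "v \<noteq> z i'" using zP[OF ab(1) im(2)] ab(4) i(3) by blast
      then obtain c where c: "(i', c) \<in> H" "v \<in> P i' c" using v(2) unfolding A_iff by blast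
      have "a \<noteq> c \<or> b \<noteq> c" using ab by blast
      then show False using xing[OF ab(1) c(1) i(3) _ ab(4) c(2)] xing[OF ab(2) c(1) i(3) _ ab(5)
          c(2)] by blast
    qed
  next
    fix j j' assume j: "j \<in> snd ` H" "j' \<in> snd ` H" "j \<noteq> j'"
    show "Y j \<inter> Y j' = {}"
    proof (rule ccontr)
      assume "Y j \<inter> Y j' \<noteq> {}"
      then obtain v i i' where v: "(i, j) \<in> H" "v \<in> P i j" "v \<notin> A i" "(i', j') \<in> H" "v \<in> P i' j'"
          "v \<notin> A i'"
        unfolding Y_def by blast
      show False
      proof (cases "i = i'")
        case True
        then have "v \<in> A i" unfolding A_iff using v j(3) by blast
        then show False using v by blast
      next
        case False
        then show False using xing[OF v(1,4) _ j(3) v(2,5)] by blast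
      qed
    qed
  next
    fix i j assume ij: "i \<in> fst ` H" "j \<in> snd ` H"
    then have im: "i < m" using lt by auto
    show "A i \<inter> Y j = {}"
    proof (rule ccontr)
      assume "A i \<inter> Y j \<noteq> {}"
      then obtain v i' where v: "v \<in> A i" "(i', j) \<in> H" "v \<in> P i' j" "v \<notin> A i'" unfolding Y_def
          by blast
      then have ne: "i' \<noteq> i" by blast
      have "v \<noteq> z i" using zP[OF v(2) im] v(3) ne by blast
      then obtain a b where ab: "(i, a) \<in> H" "(i, b) \<in> H" "a \<noteq> b" "v \<in> P i a" "v \<in> P i b" using v(1)
          unfolding A_iff by blast
      have "a \<noteq> j \<or> b \<noteq> j" using ab by blast
      then show False using xing[OF v(2) ab(1) ne _ v(3) ab(4)] xing[OF v(2) ab(2) ne _ v(3) ab(5)]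
          by blast
    qed
  next
    fix i j assume h: "(i, j) \<in> H"
    have "conn adj (P i j)" using fC[OF h h] by simp
    moreover have "P i j \<inter> A i \<subseteq> P i j" by blast
    moreover have "z i \<in> P i j \<inter> A i" using fP(2)[OF h] by (simp add: A_def)
    moreover have "w j \<in> P i j - P i j \<inter> A i" using fP(3)[OF h] wA[OF h] by blast
    ultimately have "\<exists>a\<in>P i j \<inter> A i. \<exists>b\<in>P i j - P i j \<inter> A i. adj a b" by (rule conn_cut)
    then obtain a b where ab: "a \<in> P i j \<inter> A i" "b \<in> P i j - P i j \<inter> A i" "adj a b" by (elim bexE)
    then have "b \<in> Y j" unfolding Y_def using h by blast
    then show "\<exists>a\<in>A i. \<exists>b\<in>Y j. adj a b" using ab by blast
  qed
  moreover have "card (fst ` H) \<le> m"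
    using card_mono[of "{..<m}" "fst ` H"] lt by fastforce
  moreover have "card (snd ` H) \<le> m"
    using card_mono[of "{..<m}" "snd ` H"] lt by fastforce
  ultimately show ?thesis by (simp add: distrib_left)
qed

text \<open>The sampling argument for crossing numbers: route a random bipartite demand graph with \<open>m\<close> sources and
  \<open>m\<close> sinks along the fans and delete every demand whose path meets an independent path or a foreign terminal.\<close>

lemma fan_crossing_bound:
  fixes S :: "'s set" and src :: "'s \<Rightarrow> 'v"
  assumes mb: "minor_bounded adj V g" and sym: "symp adj" and V: "finite V" and BV: "B \<subseteq> V" "B \<noteq> {}"
    and S: "finite S" "S \<noteq> {}" "\<And>\<sigma>. \<sigma> \<in> S \<Longrightarrow> src \<sigma> \<in> B \<and> fan adj V B (src \<sigma>) (\<Phi> \<sigma>)"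
  defines "p \<equiv> \<lambda>v. avg S (\<lambda>\<sigma>. avg B (\<lambda>b. of_bool (v \<in> snd (\<Phi> \<sigma>) b)))"
  shows "real m ^ 2 * avg S (\<lambda>\<sigma>. avg B (\<lambda>b. of_bool (b \<in> fst (\<Phi> \<sigma>)))) - real m ^ 4 * (\<Sum>v\<in>V. (p v)\<^sup>2)
     - real m ^ 3 * (avg B p + avg S (\<lambda>\<sigma>. p (src \<sigma>))) \<le> 6 * real m + 6 * real g"
proof -
  have finB: "finite B" using BV V finite_subset by blast
  define o1 where "o1 \<sigma> b v = (of_bool (v \<in> snd (\<Phi> \<sigma>) b) :: real)" for \<sigma> b v
  define e where "e \<sigma> b = (of_bool (b \<in> fst (\<Phi> \<sigma>)) :: real)" for \<sigma> b
  have o0: "o1 \<sigma> b v \<ge> 0" for \<sigma> b v by (simp add: o1_def)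
  have p_def': "p v = avg S (\<lambda>\<sigma>. avg B (\<lambda>b. o1 \<sigma> b v))" for v by (simp add: p_def o1_def)
  have p0: "p v \<ge> 0" for v unfolding p_def' by (intro avg_nonneg o0)
  define I where "I = {..<m}"
  have I: "finite I" "card I = m" by (auto simp: I_def)
  define Q2 where "Q2 = I \<times> I"
  \<comment> \<open>\<open>Q3\<close> and \<open>R3\<close> pair a demand with a foreign sink or
    source, \<open>Q4\<close> pairs demands without a common index. Distinct indices are sampled
    independently, so these averages factor.\<close>
  define Q3 where "Q3 = {((i, j), l). i \<in> I \<and> j \<in> I \<and> l \<in> I \<and> l \<noteq> j}"
  define R3 where "R3 = {((i, j), l). i \<in> I \<and> j \<in> I \<and> l \<in> I \<and> l \<noteq> i}"
  define Q4 where "Q4 = {((i, j), (i', j')). i \<in> I \<and> j \<in> I \<and> i' \<in> I \<and> j' \<in> I \<and> i \<noteq> i' \<and> j \<noteq> j'}"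
  have Qsub: "Q3 \<subseteq> (I \<times> I) \<times> I" "R3 \<subseteq> (I \<times> I) \<times> I" "Q4 \<subseteq> (I \<times> I) \<times> (I \<times> I)"
      by (auto simp: Q3_def R3_def Q4_def)
  have finQ: "finite Q2" "finite Q3" "finite R3" "finite Q4"
    using I finite_subset[OF Qsub(1)] finite_subset[OF Qsub(2)] finite_subset[OF Qsub(3)]
        by (auto simp: Q2_def)
  have cQ: "card Q2 = m ^ 2" "card Q3 \<le> m ^ 3" "card R3 \<le> m ^ 3" "card Q4 \<le> m ^ 4"
  proof -
    show "card Q2 = m ^ 2" by (simp add: Q2_def I card_cartesian_product power2_eq_square)
    have "card ((I \<times> I) \<times> I) = m ^ 3" "card ((I \<times> I) \<times> (I \<times> I)) = m ^ 4"
      by (simp_all add: I card_cartesian_product power3_eq_cube power4_eq_xxxx mult.assoc)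
    then show "card Q3 \<le> m ^ 3" "card R3 \<le> m ^ 3" "card Q4 \<le> m ^ 4"
      using card_mono[OF _ Qsub(1)] card_mono[OF _ Qsub(2)] card_mono[OF _ Qsub(3)] I by auto
  qed
  let ?\<Omega>s = "PiE I (\<lambda>_. S)" and ?\<Omega>w = "PiE I (\<lambda>_. B)"
  define ed where "ed s w = (\<Sum>q\<in>Q2. e (s (fst q)) (w (snd q)))" for s :: "nat \<Rightarrow> 's"
      and w :: "nat \<Rightarrow> 'v"
  define cr where "cr s w = (\<Sum>q\<in>Q4. \<Sum>v\<in>V. o1 (s (fst (fst q))) (w (snd (fst q))) v * o1 (s (fst (snd
      q))) (w (snd (snd q))) v)" for s w
  define v1 where "v1 s w = (\<Sum>q\<in>Q3. o1 (s (fst (fst q))) (w (snd (fst q))) (w (snd q)))" for s w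
  define v2 where "v2 s w = (\<Sum>q\<in>R3. o1 (s (fst (fst q))) (w (snd (fst q))) (src (s (snd q))))"
      for s w
  have avg_ed: "avg ?\<Omega>s (\<lambda>s. avg ?\<Omega>w (ed s)) = real m ^ 2 * avg S (\<lambda>\<sigma>. avg B (e \<sigma>))"
  proof -
    have "avg ?\<Omega>s (\<lambda>s. avg ?\<Omega>w (ed s)) = (\<Sum>q\<in>Q2. avg ?\<Omega>s (\<lambda>s. avg ?\<Omega>w (\<lambda>w. e (s (fst q)) (w (snd
        q)))))"
      unfolding ed_def by (simp only: avg_sum)
    also have "\<dots> = (\<Sum>q\<in>Q2. avg S (\<lambda>\<sigma>. avg B (e \<sigma>)))"
    proof (rule sum.cong[OF refl])
      fix q assume "q \<in> Q2"
      then have q: "fst q \<in> I" "snd q \<in> I" by (auto simp: Q2_def)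
      have "avg ?\<Omega>w (\<lambda>w. e \<sigma> (w (snd q))) = avg B (e \<sigma>)" for \<sigma>
          by (rule avg_coord[OF I(1) finB BV(2) q(2)])
      then show "avg ?\<Omega>s (\<lambda>s. avg ?\<Omega>w (\<lambda>w. e (s (fst q)) (w (snd q)))) = avg S (\<lambda>\<sigma>. avg B (e \<sigma>))"
        using avg_coord[OF I(1) S(1,2) q(1), of "\<lambda>\<sigma>. avg B (e \<sigma>)"] by simp
    qed
    finally show ?thesis using cQ(1) by simp
  qed
  have avg_cr: "avg ?\<Omega>s (\<lambda>s. avg ?\<Omega>w (cr s)) \<le> real m ^ 4 * (\<Sum>v\<in>V. (p v)\<^sup>2)"
  proof -
    have "avg ?\<Omega>s (\<lambda>s. avg ?\<Omega>w (cr s)) = (\<Sum>q\<in>Q4. \<Sum>v\<in>V. avg ?\<Omega>s (\<lambda>s. avg ?\<Omega>w (\<lambda>w.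
        o1 (s (fst (fst q))) (w (snd (fst q))) v * o1 (s (fst (snd q))) (w (snd (snd q))) v)))"
      unfolding cr_def by (simp only: avg_sum)
    also have "\<dots> = (\<Sum>q\<in>Q4. \<Sum>v\<in>V. (p v)\<^sup>2)"
    proof (intro sum.cong refl)
      fix q v assume "q \<in> Q4"
      then have q: "fst (fst q) \<in> I" "snd (fst q) \<in> I" "fst (snd q) \<in> I" "snd (snd q) \<in> I"
        "fst (fst q) \<noteq> fst (snd q)" "snd (fst q) \<noteq> snd (snd q)" by (auto simp: Q4_def)
      have "avg ?\<Omega>w (\<lambda>w. o1 \<sigma> (w (snd (fst q))) v * o1 \<sigma>' (w (snd (snd q))) v) =
          avg B (\<lambda>b. o1 \<sigma> b v) * avg B (\<lambda>b. o1 \<sigma>' b v)" for \<sigma> \<sigma>'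
        by (subst avg_coord2[OF I(1) finB BV(2) q(2,4,6), of "\<lambda>b b'. o1 \<sigma> b v * o1 \<sigma>' b' v"]) (simp
          only: avg_cmult)
      then have "avg ?\<Omega>s (\<lambda>s. avg ?\<Omega>w (\<lambda>w. o1 (s (fst (fst q))) (w (snd (fst q))) v * o1 (s (fst
          (snd q))) (w (snd (snd q))) v)) =
        avg ?\<Omega>s (\<lambda>s. avg B (\<lambda>b. o1 (s (fst (fst q))) b v) * avg B (\<lambda>b. o1 (s (fst (snd q))) b v))"
            by simp
      also have "\<dots> = p v * p v"
        by (subst avg_coord2[OF I(1) S(1,2) q(1,3,5),
          of "\<lambda>\<sigma> \<sigma>'. avg B (\<lambda>b. o1 \<sigma> b v) * avg B (\<lambda>b. o1 \<sigma>' b v)"])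
           (simp only: avg_cmult p_def')
      finally show "avg ?\<Omega>s (\<lambda>s. avg ?\<Omega>w (\<lambda>w. o1 (s (fst (fst q))) (w (snd (fst q))) v * o1 (s (fst
          (snd q))) (w (snd (snd q))) v)) = (p v)\<^sup>2"
        by (simp add: power2_eq_square)
    qed
    also have "\<dots> = real (card Q4) * (\<Sum>v\<in>V. (p v)\<^sup>2)" by simp
    also have "\<dots> \<le> real (m ^ 4) * (\<Sum>v\<in>V. (p v)\<^sup>2)"
      using cQ(4) by (intro mult_right_mono sum_nonneg) (auto simp only: of_nat_le_iff
          zero_le_power2)
    finally show ?thesis by simp
  qed
  have avg_v1: "avg ?\<Omega>s (\<lambda>s. avg ?\<Omega>w (v1 s)) \<le> real m ^ 3 * avg B p"
  proof -
    have "avg ?\<Omega>s (\<lambda>s. avg ?\<Omega>w (v1 s)) = (\<Sum>q\<in>Q3. avg ?\<Omega>s (\<lambda>s. avg ?\<Omega>w (\<lambda>w. o1 (s (fst (fst q))) (w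
        (snd (fst q))) (w (snd q)))))"
      unfolding v1_def by (simp only: avg_sum)
    also have "\<dots> = (\<Sum>q\<in>Q3. avg B p)"
    proof (intro sum.cong refl)
      fix q assume "q \<in> Q3"
      then have q: "fst (fst q) \<in> I" "snd (fst q) \<in> I" "snd q \<in> I" "snd (fst q) \<noteq> snd q"
          by (auto simp: Q3_def)
      have "avg ?\<Omega>w (\<lambda>w. o1 \<sigma> (w (snd (fst q))) (w (snd q))) = avg B (\<lambda>b. avg B (\<lambda>b'. o1 \<sigma> b b'))"
          for \<sigma>
        by (rule avg_coord2[OF I(1) finB BV(2) q(2-4)])
      then have "avg ?\<Omega>s (\<lambda>s. avg ?\<Omega>w (\<lambda>w. o1 (s (fst (fst q))) (w (snd (fst q))) (w (snd q)))) =
          avg S (\<lambda>\<sigma>. avg B (\<lambda>b. avg B (\<lambda>b'. o1 \<sigma> b b')))"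
        using avg_coord[OF I(1) S(1,2) q(1), of "\<lambda>\<sigma>. avg B (\<lambda>b. avg B (\<lambda>b'. o1 \<sigma> b b'))"] by simp
      also have "\<dots> = avg S (\<lambda>\<sigma>. avg B (\<lambda>b'. avg B (\<lambda>b. o1 \<sigma> b b')))"
        by (rule avg_cong) (rule avg_swap)
      also have "\<dots> = avg B p" unfolding p_def' by (rule avg_swap)
      finally show "avg ?\<Omega>s (\<lambda>s. avg ?\<Omega>w (\<lambda>w. o1 (s (fst (fst q))) (w (snd (fst q))) (w (snd q)))) =
          avg B p" .
    qed
    also have "\<dots> = real (card Q3) * avg B p" by simp
    also have "\<dots> \<le> real (m ^ 3) * avg B p" using cQ(2)
        by (intro mult_right_mono avg_nonneg p0) (simp only: of_nat_le_iff)
    finally show ?thesis by simp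
  qed
  have avg_v2: "avg ?\<Omega>s (\<lambda>s. avg ?\<Omega>w (v2 s)) \<le> real m ^ 3 * avg S (\<lambda>\<sigma>. p (src \<sigma>))"
  proof -
    have "avg ?\<Omega>s (\<lambda>s. avg ?\<Omega>w (v2 s)) = (\<Sum>q\<in>R3. avg ?\<Omega>s (\<lambda>s. avg ?\<Omega>w (\<lambda>w. o1 (s (fst (fst q))) (w
        (snd (fst q))) (src (s (snd q))))))"
      unfolding v2_def by (simp only: avg_sum)
    also have "\<dots> = (\<Sum>q\<in>R3. avg S (\<lambda>\<sigma>. p (src \<sigma>)))"
    proof (intro sum.cong refl)
      fix q assume "q \<in> R3"
      then have q: "fst (fst q) \<in> I" "snd (fst q) \<in> I" "snd q \<in> I" "fst (fst q) \<noteq> snd q"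
          by (auto simp: R3_def)
      have "avg ?\<Omega>w (\<lambda>w. o1 \<sigma> (w (snd (fst q))) v) = avg B (\<lambda>b. o1 \<sigma> b v)" for \<sigma> v
        by (rule avg_coord[OF I(1) finB BV(2) q(2)])
      then have "avg ?\<Omega>s (\<lambda>s. avg ?\<Omega>w (\<lambda>w. o1 (s (fst (fst q))) (w (snd (fst q))) (src (s (snd
          q))))) =
         avg S (\<lambda>\<sigma>. avg S (\<lambda>\<sigma>'. avg B (\<lambda>b. o1 \<sigma> b (src \<sigma>'))))"
        using avg_coord2[OF I(1) S(1,2) q(1,3,4), of "\<lambda>\<sigma> \<sigma>'. avg B (\<lambda>b. o1 \<sigma> b (src \<sigma>'))"] by simp
      also have "\<dots> = avg S (\<lambda>\<sigma>. p (src \<sigma>))" unfolding p_def' by (rule avg_swap)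
      finally show "avg ?\<Omega>s (\<lambda>s. avg ?\<Omega>w (\<lambda>w. o1 (s (fst (fst q))) (w (snd (fst q))) (src (s (snd
          q))))) = avg S (\<lambda>\<sigma>. p (src \<sigma>))" .
    qed
    also have "\<dots> = real (card R3) * avg S (\<lambda>\<sigma>. p (src \<sigma>))" by simp
    also have "\<dots> \<le> real (m ^ 3) * avg S (\<lambda>\<sigma>. p (src \<sigma>))" using cQ(3)
        by (intro mult_right_mono avg_nonneg p0) (simp only: of_nat_le_iff)
    finally show ?thesis by simp
  qed
  \<comment> \<open>Deletion method: one bad event removes at most one demand, so \<open>Z\<close>
    is a lower bound for the surviving demands.\<close>
  define Z where "Z s w = ed s w - cr s w - v1 s w - v2 s w" for s w
  have "avg ?\<Omega>s (\<lambda>s. avg ?\<Omega>w (Z s)) = avg ?\<Omega>s (\<lambda>s. avg ?\<Omega>w (ed s)) - avg ?\<Omega>s (\<lambda>s. avg ?\<Omega>w (cr s))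
     - avg ?\<Omega>s (\<lambda>s. avg ?\<Omega>w (v1 s)) - avg ?\<Omega>s (\<lambda>s. avg ?\<Omega>w (v2 s))"
    unfolding Z_def by (simp only: avg_diff)
  then have low: "real m ^ 2 * avg S (\<lambda>\<sigma>. avg B (e \<sigma>)) - real m ^ 4 * (\<Sum>v\<in>V. (p v)\<^sup>2)
     - real m ^ 3 * (avg B p + avg S (\<lambda>\<sigma>. p (src \<sigma>))) \<le> avg ?\<Omega>s (\<lambda>s. avg ?\<Omega>w (Z s))"
    using avg_ed avg_cr avg_v1 avg_v2 by (simp add: distrib_left)
  have fin\<Omega>: "finite ?\<Omega>s" "?\<Omega>s \<noteq> {}" "finite ?\<Omega>w" "?\<Omega>w \<noteq> {}"
    using I S finB BV by (auto simp: finite_PiE PiE_eq_empty_iff)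
  obtain s where s: "s \<in> ?\<Omega>s" "avg ?\<Omega>s (\<lambda>s. avg ?\<Omega>w (Z s)) \<le> avg ?\<Omega>w (Z s)"
    using exists_ge_avg[OF fin\<Omega>(1,2)] by blast
  obtain w where w: "w \<in> ?\<Omega>w" "avg ?\<Omega>w (Z s) \<le> Z s w" using exists_ge_avg[OF fin\<Omega>(3,4)] by blast
  have sS: "s i \<in> S" if "i \<in> I" for i using s(1) that by auto
  define P where "P q = snd (\<Phi> (s (fst q))) (w (snd q))" for q
  define H0 where "H0 = {q \<in> Q2. w (snd q) \<in> fst (\<Phi> (s (fst q)))}"
  define X4 where "X4 = {q \<in> Q4. P (fst q) \<inter> P (snd q) \<noteq> {}}"
  define X3 where "X3 = {q \<in> Q3. w (snd q) \<in> P (fst q)}"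
  define Y3 where "Y3 = {q \<in> R3. src (s (snd q)) \<in> P (fst q)}"
  define H where "H = H0 - (fst ` X4 \<union> fst ` X3 \<union> fst ` Y3)"
  have PV: "P q \<subseteq> V" if "q \<in> Q2" for q
  proof -
    have "fan adj V B (src (s (fst q))) (\<Phi> (s (fst q)))" using S(3) sS that by (auto simp: Q2_def)
    then show ?thesis unfolding fan_def P_def by (cases "w (snd q) \<in> fst (\<Phi> (s (fst q)))") auto
  qed
  have ed_eq: "ed s w = real (card H0)"
  proof -
    have "ed s w = (\<Sum>q\<in>Q2. if w (snd q) \<in> fst (\<Phi> (s (fst q))) then 1 else 0)" unfolding ed_def e_def
        by (intro sum.cong) auto
    then show ?thesis using finQ(1) by (simp add: sum.inter_filter[symmetric] H0_def)
  qed
  have cr_ge: "real (card X4) \<le> cr s w"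
  proof -
    have "real (card X4) = (\<Sum>q\<in>Q4. if P (fst q) \<inter> P (snd q) \<noteq> {} then 1 else 0)"
      using finQ(4) by (simp add: sum.inter_filter[symmetric] X4_def)
    also have "\<dots> \<le> cr s w" unfolding cr_def
    proof (rule sum_mono)
      fix q assume q: "q \<in> Q4"
      let ?S = "(\<Sum>v\<in>V. o1 (s (fst (fst q))) (w (snd (fst q))) v * o1 (s (fst (snd q))) (w (snd (snd
          q))) v)"
      show "(if P (fst q) \<inter> P (snd q) \<noteq> {} then 1 else 0) \<le> ?S"
      proof (cases "P (fst q) \<inter> P (snd q) \<noteq> {}")
        case True
        then obtain v where v: "v \<in> P (fst q)" "v \<in> P (snd q)" by blast
        have "fst q \<in> Q2" using q by (auto simp: Q4_def Q2_def)
        then have vV: "v \<in> V" using PV v by blast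
        have "1 = o1 (s (fst (fst q))) (w (snd (fst q))) v * o1 (s (fst (snd q))) (w (snd (snd q)))
            v"
          using v by (simp add: o1_def P_def)
        also have "\<dots> \<le> ?S" using V vV o0 by (intro member_le_sum) auto
        finally show ?thesis using True by simp
      qed (auto intro!: sum_nonneg mult_nonneg_nonneg o0)
    qed
    finally show ?thesis .
  qed
  have v1_eq: "v1 s w = real (card X3)"
  proof -
    have "v1 s w = (\<Sum>q\<in>Q3. if w (snd q) \<in> P (fst q) then 1 else 0)" unfolding v1_def o1_def P_def
        by (intro sum.cong) auto
    then show ?thesis using finQ(2) by (simp add: sum.inter_filter[symmetric] X3_def)
  qed
  have v2_eq: "v2 s w = real (card Y3)"
  proof -
    have "v2 s w = (\<Sum>q\<in>R3. if src (s (snd q)) \<in> P (fst q) then 1 else 0)"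
        unfolding v2_def o1_def P_def by (intro sum.cong) auto
    then show ?thesis using finQ(3) by (simp add: sum.inter_filter[symmetric] Y3_def)
  qed
  have finX: "finite X4" "finite X3" "finite Y3" using finQ by (auto simp: X4_def X3_def Y3_def)
  have "card H0 \<le> card H + (card X4 + card X3 + card Y3)"
  proof -
    have "H0 \<subseteq> H \<union> (fst ` X4 \<union> fst ` X3 \<union> fst ` Y3)" by (auto simp: H_def)
    moreover have "finite H" using finQ(1) by (simp add: H_def H0_def)
    ultimately have "card H0 \<le> card (H \<union> (fst ` X4 \<union> fst ` X3 \<union> fst ` Y3))" using finX
        by (intro card_mono) auto
    also have "\<dots> \<le> card H + card (fst ` X4 \<union> fst ` X3 \<union> fst ` Y3)" by (rule card_Un_le)
    also have "card (fst ` X4 \<union> fst ` X3 \<union> fst ` Y3) \<le> card (fst ` X4 \<union> fst ` X3) + card (fst ` Y3)"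
        by (rule card_Un_le)
    also have "card (fst ` X4 \<union> fst ` X3) \<le> card (fst ` X4) + card (fst ` X3)" by (rule card_Un_le)
    finally show ?thesis using card_image_le[OF finX(1), of fst] card_image_le[OF finX(2), of fst]
        card_image_le[OF finX(3), of fst]
      by linarith
  qed
  then have "Z s w \<le> real (card H)" unfolding Z_def ed_eq v1_eq v2_eq using cr_ge by linarith
  moreover have "card H \<le> 6 * m + 6 * g"
  proof (rule fan_minor_bound[OF mb sym, where z = "\<lambda>i. src (s i)" and \<Phi> = "\<lambda>i. \<Phi> (s i)" and w = w])
    show "fan adj V B (src (s i)) (\<Phi> (s i))" "src (s i) \<in> V" if "i < m" for i
      using S(3)[OF sS[of i]] that BV by (auto simp: I_def)
    show "H \<subseteq> {..<m} \<times> {..<m}" by (auto simp: H_def H0_def Q2_def I_def)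
    show "w j \<in> fst (\<Phi> (s i))" if "(i, j) \<in> H" for i j using that by (auto simp: H_def H0_def)
    have HI: "i \<in> I" "j \<in> I" if "(i, j) \<in> H" for i j using that by (auto simp: H_def H0_def Q2_def)
    show "snd (\<Phi> (s i)) (w j) \<inter> snd (\<Phi> (s i')) (w j') = {}"
        if h: "(i, j) \<in> H" "(i', j') \<in> H" "i \<noteq> i'" "j \<noteq> j'" for i j i' j'
    proof (rule ccontr)
      assume "snd (\<Phi> (s i)) (w j) \<inter> snd (\<Phi> (s i')) (w j') \<noteq> {}"
      then have "((i, j), (i', j')) \<in> X4" using HI[OF h(1)] HI[OF h(2)] h
          by (auto simp: X4_def Q4_def P_def)
      then have "(i, j) \<in> fst ` X4" by force
      then show False using h(1) by (auto simp: H_def)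
    qed
    show "w l \<notin> snd (\<Phi> (s i)) (w j)" if h: "(i, j) \<in> H" "l < m" "l \<noteq> j" for i j l
    proof
      assume "w l \<in> snd (\<Phi> (s i)) (w j)"
      then have "((i, j), l) \<in> X3" using HI[OF h(1)] h by (auto simp: X3_def Q3_def P_def I_def)
      then have "(i, j) \<in> fst ` X3" by force
      then show False using h(1) by (auto simp: H_def)
    qed
    show "src (s l) \<notin> snd (\<Phi> (s i)) (w j)" if h: "(i, j) \<in> H" "l < m" "l \<noteq> i" for i j l
    proof
      assume "src (s l) \<in> snd (\<Phi> (s i)) (w j)"
      then have "((i, j), l) \<in> Y3" using HI[OF h(1)] h by (auto simp: Y3_def R3_def P_def I_def)
      then have "(i, j) \<in> fst ` Y3" by force
      then show False using h(1) by (auto simp: H_def)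
    qed
  qed
  then have "real (card H) \<le> 6 * real m + 6 * real g" by (simp add: of_nat_le_iff[symmetric,
      where 'a = real] del: of_nat_le_iff)
  ultimately have "avg ?\<Omega>s (\<lambda>s. avg ?\<Omega>w (Z s)) \<le> 6 * real m + 6 * real g" using s(2) w(2)
      by linarith
  then show ?thesis using low unfolding e_def by linarith
qed

section \<open>Routing against quadratic congestion\<close>

text \<open>Replacing one fan changes the potential by a linear term, in which congestion divided by
  \<open>2 * A\<close> acts as a price, and by a quadratic error. Loads are divided by
  \<open>M\<close>, so after rescaling the error is at most
  \<open>card V * n\<^sup>2 / (4 * A * M)\<close> and can be made small by increasing
  \<open>M\<close>.\<close>

lemma potential_maximiser:
  fixes T :: "'s \<Rightarrow> 't set" and sz :: "'t \<Rightarrow> real" and N :: "'t \<Rightarrow> 'v \<Rightarrow> real"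
  assumes S: "finite S" and T: "\<And>\<sigma>. \<sigma> \<in> S \<Longrightarrow> finite (T \<sigma>) \<and> T \<sigma> \<noteq> {}"
    and N: "\<And>\<sigma> \<phi> v. \<sigma> \<in> S \<Longrightarrow> \<phi> \<in> T \<sigma> \<Longrightarrow> v \<in> V \<Longrightarrow> 0 \<le> N \<phi> v \<and> N \<phi> v \<le> n" and A: "A > 0"
        and M: "M > (0::real)"
  obtains \<Phi> where "\<And>\<sigma>. \<sigma> \<in> S \<Longrightarrow> \<Phi> \<sigma> \<in> T \<sigma>"
    "\<And>\<sigma> \<phi>. \<sigma> \<in> S \<Longrightarrow> \<phi> \<in> T \<sigma> \<Longrightarrow>
      sz \<phi> - (\<Sum>v\<in>V. ((\<Sum>\<tau>\<in>S. N (\<Phi> \<tau>) v) / M / (2 * A)) * N \<phi> v) \<le>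
      sz (\<Phi> \<sigma>) - (\<Sum>v\<in>V. ((\<Sum>\<tau>\<in>S. N (\<Phi> \<tau>) v) / M / (2 * A)) * N (\<Phi> \<sigma>) v) +
          real (card V) * n\<^sup>2 / (4 * A * M)"
proof -
  define c where "c \<Phi> v = (\<Sum>\<tau>\<in>S. N (\<Phi> \<tau>) v) / M" for \<Phi> :: "'s \<Rightarrow> 't" and v
  define J where "J \<Phi> = (\<Sum>\<tau>\<in>S. sz (\<Phi> \<tau>)) / M - (\<Sum>v\<in>V. (c \<Phi> v)\<^sup>2) / (4 * A)" for \<Phi>
  have "finite (PiE S T)" "PiE S T \<noteq> {}" using S T by (auto simp: finite_PiE PiE_eq_empty_iff)
  then have "\<exists>\<Phi>\<in>PiE S T. \<forall>\<Psi>\<in>PiE S T. J \<Psi> \<le> J \<Phi>"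
  proof -
    assume f: "finite (PiE S T)" "PiE S T \<noteq> {}"
    then have "Max (J ` PiE S T) \<in> J ` PiE S T" by (intro Max_in) auto
    then obtain \<Phi> where "\<Phi> \<in> PiE S T" "J \<Phi> = Max (J ` PiE S T)" by auto
    then show ?thesis using f Max_ge[of "J ` PiE S T"] by (intro bexI[of _ \<Phi>]) auto
  qed
  then obtain \<Phi> where \<Phi>: "\<Phi> \<in> PiE S T" "\<And>\<Psi>. \<Psi> \<in> PiE S T \<Longrightarrow> J \<Psi> \<le> J \<Phi>" by blast
  show thesis
  proof (rule that[of \<Phi>])
    show m: "\<Phi> \<sigma> \<in> T \<sigma>" if "\<sigma> \<in> S" for \<sigma> using \<Phi>(1) that by auto
    fix \<sigma> \<phi> assume h: "\<sigma> \<in> S" "\<phi> \<in> T \<sigma>"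
    define \<Psi> where "\<Psi> = \<Phi>(\<sigma> := \<phi>)"
    have "\<Psi> \<in> PiE S T" using \<Phi>(1) h by (auto simp: \<Psi>_def PiE_def extensional_def)
    then have JJ: "J \<Psi> \<le> J \<Phi>" by (rule \<Phi>(2))
    have upd: "(\<Sum>\<tau>\<in>S. f (\<Psi> \<tau>)) = (\<Sum>\<tau>\<in>S. f (\<Phi> \<tau>)) + (f \<phi> - f (\<Phi> \<sigma>))" for f :: "'t \<Rightarrow> real"
    proof -
      have "(\<Sum>\<tau>\<in>S. f (\<Psi> \<tau>)) = f \<phi> + (\<Sum>\<tau>\<in>S - {\<sigma>}. f (\<Phi> \<tau>))"
        using S h by (subst sum.remove[OF S h(1)]) (auto simp: \<Psi>_def intro!: sum.cong)
      moreover have "(\<Sum>\<tau>\<in>S. f (\<Phi> \<tau>)) = f (\<Phi> \<sigma>) + (\<Sum>\<tau>\<in>S - {\<sigma>}. f (\<Phi> \<tau>))"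
          by (rule sum.remove[OF S h(1)])
      ultimately show ?thesis by simp
    qed
    define d where "d v = N \<phi> v - N (\<Phi> \<sigma>) v" for v
    have cd: "c \<Psi> v = c \<Phi> v + d v / M" for v unfolding c_def upd[of "\<lambda>t. N t v"] d_def
        by (simp add: add_divide_distrib)
    have dn: "(d v)\<^sup>2 \<le> n\<^sup>2" if "v \<in> V" for v
    proof -
      have "\<bar>d v\<bar> \<le> n" using N[OF h that] N[OF h(1) m[OF h(1)] that] by (auto simp: d_def)
      then show ?thesis using abs_le_square_iff[of "d v" n] by linarith
    qed
    have "(\<Sum>v\<in>V. (c \<Psi> v)\<^sup>2) = (\<Sum>v\<in>V. (c \<Phi> v)\<^sup>2) + (\<Sum>v\<in>V. 2 * c \<Phi> v * d v / M) +
        (\<Sum>v\<in>V. (d v)\<^sup>2 / M\<^sup>2)"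
      unfolding cd by (simp add: power2_sum sum.distrib power_divide algebra_simps)
    moreover have "J \<Psi> = (\<Sum>\<tau>\<in>S. sz (\<Phi> \<tau>)) / M + (sz \<phi> - sz (\<Phi> \<sigma>)) / M - (\<Sum>v\<in>V. (c \<Psi> v)\<^sup>2) / (4 * A)"
      unfolding J_def upd[of sz] by (simp add: add_divide_distrib)
    ultimately have "(sz \<phi> - sz (\<Phi> \<sigma>)) / M \<le> ((\<Sum>v\<in>V. 2 * c \<Phi> v * d v / M) +
        (\<Sum>v\<in>V. (d v)\<^sup>2 / M\<^sup>2)) / (4 * A)"
      using JJ unfolding J_def by (simp add: add_divide_distrib)
    then have "M * ((sz \<phi> - sz (\<Phi> \<sigma>)) / M) \<le> M * (((\<Sum>v\<in>V. 2 * c \<Phi> v * d v / M) +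
        (\<Sum>v\<in>V. (d v)\<^sup>2 / M\<^sup>2)) / (4 * A))"
      using M by (intro mult_left_mono) auto
    moreover have "M * ((sz \<phi> - sz (\<Phi> \<sigma>)) / M) = sz \<phi> - sz (\<Phi> \<sigma>)" using M by simp
    moreover have "M * (((\<Sum>v\<in>V. 2 * c \<Phi> v * d v / M) + (\<Sum>v\<in>V. (d v)\<^sup>2 / M\<^sup>2)) / (4 * A)) =
        (\<Sum>v\<in>V. c \<Phi> v / (2 * A) * d v) + (\<Sum>v\<in>V. (d v)\<^sup>2) / (4 * A * M)"
    proof -
      have e1: "(\<Sum>v\<in>V. 2 * c \<Phi> v * d v / M) = (2 / M) * (\<Sum>v\<in>V. c \<Phi> v * d v)"
          by (simp add: sum_distrib_left sum_divide_distrib mult_ac)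
      have e2: "(\<Sum>v\<in>V. (d v)\<^sup>2 / M\<^sup>2) = (1 / M\<^sup>2) * (\<Sum>v\<in>V. (d v)\<^sup>2)"
          by (simp add: sum_divide_distrib)
      have e3: "(\<Sum>v\<in>V. c \<Phi> v / (2 * A) * d v) = (1 / (2 * A)) * (\<Sum>v\<in>V. c \<Phi> v * d v)"
          by (simp add: sum_distrib_left sum_divide_distrib mult_ac)
      show ?thesis unfolding e1 e2 e3 using M A by (simp add: field_simps power2_eq_square)
    qed
    moreover have "(\<Sum>v\<in>V. (d v)\<^sup>2) / (4 * A * M) \<le> real (card V) * n\<^sup>2 / (4 * A * M)"
      using sum_mono[of V "\<lambda>v. (d v)\<^sup>2" "\<lambda>_. n\<^sup>2"] dn A M by (intro divide_right_mono) auto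
    moreover have "(\<Sum>v\<in>V. c \<Phi> v / (2 * A) * d v) = (\<Sum>v\<in>V. c \<Phi> v / (2 * A) * N \<phi> v) - (\<Sum>v\<in>V. c \<Phi> v /
        (2 * A) * N (\<Phi> \<sigma>) v)"
      by (simp add: d_def right_diff_distrib sum_subtractf)
    ultimately show "sz \<phi> - (\<Sum>v\<in>V. ((\<Sum>\<tau>\<in>S. N (\<Phi> \<tau>) v) / M / (2 * A)) * N \<phi> v) \<le>
      sz (\<Phi> \<sigma>) - (\<Sum>v\<in>V. ((\<Sum>\<tau>\<in>S. N (\<Phi> \<tau>) v) / M / (2 * A)) * N (\<Phi> \<sigma>) v) +
          real (card V) * n\<^sup>2 / (4 * A * M)"
      unfolding c_def by linarith
  qed
qed

text \<open>The size of a fan minus its priced load splits into one term for each sink: 1 minus the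
  price of its path. A fan of large value therefore uses cheap paths and serves the sinks within
  price distance 1.\<close>

lemma fan_gain:
  assumes "finite V" "finite B" "fan adj V B x \<phi>"
  shows "real (card (fst \<phi>)) - (\<Sum>v\<in>V. \<omega> v * real (card {y \<in> fst \<phi>. v \<in> snd \<phi> y})) =
    (\<Sum>y\<in>fst \<phi>. 1 - sum \<omega> (snd \<phi> y))"
proof -
  have fin: "finite (fst \<phi>)" using assms(2,3) finite_subset by (auto simp: fan_def)
  have OV: "snd \<phi> y \<subseteq> V" if "y \<in> fst \<phi>" for y using assms(3) that by (auto simp: fan_def)
  have "(\<Sum>v\<in>V. \<omega> v * real (card {y \<in> fst \<phi>. v \<in> snd \<phi> y})) =
      (\<Sum>v\<in>V. \<Sum>y\<in>fst \<phi>. if v \<in> snd \<phi> y then \<omega> v else 0)"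
  proof (rule sum.cong[OF refl])
    fix v
    have "(\<Sum>y\<in>fst \<phi>. if v \<in> snd \<phi> y then \<omega> v else 0) = (\<Sum>y\<in>{y \<in> fst \<phi>. v \<in> snd \<phi> y}. \<omega> v)"
      by (rule sum.inter_filter[symmetric]) (rule fin)
    then show "\<omega> v * real (card {y \<in> fst \<phi>. v \<in> snd \<phi> y}) =
        (\<Sum>y\<in>fst \<phi>. if v \<in> snd \<phi> y then \<omega> v else 0)"
      by (simp add: mult.commute)
  qed
  also have "\<dots> = (\<Sum>y\<in>fst \<phi>. \<Sum>v\<in>V. if v \<in> snd \<phi> y then \<omega> v else 0)" by (rule sum.swap)
  also have "\<dots> = (\<Sum>y\<in>fst \<phi>. sum \<omega> (snd \<phi> y))"
  proof (rule sum.cong[OF refl])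
    fix y assume y: "y \<in> fst \<phi>"
    have "{v \<in> V. v \<in> snd \<phi> y} = snd \<phi> y" using OV[OF y] by blast
    then show "(\<Sum>v\<in>V. if v \<in> snd \<phi> y then \<omega> v else 0) = sum \<omega> (snd \<phi> y)"
      using assms(1) by (simp add: sum.inter_filter[symmetric])
  qed
  finally show ?thesis by (simp add: sum_subtractf)
qed

text \<open>Distance at most \<open>L\<close> in the vertex-weighted metric of \<open>V\<close>,
  with both ends counted; a connected set stands in for the path.\<close>

definition close :: "('v \<Rightarrow> 'v \<Rightarrow> bool) \<Rightarrow> 'v set \<Rightarrow> ('v \<Rightarrow> nat) \<Rightarrow> nat \<Rightarrow> 'v \<Rightarrow> 'v \<Rightarrow> bool" where
  "close adj V \<nu> L x y \<longleftrightarrow> (\<exists>U\<subseteq>V. conn adj U \<and> x \<in> U \<and> y \<in> U \<and> sum \<nu> U \<le> L)"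

text \<open>The comparison fan serves, along lightest paths, all sinks at rescaled distance at most
  1. A sink at distance at most \<open>1/2\<close> is worth at least \<open>1/2\<close> in it. The
  tolerance \<open>1/4\<close> of optimality and the error \<open>1/8\<close> from rounding the
  prices to integers do not make up for omitting such a sink.\<close>

lemma optimal_fan_contains_close:
  fixes \<omega> :: "'v \<Rightarrow> real"
  assumes V: "finite V" "symp adj" "conn adj V" and BV: "B \<subseteq> V" and x: "x \<in> V"
    and \<nu>: "\<And>v. v \<in> V \<Longrightarrow> \<nu> v \<ge> 1" "\<And>v. v \<in> V \<Longrightarrow> real Q * \<omega> v \<le> real (\<nu> v)"
        "\<And>v. v \<in> V \<Longrightarrow> real (\<nu> v) \<le> real Q * \<omega> v + 1"
    and Q: "Q \<ge> 1" "8 * real (card B) * real (card V) \<le> real Q"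
    and fan: "fan adj V B x \<phi>"
    and opt: "\<And>\<psi>. fan adj V B x \<psi> \<Longrightarrow> (\<Sum>y\<in>fst \<psi>. 1 - sum \<omega> (snd \<psi> y)) \<le>
        (\<Sum>y\<in>fst \<phi>. 1 - sum \<omega> (snd \<phi> y)) + 1/4"
    and y0: "y0 \<in> B" "y0 \<noteq> x" "close adj V \<nu> L x y0" "2 * L \<le> Q"
  shows "y0 \<in> fst \<phi>"
proof (rule ccontr)
  assume no: "y0 \<notin> fst \<phi>"
  have finB: "finite B" using BV V(1) finite_subset by blast
  obtain Ot where Ot: "\<And>Y. Y \<subseteq> B - {x} \<Longrightarrow> fan adj V B x (Y, \<lambda>y. if y \<in> Y then Ot y else {})"
    "\<And>y. y \<in> V \<Longrightarrow> Ot y \<subseteq> V"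
    "\<And>y U. y \<in> V \<Longrightarrow> U \<subseteq> V \<Longrightarrow> conn adj U \<Longrightarrow> x \<in> U \<Longrightarrow> y \<in> U \<Longrightarrow> sum \<nu> (Ot y) \<le> sum \<nu> U"
    by (rule shortest_path_fan[OF V(1-3) x \<nu>(1) BV]) auto
  have Qp: "real Q > 0" using Q by simp
  define p where "p y = real (sum \<nu> (Ot y)) / real Q" for y
  define Y' where "Y' = {y \<in> B - {x}. p y \<le> 1}"
  have Y'f: "finite Y'" "Y' \<subseteq> B - {x}" "Y' \<subseteq> V" using finB BV by (auto simp: Y'_def)
  let ?\<psi> = "(Y', \<lambda>y. if y \<in> Y' then Ot y else {})"
  have \<omega>_le: "sum \<omega> (Ot y) \<le> p y" if y: "y \<in> V" for y
  proof -
    have "real Q * sum \<omega> (Ot y) = (\<Sum>v\<in>Ot y. real Q * \<omega> v)" by (simp add: sum_distrib_left)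
    also have "\<dots> \<le> (\<Sum>v\<in>Ot y. real (\<nu> v))" by (rule sum_mono) (use \<nu>(2) Ot(2)[OF y] in blast)
    finally show ?thesis using Qp by (simp add: p_def pos_le_divide_eq mult.commute)
  qed
  have g': "(\<Sum>y\<in>Y'. 1 - p y) \<le> (\<Sum>y\<in>fst ?\<psi>. 1 - sum \<omega> (snd ?\<psi> y))"
    unfolding fst_conv snd_conv by (rule sum_mono) (use \<omega>_le Y'f in auto)
  define \<eta> where "\<eta> = real (card V) / real Q"
  have Yf: "fst \<phi> \<subseteq> B - {x}" "finite (fst \<phi>)" using fan finB finite_subset by (auto simp: fan_def)
  have \<omega>_ge: "p y - \<eta> \<le> sum \<omega> (snd \<phi> y)" if y: "y \<in> fst \<phi>" for y
  proof -
    have U: "snd \<phi> y \<subseteq> V" "x \<in> snd \<phi> y" "y \<in> snd \<phi> y" "conn adj (snd \<phi> y \<inter> snd \<phi> y)"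
      using fan y unfolding fan_def by blast+
    have yV: "y \<in> V" using y Yf BV by blast
    have "sum \<nu> (Ot y) \<le> sum \<nu> (snd \<phi> y)" by (rule Ot(3)[OF yV U(1) _ U(2,3)]) (use U(4) in simp)
    then have "real (sum \<nu> (Ot y)) \<le> (\<Sum>v\<in>snd \<phi> y. real (\<nu> v))" by (metis of_nat_le_iff of_nat_sum)
    also have "\<dots> \<le> (\<Sum>v\<in>snd \<phi> y. real Q * \<omega> v + 1)" by (rule sum_mono) (use \<nu>(3) U(1) in blast)
    also have "\<dots> = real Q * sum \<omega> (snd \<phi> y) + real (card (snd \<phi> y))"
        by (simp add: sum.distrib sum_distrib_left)
    also have "real (card (snd \<phi> y)) \<le> real (card V)" using card_mono[OF V(1) U(1)] by simp
    finally have "real (sum \<nu> (Ot y)) \<le> real Q * sum \<omega> (snd \<phi> y) + real (card V)" by simp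
    then have "real (sum \<nu> (Ot y)) / real Q \<le> (real Q * sum \<omega> (snd \<phi> y) + real (card V)) / real Q"
      using Qp by (intro divide_right_mono) auto
    then show ?thesis using Qp by (simp add: p_def \<eta>_def add_divide_distrib)
  qed
  have \<eta>0: "\<eta> \<ge> 0" by (simp add: \<eta>_def)
  have "(\<Sum>y\<in>fst \<phi>. 1 - sum \<omega> (snd \<phi> y)) \<le> (\<Sum>y\<in>fst \<phi>. (1 - p y) + \<eta>)"
    by (rule sum_mono) (use \<omega>_ge in force)
  also have "\<dots> = (\<Sum>y\<in>fst \<phi>. 1 - p y) + real (card (fst \<phi>)) * \<eta>" by (simp add: sum.distrib)
  also have "real (card (fst \<phi>)) * \<eta> \<le> 1/8"
  proof -
    have "card (fst \<phi>) \<le> card B" using Yf finB by (intro card_mono) auto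
    then have "real (card (fst \<phi>)) * \<eta> \<le> real (card B) * \<eta>" using \<eta>0 by (intro mult_right_mono) auto
    also have "\<dots> \<le> 1/8" using Q(2) Qp by (simp add: \<eta>_def field_simps)
    finally show ?thesis .
  qed
  also have "(\<Sum>y\<in>fst \<phi>. 1 - p y) \<le> (\<Sum>y\<in>Y' - {y0}. 1 - p y)"
  proof -
    have "(\<Sum>y\<in>fst \<phi>. 1 - p y) \<le> (\<Sum>y\<in>fst \<phi>. if p y \<le> 1 then 1 - p y else 0)" by (rule sum_mono) auto
    also have "\<dots> = (\<Sum>y\<in>{y \<in> fst \<phi>. p y \<le> 1}. 1 - p y)" using Yf by (simp add: sum.inter_filter)
    also have "\<dots> \<le> (\<Sum>y\<in>Y' - {y0}. 1 - p y)"
      by (rule sum_mono2) (use Y'f Yf no in \<open>auto simp: Y'_def\<close>)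
    finally show ?thesis .
  qed
  finally have gle: "(\<Sum>y\<in>fst \<phi>. 1 - sum \<omega> (snd \<phi> y)) \<le> (\<Sum>y\<in>Y' - {y0}. 1 - p y) + 1/8" by simp
  have p0: "p y0 \<le> 1/2"
  proof -
    obtain U where U: "U \<subseteq> V" "conn adj U" "x \<in> U" "y0 \<in> U" "sum \<nu> U \<le> L" using y0(3)
        unfolding close_def by blast
    have "sum \<nu> (Ot y0) \<le> sum \<nu> U" by (rule Ot(3)) (use U y0 BV in auto)
    then have "2 * sum \<nu> (Ot y0) \<le> Q" using U(5) y0(4) by linarith
    then have "2 * real (sum \<nu> (Ot y0)) \<le> real Q"
        by (metis of_nat_le_iff of_nat_mult of_nat_numeral)
    then show ?thesis using Qp by (simp add: p_def field_simps)
  qed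
  then have "y0 \<in> Y'" using y0 by (simp add: Y'_def)
  then have "(\<Sum>y\<in>Y'. 1 - p y) = (1 - p y0) + (\<Sum>y\<in>Y' - {y0}. 1 - p y)"
      by (rule sum.remove[OF Y'f(1)])
  then show False using opt[OF Ot(1)[OF Y'f(2)]] g' gle p0 by linarith
qed

text \<open>Every point of \<open>B\<close> owns \<open>M\<close> fans, which makes the routing
  nearly fractional; \<open>T\<close> is the number of routed pairs per copy. If \<open>T\<close>
  exceeded \<open>n\<^sup>2 / K\<close>, a random sample would contradict the edge bound for minors.
  Hence \<open>T\<close> is small, and since optimal fans serve all close pairs, so is the number of
  close pairs for the prices rounded at scale \<open>Q\<close>.\<close>

lemma spread_weight:
  fixes adj :: "'v \<Rightarrow> 'v \<Rightarrow> bool" and V B :: "'v set"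
  assumes V: "finite V" "symp adj" "conn adj V" and BV: "B \<subseteq> V" and mb: "minor_bounded adj V g"
    and K: "K \<ge> 1" "g \<le> K" "64 * K \<le> card B" and c0: "c0 \<ge> (1::nat)"
  shows "\<exists>\<nu> Q. Q \<ge> 1 \<and> c0 dvd Q \<and> (\<forall>v\<in>V. \<nu> v \<ge> 1) \<and> real (\<Sum>v\<in>V. (\<nu> v)\<^sup>2) \<le>
      20002 * real K * (real Q)\<^sup>2 \<and>
     (\<forall>L. 2 * L \<le> Q \<longrightarrow> real K * real (card {(x, y). x \<in> B \<and> y \<in> B \<and> x \<noteq> y \<and> close adj V \<nu> L x y}) \<le>
         (real (card B))\<^sup>2)"
proof -
  define n where "n = real (card B)"
  have finB: "finite B" using BV V(1) finite_subset by blast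
  have n64: "n \<ge> 64 * real K" using K(3) unfolding n_def
      by (metis of_nat_le_iff of_nat_mult of_nat_numeral)
  have K1: "real K \<ge> 1" using K(1) by simp
  have n0: "n > 0" using n64 K1 by linarith
  then have Bne: "B \<noteq> {}" by (auto simp: n_def)
  \<comment> \<open>The sampling bound will give \<open>m * T \<le> 24 * n\<^sup>2\<close>, while
    \<open>T > n\<^sup>2 / K\<close> gives \<open>m * T > 25 * n\<^sup>2\<close>.\<close>
  define m where "m = 25 * K"
  have m: "real m = 25 * real K" by (simp add: m_def)
  have m0: "real m > 0" using m K1 by linarith
  \<comment> \<open>Makes the crossing term of the sample at most a quarter of the expected number
    \<open>m\<^sup>2 * T / n\<^sup>2\<close> of demands.\<close>
  define A where "A = n\<^sup>2 / (16 * (real m)\<^sup>2)"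
  have A0: "A > 0" using n0 m0 by (simp add: A_def)
  \<comment> \<open>So many copies that the optimality errors, added over all points of
    \<open>B\<close>, stay below \<open>1/4\<close>.\<close>
  obtain M :: nat where M: "real (card V) * n ^ 3 / A + 1 < real M" using reals_Archimedean2
      by blast
  have cV0: "real (card V) * n ^ 3 / A \<ge> 0" using n0 A0 by simp
  then have M0: "real M > 0" using M by linarith
  define \<epsilon> where "\<epsilon> = real (card V) * n\<^sup>2 / (4 * A * real M)"
  have \<epsilon>0: "\<epsilon> \<ge> 0" using A0 M0 by (simp add: \<epsilon>_def)
  have \<epsilon>n: "n * \<epsilon> \<le> 1/4"
  proof -
    have "real (card V) * n ^ 3 / A \<le> real M" using M by linarith
    then have "real (card V) * n ^ 3 \<le> real M * A" using A0 by (simp add: field_simps)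
    then have "real (card V) * n ^ 3 / (4 * A * real M) \<le> 1/4" using A0 M0
        by (simp add: field_simps)
    moreover have "n * \<epsilon> = real (card V) * n ^ 3 / (4 * A * real M)"
        by (simp add: \<epsilon>_def power3_eq_cube power2_eq_square)
    ultimately show ?thesis by simp
  qed
  have \<epsilon>4: "\<epsilon> \<le> 1/4"
  proof -
    have "1 * \<epsilon> \<le> n * \<epsilon>" using n64 K1 \<epsilon>0 by (intro mult_right_mono) auto
    then show ?thesis using \<epsilon>n by simp
  qed
  define S where "S = B \<times> {..<M}"
  have Sf: "finite S" "S \<noteq> {}" using finB Bne M0 by (auto simp: S_def)
  have cS: "real (card S) = n * real M" by (simp add: S_def card_cartesian_product n_def)
  define N where "N \<phi> v = real (card {y \<in> fst \<phi>. v \<in> snd \<phi> y})" for \<phi> :: "'v set \<times> ('v \<Rightarrow> 'v set)"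
      and v
  have fanY: "finite (fst \<phi>)" "fst \<phi> \<subseteq> B" if "fan adj V B x \<phi>" for x \<phi>
    using that finB finite_subset by (auto simp: fan_def)
  obtain \<Phi> where \<Phi>0: "\<And>\<sigma>. \<sigma> \<in> S \<Longrightarrow> \<Phi> \<sigma> \<in> {\<phi>. fan adj V B (fst \<sigma>) \<phi>}"
    and opt0: "\<And>\<sigma> \<phi>. \<sigma> \<in> S \<Longrightarrow> \<phi> \<in> {\<phi>. fan adj V B (fst \<sigma>) \<phi>} \<Longrightarrow>
      real (card (fst \<phi>)) - (\<Sum>v\<in>V. ((\<Sum>\<tau>\<in>S. N (\<Phi> \<tau>) v) / real M / (2 * A)) * N \<phi> v) \<le>
      real (card (fst (\<Phi> \<sigma>))) - (\<Sum>v\<in>V. ((\<Sum>\<tau>\<in>S. N (\<Phi> \<tau>) v) / real M / (2 * A)) * N (\<Phi> \<sigma>) v) +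
          real (card V) * n\<^sup>2 / (4 * A * real M)"
  proof (rule potential_maximiser[OF Sf(1), where T = "\<lambda>\<sigma>. {\<phi>. fan adj V B (fst \<sigma>) \<phi>}" and N = N
      and n = n and A = A and M = "real M"
        and sz = "\<lambda>\<phi>. real (card (fst \<phi>))" and V = V])
    show "finite {\<phi>. fan adj V B (fst \<sigma>) \<phi>} \<and> {\<phi>. fan adj V B (fst \<sigma>) \<phi>} \<noteq> {}" for \<sigma> :: "'v \<times> nat"
      using finite_fans[OF V(1) finB, of adj "fst \<sigma>"] empty_fan[of adj V B "fst \<sigma>"] by blast
    show "0 \<le> N \<phi> v \<and> N \<phi> v \<le> n" if "\<phi> \<in> {\<phi>. fan adj V B (fst \<sigma>) \<phi>}" for \<phi> v and \<sigma> :: "'v \<times> nat"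
    proof -
      have "card {y \<in> fst \<phi>. v \<in> snd \<phi> y} \<le> card B" using fanY[of "fst \<sigma>" \<phi>] that finB
          by (intro card_mono) auto
      then show ?thesis by (simp add: N_def n_def)
    qed
  qed (use A0 M0 in auto)
  have \<Phi>: "fan adj V B (fst \<sigma>) (\<Phi> \<sigma>)" if "\<sigma> \<in> S" for \<sigma> using \<Phi>0[OF that] by simp
  define c where "c v = (\<Sum>\<tau>\<in>S. N (\<Phi> \<tau>) v) / real M" for v
  define \<omega> where "\<omega> v = c v / (2 * A)" for v
  have c0': "c v \<ge> 0" for v unfolding c_def N_def by (intro divide_nonneg_nonneg sum_nonneg) auto
  have \<omega>0: "\<omega> v \<ge> 0" for v using c0' A0 by (simp add: \<omega>_def)
  have gain: "real (card (fst \<phi>)) - (\<Sum>v\<in>V. \<omega> v * N \<phi> v) = (\<Sum>y\<in>fst \<phi>. 1 - sum \<omega> (snd \<phi> y))"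
      if "fan adj V B x \<phi>" for x \<phi>
    unfolding N_def by (rule fan_gain[OF V(1) finB that])
  have opt: "(\<Sum>y\<in>fst \<psi>. 1 - sum \<omega> (snd \<psi> y)) \<le> (\<Sum>y\<in>fst (\<Phi> \<sigma>). 1 - sum \<omega> (snd (\<Phi> \<sigma>) y)) + \<epsilon>"
    if "\<sigma> \<in> S" "fan adj V B (fst \<sigma>) \<psi>" for \<sigma> \<psi>
    using opt0[OF that(1), of \<psi>] that(2) gain[OF that(2)] gain[OF \<Phi>[OF that(1)]]
        by (simp add: \<omega>_def c_def \<epsilon>_def)
  define T where "T = (\<Sum>\<sigma>\<in>S. real (card (fst (\<Phi> \<sigma>)))) / real M"
  \<comment> \<open>An optimal fan is not worse than the empty one, so its priced load is at most
    its size, up to \<open>\<epsilon>\<close>.\<close>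
  have en: "(\<Sum>v\<in>V. \<omega> v * c v) \<le> T + 1"
  proof -
    have "(\<Sum>v\<in>V. \<omega> v * N (\<Phi> \<sigma>) v) \<le> real (card (fst (\<Phi> \<sigma>))) + \<epsilon>" if "\<sigma> \<in> S" for \<sigma>
      using opt[OF that empty_fan] gain[OF \<Phi>[OF that]] by simp
    then have "(\<Sum>\<sigma>\<in>S. \<Sum>v\<in>V. \<omega> v * N (\<Phi> \<sigma>) v) \<le> (\<Sum>\<sigma>\<in>S. real (card (fst (\<Phi> \<sigma>))) + \<epsilon>)"
        by (rule sum_mono)
    also have "\<dots> = real M * T + real (card S) * \<epsilon>" using M0 by (simp add: sum.distrib T_def)
    finally have "(\<Sum>\<sigma>\<in>S. \<Sum>v\<in>V. \<omega> v * N (\<Phi> \<sigma>) v) \<le> real M * (T + n * \<epsilon>)"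
        by (simp add: cS algebra_simps)
    moreover have "(\<Sum>\<sigma>\<in>S. \<Sum>v\<in>V. \<omega> v * N (\<Phi> \<sigma>) v) = real M * (\<Sum>v\<in>V. \<omega> v * c v)"
    proof -
      have "(\<Sum>\<sigma>\<in>S. \<omega> v * N (\<Phi> \<sigma>) v) = real M * (\<omega> v * c v)" for v
        unfolding c_def using M0 by (simp add: sum_distrib_left[symmetric])
      then show ?thesis by (subst sum.swap) (simp add: sum_distrib_left)
    qed
    ultimately have "(\<Sum>v\<in>V. \<omega> v * c v) \<le> T + n * \<epsilon>" using M0 by simp
    then show ?thesis using \<epsilon>n by linarith
  qed
  have c2: "(\<Sum>v\<in>V. (c v)\<^sup>2) = 2 * A * (\<Sum>v\<in>V. \<omega> v * c v)"
    using A0 by (simp add: \<omega>_def sum_distrib_left power2_eq_square)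
  have nK: "n\<^sup>2 / real K \<ge> 64 * n"
  proof -
    have "64 * real K * n \<le> n * n" using n64 n0 by (intro mult_right_mono) auto
    then show ?thesis using K1 by (simp add: field_simps power2_eq_square)
  qed
  have TK: "T \<le> n\<^sup>2 / real K"
  proof (rule ccontr)
    assume "\<not> T \<le> n\<^sup>2 / real K"
    then have Tbig: "T > n\<^sup>2 / real K" by simp
    then have T64: "T > 64 * n" using nK by linarith
    then have T1: "T \<ge> 1" using n64 K1 by linarith
    have c2T: "(\<Sum>v\<in>V. (c v)\<^sup>2) \<le> n\<^sup>2 * T / (4 * (real m)\<^sup>2)"
    proof -
      have "(\<Sum>v\<in>V. (c v)\<^sup>2) \<le> 2 * A * (2 * T)" unfolding c2 using en T1 A0
          by (intro mult_left_mono) auto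
      also have "\<dots> = n\<^sup>2 * T / (4 * (real m)\<^sup>2)" by (simp add: A_def)
      finally show ?thesis .
    qed
    let ?p = "\<lambda>v. avg S (\<lambda>\<sigma>. avg B (\<lambda>b. of_bool (v \<in> snd (\<Phi> \<sigma>) b)))"
    have Nsum: "(\<Sum>b\<in>B. of_bool (v \<in> snd (\<Phi> \<sigma>) b)) = N (\<Phi> \<sigma>) v" if s: "\<sigma> \<in> S" for \<sigma> v
    proof -
      have "(\<Sum>b\<in>B. of_bool (v \<in> snd (\<Phi> \<sigma>) b)) = real (card {b \<in> B. v \<in> snd (\<Phi> \<sigma>) b})"
        using finB by (simp add: Int_def)
      moreover have "{b \<in> B. v \<in> snd (\<Phi> \<sigma>) b} = {y \<in> fst (\<Phi> \<sigma>). v \<in> snd (\<Phi> \<sigma>) y}"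
        using \<Phi>[OF s] unfolding fan_def by blast
      ultimately show ?thesis by (simp add: N_def)
    qed
    have p: "?p v = c v / n\<^sup>2" for v
    proof -
      have "?p v = avg S (\<lambda>\<sigma>. N (\<Phi> \<sigma>) v / n)" by (rule avg_cong) (simp only: avg_def Nsum n_def)
      also have "\<dots> = (\<Sum>\<sigma>\<in>S. N (\<Phi> \<sigma>) v) / n / (n * real M)"
          by (simp add: avg_def cS sum_divide_distrib)
      also have "\<dots> = c v / n\<^sup>2" by (simp add: c_def power2_eq_square field_simps)
      finally show ?thesis .
    qed
    define CB where "CB = (\<Sum>b\<in>B. c b)"
    have avgB: "avg B ?p = CB / n ^ 3"
      unfolding p by (simp add: avg_def CB_def n_def sum_divide_distrib[symmetric] power2_eq_square
          power3_eq_cube)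
    have avgS: "avg S (\<lambda>\<sigma>. ?p (fst \<sigma>)) = CB / n ^ 3"
    proof -
      have "(\<Sum>\<sigma>\<in>S. c (fst \<sigma>) / n\<^sup>2) = (\<Sum>x\<in>B. \<Sum>k<M. c x / n\<^sup>2)"
        unfolding S_def by (subst sum.cartesian_product) (simp only: case_prod_unfold)
      also have "\<dots> = real M * CB / n\<^sup>2" by (simp add: CB_def sum_distrib_left sum_divide_distrib)
      finally show ?thesis unfolding p unfolding avg_def cS using M0 n0
          by (simp add: power2_eq_square power3_eq_cube)
    qed
    have avgE: "avg S (\<lambda>\<sigma>. avg B (\<lambda>b. of_bool (b \<in> fst (\<Phi> \<sigma>)))) = T / n\<^sup>2"
    proof -
      have "avg B (\<lambda>b. of_bool (b \<in> fst (\<Phi> \<sigma>))) = real (card (fst (\<Phi> \<sigma>))) / n" if "\<sigma> \<in> S" for \<sigma>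
      proof -
        have "B \<inter> fst (\<Phi> \<sigma>) = fst (\<Phi> \<sigma>)" using fanY(2)[OF \<Phi>[OF that]] by blast
        then show ?thesis using finB by (simp add: avg_def n_def)
      qed
      then have "avg S (\<lambda>\<sigma>. avg B (\<lambda>b. of_bool (b \<in> fst (\<Phi> \<sigma>)))) =
          avg S (\<lambda>\<sigma>. real (card (fst (\<Phi> \<sigma>))) / n)" by (rule avg_cong)
      also have "\<dots> = (\<Sum>\<sigma>\<in>S. real (card (fst (\<Phi> \<sigma>)))) / n / (n * real M)"
          by (simp add: avg_def cS sum_divide_distrib)
      finally show ?thesis by (simp add: T_def power2_eq_square field_simps)
    qed
    have main: "real m ^ 2 * (T / n\<^sup>2) - real m ^ 4 * (\<Sum>v\<in>V. (c v / n\<^sup>2)\<^sup>2) - real m ^ 3 * (CB / n ^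
        3 + CB / n ^ 3) \<le> 6 * real m + 6 * real g"
    proof -
      have sf: "fst \<sigma> \<in> B \<and> fan adj V B (fst \<sigma>) (\<Phi> \<sigma>)" if "\<sigma> \<in> S" for \<sigma> using \<Phi>[OF that] that
          by (auto simp: S_def)
      from fan_crossing_bound[where src = fst and \<Phi> = \<Phi> and S = S
          and m = m, OF mb V(2,1) BV Bne Sf sf]
      show ?thesis unfolding avgB avgS avgE unfolding p .
    qed
    have t2: "real m ^ 4 * (\<Sum>v\<in>V. (c v / n\<^sup>2)\<^sup>2) \<le> (real m)\<^sup>2 * T / (4 * n\<^sup>2)"
    proof -
      have "(\<Sum>v\<in>V. (c v / n\<^sup>2)\<^sup>2) = (\<Sum>v\<in>V. (c v)\<^sup>2) / n ^ 4"
          by (simp add: power_divide sum_divide_distrib flip: power_mult)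
      also have "\<dots> \<le> (n\<^sup>2 * T / (4 * (real m)\<^sup>2)) / n ^ 4" using c2T n0
          by (intro divide_right_mono) auto
      finally have "real m ^ 4 * (\<Sum>v\<in>V. (c v / n\<^sup>2)\<^sup>2) \<le> real m ^ 4 * ((n\<^sup>2 * T / (4 * (real m)\<^sup>2))
          / n ^ 4)" by (intro mult_left_mono) auto
      also have "\<dots> = (real m)\<^sup>2 * T / (4 * n\<^sup>2)" using m0 n0
          by (simp add: power2_eq_square power4_eq_xxxx field_simps)
      finally show ?thesis .
    qed
    \<comment> \<open>Demands that run into foreign terminals: Cauchy-Schwarz bounds the congestion
      on \<open>B\<close> by the squared congestion on \<open>V\<close>, and
      \<open>T > 64 * n\<close> absorbs the resulting factor \<open>n\<close>.\<close>
    have t3: "real m ^ 3 * (CB / n ^ 3 + CB / n ^ 3) \<le> (real m)\<^sup>2 * T / (4 * n\<^sup>2)"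
    proof -
      have "CB\<^sup>2 \<le> n * (\<Sum>b\<in>B. (c b)\<^sup>2)"
        using sum_squared_le_sum_of_squares[of c B] by (simp add: CB_def n_def mult.commute)
      also have "\<dots> \<le> n * (\<Sum>v\<in>V. (c v)\<^sup>2)" using n0 V(1) BV by (intro mult_left_mono sum_mono2) auto
      also have "\<dots> \<le> n * (n\<^sup>2 * T / (4 * (real m)\<^sup>2))" using c2T n0 by (intro mult_left_mono) auto
      finally have a: "CB\<^sup>2 \<le> n ^ 3 * T / (4 * (real m)\<^sup>2)"
          by (simp add: power2_eq_square power3_eq_cube)
      have "(8 * real m * CB)\<^sup>2 = 64 * (real m)\<^sup>2 * CB\<^sup>2" by (simp add: power_mult_distrib)
      also have "\<dots> \<le> 64 * (real m)\<^sup>2 * (n ^ 3 * T / (4 * (real m)\<^sup>2))" using a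
          by (intro mult_left_mono) auto
      also have "\<dots> = 16 * n * (n\<^sup>2 * T)" using m0 by (simp add: power2_eq_square power3_eq_cube)
      also have "\<dots> \<le> T * (n\<^sup>2 * T)" using T64 n0 T1 by (intro mult_right_mono) auto
      also have "\<dots> = (n * T)\<^sup>2" by (simp add: power2_eq_square)
      finally have "8 * real m * CB \<le> n * T" using n0 T1
          by (intro power2_le_imp_le[of "8 * real m * CB"]) auto
      then have "(real m)\<^sup>2 * (8 * real m * CB) \<le> (real m)\<^sup>2 * (n * T)"
          by (intro mult_left_mono) auto
      then show ?thesis using n0 by (simp add: field_simps power2_eq_square power3_eq_cube)
    qed
    have "(real m)\<^sup>2 * T / (2 * n\<^sup>2) \<le> 6 * real m + 6 * real g"
    proof -
      define X where "X = (real m)\<^sup>2 * T / n\<^sup>2"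
      have "real m ^ 2 * (T / n\<^sup>2) = X" "(real m)\<^sup>2 * T / (4 * n\<^sup>2) = X / 4"
          "(real m)\<^sup>2 * T / (2 * n\<^sup>2) = X / 2"
        by (simp_all add: X_def)
      then show ?thesis using main t2 t3 by linarith
    qed
    also have "\<dots> \<le> 12 * real m"
    proof -
      have "real g \<le> real K" using K(2) by simp
      then show ?thesis using m K1 by linarith
    qed
    finally have "(real m)\<^sup>2 * T \<le> 12 * real m * (2 * n\<^sup>2)" using n0 by (simp add: pos_divide_le_eq)
    then have "real m * (real m * T) \<le> real m * (24 * n\<^sup>2)"
        by (simp add: power2_eq_square algebra_simps)
    then have "real m * T \<le> 24 * n\<^sup>2" using m0 by simp
    moreover have "n\<^sup>2 < real K * T" using Tbig K1 by (simp add: pos_divide_less_eq mult.commute)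
    moreover have "n\<^sup>2 > 0" using n0 by simp
    ultimately show False using m by (simp add: mult.assoc)
  qed
  \<comment> \<open>\<open>8 * card B * card V\<close> keeps the accumulated rounding error below
    \<open>1/8\<close>, and \<open>c0\<close> provides the divisibility.\<close>
  define Q where "Q = c0 * (8 * card B * card V)"
  have cV1: "card V \<ge> 1" "card B \<ge> 1" using Bne BV V(1) finB by (auto simp: Suc_le_eq card_gt_0_iff)
  have QV: "8 * card B * card V \<le> Q" using c0 unfolding Q_def by simp
  have Q1: "Q \<ge> 1" "card V \<le> Q"
  proof -
    have "1 * card V \<le> 8 * card B * card V" using cV1 by (intro mult_right_mono) auto
    then have "card V \<le> 8 * card B * card V" by (simp only: mult_1)
    then show "card V \<le> Q" using QV by (rule le_trans)
    then show "Q \<ge> 1" using cV1 by simp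
  qed
  define \<nu> where "\<nu> v = nat \<lfloor>real Q * \<omega> v\<rfloor> + 1" for v
  have \<nu>1: "\<nu> v \<ge> 1" for v by (simp add: \<nu>_def)
  have \<nu>2: "real Q * \<omega> v \<le> real (\<nu> v)" "real (\<nu> v) \<le> real Q * \<omega> v + 1" for v
  proof -
    have "real Q * \<omega> v \<ge> 0" using \<omega>0 by simp
    then show "real Q * \<omega> v \<le> real (\<nu> v)" "real (\<nu> v) \<le> real Q * \<omega> v + 1" unfolding \<nu>_def
        by linarith+
  qed
  \<comment> \<open>For \<open>m = 25 * K\<close> the bound \<open>16 * m\<^sup>2 / K\<close> equals
    \<open>10000 * K\<close>. Rounding at most adds 1 to \<open>Q * \<omega> v\<close>, which at
    most doubles the squares and adds 2 for each vertex; this gives 20002.\<close>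
  have \<omega>2: "(\<Sum>v\<in>V. (\<omega> v)\<^sup>2) \<le> 10000 * real K"
  proof -
    have "(\<Sum>v\<in>V. (\<omega> v)\<^sup>2) = (\<Sum>v\<in>V. \<omega> v * c v) / (2 * A)"
      by (simp add: \<omega>_def power2_eq_square sum_divide_distrib)
    also have "\<dots> \<le> (T + 1) / (2 * A)" using en A0 by (intro divide_right_mono) auto
    also have "\<dots> \<le> (2 * (n\<^sup>2 / real K)) / (2 * A)"
    proof (rule divide_right_mono)
      have "1 \<le> n\<^sup>2 / real K" using nK n64 K1 by linarith
      then show "T + 1 \<le> 2 * (n\<^sup>2 / real K)" using TK by linarith
    qed (use A0 in simp)
    also have "\<dots> = 16 * (real m)\<^sup>2 / real K" using n0 by (simp add: A_def)
    also have "\<dots> = 10000 * real K" using K1 by (simp add: m power2_eq_square)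
    finally show ?thesis .
  qed
  have "real (\<Sum>v\<in>V. (\<nu> v)\<^sup>2) \<le> 20002 * real K * (real Q)\<^sup>2"
  proof -
    have "(real (\<nu> v))\<^sup>2 \<le> 2 * (real Q)\<^sup>2 * (\<omega> v)\<^sup>2 + 2" for v
    proof -
      have "(real (\<nu> v))\<^sup>2 \<le> (real Q * \<omega> v + 1)\<^sup>2" using \<nu>2(2) by (intro power_mono) auto
      also have "\<dots> \<le> 2 * (real Q * \<omega> v)\<^sup>2 + 2" using sum_squares_ge_zero[of "real Q * \<omega> v - 1" 0]
        by (simp add: power2_eq_square algebra_simps)
      finally show ?thesis by (simp add: power_mult_distrib)
    qed
    then have "(\<Sum>v\<in>V. (real (\<nu> v))\<^sup>2) \<le> (\<Sum>v\<in>V. 2 * (real Q)\<^sup>2 * (\<omega> v)\<^sup>2 + 2)" by (rule sum_mono)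
    also have "\<dots> = 2 * (real Q)\<^sup>2 * (\<Sum>v\<in>V. (\<omega> v)\<^sup>2) + 2 * real (card V)"
        by (simp add: sum.distrib sum_distrib_left)
    also have "\<dots> \<le> 2 * (real Q)\<^sup>2 * (10000 * real K) + 2 * (real K * (real Q)\<^sup>2)"
    proof (intro add_mono mult_left_mono \<omega>2)
      have "real (card V) \<le> real Q" using Q1 by simp
      also have "\<dots> \<le> (real Q)\<^sup>2" using Q1 by (simp add: power2_eq_square)
      also have "\<dots> \<le> real K * (real Q)\<^sup>2" using K1 mult_right_mono[OF K1, of "(real Q)\<^sup>2"] by simp
      finally show "real (card V) \<le> real K * (real Q)\<^sup>2" .
    qed auto
    finally show ?thesis by simp
  qed
  moreover have "real K * real (card {(x, y). x \<in> B \<and> y \<in> B \<and> x \<noteq> y \<and> close adj V \<nu> L x y}) \<le> n\<^sup>2"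
      if L: "2 * L \<le> Q" for L
  proof -
    define P where "P x = {y \<in> B. x \<noteq> y \<and> close adj V \<nu> L x y}" for x
    have sub: "P x \<subseteq> fst (\<Phi> (x, k))" if xk: "x \<in> B" "k < M" for x k
    proof
      fix y assume y: "y \<in> P x"
      have s: "(x, k) \<in> S" using xk by (simp add: S_def)
      show "y \<in> fst (\<Phi> (x, k))"
      proof (rule optimal_fan_contains_close[OF V BV, where \<nu> = \<nu> and Q = Q and \<omega> = \<omega> and x = x
          and L = L])
        show "x \<in> V" using xk BV by blast
        show "8 * real (card B) * real (card V) \<le> real Q" using QV
            by (metis of_nat_le_iff of_nat_mult of_nat_numeral)
        show "fan adj V B x (\<Phi> (x, k))" using \<Phi>[OF s] by simp
        show "(\<Sum>y\<in>fst \<psi>. 1 - sum \<omega> (snd \<psi> y)) \<le> (\<Sum>y\<in>fst (\<Phi> (x, k)). 1 - sum \<omega> (snd (\<Phi> (x, k)) y)) +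
            1/4"
          if "fan adj V B x \<psi>" for \<psi> using opt[OF s, of \<psi>] that \<epsilon>4 by simp
        show "2 * L \<le> Q" by (rule L)
      qed (use \<nu>1 \<nu>2 Q1 y in \<open>auto simp: P_def\<close>)
    qed
    have "{(x, y). x \<in> B \<and> y \<in> B \<and> x \<noteq> y \<and> close adj V \<nu> L x y} = Sigma B P" by (auto simp: P_def)
    moreover have "finite (P x)" for x using finB by (simp add: P_def)
    ultimately have cP: "card {(x, y). x \<in> B \<and> y \<in> B \<and> x \<noteq> y \<and> close adj V \<nu> L x y} =
        (\<Sum>x\<in>B. card (P x))"
      using finB by (simp add: card_SigmaI)
    have "real M * (\<Sum>x\<in>B. real (card (P x))) = (\<Sum>x\<in>B. \<Sum>k<M. real (card (P x)))"
        by (simp add: sum_distrib_left)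
    also have "\<dots> \<le> (\<Sum>x\<in>B. \<Sum>k<M. real (card (fst (\<Phi> (x, k)))))"
    proof (intro sum_mono)
      fix x k assume h: "x \<in> B" "k \<in> {..<M}"
      then have "(x, k) \<in> S" by (simp add: S_def)
      then have "finite (fst (\<Phi> (x, k)))" using fanY(1)[OF \<Phi>] by blast
      then show "real (card (P x)) \<le> real (card (fst (\<Phi> (x, k))))" using sub[of x k] h
          by (simp add: card_mono)
    qed
    also have "\<dots> = real M * T" using M0 by (simp add: T_def S_def sum.cartesian_product
        case_prod_unfold)
    finally have "(\<Sum>x\<in>B. real (card (P x))) \<le> T" using M0 by simp
    then have "(\<Sum>x\<in>B. real (card (P x))) \<le> n\<^sup>2 / real K" using TK by linarith
    then have "real K * (\<Sum>x\<in>B. real (card (P x))) \<le> n\<^sup>2" using K1 by (simp add: field_simps)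
    then show ?thesis unfolding cP by simp
  qed
  moreover have "c0 dvd Q" by (simp add: Q_def)
  ultimately show ?thesis using Q1(1) \<nu>1 unfolding n_def by blast
qed

section \<open>Chopping into annuli\<close>

definition dist_from :: "('v \<Rightarrow> 'v \<Rightarrow> bool) \<Rightarrow> ('v \<Rightarrow> nat) \<Rightarrow> 'v set \<Rightarrow> 'v \<Rightarrow> ('v \<Rightarrow> nat) \<Rightarrow> bool" where
  "dist_from adj \<nu> C r \<rho> \<longleftrightarrow> r \<in> C \<and> \<rho> r = 0 \<and> (\<forall>x\<in>C. \<forall>y\<in>C. adj x y \<longrightarrow> \<rho> y \<le> \<rho> x + \<nu> y) \<and>
     (\<forall>x\<in>C. x \<noteq> r \<longrightarrow> (\<exists>y\<in>C. adj y x \<and> \<rho> x = \<rho> y + \<nu> x))"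

text \<open>Parents are followed until \<open>T\<close> is met for the first time. The values of
  \<open>\<rho>\<close> drop strictly, so the walk cannot continue forever and ends at the root at
  the latest.\<close>

lemma descending_path:
  assumes d: "dist_from adj \<nu> C r \<rho>" and \<nu>: "\<And>x. x \<in> C \<Longrightarrow> \<nu> x \<ge> (1::nat)"
    and u: "u \<in> C" "u \<notin> T" and r: "r \<in> T"
  obtains f k where "f 0 = u" "k \<ge> (1::nat)" "\<And>j. j < k \<Longrightarrow> f j \<in> C - T" "f k \<in> C \<inter> T"
    "\<And>j. j < k \<Longrightarrow> adj (f (Suc j)) (f j) \<and> \<rho> (f j) = \<rho> (f (Suc j)) + \<nu> (f j)"
proof -
  have "\<exists>p. \<forall>x. x \<in> C \<longrightarrow> x \<noteq> r \<longrightarrow> p x \<in> C \<and> adj (p x) x \<and> \<rho> x = \<rho> (p x) + \<nu> x"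
    by (rule choice) (use d in \<open>unfold dist_from_def, blast\<close>)
  then obtain p where p: "\<And>x. x \<in> C \<Longrightarrow> x \<noteq> r \<Longrightarrow> p x \<in> C \<and> adj (p x) x \<and> \<rho> x = \<rho> (p x) + \<nu> x" by blast
  define f where "f j = (p ^^ j) u" for j
  have f0: "f 0 = u" by (simp add: f_def)
  have fS: "f (Suc j) = p (f j)" for j by (simp add: f_def)
  have ex: "\<exists>j. f j \<in> T"
  proof (rule ccontr)
    assume no: "\<not> (\<exists>j. f j \<in> T)"
    have "f j \<in> C \<and> \<rho> (f j) + j \<le> \<rho> u" for j
    proof (induction j)
      case 0 then show ?case using u f0 by simp
    next
      case (Suc j)
      then have "f j \<noteq> r" using no r by metis
      then have "p (f j) \<in> C" "\<rho> (f j) = \<rho> (p (f j)) + \<nu> (f j)" using p Suc by auto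
      then show ?case using Suc \<nu>[of "f j"] unfolding fS by simp
    qed
    from this[of "Suc (\<rho> u)"] show False by simp
  qed
  define k where "k = (LEAST j. f j \<in> T)"
  have kT: "f k \<in> T" unfolding k_def using ex by (rule LeastI_ex)
  have lt: "f j \<notin> T" if "j < k" for j using that not_less_Least unfolding k_def by blast
  have fC: "f j \<in> C" if "j \<le> k" for j
    using that
  proof (induction j)
    case 0 then show ?case using u f0 by simp
  next
    case (Suc j)
    then have "f j \<notin> T" using lt by simp
    then have "f j \<noteq> r" using r by blast
    then show ?case using p Suc unfolding fS by simp
  qed
  show thesis
  proof (rule that[of f k])
    show "f 0 = u" by (rule f0)
    show "k \<ge> 1" using kT u f0 by (cases k) auto
    show "f j \<in> C - T" if "j < k" for j using lt fC that by simp
    show "f k \<in> C \<inter> T" using kT fC by simp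
    show "adj (f (Suc j)) (f j) \<and> \<rho> (f j) = \<rho> (f (Suc j)) + \<nu> (f j)" if "j < k" for j
    proof -
      have "f j \<noteq> r" using lt[OF that] r by blast
      then show ?thesis using p[OF fC[of j]] that unfolding fS by simp
    qed
  qed
qed

lemma descending_telescope:
  assumes "\<And>j. j < k \<Longrightarrow> \<rho> (f j) = \<rho> (f (Suc j)) + (\<nu> (f j) :: nat)" "i \<le> k"
  shows "(\<Sum>j<i. \<nu> (f j)) + \<rho> (f i) = \<rho> (f 0)"
  using assms(2) by (induction i) (use assms(1) in \<open>auto simp: Suc_le_eq\<close>)

lemma descending_mono:
  assumes "\<And>j. j < k \<Longrightarrow> \<rho> (f j) = \<rho> (f (Suc j)) + (\<nu> (f j) :: nat)" "i \<le> j" "j \<le> k"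
  shows "\<rho> (f j) \<le> \<rho> (f i)"
  using assms(2,3)
proof (induction j rule: dec_induct)
  case (step n)
  then show ?case using assms(1)[of n] by simp
qed simp

lemma descending_conn:
  assumes "symp adj" "\<And>j. Suc j < i \<Longrightarrow> adj (f (Suc j)) (f j)"
  shows "conn adj (f ` {..<i})"
proof (rule conn_star[OF assms(1), of _ "f 0"])
  fix y assume "y \<in> f ` {..<i}"
  then obtain j where j: "y = f j" "j < i" by auto
  show "(\<lambda>a b. adj a b \<and> a \<in> f ` {..<i} \<and> b \<in> f ` {..<i})\<^sup>*\<^sup>* (f 0) y"
    unfolding j(1) using j(2)
  proof (induction j)
    case (Suc j)
    have "adj (f j) (f (Suc j))" using assms Suc.prems by (meson sympD)
    then show ?case using Suc by (intro rtranclp.rtrancl_into_rtrancl[OF Suc.IH]) auto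
  qed simp
qed

lemma sum_descending_le: "sum \<nu> (f ` {..<i}) \<le> (\<Sum>j<(i::nat). \<nu> (f j) :: nat)"
  using sum_image_le[of "{..<i}" \<nu> f] by (simp add: o_def)

lemma close_trans:
  assumes "symp adj" "finite X" "close adj X \<nu> a x y" "close adj X \<nu> b y z"
  shows "close adj X \<nu> (a + b) x z"
proof -
  obtain U where U: "U \<subseteq> X" "conn adj U" "x \<in> U" "y \<in> U" "sum \<nu> U \<le> a" using assms(3)
      unfolding close_def by blast
  obtain W where W: "W \<subseteq> X" "conn adj W" "y \<in> W" "z \<in> W" "sum \<nu> W \<le> b" using assms(4)
      unfolding close_def by blast
  have fin: "finite U" "finite W" using U W assms(2) finite_subset by blast+
  have "sum \<nu> (U \<union> W) \<le> sum \<nu> U + sum \<nu> W" using sum.union_inter[OF fin, of \<nu>] by simp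
  moreover have "conn adj (U \<union> W)" by (rule conn_Un[OF assms(1) U(2) W(2)]) (use U W in blast)
  ultimately show ?thesis unfolding close_def using U W by (intro exI[of _ "U \<union> W"]) auto
qed

lemma close_sym: "close adj X \<nu> a x y \<Longrightarrow> close adj X \<nu> a y x"
  unfolding close_def by blast

lemma close_mono: "close adj X \<nu> a x y \<Longrightarrow> X \<subseteq> X' \<Longrightarrow> a \<le> b \<Longrightarrow> close adj X' \<nu> b x y"
  unfolding close_def by (meson order_trans)

text \<open>One round passes to a component of an annulus of width \<open>W\<close> about a root,
  with distances measured inside the previous cluster. \<open>low\<close> is an integer since a
  shifted annulus may begin below 0.\<close>

inductive chopped :: "('v \<Rightarrow> 'v \<Rightarrow> bool) \<Rightarrow> ('v \<Rightarrow> nat) \<Rightarrow> nat \<Rightarrow> 'v set \<Rightarrow> nat \<Rightarrow> 'v set \<Rightarrow> bool"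
  for adj \<nu> W X where
  chopped_0: "C \<subseteq> X \<Longrightarrow> conn adj C \<Longrightarrow> chopped adj \<nu> W X 0 C"
| chopped_Suc: "chopped adj \<nu> W X i C \<Longrightarrow> dist_from adj \<nu> C r \<rho> \<Longrightarrow> C' \<subseteq> C \<Longrightarrow> conn adj C' \<Longrightarrow>
    (\<And>x. x \<in> C' \<Longrightarrow> (low::int) \<le> int (\<rho> x) \<and> int (\<rho> x) < low + int W) \<Longrightarrow>
    (\<And>x y. x \<in> C' \<Longrightarrow> y \<in> C \<Longrightarrow> adj x y \<Longrightarrow> low \<le> int (\<rho> y) \<Longrightarrow> int (\<rho> y) < low + int W \<Longrightarrow> y \<in> C') \<Longrightarrow>
    chopped adj \<nu> W X (Suc i) C'"

lemma chopped_subset: "chopped adj \<nu> W X i C \<Longrightarrow> C \<subseteq> X"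
  by (induction rule: chopped.induct) auto

text \<open>A partial \<open>K\<^bsub>j,card Y\<^esub>\<close> minor with hubs \<open>H k\<close> and one branch set \<open>A y\<close> around each \<open>y \<in> Y\<close>. Short walks
  from the representative \<open>p y\<close> avoid the hubs, so that the branch set can be prolonged to the next hub.\<close>

definition hub_minor :: "('v \<Rightarrow> 'v \<Rightarrow> bool) \<Rightarrow> ('v \<Rightarrow> nat) \<Rightarrow> nat \<Rightarrow> 'v set \<Rightarrow> 'v set \<Rightarrow> nat \<Rightarrow> 'v set \<Rightarrow>
    ('v \<Rightarrow> 'v set) \<Rightarrow> ('v \<Rightarrow> 'v) \<Rightarrow> (nat \<Rightarrow> 'v set) \<Rightarrow> bool" where
  "hub_minor adj \<nu> W X Y j C A p H \<longleftrightarrow>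
     (\<forall>y\<in>Y. conn adj (A y) \<and> y \<in> A y \<and> p y \<in> A y \<and> A y \<subseteq> C \<and> (\<forall>z\<in>A y. close adj X \<nu> (W +
         8 * W * j) y z)) \<and>
     (\<forall>k<j. H k \<noteq> {} \<and> conn adj (H k) \<and> H k \<subseteq> C) \<and>
     (\<forall>k<j. \<forall>l<j. k \<noteq> l \<longrightarrow> H k \<inter> H l = {}) \<and>
     (\<forall>y\<in>Y. \<forall>k<j. A y \<inter> H k = {} \<and> (\<exists>a\<in>A y. \<exists>b\<in>H k. adj a b)) \<and>
     (\<forall>y\<in>Y. \<forall>k<j. \<forall>U. U \<subseteq> C \<longrightarrow> conn adj U \<longrightarrow> p y \<in> U \<longrightarrow> sum \<nu> U \<le> 2 * W \<longrightarrow> U \<inter> H k = {})"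

lemma hub_minor_branch:
  assumes "hub_minor adj \<nu> W X Y j C A p H" "y \<in> Y"
  shows "conn adj (A y)" "y \<in> A y" "p y \<in> A y" "A y \<subseteq> C"
      "z \<in> A y \<Longrightarrow> close adj X \<nu> (W + 8 * W * j) y z"
  using assms unfolding hub_minor_def by (elim conjE; simp)+

lemma hub_minor_hub:
  assumes "hub_minor adj \<nu> W X Y j C A p H" "k < j"
  shows "H k \<noteq> {}" "conn adj (H k)" "H k \<subseteq> C" "l < j \<Longrightarrow> k \<noteq> l \<Longrightarrow> H k \<inter> H l = {}"
    "y \<in> Y \<Longrightarrow> A y \<inter> H k = {}" "y \<in> Y \<Longrightarrow> \<exists>a\<in>A y. \<exists>b\<in>H k. adj a b"
    "y \<in> Y \<Longrightarrow> U \<subseteq> C \<Longrightarrow> conn adj U \<Longrightarrow> p y \<in> U \<Longrightarrow> sum \<nu> U \<le> 2 * W \<Longrightarrow> U \<inter> H k = {}"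
  using assms unfolding hub_minor_def by (elim conjE; simp)+

lemma dist_from_close_root:
  assumes sym: "symp adj" and X: "finite X" "C \<subseteq> X" and d: "dist_from adj \<nu> C r \<rho>"
      and \<nu>: "\<And>x. x \<in> X \<Longrightarrow> \<nu> x \<ge> (1::nat)"
    and y: "y \<in> C"
  shows "close adj X \<nu> (\<rho> y + \<nu> r) y r"
proof (cases "y = r")
  case True
  then have "\<rho> y = 0" using d by (simp add: dist_from_def)
  then show ?thesis unfolding close_def using True y X by (intro exI[of _ "{r}"]) auto
next
  case False
  obtain f k where f: "f 0 = y" "k \<ge> (1::nat)" "\<And>j. j < k \<Longrightarrow> f j \<in> C - {r}" "f k \<in> C \<inter> {r}"
    "\<And>j. j < k \<Longrightarrow> adj (f (Suc j)) (f j) \<and> \<rho> (f j) = \<rho> (f (Suc j)) + \<nu> (f j)"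
    by (rule descending_path[OF d, of y "{r}"]) (use \<nu> X y False in auto)
  have "conn adj (f ` {..<Suc k})" by (rule descending_conn[OF sym]) (use f(5) in auto)
  moreover have "sum \<nu> (f ` {..<Suc k}) \<le> \<rho> y + \<nu> r"
  proof -
    have "sum \<nu> (f ` {..<Suc k}) \<le> (\<Sum>j<Suc k. \<nu> (f j))" by (rule sum_descending_le)
    also have "\<dots> = (\<Sum>j<k. \<nu> (f j)) + \<nu> r" using f(4) by simp
    also have "(\<Sum>j<k. \<nu> (f j)) \<le> \<rho> y" using descending_telescope[of k \<rho> f \<nu> k] f(1,5) by simp
    finally show ?thesis by simp
  qed
  moreover have "f ` {..<Suc k} \<subseteq> X" unfolding lessThan_Suc image_insert using f(3,4) X(2) by blast
  moreover have "y \<in> f ` {..<Suc k}" using f(1) by force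
  moreover have "r \<in> f ` {..<Suc k}" using f(4) by force
  ultimately show ?thesis unfolding close_def by blast
qed

lemma dist_from_lipschitz:
  assumes d: "dist_from adj \<nu> C r \<rho>" and U: "U \<subseteq> C" "conn adj U" "finite U"
      "\<And>x. x \<in> U \<Longrightarrow> \<nu> x \<ge> (1::nat)"
    and xy: "x \<in> U" "y \<in> U"
  shows "\<rho> y \<le> \<rho> x + sum \<nu> U"
proof -
  have "\<rho> y + \<nu> x \<le> \<rho> x + sum \<nu> U"
    by (rule conn_lipschitz_le_sum[OF U(2,3) xy U(4)]) (use d U(1) in \<open>auto simp: dist_from_def\<close>)
  then show ?thesis by simp
qed

text \<open>Undoes one round of chopping. The new hub is the ball about the root of all points with
  distance below \<open>low - 6 * W\<close>; it lies inside the annulus' inner rim and so off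
  \<open>C'\<close> and the old hubs. Every branch set is prolonged along a descending path from its
  representative to this ball. Within the annulus the path is light enough for the clearance of the
  representative, and below the annulus there are no old hubs.\<close>

lemma hub_minor_step:
  assumes sym: "symp adj" and X: "finite X" "\<And>x. x \<in> X \<Longrightarrow> 1 \<le> \<nu> x \<and> \<nu> x \<le> W" and CX: "C \<subseteq> X"
    and d: "dist_from adj \<nu> C r \<rho>" and C': "C' \<subseteq> C"
    and ann: "\<And>x. x \<in> C' \<Longrightarrow> (low::int) \<le> int (\<rho> x) \<and> int (\<rho> x) < low + int W"
    and cl: "\<And>x y. x \<in> C' \<Longrightarrow> y \<in> C \<Longrightarrow> adj x y \<Longrightarrow> low \<le> int (\<rho> y) \<Longrightarrow> int (\<rho> y) < low + int W \<Longrightarrow> y \<in> C'"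
    and Y: "Y \<subseteq> C'" "y1 \<in> Y" "y2 \<in> Y" "y1 \<noteq> y2"
    and far: "\<And>y y'. y \<in> Y \<Longrightarrow> y' \<in> Y \<Longrightarrow> y \<noteq> y' \<Longrightarrow> \<not> close adj X \<nu> (16 * W) y y'"
    and hm: "hub_minor adj \<nu> W X Y j C' A p H"
  shows "\<exists>A' p' H'. hub_minor adj \<nu> W X Y (Suc j) C A' p' H'"
proof -
  have rC: "r \<in> C" "\<rho> r = 0" using d by (auto simp: dist_from_def)
  have \<nu>1: "\<nu> x \<ge> 1" "\<nu> x \<le> W" if "x \<in> C" for x using X(2) CX that by auto
  \<comment> \<open>Otherwise every point of \<open>Y\<close> is within \<open>8 * W\<close> of the
    root, and two of them are within \<open>16 * W\<close> of each other.\<close>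
  have low6: "low > 6 * int W"
  proof (rule ccontr)
    assume "\<not> low > 6 * int W"
    then have "close adj X \<nu> (8 * W) y r" if y: "y \<in> Y" for y
    proof -
      have "\<rho> y < 7 * W" using ann[of y] y Y(1) \<open>\<not> low > 6 * int W\<close> by auto
      then have "\<rho> y + \<nu> r \<le> 8 * W" using \<nu>1[OF rC(1)] by simp
      moreover have "close adj X \<nu> (\<rho> y + \<nu> r) y r"
        by (rule dist_from_close_root[OF sym X(1) CX d]) (use X(2) y Y(1) C' in auto)
      ultimately show ?thesis by (rule close_mono[rotated 2]) auto
    qed
    from close_trans[OF sym X(1) this[OF Y(2)] close_sym[OF this[OF Y(3)]]]
    have "close adj X \<nu> (16 * W) y1 y2" by simp
    then show False using far Y by blast
  qed
  define Hn where "Hn = {z \<in> C. int (\<rho> z) + 6 * int W < low}"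
  have rH: "r \<in> Hn" using rC low6 by (simp add: Hn_def)
  have HnC': "Hn \<inter> C' = {}" using ann by (force simp: Hn_def)
  note A0 = hub_minor_branch[OF hm]
  note H0 = hub_minor_hub(1-3)[OF hm]
  note AH = hub_minor_hub(5,6)[OF hm]
  have HH: "H k \<inter> H l = {}" if "k < j" "l < j" "k \<noteq> l" for k l using hub_minor_hub(4)[OF hm that] .
  have clear: "U \<inter> H k = {}" if "y \<in> Y" "k < j" "U \<subseteq> C'" "conn adj U" "p y \<in> U" "sum \<nu> U \<le> 2 * W"
      for y k U
    using hub_minor_hub(7)[OF hm that(2,1,3-6)] .
  have connHn: "conn adj Hn"
  proof (rule conn_star[OF sym, of _ r])
    fix z assume z: "z \<in> Hn"
    let ?R = "\<lambda>a b. adj a b \<and> a \<in> Hn \<and> b \<in> Hn"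
    have "?R\<^sup>*\<^sup>* z r" if "z \<in> Hn" for z
      using that
    proof (induction "\<rho> z" arbitrary: z rule: less_induct)
      case less
      show ?case
      proof (cases "z = r")
        case False
        have zC: "z \<in> C" using less.prems by (simp add: Hn_def)
        then obtain w where w: "w \<in> C" "adj w z" "\<rho> z = \<rho> w + \<nu> z" using d False
            unfolding dist_from_def by blast
        then have "\<rho> w < \<rho> z" using \<nu>1[OF zC] by simp
        moreover have wH: "w \<in> Hn" using w less.prems by (simp add: Hn_def)
        ultimately have "?R\<^sup>*\<^sup>* w r" using less.hyps by blast
        moreover have "?R z w" using w wH less.prems sym by (auto simp: symp_def)
        ultimately show ?thesis by (rule converse_rtranclp_into_rtranclp[rotated])
      qed simp
    qed
    then have "?R\<^sup>*\<^sup>* z r" using z by blast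
    moreover have "symp ?R\<^sup>*\<^sup>*" by (rule symp_rtranclp) (use sym in \<open>auto simp: symp_def\<close>)
    ultimately show "?R\<^sup>*\<^sup>* r z" by (simp add: symp_def)
  qed
  \<comment> \<open>The path descends from below \<open>low + W\<close> to at least
    \<open>low - 6 * W\<close>, and one more vertex weighs at most \<open>W\<close>: together
    \<open>8 * W\<close>. The new representative lies between \<open>low - 4 * W\<close> and
    \<open>low - 3 * W\<close>, so that connected sets of weight \<open>2 * W\<close> around it miss
    both the new hub and the annulus.\<close>
  define P where "P y S v \<longleftrightarrow> conn adj S \<and> p y \<in> S \<and> v \<in> S \<and> S \<subseteq> C \<and> S \<inter> Hn = {} \<and> sum \<nu> S \<le> 8 * W \<and>
      (\<exists>a\<in>S. \<exists>b\<in>Hn. adj a b) \<and>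
      (\<forall>k<j. S \<inter> H k = {}) \<and> low - 4 * int W \<le> int (\<rho> v) \<and> int (\<rho> v) + 3 * int W < low" for y S v
  have "\<exists>S v. P y S v" if y: "y \<in> Y" for y
  proof -
    have pC': "p y \<in> C'" using A0(3,4)[OF y] by blast
    then have pC: "p y \<in> C" "p y \<notin> Hn" using C' HnC' by blast+
    obtain f k where f: "f 0 = p y" "k \<ge> (1::nat)" "\<And>j. j < k \<Longrightarrow> f j \<in> C - Hn" "f k \<in> C \<inter> Hn"
      "\<And>j. j < k \<Longrightarrow> adj (f (Suc j)) (f j) \<and> \<rho> (f j) = \<rho> (f (Suc j)) + \<nu> (f j)"
      by (rule descending_path[OF d \<nu>1(1) pC rH]) blast+
    have step: "\<rho> (f j) = \<rho> (f (Suc j)) + \<nu> (f j)" if "j < k" for j using f(5)[OF that] by simp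
    have tel: "(\<Sum>j<i. \<nu> (f j)) + \<rho> (f i) = \<rho> (p y)" if "i \<le> k" for i
      using descending_telescope[where k = k and \<rho> = \<rho> and f = f and \<nu> = \<nu> and i = i] step that f(1)
          by simp
    have fC: "f i \<in> C" if "i \<le> k" for i using f(3)[of i] f(4) that by (cases "i = k") auto
    have \<rho>p: "low \<le> int (\<rho> (p y))" "int (\<rho> (p y)) < low + int W" using ann[OF pC'] by auto
    have wt: "sum \<nu> (f ` {..<i}) \<le> \<rho> (p y) - \<rho> (f (i - 1)) + W" if i: "1 \<le> i" "i \<le> k" for i
    proof -
      have "sum \<nu> (f ` {..<i}) \<le> (\<Sum>j<i. \<nu> (f j))" by (rule sum_descending_le)
      also have "\<dots> = (\<Sum>j<i - 1. \<nu> (f j)) + \<nu> (f (i - 1))"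
        using i(1) by (cases i) auto
      also have "\<dots> \<le> (\<rho> (p y) - \<rho> (f (i - 1))) + W"
      proof -
        have le: "i - 1 \<le> k" using i by simp
        show ?thesis using tel[OF le] \<nu>1(2)[OF fC[OF le]] by linarith
      qed
      finally show ?thesis .
    qed
    define S where "S = f ` {..<k}"
    have connS: "conn adj (f ` {..<i})" if "i \<le> k" for i
        by (rule descending_conn[OF sym]) (use f(5) that in auto)
    have mem: "f i \<in> S" if "i < k" for i using that by (auto simp: S_def)
    have pS: "p y \<in> S" using mem[of 0] f(1,2) by simp
    have SC: "S \<subseteq> C" "S \<inter> Hn = {}" using f(3) by (auto simp: S_def)
    have notH: "low - 6 * int W \<le> int (\<rho> (f i))" if "i < k" for i using f(3)[OF that]
        by (auto simp: Hn_def)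
    have wS: "sum \<nu> S \<le> 8 * W"
      using wt[of k] f(2) notH[of "k - 1"] \<rho>p(2) unfolding S_def by auto
    have adjS: "\<exists>a\<in>S. \<exists>b\<in>Hn. adj a b"
    proof -
      have "adj (f k) (f (k - 1))" using f(5)[of "k - 1"] f(2) by simp
      then have "adj (f (k - 1)) (f k)" using sym by (auto simp: symp_def)
      then show ?thesis using mem[of "k - 1"] f(2,4) by auto
    qed
    have SH: "S \<inter> H l = {}" if l: "l < j" for l
    proof -
      \<comment> \<open>First index at which the path is below the annulus. Up to there it stays in
        the component \<open>C'\<close> and weighs at most \<open>2 * W\<close>.\<close>
      define k0 where "k0 = (LEAST i. i = k \<or> int (\<rho> (f i)) < low)"
      have k0: "k0 = k \<or> int (\<rho> (f k0)) < low" unfolding k0_def by (rule LeastI[of _ k]) simp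
      have k0k: "k0 \<le> k" unfolding k0_def by (rule Least_le) simp
      have pre: "i \<noteq> k \<and> low \<le> int (\<rho> (f i))" if "i < k0" for i
        using not_less_Least[of i "\<lambda>i. i = k \<or> int (\<rho> (f i)) < low"] that unfolding k0_def by auto
      have inC': "f i \<in> C'" if "i < k0" for i
        using that
      proof (induction i)
        case 0 then show ?case using f(1) pC' by simp
      next
        case (Suc i)
        have ik: "Suc i \<le> k" using Suc.prems k0k by simp
        have "adj (f i) (f (Suc i))" using f(5)[of i] ik sym by (auto simp: symp_def)
        moreover have "\<rho> (f (Suc i)) \<le> \<rho> (f 0)"
          by (rule descending_mono[where k = k and f = f and \<rho> = \<rho> and \<nu> = \<nu>]) (use step ik in auto)
        ultimately show ?case using cl[of "f i" "f (Suc i)"] Suc pre[OF Suc.prems] fC[OF ik] f(1)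
            \<rho>p(2) by auto
      qed
      have k01: "k0 \<ge> 1" using pre k0 f(1,2) \<rho>p(1) by (cases k0) auto
      have "f ` {..<k0} \<inter> H l = {}"
      proof (rule clear[OF y l])
        show "f ` {..<k0} \<subseteq> C'" using inC' by blast
        show "conn adj (f ` {..<k0})" by (rule connS[OF k0k])
        show "p y \<in> f ` {..<k0}" using f(1) k01 by (intro image_eqI[of _ _ 0]) auto
        show "sum \<nu> (f ` {..<k0}) \<le> 2 * W"
          using wt[OF k01 k0k] pre[of "k0 - 1"] k01 \<rho>p(2) by auto
      qed
      moreover have "f i \<notin> H l" if i: "k0 \<le> i" "i < k" for i
      proof
        assume "f i \<in> H l"
        then have "low \<le> int (\<rho> (f i))" using H0(3)[OF l] ann by blast
        moreover have "\<rho> (f i) \<le> \<rho> (f k0)"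
          by (rule descending_mono[where k = k and f = f and \<rho> = \<rho> and \<nu> = \<nu>]) (use step i in auto)
        moreover have "int (\<rho> (f k0)) < low" using k0 i by auto
        ultimately show False by simp
      qed
      ultimately show ?thesis unfolding S_def using not_le by blast
    qed
    define i2 where "i2 = (LEAST i. int (\<rho> (f i)) + 3 * int W < low)"
    have exk: "int (\<rho> (f k)) + 3 * int W < low" using f(4) by (auto simp: Hn_def)
    have i2: "int (\<rho> (f i2)) + 3 * int W < low" unfolding i2_def by (rule LeastI[of _ k]) (rule exk)
    have i2k: "i2 \<le> k" unfolding i2_def by (rule Least_le) (rule exk)
    have i21: "i2 \<ge> 1" using i2 f(1) \<rho>p(1) by (cases i2) auto
    have "\<not> int (\<rho> (f (i2 - 1))) + 3 * int W < low"
      using not_less_Least[of "i2 - 1" "\<lambda>i. int (\<rho> (f i)) + 3 * int W < low"] i21 unfolding i2_def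
          by auto
    moreover have "\<rho> (f (i2 - 1)) = \<rho> (f i2) + \<nu> (f (i2 - 1))" using step[of "i2 - 1"] i21 i2k
        by simp
    moreover have "\<nu> (f (i2 - 1)) \<le> W" using \<nu>1(2) fC[of "i2 - 1"] i2k by simp
    ultimately have v4: "low - 4 * int W \<le> int (\<rho> (f i2))" by linarith
    then have "f i2 \<notin> Hn" using \<nu>1[OF rC(1)] by (auto simp: Hn_def)
    then have "i2 < k" using i2k f(4) by (cases "i2 = k") auto
    then have "f i2 \<in> S" by (rule mem)
    then have "P y S (f i2)" unfolding P_def using connS[of k] pS SC wS adjS SH v4 i2
        by (simp add: S_def)
    then show ?thesis by blast
  qed
  then obtain S v where "\<And>y. y \<in> Y \<Longrightarrow> P y (S y) (v y)" by metis
  note Sv = this[unfolded P_def]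
  define H' where "H' = H(j := Hn)"
  have H'k: "H' k = H k" if "k < j" for k using that by (simp add: H'_def)
  have H'j: "H' j = Hn" by (simp add: H'_def)
  have "hub_minor adj \<nu> W X Y (Suc j) C (\<lambda>y. A y \<union> S y) v H'"
    unfolding hub_minor_def
  proof (intro conjI ballI allI impI)
    fix y assume y: "y \<in> Y"
    show "conn adj (A y \<union> S y)" by (rule conn_Un[OF sym A0(1)[OF y]]) (use Sv[OF y] A0(3)[OF y]
        in auto)
    show "y \<in> A y \<union> S y" "v y \<in> A y \<union> S y" using A0(2)[OF y] Sv[OF y] by auto
    show "A y \<union> S y \<subseteq> C" using A0(4)[OF y] C' Sv[OF y] by auto
    fix z assume "z \<in> A y \<union> S y"
    then show "close adj X \<nu> (W + 8 * W * Suc j) y z"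
    proof
      assume "z \<in> A y"
      from A0(5)[OF y this] show ?thesis by (rule close_mono) auto
    next
      assume z: "z \<in> S y"
      have "close adj X \<nu> (8 * W) (p y) z" unfolding close_def using Sv[OF y] z CX
          by (intro exI[of _ "S y"]) auto
      from close_trans[OF sym X(1) A0(5)[OF y A0(3)[OF y]] this] show ?thesis
          by (simp add: algebra_simps)
    qed
  next
    fix k assume k: "k < Suc j"
    show "H' k \<noteq> {}" "conn adj (H' k)" "H' k \<subseteq> C"
      using k H0[of k] C' rH connHn H'k H'j by (cases "k = j"; auto simp: Hn_def)+
  next
    fix k l assume kl: "k < Suc j" "l < Suc j" "k \<noteq> l"
    have Hnk: "Hn \<inter> H k = {}" if "k < j" for k using H0(3)[OF that] HnC' by blast
    from kl consider "k < j" "l < j" | "k = j" "l < j" | "k < j" "l = j" by linarith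
    then show "H' k \<inter> H' l = {}"
    proof cases
      case 1 then show ?thesis using HH kl H'k by simp
    next
      case 2 then show ?thesis using Hnk H'k H'j by simp
    next
      case 3 then show ?thesis using Hnk[of k] H'k H'j by (simp add: Int_commute)
    qed
  next
    fix y k assume y: "y \<in> Y" and k: "k < Suc j"
    show "(A y \<union> S y) \<inter> H' k = {}"
    proof (cases "k = j")
      case True then show ?thesis using A0(4)[OF y] HnC' Sv[OF y] H'j by auto
    next
      case False
      then have "k < j" using k by simp
      then show ?thesis using AH(1)[OF _ y] Sv[OF y] H'k by auto
    qed
    show "\<exists>a\<in>A y \<union> S y. \<exists>b\<in>H' k. adj a b"
    proof (cases "k = j")
      case True then show ?thesis using Sv[OF y] H'j by auto
    next
      case False
      then have "k < j" using k by simp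
      then obtain a b where "a \<in> A y" "b \<in> H k" "adj a b" using AH(2)[OF _ y] by blast
      then show ?thesis using H'k[OF \<open>k < j\<close>] by blast
    qed
  next
    fix y k U assume y: "y \<in> Y" and k: "k < Suc j"
        and U: "U \<subseteq> C" "conn adj U" "v y \<in> U" "sum \<nu> U \<le> 2 * W"
    have finU: "finite U" by (rule finite_subset[OF subset_trans[OF U(1) CX] X(1)])
    have \<rho>z: "int (\<rho> z) < low - int W \<and> low - 6 * int W \<le> int (\<rho> z)" if z: "z \<in> U" for z
    proof -
      have "\<rho> z \<le> \<rho> (v y) + sum \<nu> U" by (rule dist_from_lipschitz[OF d U(1,2) finU _ U(3) z]) (use
          \<nu>1 U(1) in blast)
      moreover have "\<rho> (v y) \<le> \<rho> z + sum \<nu> U"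
          by (rule dist_from_lipschitz[OF d U(1,2) finU _ z U(3)]) (use \<nu>1 U(1) in blast)
      moreover have "low - 4 * int W \<le> int (\<rho> (v y))" "int (\<rho> (v y)) + 3 * int W < low"
          using Sv[OF y] by auto
      ultimately show ?thesis using U(4) by linarith
    qed
    show "U \<inter> H' k = {}"
    proof (cases "k = j")
      case True
      have "z \<notin> Hn" if "z \<in> U" for z using \<rho>z[OF that] by (auto simp: Hn_def)
      then show ?thesis using True H'j by blast
    next
      case False
      then have k': "k < j" using k by simp
      have "z \<notin> C'" if "z \<in> U" for z using \<rho>z[OF that] ann[of z] by auto
      then show ?thesis using H0(3)[OF k'] H'k[OF k'] by blast
    qed
  qed
  then show ?thesis by blast
qed

text \<open>The rounds are undone from the innermost cluster outwards; each contributes one hub,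
  while \<open>Y\<close> stays the same.\<close>

lemma chopped_hub_minor:
  assumes sym: "symp adj" and X: "finite X" "\<And>x. x \<in> X \<Longrightarrow> 1 \<le> \<nu> x \<and> \<nu> x \<le> W"
    and ch: "chopped adj \<nu> W X i C" and Y: "Y \<subseteq> C" "y1 \<in> Y" "y2 \<in> Y" "y1 \<noteq> y2"
    and far: "\<And>y y'. y \<in> Y \<Longrightarrow> y' \<in> Y \<Longrightarrow> y \<noteq> y' \<Longrightarrow> \<not> close adj X \<nu> (16 * W) y y'"
    and hm: "hub_minor adj \<nu> W X Y j C A p H"
  shows "\<exists>C0 A' p' H'. C0 \<subseteq> X \<and> hub_minor adj \<nu> W X Y (j + i) C0 A' p' H'"
  using ch Y(1) hm
proof (induction arbitrary: j A p H rule: chopped.induct)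
  case (chopped_0 C)
  then show ?case by auto
next
  case (chopped_Suc i C r \<rho> C' low)
  have CX: "C \<subseteq> X" using chopped_subset[OF chopped_Suc.hyps(1)] .
  have "\<exists>A' p' H'. hub_minor adj \<nu> W X Y (Suc j) C A' p' H'"
    by (rule hub_minor_step[where C' = C' and low = low and \<rho> = \<rho> and r = r and ?y1.0 = y1
      and ?y2.0 = y2],
      rule sym, rule X(1), erule X(2), rule CX, rule chopped_Suc.hyps(2), rule chopped_Suc.hyps(3),
          erule chopped_Suc.hyps(5),
      erule (4) chopped_Suc.hyps(6), rule chopped_Suc.prems(1), rule Y(2), rule Y(3), rule Y(4),
          erule (2) far, rule chopped_Suc.prems(2))
  then obtain A' p' H' where "hub_minor adj \<nu> W X Y (Suc j) C A' p' H'" by blast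
  moreover have "Y \<subseteq> C" using chopped_Suc by blast
  ultimately show ?case using chopped_Suc.IH[of "Suc j"] by simp
qed

text \<open>Four is the first number of hubs above the slope 3 of the edge bound:
  \<open>4 * card Y \<le> 3 * (card Y + 4) + 6 * g\<close>. Branch sets reach at most
  \<open>W + 8 * W * 4 = 33 * W\<close> from their centres, so centres more than
  \<open>66 * W\<close> apart have disjoint ones.\<close>

lemma chopped_far_bound:
  assumes sym: "symp adj" and X: "finite X" "\<And>x. x \<in> X \<Longrightarrow> 1 \<le> \<nu> x \<and> \<nu> x \<le> W"
      and mb: "minor_bounded adj V g" "X \<subseteq> V"
    and ch: "chopped adj \<nu> W X 4 C" and Y: "Y \<subseteq> C"
    and far: "\<And>y y'. y \<in> Y \<Longrightarrow> y' \<in> Y \<Longrightarrow> y \<noteq> y' \<Longrightarrow> \<not> close adj X \<nu> (66 * W) y y'"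
  shows "card Y \<le> 12 + 6 * g"
proof (cases "\<exists>y1\<in>Y. \<exists>y2\<in>Y. y1 \<noteq> y2")
  case False
  have "card Y \<le> 1" using False by (metis card_le_Suc0_iff_eq card.infinite One_nat_def le0)
  then show ?thesis by simp
next
  case True
  then obtain y1 y2 where y12: "y1 \<in> Y" "y2 \<in> Y" "y1 \<noteq> y2" by blast
  have CX: "C \<subseteq> X" by (rule chopped_subset[OF ch])
  have finY: "finite Y" by (rule finite_subset[OF subset_trans[OF Y CX] X(1)])
  have hm: "hub_minor adj \<nu> W X Y 0 C (\<lambda>y. {y}) (\<lambda>y. y) (\<lambda>_. {})"
    unfolding hub_minor_def
  proof (intro conjI ballI allI impI)
    fix y z assume "y \<in> Y" "z \<in> {y}"
    then show "close adj X \<nu> (W + 8 * W * 0) y z" unfolding close_def using X(2)[of y] Y CX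
        by (intro exI[of _ "{y}"]) auto
  qed (use Y in auto)
  have far16: "\<not> close adj X \<nu> (16 * W) y y'" if "y \<in> Y" "y' \<in> Y" "y \<noteq> y'" for y y'
    using far[OF that] close_mono[of adj X \<nu> "16 * W" y y' X "66 * W"] by auto
  obtain C0 A p H where C0: "C0 \<subseteq> X" and hm4: "hub_minor adj \<nu> W X Y 4 C0 A p H"
    using chopped_hub_minor[OF sym X ch Y y12 far16 hm] by auto
  have A: "conn adj (A y)" "y \<in> A y" "A y \<subseteq> C0" "z \<in> A y \<Longrightarrow> close adj X \<nu> (33 * W) y z" if "y \<in> Y"
      for y z
    using hub_minor_branch[OF hm4 that] by (simp_all add: mult.commute)
  have "card (Y \<times> {..<4::nat}) \<le> 3 * (card Y + card {..<4::nat}) + 6 * g"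
  proof (rule minor_bounded_bipartite[OF mb(1) finY, where A = A and Y = H])
    show "A y \<noteq> {} \<and> A y \<subseteq> V \<and> conn adj (A y)" if "y \<in> Y" for y using A[OF that] C0 mb(2) by blast
    show "H k \<noteq> {} \<and> H k \<subseteq> V \<and> conn adj (H k)" if "k \<in> {..<4}" for k
      using hub_minor_hub(1-3)[OF hm4, of k] that C0 mb(2) by auto
    show "A y \<inter> A y' = {}" if y: "y \<in> Y" "y' \<in> Y" "y \<noteq> y'" for y y'
    proof (rule ccontr)
      assume "A y \<inter> A y' \<noteq> {}"
      then obtain z where "z \<in> A y" "z \<in> A y'" by blast
      from close_trans[OF sym X(1) A(4)[OF y(1) this(1)] close_sym[OF A(4)[OF y(2) this(2)]]]
          far[OF y] show False by simp
    qed
    show "H k \<inter> H l = {}" if "k \<in> {..<4}" "l \<in> {..<4}" "k \<noteq> l" for k l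
      using hub_minor_hub(4)[OF hm4, of k l] that by auto
    show "A y \<inter> H k = {}" if "y \<in> Y" "k \<in> {..<4}" for y k
        using hub_minor_hub(5)[OF hm4, of k y] that by auto
    show "\<exists>a\<in>A y. \<exists>b\<in>H k. adj a b" if "(y, k) \<in> Y \<times> {..<4}" for y k
        using hub_minor_hub(6)[OF hm4, of k y] that by auto
  qed auto
  then show ?thesis by (simp add: card_cartesian_product)
qed

section \<open>Padding against the boundaries of annuli\<close>

text \<open>Distance to the nearest multiple of \<open>W\<close>, truncated at
  \<open>\<tau>\<close>.\<close>

definition gap :: "nat \<Rightarrow> nat \<Rightarrow> nat \<Rightarrow> nat" where
  "gap \<tau> W a = min \<tau> (min (a mod W) (W - a mod W))"

lemma gap_lipschitz:
  assumes "a div W = b div W" "a \<le> b + m" "b \<le> a + m"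
  shows "gap \<tau> W a \<le> gap \<tau> W b + m"
proof -
  have "a = a div W * W + a mod W" "b = a div W * W + b mod W"
    unfolding assms(1) using div_mult_mod_eq[of a W] div_mult_mod_eq[of b W] assms(1) by simp_all
  then have "a mod W \<le> b mod W + m" "b mod W \<le> a mod W + m" using assms(2,3) by linarith+
  then show ?thesis unfolding gap_def by (auto simp: min_def)
qed

text \<open>A multiple of \<open>W\<close> lies between the two values, and their distances to it
  add up to at most \<open>m\<close>.\<close>

lemma gap_add_le:
  assumes W: "W > 0" and ab: "a div W < b div W" and m: "b \<le> a + m"
  shows "gap \<tau> W a + gap \<tau> W b \<le> m"
proof -
  have a: "a = a div W * W + a mod W" and b: "b = b div W * W + b mod W" by simp_all
  have "(a div W + 1) * W \<le> b div W * W" using ab by (intro mult_right_mono) auto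
  then have "a div W * W + W \<le> b div W * W" by simp
  then have "W + b mod W \<le> a mod W + m" using a b m by linarith
  moreover have "a mod W < W" using W by simp
  moreover have "gap \<tau> W a \<le> W - a mod W" "gap \<tau> W b \<le> b mod W" by (auto simp: gap_def)
  ultimately show ?thesis by linarith
qed

lemma gap_add_le':
  assumes W: "W > 0" and ab: "a div W \<noteq> b div W" and m: "b \<le> a + m" "a \<le> b + m"
  shows "gap \<tau> W a + gap \<tau> W b \<le> m"
proof (cases "a div W < b div W")
  case True then show ?thesis using gap_add_le[OF W _ m(1)] by simp
next
  case False
  then have "b div W < a div W" using ab by simp
  then show ?thesis using gap_add_le[OF W _ m(2), of \<tau>] by simp
qed

text \<open>Adding \<open>\<tau>\<close> moves the zone around the multiples of
  \<open>2 * \<tau> * q\<close> into the first of \<open>q\<close> windows of length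
  \<open>2 * \<tau>\<close>, and each shift advances a point by exactly one window.\<close>

lemma gap_small_mod:
  assumes \<tau>: "\<tau> \<ge> 1" and q: "q \<ge> 1" and G: "gap \<tau> (2 * \<tau> * q) (h + 2 * \<tau> * l) < \<tau>"
  shows "((h + \<tau>) div (2 * \<tau>) + l) mod q = 0"
proof -
  let ?W = "2 * \<tau> * q" let ?e = "h + 2 * \<tau> * l"
  have W: "?W > 0" "2 * \<tau> \<le> ?W" using \<tau> q by auto
  have lt: "?e mod ?W < ?W" using W by simp
  have "(?e mod ?W + \<tau>) mod ?W < 2 * \<tau>"
  proof (cases "?e mod ?W < \<tau>")
    case True
    then have "?e mod ?W + \<tau> < 2 * \<tau>" by simp
    then show ?thesis using le_less_trans[OF mod_less_eq_dividend] by blast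
  next
    case False
    then have "?W - ?e mod ?W < \<tau>" using G unfolding gap_def by linarith
    then have ge: "?W \<le> ?e mod ?W + \<tau>" by linarith
    have "(?e mod ?W + \<tau>) mod ?W = (?e mod ?W + \<tau> - ?W) mod ?W" using ge by (rule le_mod_geq)
    also have "\<dots> \<le> ?e mod ?W + \<tau> - ?W" by (rule mod_less_eq_dividend)
    also have "\<dots> < 2 * \<tau>" using lt \<tau> ge by linarith
    finally show ?thesis .
  qed
  then have *: "(?e + \<tau>) mod (2 * \<tau> * q) < 2 * \<tau>" by (simp only: mod_add_left_eq)
  have "(?e + \<tau>) mod (2 * \<tau> * q) = 2 * \<tau> * ((?e + \<tau>) div (2 * \<tau>) mod q) + (?e + \<tau>) mod (2 * \<tau>)"
    by (rule mod_mult2_eq)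
  then have "2 * \<tau> * ((?e + \<tau>) div (2 * \<tau>) mod q) < 2 * \<tau> * 1" using * by linarith
  then have "(?e + \<tau>) div (2 * \<tau>) mod q < 1" by (simp only: nat_mult_less_cancel1 mult_less_cancel1)
  moreover have "(?e + \<tau>) div (2 * \<tau>) = (h + \<tau>) div (2 * \<tau>) + l"
  proof -
    have "?e + \<tau> = (h + \<tau>) + l * (2 * \<tau>)" by simp
    then show ?thesis using \<tau> by (simp only: div_mult_self1)
  qed
  ultimately show ?thesis by simp
qed

lemma gap_small_unique:
  assumes \<tau>: "\<tau> \<ge> 1" and l: "l < q" "l' < q" and G: "gap \<tau> (2 * \<tau> * q) (h + 2 * \<tau> * l) < \<tau>"
      "gap \<tau> (2 * \<tau> * q) (h + 2 * \<tau> * l') < \<tau>"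
  shows "l = l'"
proof -
  have q: "q \<ge> 1" using l by simp
  let ?k = "(h + \<tau>) div (2 * \<tau>)"
  have eq: "(?k + l) mod q = (?k + l') mod q"
      using gap_small_mod[OF \<tau> q G(1)] gap_small_mod[OF \<tau> q G(2)] by simp
  have "b \<le> a" if "(k + a) mod q = (k + b) mod q" "a < q" "b < q" for k a b
  proof (rule ccontr)
    assume "\<not> b \<le> a"
    then have "q dvd b - a" using mod_eq_dvd_iff_nat[of "k + a" "k + b" q] that(1) by simp
    then show False using \<open>\<not> b \<le> a\<close> that by (auto dest: dvd_imp_le)
  qed
  from this[OF eq l] this[OF eq[symmetric] l(2,1)] show ?thesis by simp
qed

text \<open>Every point is badly placed for at most one of the \<open>q\<close> shifts, so by
  averaging some shift is bad for at most a \<open>1 / q\<close> share of \<open>B\<close>.\<close>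

lemma exists_good_shift:
  assumes \<tau>: "\<tau> \<ge> 1" and q: "q \<ge> 1" and B: "finite B"
  shows "\<exists>l<q. q * card {x \<in> B. gap \<tau> (2 * \<tau> * q) (h x + 2 * \<tau> * l) < \<tau>} \<le> card B"
proof (rule ccontr)
  let ?S = "\<lambda>l. {x \<in> B. gap \<tau> (2 * \<tau> * q) (h x + 2 * \<tau> * l) < \<tau>}"
  assume "\<not> ?thesis"
  then have gt: "card B < q * card (?S l)" if "l < q" for l using that not_le by blast
  have "q * card B = (\<Sum>l<q. card B)" by simp
  also have "\<dots> < (\<Sum>l<q. q * card (?S l))" by (rule sum_strict_mono) (use q gt in \<open>auto
      simp: lessThan_empty_iff\<close>)
  also have "\<dots> = q * (\<Sum>l<q. card (?S l))" by (simp add: sum_distrib_left)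
  also have "(\<Sum>l<q. card (?S l)) = card (\<Union>l\<in>{..<q}. ?S l)"
    by (rule card_UN_disjoint[symmetric]) (use B in \<open>auto dest: gap_small_unique[OF \<tau>]\<close>)
  also have "\<dots> \<le> card B" by (rule card_mono[OF B]) auto
  finally show False by simp
qed

lemma chopped_conn: "chopped adj \<nu> W X i C \<Longrightarrow> conn adj C"
  by (induction rule: chopped.induct) auto

text \<open>Outside the set where \<open>F < \<tau>\<close> the clusters are at distance at least \<open>\<tau>\<close> from each other;
  each of the \<open>R\<close> rounds of chopping spoils at most a fraction \<open>1/q\<close> of \<open>B\<close>.\<close>

lemma padded_decomposition:
  assumes sym: "symp adj" and B: "finite B" "B \<subseteq> X" and \<tau>: "\<tau> \<ge> 1" and q: "q \<ge> 1"
  shows "\<exists>cl F. (\<forall>x\<in>X. x \<in> cl x \<and> chopped adj \<nu> (2 * \<tau> * q) X R (cl x) \<and> (\<forall>y\<in>cl x. cl y = cl x)) \<and>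
      (\<forall>x. F x \<le> \<tau>) \<and>
    (\<forall>x\<in>X. \<forall>y\<in>X. adj x y \<longrightarrow> (if cl x = cl y then F x \<le> F y + (\<nu> x + \<nu> y) else F x + F y \<le> \<nu> x +
        \<nu> y)) \<and>
    q * card {x \<in> B. F x < \<tau>} \<le> R * card B"
proof (induction R)
  case 0
  let ?cl = "component adj X"
  have "?cl x = ?cl y" if "x \<in> X" "y \<in> X" "adj x y" for x y
    using component_eq[OF sym component_step[where y = x and x = x and adj = adj and z = y
        and S = X]] component_self[of x X adj] that by simp
  then show ?case
    by (intro exI[of _ ?cl] exI[of _ "\<lambda>_. \<tau>"] conjI ballI allI impI component_self chopped_0
      component_subset conn_component[OF sym] component_eq[OF sym]) auto
next
  case (Suc R)
  let ?W = "2 * \<tau> * q"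
  have W: "?W > 0" using \<tau> q by simp
  obtain cl F where ih: "(\<forall>x\<in>X. x \<in> cl x \<and> chopped adj \<nu> ?W X R (cl x) \<and> (\<forall>y\<in>cl x. cl y = cl x)) \<and>
      (\<forall>x. F x \<le> \<tau>) \<and>
    (\<forall>x\<in>X. \<forall>y\<in>X. adj x y \<longrightarrow> (if cl x = cl y then F x \<le> F y + (\<nu> x + \<nu> y) else F x + F y \<le> \<nu> x +
        \<nu> y)) \<and>
    q * card {x \<in> B. F x < \<tau>} \<le> R * card B"
    using Suc.IH by (elim exE)
  have cl: "x \<in> cl x" "chopped adj \<nu> ?W X R (cl x)" "y \<in> cl x \<Longrightarrow> cl y = cl x" if "x \<in> X" for x y
    using bspec[OF conjunct1[OF ih] that] by blast+
  note ih = conjunct2[OF ih]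
  have F: "F x \<le> \<tau>" for x using conjunct1[OF ih] by simp
  note ih = conjunct2[OF ih]
  have Fadj: "if cl x = cl y then F x \<le> F y + (\<nu> x + \<nu> y) else F x + F y \<le> \<nu> x + \<nu> y"
      if "x \<in> X" "y \<in> X" "adj x y" for x y
    by (rule conjunct1[OF ih, rule_format, OF that])
  note Fcard = conjunct2[OF ih]
  have "\<exists>\<rho>. \<exists>r. dist_from adj \<nu> C r \<rho>" if C: "C \<in> cl ` X" for C
  proof -
    obtain x where x: "x \<in> X" "C = cl x" using C by blast
    have xC: "conn adj C" "x \<in> C" using chopped_conn[OF cl(2)] cl(1) x by auto
    from conn_dist[OF this, of \<nu>] obtain \<rho> where \<rho>: "\<rho> x = 0"
        "\<And>a b. a \<in> C \<Longrightarrow> b \<in> C \<Longrightarrow> adj a b \<Longrightarrow> \<rho> b \<le> \<rho> a + \<nu> b"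
        "\<And>a. a \<in> C \<Longrightarrow> a \<noteq> x \<Longrightarrow> \<exists>b\<in>C. adj b a \<and> \<rho> a = \<rho> b + \<nu> a" by blast
    then have "dist_from adj \<nu> C x \<rho>" using xC unfolding dist_from_def by simp
    then show ?thesis by blast
  qed
  then obtain \<rho> where \<rho>: "\<And>C. C \<in> cl ` X \<Longrightarrow> \<exists>r. dist_from adj \<nu> C r (\<rho> C)" by metis
  define h where "h x = \<rho> (cl x) x" for x
  have clX: "cl x \<subseteq> X" if "x \<in> X" for x using chopped_subset[OF cl(2)[OF that]] .
  have hlip: "h y \<le> h x + \<nu> y" if x: "x \<in> X" "y \<in> X" "adj x y" "cl x = cl y" for x y
  proof -
    obtain r where "dist_from adj \<nu> (cl x) r (\<rho> (cl x))" using \<rho>[OF imageI[OF x(1)]] by blast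
    moreover have "x \<in> cl x" "y \<in> cl x" using cl(1) x by auto
    ultimately show ?thesis using x(3,4) unfolding dist_from_def h_def by simp
  qed
  obtain l where l: "l < q" "q * card {x \<in> B. gap \<tau> ?W (h x + 2 * \<tau> * l) < \<tau>} \<le> card B"
    using exists_good_shift[OF \<tau> q B(1), of h] by blast
  define e where "e x = h x + 2 * \<tau> * l" for x
  define G where "G x = gap \<tau> ?W (e x)" for x
  define idx where "idx x = e x div ?W" for x
  define S where "S x = {y \<in> cl x. idx y = idx x}" for x
  define cl' where "cl' x = component adj (S x) x" for x
  \<comment> \<open>Padding against the old and the new cluster boundaries at once.\<close>
  define F' where "F' x = min (F x) (G x)" for x
  have cl'S: "cl' x \<subseteq> S x" for x unfolding cl'_def by (rule component_subset)
  have xS: "x \<in> S x" if "x \<in> X" for x using cl(1)[OF that] by (simp add: S_def)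
  have self: "x \<in> cl' x" if "x \<in> X" for x unfolding cl'_def by (rule component_self[OF xS[OF that]])
  have Seq: "S y = S x" if "x \<in> X" "y \<in> S x" for x y using cl(3)[OF that(1)] that(2)
      by (auto simp: S_def)
  have eqv: "cl' y = cl' x" if "x \<in> X" "y \<in> cl' x" for x y
    using component_eq[OF sym, of y "S x" x] that Seq[of x y] cl'S[of x] unfolding cl'_def by auto
  have chop: "chopped adj \<nu> ?W X (Suc R) (cl' x)" if x: "x \<in> X" for x
  proof -
    obtain r where d: "dist_from adj \<nu> (cl x) r (\<rho> (cl x))" using \<rho>[OF imageI[OF x]] by blast
    \<comment> \<open>Lower end of the annulus of \<open>x\<close> before the shift, possibly
      negative.\<close>
    define low where "low = int (idx x * ?W) - int (2 * \<tau> * l)"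
    have iff: "(low \<le> int (\<rho> (cl x) y) \<and> int (\<rho> (cl x) y) < low + int ?W) \<longleftrightarrow> idx y = idx x"
        if y: "y \<in> cl x" for y
    proof -
      have "\<rho> (cl x) y = h y" using cl(3)[OF x y] by (simp add: h_def)
      moreover have "int (e y) = int (h y) + int (2 * \<tau> * l)" by (simp add: e_def)
      ultimately have "(low \<le> int (\<rho> (cl x) y) \<and> int (\<rho> (cl x) y) < low + int ?W) \<longleftrightarrow>
          int (idx x * ?W) \<le> int (e y) \<and> int (e y) < int (idx x * ?W) + int ?W" unfolding low_def
              by linarith
      also have "\<dots> \<longleftrightarrow> idx x * ?W \<le> e y \<and> e y < idx x * ?W + ?W" by linarith
      also have "\<dots> \<longleftrightarrow> idx y = idx x"
      proof
        assume "idx x * ?W \<le> e y \<and> e y < idx x * ?W + ?W"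
        then show "idx y = idx x" unfolding idx_def[of y]
            by (intro div_nat_eqI) (auto simp: mult.commute)
      next
        assume "idx y = idx x"
        then have "e y = idx x * ?W + e y mod ?W" using div_mult_mod_eq[of "e y" ?W]
            unfolding idx_def by simp
        then show "idx x * ?W \<le> e y \<and> e y < idx x * ?W + ?W" using mod_less_divisor[OF W, of "e y"]
            by linarith
      qed
      finally show ?thesis .
    qed
    show ?thesis
    proof (rule chopped_Suc[OF cl(2)[OF x] d, where low = low])
      show "cl' x \<subseteq> cl x" using cl'S[of x] by (auto simp: S_def)
      show "conn adj (cl' x)" unfolding cl'_def by (rule conn_component[OF sym])
      fix y assume y: "y \<in> cl' x"
      then have yS: "y \<in> S x" using cl'S by blast
      then show "low \<le> int (\<rho> (cl x) y) \<and> int (\<rho> (cl x) y) < low + int ?W" using iff[of y]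
          by (simp add: S_def)
      fix z assume z: "z \<in> cl x" "adj y z" "low \<le> int (\<rho> (cl x) z)"
          "int (\<rho> (cl x) z) < low + int ?W"
      then have "z \<in> S x" using iff[of z] by (simp add: S_def)
      then show "z \<in> cl' x" using component_step[of y adj "S x" x z] y z(2) unfolding cl'_def
          by simp
    qed
  qed
  have adj': "if cl' x = cl' y then F' x \<le> F' y + (\<nu> x + \<nu> y) else F' x + F' y \<le> \<nu> x + \<nu> y"
    if x: "x \<in> X" and y: "y \<in> X" and a: "adj x y" for x y
  proof (cases "cl x = cl y")
    case False
    have "cl' x \<noteq> cl' y"
    proof
      assume "cl' x = cl' y"
      then have "y \<in> cl x" using self[OF y] cl'S[of x] by (auto simp: S_def)
      then show False using cl(3)[OF x] False by simp
    qed
    then show ?thesis using Fadj[OF x y a] False by (simp add: F'_def)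
  next
    case True
    have e: "e y \<le> e x + (\<nu> x + \<nu> y)" "e x \<le> e y + (\<nu> x + \<nu> y)"
      using hlip[OF x y a True] hlip[OF y x _ True[symmetric]] a sym unfolding e_def
          by (auto simp: symp_def)
    show ?thesis
    proof (cases "idx x = idx y")
      case i: True
      then have "y \<in> S x" using True cl(1)[OF y] by (simp add: S_def)
      then have "y \<in> cl' x" using component_step[OF self[OF x, unfolded cl'_def] a]
          by (simp add: cl'_def)
      then have "cl' x = cl' y" using eqv[OF x] by simp
      moreover have "G x \<le> G y + (\<nu> x + \<nu> y)" unfolding G_def
          by (rule gap_lipschitz) (use i e in \<open>simp_all add: idx_def\<close>)
      moreover have "F x \<le> F y + (\<nu> x + \<nu> y)" using Fadj[OF x y a] True by simp
      ultimately show ?thesis by (simp add: F'_def min_def)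
    next
      case i: False
      have "cl' x \<noteq> cl' y" using self[OF y] cl'S[of x] i by (auto simp: S_def)
      moreover have "G x + G y \<le> \<nu> x + \<nu> y" unfolding G_def
          by (rule gap_add_le'[OF W]) (use i e in \<open>simp_all add: idx_def\<close>)
      ultimately show ?thesis by (simp add: F'_def min_def)
    qed
  qed
  have "{x \<in> B. F' x < \<tau>} = {x \<in> B. F x < \<tau>} \<union> {x \<in> B. G x < \<tau>}" by (auto simp: F'_def)
  then have "card {x \<in> B. F' x < \<tau>} \<le> card {x \<in> B. F x < \<tau>} + card {x \<in> B. G x < \<tau>}"
      using card_Un_le by simp
  then have "q * card {x \<in> B. F' x < \<tau>} \<le> q * (card {x \<in> B. F x < \<tau>} + card {x \<in> B. G x < \<tau>})"
      by (rule mult_le_mono2)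
  also have "\<dots> \<le> R * card B + card B" using Fcard l(2) unfolding G_def e_def
      by (simp add: add_mult_distrib2)
  finally have cnt: "q * card {x \<in> B. F' x < \<tau>} \<le> Suc R * card B" by simp
  have le: "F' x \<le> \<tau>" for x using F[of x] by (simp add: F'_def min_def)
  show ?case
    by (intro exI[of _ cl'] exI[of _ F'] conjI ballI allI impI) (use self chop eqv le adj' cnt
      in \<open>assumption | blast\<close>)+
qed

section \<open>Balanced separated functions\<close>

text \<open>A smallest set of weight at least \<open>n / 4\<close> weighs less than
  \<open>n / 2\<close>: without one of its elements it is below \<open>n / 4\<close>, and an element
  weighs at most \<open>n / 4\<close>. Of the total \<open>3 * n / 4\<close> at least
  \<open>n / 4\<close> remains.\<close>

lemma balanced_split:
  fixes w :: "'i \<Rightarrow> nat"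
  assumes I: "finite I" and w: "\<And>i. i \<in> I \<Longrightarrow> 4 * w i \<le> n" and tot: "3 * n \<le> 4 * sum w I"
  shows "\<exists>A\<subseteq>I. n \<le> 4 * sum w A \<and> n \<le> 4 * sum w (I - A)"
proof (cases "n = 0")
  case False
  define P where "P A \<longleftrightarrow> A \<subseteq> I \<and> n \<le> 4 * sum w A" for A
  have "P I" using tot by (simp add: P_def)
  then obtain A where A: "P A" "\<And>A'. P A' \<Longrightarrow> card A \<le> card A'" using ex_has_least_nat[of P I card]
      by blast
  have fin: "finite A" using A(1) I finite_subset unfolding P_def by blast
  have "A \<noteq> {}" using A(1) False by (auto simp: P_def)
  then obtain a where a: "a \<in> A" by blast
  have "\<not> P (A - {a})" using A(2)[of "A - {a}"] card_Diff1_less[OF fin a] by auto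
  then have "4 * sum w (A - {a}) < n" using A(1) by (auto simp: P_def)
  moreover have "sum w A = w a + sum w (A - {a})" using fin a by (simp add: sum.remove)
  moreover have "4 * w a \<le> n" using w a A(1) by (auto simp: P_def)
  moreover have "sum w I = sum w (I - A) + sum w A" using A(1) I
      by (simp add: P_def sum.subset_diff)
  ultimately have "n \<le> 4 * sum w (I - A)" using tot by linarith
  then show ?thesis using A(1) by (auto simp: P_def)
qed auto

lemma exists_net:
  assumes N: "finite N"
  shows "\<exists>Y\<subseteq>N. (\<forall>y\<in>Y. \<forall>z\<in>Y. y \<noteq> z \<longrightarrow> \<not> r y z \<and> \<not> r z y) \<and> (\<forall>x\<in>N - Y. \<exists>y\<in>Y. r y x \<or> r x y)"
proof -
  define P where "P Y \<longleftrightarrow> Y \<subseteq> N \<and> (\<forall>y\<in>Y. \<forall>z\<in>Y. y \<noteq> z \<longrightarrow> \<not> r y z \<and> \<not> r z y)" for Y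
  have "P {}" by (simp add: P_def)
  moreover have "card Y < Suc (card N)" if "P Y" for Y using that card_mono[OF N]
      by (auto simp: P_def less_Suc_eq_le)
  ultimately obtain Y where Y: "P Y" "\<And>Y'. P Y' \<Longrightarrow> card Y' \<le> card Y"
    using ex_has_greatest_nat[of P "{}" card "Suc (card N)"] by blast
  have fin: "finite Y" using Y(1) N finite_subset unfolding P_def by blast
  have "\<exists>y\<in>Y. r y x \<or> r x y" if x: "x \<in> N - Y" for x
  proof (rule ccontr)
    assume no: "\<not> ?thesis"
    have "P (insert x Y)" using Y(1) x no unfolding P_def by blast
    from Y(2)[OF this] fin x show False by simp
  qed
  then have "\<forall>x\<in>N - Y. \<exists>y\<in>Y. r y x \<or> r x y" by (rule ballI)
  then show ?thesis using Y(1)[unfolded P_def]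
      by (intro exI[of _ Y] conjI) (elim conjE, assumption)+
qed

text \<open>Markov's inequality for the number of close partners of a point.\<close>

lemma few_heavy_points:
  fixes r :: "'v \<Rightarrow> 'v \<Rightarrow> bool"
  assumes B: "finite B" "B \<noteq> {}" and P: "16 * k * card {(x, y). x \<in> B \<and> y \<in> B \<and> x \<noteq> y \<and> r x y} \<le>
      (card B)\<^sup>2"
  shows "16 * card {x \<in> B. card B < k * card {y \<in> B. x \<noteq> y \<and> r x y}} \<le> card B"
proof -
  let ?N = "\<lambda>x. {y \<in> B. x \<noteq> y \<and> r x y}" let ?H = "{x \<in> B. card B < k * card (?N x)}"
  have "{(x, y). x \<in> B \<and> y \<in> B \<and> x \<noteq> y \<and> r x y} = Sigma B ?N" by auto
  then have card: "card {(x, y). x \<in> B \<and> y \<in> B \<and> x \<noteq> y \<and> r x y} = (\<Sum>x\<in>B. card (?N x))" using B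
      by simp
  have "card B * card ?H = (\<Sum>x\<in>?H. card B)" by simp
  also have "\<dots> \<le> (\<Sum>x\<in>?H. k * card (?N x))" by (rule sum_mono) simp
  also have "\<dots> \<le> (\<Sum>x\<in>B. k * card (?N x))" by (rule sum_mono2) (use B in auto)
  also have "\<dots> = k * (\<Sum>x\<in>B. card (?N x))" by (simp add: sum_distrib_left)
  finally have "card B * (16 * card ?H) \<le> 16 * k * (\<Sum>x\<in>B. card (?N x))" by simp
  also have "\<dots> \<le> card B * card B" using P unfolding card by (simp add: power2_eq_square)
  finally have "16 * card ?H \<le> card B" using B by (simp add: card_gt_0_iff)
  then show ?thesis .
qed

text \<open>A maximal set of pairwise far light points of \<open>S\<close> has at most
  \<open>12 + 6 * g \<le> 18 * g\<close> elements, and the balls around them cover the light points.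
  Such a ball, centre included, holds at most \<open>9/8\<close> of
  \<open>card B / (144 * g)\<close>, so all of them hold at most \<open>162/1152\<close> of
  \<open>card B\<close>. A set \<open>S\<close> above \<open>1/4\<close> would keep more than
  \<open>1/4 - 1/16 = 3/16\<close> after losing its heavy points.\<close>

lemma cluster_mass_bound:
  fixes adj :: "'v \<Rightarrow> 'v \<Rightarrow> bool"
  assumes sym: "symp adj" and V: "finite V" "X \<subseteq> V" and \<nu>: "\<And>x. x \<in> X \<Longrightarrow> 1 \<le> \<nu> x \<and> \<nu> x \<le> W"
    and mb: "minor_bounded adj V g" "g \<ge> 1" and ch: "chopped adj \<nu> W X 4 C" and B: "finite B"
        and S: "S \<subseteq> B" "S \<subseteq> C"
    and heavy: "16 * card {x \<in> B. card B < 144 * g * card {y \<in> B. x \<noteq> y \<and>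
        close adj V \<nu> (66 * W) x y}} \<le> card B"
    and n: "8 * (144 * g) \<le> card B"
  shows "4 * card S \<le> card B"
proof (rule ccontr)
  assume big: "\<not> 4 * card S \<le> card B"
  let ?N = "\<lambda>x. {y \<in> B. x \<noteq> y \<and> close adj V \<nu> (66 * W) x y}"
  let ?H = "{x \<in> B. card B < 144 * g * card (?N x)}"
  have finS: "finite S" using S B finite_subset by blast
  have "card S \<le> card (S - ?H) + card ?H"
    using diff_card_le_card_Diff[of ?H S] B by simp
  then have N: "3 * card B < 16 * card (S - ?H)" using big heavy by linarith
  obtain Y where Y: "Y \<subseteq> S - ?H" "\<And>y z. y \<in> Y \<Longrightarrow> z \<in> Y \<Longrightarrow> y \<noteq> z \<Longrightarrow> \<not> close adj V \<nu> (66 * W) y z"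
      "\<And>x. x \<in> S - ?H - Y \<Longrightarrow> \<exists>y\<in>Y. close adj V \<nu> (66 * W) y x"
    using exists_net[of "S - ?H" "close adj V \<nu> (66 * W)"] finS close_sym
        by (metis (no_types, lifting) finite_Diff)
  have finY: "finite Y" using Y(1) finS finite_subset by blast
  have "card Y \<le> 12 + 6 * g"
  proof (rule chopped_far_bound[OF sym finite_subset[OF V(2,1)] \<nu> mb(1) V(2) ch])
    show "Y \<subseteq> C" using Y(1) S(2) by blast
    show "\<not> close adj X \<nu> (66 * W) y y'" if "y \<in> Y" "y' \<in> Y" "y \<noteq> y'" for y y'
      using Y(2)[OF that] close_mono[OF _ V(2) order_refl] by blast
  qed
  moreover have "card (S - ?H) \<le> (\<Sum>y\<in>Y. card (insert y (?N y)))"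
  proof -
    have "S - ?H \<subseteq> (\<Union>y\<in>Y. insert y (?N y))"
    proof
      fix x assume x: "x \<in> S - ?H"
      show "x \<in> (\<Union>y\<in>Y. insert y (?N y))"
      proof (cases "x \<in> Y")
        case False
        then obtain y where "y \<in> Y" "close adj V \<nu> (66 * W) y x" using Y(3) x by blast
        then have "x \<in> ?N y" using x S(1) False by auto
        then show ?thesis using \<open>y \<in> Y\<close> by blast
      qed blast
    qed
    then have "card (S - ?H) \<le> card (\<Union>y\<in>Y. insert y (?N y))"
        by (rule card_mono[rotated]) (use finY B in auto)
    also have "\<dots> \<le> (\<Sum>y\<in>Y. card (insert y (?N y)))" by (rule card_UN_le[OF finY])
    finally show ?thesis .
  qed
  moreover have "8 * (144 * g) * (\<Sum>y\<in>Y. card (insert y (?N y))) \<le> card Y * (9 * card B)"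
  proof -
    have "8 * (144 * g) * card (insert y (?N y)) \<le> 9 * card B" if y: "y \<in> Y" for y
    proof -
      have "y \<in> B" "y \<notin> ?H" using y Y(1) S(1) by blast+
      then have "144 * g * card (?N y) \<le> card B" by simp
      moreover have "card (insert y (?N y)) = Suc (card (?N y))" using B by simp
      ultimately show ?thesis using n by simp
    qed
    then have "(\<Sum>y\<in>Y. 8 * (144 * g) * card (insert y (?N y))) \<le> (\<Sum>y\<in>Y. 9 * card B)"
        by (intro sum_mono)
    then show ?thesis by (simp add: sum_distrib_left)
  qed
  ultimately have "8 * (144 * g) * card (S - ?H) \<le> (12 + 6 * g) * (9 * card B)"
    by (meson mult_le_mono order_refl order_trans)
  also have "\<dots> \<le> (18 * g) * (9 * card B)" using mb(2) by (intro mult_right_mono) auto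
  finally have "1152 * (g * card (S - ?H)) \<le> 162 * (g * card B)"
      by (simp add: mult.assoc mult.left_commute)
  moreover have "g * (3 * card B) < g * (16 * card (S - ?H))" using N mb(2)
      by (intro mult_strict_left_mono) auto
  ultimately show False by simp
qed

text \<open>With \<open>q = 32\<close> the annuli have width \<open>64 * \<tau>\<close>, and the
  closeness radius \<open>66 * 64 * \<tau> = 4224 * \<tau>\<close> is half of
  \<open>Q = 8448 * \<tau>\<close>. Four rounds spoil \<open>4/32\<close> of \<open>B\<close> and
  the removed vertices account for at most another eighth, which leaves three quarters. The factor
  \<open>2304\<close> is \<open>16 * 144\<close>: Markov's inequality times the density of light
  balls.\<close>

lemma separated_functions:
  fixes adj :: "'v \<Rightarrow> 'v \<Rightarrow> bool" and c1 :: nat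
  defines "c1 \<equiv> 20002 * 8448\<^sup>2"
  assumes V: "finite V" "symp adj" "conn adj V" and BV: "B \<subseteq> V"
      and mb: "minor_bounded adj V g" "g \<ge> 1"
    and n: "8 * c1 * (2304 * g) \<le> card B"
  shows "\<exists>\<nu> \<tau> F s. \<tau> \<ge> (1::nat) \<and> (\<Sum>v\<in>V. (\<nu> v)\<^sup>2) \<le> c1 * (2304 * g) * \<tau>\<^sup>2 \<and>
     (\<forall>x\<in>V. \<forall>y\<in>V. adj x y \<longrightarrow> (if s x = s y then F x \<le> F y + (\<nu> x + \<nu> y) else F x + F y \<le> \<nu> x +
         \<nu> y)) \<and>
     card B \<le> 4 * card {x \<in> B. s x \<and> F x = \<tau>} \<and> card B \<le> 4 * card {x \<in> B. \<not> s x \<and> F x = \<tau>}"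
proof -
  define K where "K = 2304 * g"
  have c1: "c1 \<ge> 1000" by (simp add: c1_def)
  have nK: "8 * c1 * K \<le> card B" using n by (simp add: K_def)
  have K1: "K \<ge> 1" "g \<le> K" using mb(2) by (auto simp: K_def)
  have "8000 * K \<le> 8 * c1 * K" using c1 by (intro mult_right_mono) auto
  then have nK': "8000 * K \<le> card B" using nK by linarith
  have finB: "finite B" using BV V(1) finite_subset by blast
  have Bne: "B \<noteq> {}" using nK' K1 by auto
  obtain \<nu> Q where Q: "Q \<ge> 1" "8448 dvd Q" "\<And>v. v \<in> V \<Longrightarrow> \<nu> v \<ge> 1"
      "real (\<Sum>v\<in>V. (\<nu> v)\<^sup>2) \<le> 20002 * real K * (real Q)\<^sup>2"
     "\<And>L. 2 * L \<le> Q \<Longrightarrow> real K * real (card {(x, y). x \<in> B \<and> y \<in> B \<and> x \<noteq> y \<and> close adj V \<nu> L x y}) \<le>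
         (real (card B))\<^sup>2"
  proof -
    have "64 * K \<le> card B" using nK' by linarith
    from spread_weight[OF V BV mb(1) K1 this, of 8448, simplified] obtain \<nu> Q
        where "1 \<le> Q \<and> 8448 dvd Q \<and> (\<forall>v\<in>V. 1 \<le> \<nu> v) \<and>
      real (\<Sum>v\<in>V. (\<nu> v)\<^sup>2) \<le> 20002 * real K * (real Q)\<^sup>2 \<and>
      (\<forall>L. 2 * L \<le> Q \<longrightarrow> real K * real (card {(x, y). x \<in> B \<and> y \<in> B \<and> x \<noteq> y \<and> close adj V \<nu> L x y}) \<le>
          (real (card B))\<^sup>2)"
      by (elim exE) simp
    then show thesis by (elim conjE) (rule that, auto)
  qed
  obtain \<tau> where \<tau>: "Q = 8448 * \<tau>" using Q(2) by blast
  have \<tau>1: "\<tau> \<ge> 1" using Q(1) \<tau> by simp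
  have sq: "(\<Sum>v\<in>V. (\<nu> v)\<^sup>2) \<le> c1 * K * \<tau>\<^sup>2"
  proof -
    have "20002 * real K * (real Q)\<^sup>2 = real (c1 * K * \<tau>\<^sup>2)" unfolding \<tau> c1_def
        by (simp add: power_mult_distrib)
    then show ?thesis using Q(4) by (simp only: of_nat_le_iff)
  qed
  define L where "L = 66 * (2 * \<tau> * 32)"
  have "16 * (144 * g) * card {(x, y). x \<in> B \<and> y \<in> B \<and> x \<noteq> y \<and> close adj V \<nu> L x y} \<le> (card B)\<^sup>2"
  proof -
    have "2 * L \<le> Q" by (simp add: L_def \<tau>)
    from Q(5)[OF this] have "real (K * card {(x, y). x \<in> B \<and> y \<in> B \<and> x \<noteq> y \<and> close adj V \<nu> L x y}) \<le>
        real ((card B)\<^sup>2)" by simp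
    then show ?thesis unfolding of_nat_le_iff by (simp add: K_def)
  qed
  note heavy = few_heavy_points[OF finB Bne this]
  \<comment> \<open>The slope condition allows a drop from \<open>\<tau>\<close> to 0 at such a
    vertex, so it can be removed, which also provides the weight bound that chopping requires. The
    bound on the squared weights limits these vertices to an eighth of
    \<open>card B\<close>.\<close>
  define Big where "Big = {v \<in> V. \<tau> \<le> \<nu> v}"
  define X where "X = V - Big"
  have "card Big * \<tau>\<^sup>2 = (\<Sum>v\<in>Big. \<tau>\<^sup>2)" by simp
  also have "\<dots> \<le> (\<Sum>v\<in>Big. (\<nu> v)\<^sup>2)" by (rule sum_mono) (auto simp: Big_def intro: power_mono)
  also have "\<dots> \<le> (\<Sum>v\<in>V. (\<nu> v)\<^sup>2)" by (rule sum_mono2) (use V(1) in \<open>auto simp: Big_def\<close>)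
  finally have "card Big * \<tau>\<^sup>2 \<le> c1 * K * \<tau>\<^sup>2" using sq by linarith
  then have "card Big \<le> c1 * K" using \<tau>1 by simp
  then have Big8: "8 * card Big \<le> card B" using nK by linarith
  have XV: "X \<subseteq> V" by (auto simp: X_def)
  have \<nu>X: "1 \<le> \<nu> x \<and> \<nu> x \<le> 2 * \<tau> * 32" if "x \<in> X" for x using that Q(3)[of x]
      by (auto simp: X_def Big_def)
  define B0 where "B0 = B \<inter> X"
  have B0: "finite B0" "B0 \<subseteq> X" using finB by (auto simp: B0_def)
  obtain cl F where pd: "(\<forall>x\<in>X. x \<in> cl x \<and> chopped adj \<nu> (2 * \<tau> * 32) X 4 (cl x) \<and> (\<forall>y\<in>cl x. cl y =
      cl x)) \<and> (\<forall>x. F x \<le> \<tau>) \<and>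
    (\<forall>x\<in>X. \<forall>y\<in>X. adj x y \<longrightarrow> (if cl x = cl y then F x \<le> F y + (\<nu> x + \<nu> y) else F x + F y \<le> \<nu> x +
        \<nu> y)) \<and>
    32 * card {x \<in> B0. F x < \<tau>} \<le> 4 * card B0"
    using padded_decomposition[OF V(2) B0 \<tau>1, of 32 \<nu> 4] by (elim meta_impE exE) simp_all
  have cl: "x \<in> cl x" "chopped adj \<nu> (2 * \<tau> * 32) X 4 (cl x)" "y \<in> cl x \<Longrightarrow> cl y = cl x" if "x \<in> X"
      for x y
    using bspec[OF conjunct1[OF pd] that] by blast+
  note pd = conjunct2[OF pd]
  have F: "F x \<le> \<tau>" for x using conjunct1[OF pd] by simp
  note pd = conjunct2[OF pd]
  have Fadj: "if cl x = cl y then F x \<le> F y + (\<nu> x + \<nu> y) else F x + F y \<le> \<nu> x + \<nu> y"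
      if "x \<in> X" "y \<in> X" "adj x y" for x y
    by (rule conjunct1[OF pd, rule_format, OF that])
  note Fcard = conjunct2[OF pd]
  define B' where "B' = {x \<in> B0. F x = \<tau>}"
  have B': "finite B'" "B' \<subseteq> B" "B' \<subseteq> X" using B0 by (simp add: B'_def, auto simp: B'_def B0_def)
  have mass: "3 * card B \<le> 4 * card B'"
  proof -
    have "card B \<le> card (B0 \<union> Big)" by (rule card_mono) (use B0 V(1) BV in \<open>auto simp: B0_def X_def
        Big_def\<close>)
    also have "\<dots> \<le> card B0 + card Big" by (rule card_Un_le)
    finally have 1: "card B \<le> card B0 + card Big" .
    have "B0 = B' \<union> {x \<in> B0. F x < \<tau>}" using F by (auto simp: B'_def not_less intro: antisym)
    then have "card B0 \<le> card B' + card {x \<in> B0. F x < \<tau>}" using card_Un_le by metis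
    moreover have "card B0 \<le> card B" by (rule card_mono[OF finB]) (auto simp: B0_def)
    ultimately show ?thesis using 1 Fcard Big8 by linarith
  qed
  define \<C> where "\<C> = cl ` X"
  have fin\<C>: "finite \<C>" using V(1) by (simp add: \<C>_def X_def)
  have sumC: "(\<Sum>C\<in>\<D>. card (C \<inter> B')) = card {x \<in> B'. cl x \<in> \<D>}" if D: "\<D> \<subseteq> \<C>" for \<D>
  proof -
    have mem: "cl x = C" if "C \<in> \<D>" "x \<in> C" for x C
    proof -
      obtain z where "z \<in> X" "C = cl z" using \<open>C \<in> \<D>\<close> D by (auto simp: \<C>_def)
      then show ?thesis using cl(3)[of z x] \<open>x \<in> C\<close> by simp
    qed
    have "(\<Union>C\<in>\<D>. C \<inter> B') = {x \<in> B'. cl x \<in> \<D>}"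
    proof (intro equalityI subsetI)
      fix x assume "x \<in> (\<Union>C\<in>\<D>. C \<inter> B')"
      then obtain C where "C \<in> \<D>" "x \<in> C" "x \<in> B'" by blast
      then show "x \<in> {x \<in> B'. cl x \<in> \<D>}" using mem[of C x] by simp
    next
      fix x assume x: "x \<in> {x \<in> B'. cl x \<in> \<D>}"
      then have "x \<in> cl x" using cl(1) B'(3) by blast
      then show "x \<in> (\<Union>C\<in>\<D>. C \<inter> B')" using x by blast
    qed
    moreover have "card (\<Union>C\<in>\<D>. C \<inter> B') = (\<Sum>C\<in>\<D>. card (C \<inter> B'))"
    proof (rule card_UN_disjoint)
      show "finite \<D>" using D fin\<C> finite_subset by blast
      show "\<forall>C\<in>\<D>. finite (C \<inter> B')" using B' by simp
      show "\<forall>C\<in>\<D>. \<forall>C'\<in>\<D>. C \<noteq> C' \<longrightarrow> C \<inter> B' \<inter> (C' \<inter> B') = {}"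
      proof (intro ballI impI)
        fix C C' assume C: "C \<in> \<D>" "C' \<in> \<D>" "C \<noteq> C'"
        have False if "x \<in> C" "x \<in> C'" for x using mem[OF C(1) that(1)] mem[OF C(2) that(2)] C(3)
            by simp
        then show "C \<inter> B' \<inter> (C' \<inter> B') = {}" by blast
      qed
    qed
    ultimately show ?thesis by simp
  qed
  have "4 * card (C \<inter> B') \<le> card B" if C: "C \<in> \<C>" for C
  proof -
    obtain x where x: "x \<in> X" "C = cl x" using C by (auto simp: \<C>_def)
    show ?thesis
    proof (rule cluster_mass_bound[OF V(2,1) XV \<nu>X mb, where C = C])
      show "chopped adj \<nu> (2 * \<tau> * 32) X 4 C" using cl(2)[OF x(1)] x(2) by simp
      show "16 * card {x \<in> B. card B < 144 * g * card {y \<in> B. x \<noteq> y \<and>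
          close adj V \<nu> (66 * (2 * \<tau> * 32)) x y}} \<le> card B"
        using heavy unfolding L_def .
      show "8 * (144 * g) \<le> card B" using nK' by (simp add: K_def)
    qed (use finB B' in auto)
  qed
  moreover have "3 * card B \<le> 4 * (\<Sum>C\<in>\<C>. card (C \<inter> B'))"
  proof -
    have "{x \<in> B'. cl x \<in> \<C>} = B'" using B'(3) by (auto simp: \<C>_def)
    then show ?thesis using sumC[OF order_refl] mass by simp
  qed
  ultimately obtain \<A> where A: "\<A> \<subseteq> \<C>" "card B \<le> 4 * (\<Sum>C\<in>\<A>. card (C \<inter> B'))"
      "card B \<le> 4 * (\<Sum>C\<in>\<C> - \<A>. card (C \<inter> B'))"
    using balanced_split[OF fin\<C>, of "\<lambda>C. card (C \<inter> B')" "card B"] by blast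
  define s where "s x \<longleftrightarrow> cl x \<in> \<A>" for x
  \<comment> \<open>The value 0 off \<open>X\<close> makes the slope condition hold on edges at
    removed vertices, as \<open>F\<close> never exceeds \<open>\<tau>\<close>.\<close>
  define F' where "F' x = (if x \<in> X then F x else 0)" for x
  have F'\<tau>: "F' x \<le> \<tau>" for x using F[of x] by (simp add: F'_def)
  have side: "if s x = s y then F' x \<le> F' y + (\<nu> x + \<nu> y) else F' x + F' y \<le> \<nu> x + \<nu> y"
    if xy: "x \<in> V" "y \<in> V" "adj x y" for x y
  proof (cases "x \<in> X \<and> y \<in> X")
    case True
    then have "F' x = F x" "F' y = F y" by (auto simp: F'_def)
    moreover have "cl x \<noteq> cl y" if "s x \<noteq> s y" using that by (auto simp: s_def)
    ultimately show ?thesis using Fadj[of x y] True xy(3) by (cases "cl x = cl y") auto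
  next
    case False
    then have "\<tau> \<le> \<nu> x \<and> F' x = 0 \<or> \<tau> \<le> \<nu> y \<and> F' y = 0" using xy(1,2)
        by (auto simp: X_def Big_def F'_def)
    then show ?thesis using F'\<tau>[of x] F'\<tau>[of y] by auto
  qed
  have "{x \<in> B'. cl x \<in> \<A>} = {x \<in> B. s x \<and> F' x = \<tau>}" using \<tau>1
      by (auto simp: B'_def B0_def s_def F'_def split: if_splits)
  then have side1: "card B \<le> 4 * card {x \<in> B. s x \<and> F' x = \<tau>}" using A(2) sumC[OF A(1)] by simp
  have "{x \<in> B'. cl x \<in> \<C> - \<A>} = {x \<in> B. \<not> s x \<and> F' x = \<tau>}" using \<tau>1
      by (auto simp: B'_def B0_def s_def F'_def \<C>_def split: if_splits)
  then have side2: "card B \<le> 4 * card {x \<in> B. \<not> s x \<and> F' x = \<tau>}"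
      using A(3) sumC[OF Diff_subset, of \<A>] by simp
  show ?thesis
    by (intro exI[of _ \<nu>] exI[of _ \<tau>] exI[of _ F'] exI[of _ s] conjI ballI impI side \<tau>1 side1 side2
      sq[unfolded K_def])
qed

section \<open>The second Steklov eigenvalue\<close>

lemma minor_bounded_subset: "minor_bounded adj V g \<Longrightarrow> W \<subseteq> V \<Longrightarrow> minor_bounded adj W g"
  unfolding minor_bounded_def by (elim all_forward, intro impI, elim impE, elim conjE, intro conjI)
      (blast | assumption)+

lemma square_diff_le: "(a - b)\<^sup>2 \<le> 2 * (a\<^sup>2 + b\<^sup>2)" for a b :: real
proof -
  have "0 \<le> (a + b) * (a + b)" by simp
  then show ?thesis by (simp add: power2_eq_square algebra_simps)
qed

section \<open>Rayleigh quotients of the test functions\<close>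

text \<open>Each edge is charged to its two ends, and a vertex is charged at most \<open>D\<close>
  times.\<close>

lemma energy_le:
  assumes G: "simple_graph V E" and D: "max_degree_le V E D" and M: "M \<ge> 0" and w: "\<And>x. w x \<ge> 0"
    and h: "\<And>x y. x \<in> V \<Longrightarrow> y \<in> nbrs E x \<Longrightarrow> (h x - h y)\<^sup>2 \<le> M * (w x + w y)"
  shows "energy V E h h \<le> M * real D * sum w V"
proof -
  have "(\<Sum>x\<in>V. \<Sum>y\<in>nbrs E x. (h x - h y) * (h x - h y)) \<le> (\<Sum>x\<in>V. \<Sum>y\<in>nbrs E x. M * w x + M * w y)"
    by (intro sum_mono) (use h in \<open>simp add: power2_eq_square distrib_left\<close>)
  also have "\<dots> = (\<Sum>x\<in>V. \<Sum>y\<in>nbrs E x. M * w x) + (\<Sum>x\<in>V. \<Sum>y\<in>nbrs E x. M * w y)"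
    by (simp add: sum.distrib)
  also have "(\<Sum>x\<in>V. \<Sum>y\<in>nbrs E x. M * w y) = (\<Sum>x\<in>V. \<Sum>y\<in>nbrs E x. M * w x)"
    by (rule sum_nbrs_swap[OF G])
  finally have "energy V E h h \<le> (\<Sum>x\<in>V. \<Sum>y\<in>nbrs E x. M * w x)" unfolding energy_def by simp
  also have "\<dots> = (\<Sum>x\<in>V. real (card (nbrs E x)) * (M * w x))" by simp
  also have "\<dots> \<le> (\<Sum>x\<in>V. real D * (M * w x))"
    by (intro sum_mono mult_right_mono) (use D M w in \<open>auto simp: max_degree_le_def\<close>)
  also have "\<dots> = M * real D * sum w V" by (simp add: sum_distrib_left mult_ac)
  finally show ?thesis .
qed

lemma inner_on_ge:
  assumes "finite B" "T \<subseteq> B" shows "(\<Sum>x\<in>T. (h x)\<^sup>2) \<le> inner_on B h h"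
  unfolding inner_on_def using assms by (simp add: power2_eq_square[symmetric]) (rule sum_mono2,
      auto)

text \<open>Two point masses on the boundary serve as test functions. This handles boundaries that
  are small compared with \<open>g\<close>.\<close>

lemma steklov_second_le_degree:
  assumes G: "simple_graph V E" and D: "max_degree_le V E D" and B: "B \<subseteq> V" "card B \<ge> 2"
  shows "steklov_eigenvalue V E B 2 \<le> 2 * real D"
proof -
  obtain S where S: "S \<subseteq> B" "card S = 2" using obtain_subset_with_card_n[OF B(2)] by metis
  then obtain a b where ab: "a \<in> B" "b \<in> B" "a \<noteq> b" by (auto simp: card_2_iff)
  have fin: "finite V" "finite B" using G B finite_subset by (auto simp: simple_graph_def)
  show ?thesis
  proof (rule steklov_second_le[OF G B, of "\<lambda>x. of_bool (x = a)" "\<lambda>x. of_bool (x = b)"])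
    fix c d :: real assume cd: "c \<noteq> 0 \<or> d \<noteq> 0"
    let ?h = "\<lambda>x. c * of_bool (x = a) + d * of_bool (x = b)"
    have "(\<Sum>x\<in>{a, b}. (?h x)\<^sup>2) \<le> inner_on B ?h ?h" by (rule inner_on_ge) (use fin ab in auto)
    then have ge: "c\<^sup>2 + d\<^sup>2 \<le> inner_on B ?h ?h" using ab by simp
    have "energy V E ?h ?h \<le> 2 * real D * (\<Sum>x\<in>V. (?h x)\<^sup>2)"
    proof (rule energy_le[OF G D])
      fix x y
      show "(?h x - ?h y)\<^sup>2 \<le> 2 * ((?h x)\<^sup>2 + (?h y)\<^sup>2)" by (rule square_diff_le)
    qed simp_all
    also have "(\<Sum>x\<in>V. (?h x)\<^sup>2) = (\<Sum>x\<in>{a, b}. (?h x)\<^sup>2)"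
        by (rule sum.mono_neutral_right) (use fin ab B in auto)
    also have "\<dots> = c\<^sup>2 + d\<^sup>2" using ab by simp
    also have "2 * real D * (c\<^sup>2 + d\<^sup>2) \<le> 2 * real D * inner_on B ?h ?h" using ge
        by (rule mult_left_mono) simp
    finally have "energy V E ?h ?h \<le> 2 * real D * inner_on B ?h ?h" .
    moreover have "c\<^sup>2 + d\<^sup>2 > 0" using cd by (simp add: sum_power2_gt_zero_iff)
    ultimately show "0 < inner_on B ?h ?h \<and> energy V E ?h ?h \<le> 2 * real D * inner_on B ?h ?h"
        using ge by linarith
  qed
qed

lemma symp_edge: "symp (\<lambda>x y. {x, y} \<in> E)"
  by (simp add: symp_def insert_commute)

text \<open>The indicators of a component and of its complement have energy 0, and neither vanishes
  on \<open>B\<close>.\<close>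

lemma steklov_second_le_disconnected:
  assumes G: "simple_graph V E" and B: "B \<subseteq> V" "card B \<ge> 2"
    and ab: "a \<in> B" "b \<in> B" "b \<notin> component (\<lambda>x y. {x, y} \<in> E) V a"
  shows "steklov_eigenvalue V E B 2 \<le> 0"
proof -
  let ?adj = "\<lambda>x y. {x, y} \<in> E"
  let ?A = "component ?adj V a"
  have fin: "finite V" "finite B" using G B finite_subset by (auto simp: simple_graph_def)
  have aA: "a \<in> ?A" using component_self[of a V ?adj] ab(1) B(1) by blast
  have ne: "a \<noteq> b" using aA ab(3) by blast
  have step: "y \<in> ?A" if "x \<in> ?A" "{x, y} \<in> E" for x y
  proof -
    have "y \<in> V" using G that(2) by (auto simp: simple_graph_def)
    then show ?thesis using component_step[of x ?adj V a y] that by simp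
  qed
  have iff: "x \<in> ?A \<longleftrightarrow> y \<in> ?A" if "{x, y} \<in> E" for x y using step[of x y] step[of y x] that
      by (auto simp: insert_commute)
  show ?thesis
  proof (rule steklov_second_le[OF G B, of "\<lambda>x. of_bool (x \<in> ?A)" "\<lambda>x. of_bool (x \<notin> ?A)"])
    fix c d :: real assume cd: "c \<noteq> 0 \<or> d \<noteq> 0"
    let ?h = "\<lambda>x. c * of_bool (x \<in> ?A) + d * of_bool (x \<notin> ?A)"
    have "(\<Sum>x\<in>{a, b}. (?h x)\<^sup>2) \<le> inner_on B ?h ?h" by (rule inner_on_ge) (use fin ab in auto)
    then have "c\<^sup>2 + d\<^sup>2 \<le> inner_on B ?h ?h" using ne aA ab(3) by simp
    moreover have "c\<^sup>2 + d\<^sup>2 > 0" using cd by (simp add: sum_power2_gt_zero_iff)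
    moreover have "energy V E ?h ?h = 0"
    proof -
      have "?h x = ?h y" if "y \<in> nbrs E x" for x y using iff[of x y] that by (simp add: nbrs_def)
      then show ?thesis unfolding energy_def by (simp del: mult_eq_0_iff)
    qed
    ultimately show "0 < inner_on B ?h ?h \<and> energy V E ?h ?h \<le> 0 * inner_on B ?h ?h" by simp
  qed
qed

text \<open>The test functions are \<open>F\<close> restricted to the two sides of \<open>s\<close>.
  On edges between the sides both values together are at most \<open>\<nu> x + \<nu> y\<close>, so a
  combination with coefficients \<open>c\<close>, \<open>d\<close> has squared increments at most
  \<open>(c\<^sup>2 + d\<^sup>2) * (\<nu> x + \<nu> y)\<^sup>2\<close> on all edges. The 8 is the 2
  from squaring this sum times the 4 from the quarter of \<open>B\<close>.\<close>

lemma steklov_second_le_separated: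
  fixes \<nu> F :: "'a \<Rightarrow> real"
  assumes G: "simple_graph V E" and D: "max_degree_le V E D" and B: "B \<subseteq> V" "card B \<ge> 2"
      and \<tau>: "\<tau> > 0"
    and F: "\<And>x. F x \<ge> 0"
    and adj: "\<And>x y. {x, y} \<in> E \<Longrightarrow> (if s x = s y then F x \<le> F y + (\<nu> x + \<nu> y) else F x + F y \<le> \<nu> x +
        \<nu> y)"
    and B1: "real (card B) \<le> 4 * real (card {x \<in> B. s x \<and> F x = \<tau>})"
    and B2: "real (card B) \<le> 4 * real (card {x \<in> B. \<not> s x \<and> F x = \<tau>})"
  shows "steklov_eigenvalue V E B 2 \<le> 8 * real D * (\<Sum>x\<in>V. (\<nu> x)\<^sup>2) / (\<tau>\<^sup>2 * real (card B))"
proof -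
  have fin: "finite V" "finite B" using G B finite_subset by (auto simp: simple_graph_def)
  have n: "real (card B) > 0" using B(2) by simp
  let ?f = "\<lambda>x. of_bool (s x) * F x" let ?g = "\<lambda>x. of_bool (\<not> s x) * F x"
  let ?N = "\<Sum>x\<in>V. (\<nu> x)\<^sup>2"
  show ?thesis
  proof (rule steklov_second_le[OF G B, of ?f ?g])
    fix c d :: real assume cd: "c \<noteq> 0 \<or> d \<noteq> 0"
    let ?h = "\<lambda>x. c * ?f x + d * ?g x"
    define S T where "S = {x \<in> B. s x \<and> F x = \<tau>}" and "T = {x \<in> B. \<not> s x \<and> F x = \<tau>}"
    have cd0: "c\<^sup>2 + d\<^sup>2 > 0" using cd by (simp add: sum_power2_gt_zero_iff)
    have "(\<Sum>x\<in>S \<union> T. (?h x)\<^sup>2) \<le> inner_on B ?h ?h"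
        by (rule inner_on_ge) (use fin in \<open>auto simp: S_def T_def\<close>)
    also have "(\<Sum>x\<in>S \<union> T. (?h x)\<^sup>2) = (\<Sum>x\<in>S. (?h x)\<^sup>2) + (\<Sum>x\<in>T. (?h x)\<^sup>2)"
      by (rule sum.union_disjoint) (use fin in \<open>auto simp: S_def T_def\<close>)
    also have "(\<Sum>x\<in>S. (?h x)\<^sup>2) = (\<Sum>x\<in>S. (c * \<tau>)\<^sup>2)" by (rule sum.cong) (auto simp: S_def)
    also have "(\<Sum>x\<in>T. (?h x)\<^sup>2) = (\<Sum>x\<in>T. (d * \<tau>)\<^sup>2)" by (rule sum.cong) (auto simp: T_def)
    finally have "real (card S) * (c * \<tau>)\<^sup>2 + real (card T) * (d * \<tau>)\<^sup>2 \<le> inner_on B ?h ?h" by simp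
    moreover have "real (card B) / 4 * (c * \<tau>)\<^sup>2 \<le> real (card S) * (c * \<tau>)\<^sup>2"
      by (rule mult_right_mono) (use B1 in \<open>auto simp: S_def\<close>)
    moreover have "real (card B) / 4 * (d * \<tau>)\<^sup>2 \<le> real (card T) * (d * \<tau>)\<^sup>2"
      by (rule mult_right_mono) (use B2 in \<open>auto simp: T_def\<close>)
    ultimately have "real (card B) / 4 * (c * \<tau>)\<^sup>2 + real (card B) / 4 * (d * \<tau>)\<^sup>2 \<le>
        inner_on B ?h ?h" by linarith
    then have ge: "real (card B) / 4 * \<tau>\<^sup>2 * (c\<^sup>2 + d\<^sup>2) \<le> inner_on B ?h ?h"
      by (simp add: power_mult_distrib algebra_simps)
    have "energy V E ?h ?h \<le> 2 * (c\<^sup>2 + d\<^sup>2) * real D * ?N"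
    proof (rule energy_le[OF G D])
      fix x y assume "x \<in> V" "y \<in> nbrs E x"
      then have e: "{x, y} \<in> E" "{y, x} \<in> E" by (auto simp: nbrs_def insert_commute)
      have "(?h x - ?h y)\<^sup>2 \<le> (c\<^sup>2 + d\<^sup>2) * (\<nu> x + \<nu> y)\<^sup>2"
      proof (cases "s x = s y")
        case True
        have "\<bar>F x - F y\<bar> \<le> \<nu> x + \<nu> y" using adj[OF e(1)] adj[OF e(2)] True by auto
        then have "(F x - F y)\<^sup>2 \<le> (\<nu> x + \<nu> y)\<^sup>2"
            using power2_le_iff_abs_le[of "\<nu> x + \<nu> y" "F x - F y"] by linarith
        then have le: "k\<^sup>2 * (F x - F y)\<^sup>2 \<le> (c\<^sup>2 + d\<^sup>2) * (\<nu> x + \<nu> y)\<^sup>2" if "k = c \<or> k = d" for k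
          using that by (intro mult_mono) auto
        have "(?h x - ?h y)\<^sup>2 = (if s x then c else d)\<^sup>2 * (F x - F y)\<^sup>2"
          using True by (simp add: power_mult_distrib[symmetric] right_diff_distrib)
        also have "\<dots> \<le> (c\<^sup>2 + d\<^sup>2) * (\<nu> x + \<nu> y)\<^sup>2" by (rule le) simp
        finally show ?thesis .
      next
        case False
        have le: "F x + F y \<le> \<nu> x + \<nu> y" using adj[OF e(1)] False by simp
        have cs: "(k * u - l * v)\<^sup>2 \<le> (k\<^sup>2 + l\<^sup>2) * (\<nu> x + \<nu> y)\<^sup>2"
            if uv: "u \<ge> 0" "v \<ge> 0" "u + v \<le> \<nu> x + \<nu> y" for k l u v :: real
        proof -
          \<comment> \<open>The right-hand side is exactly the difference of the two sides of the
            next inequality.\<close>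
          have "0 \<le> (k * v + l * u)\<^sup>2 + (k\<^sup>2 + l\<^sup>2) * (2 * (u * v))" using uv by simp
          then have "(k * u - l * v)\<^sup>2 \<le> (k\<^sup>2 + l\<^sup>2) * (u + v)\<^sup>2"
              by (simp add: power2_eq_square algebra_simps)
          also have "\<dots> \<le> (k\<^sup>2 + l\<^sup>2) * (\<nu> x + \<nu> y)\<^sup>2" using uv
              by (intro mult_left_mono power_mono) auto
          finally show ?thesis .
        qed
        show ?thesis
        proof (cases "s x")
          case True
          then show ?thesis using cs[OF F F le, of c d] False by simp
        next
          case sF: False
          then show ?thesis using cs[OF F F le, of d c] False by (simp add: add.commute)
        qed
      qed
      also have "\<dots> \<le> (c\<^sup>2 + d\<^sup>2) * (2 * ((\<nu> x)\<^sup>2 + (\<nu> y)\<^sup>2))" using square_diff_le[of "\<nu> x" "- \<nu> y"]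
          by (intro mult_left_mono) simp_all
      finally show "(?h x - ?h y)\<^sup>2 \<le> 2 * (c\<^sup>2 + d\<^sup>2) * ((\<nu> x)\<^sup>2 + (\<nu> y)\<^sup>2)" by (simp only: mult_ac)
    qed simp_all
    also have "\<dots> = (8 * real D * ?N / (\<tau>\<^sup>2 * real (card B))) * (real (card B) / 4 * \<tau>\<^sup>2 * (c\<^sup>2 +
        d\<^sup>2))"
      using n \<tau> by (simp add: field_simps)
    also have "\<dots> \<le> (8 * real D * ?N / (\<tau>\<^sup>2 * real (card B))) * inner_on B ?h ?h"
      using ge by (rule mult_left_mono) (simp add: sum_nonneg)
    finally have "energy V E ?h ?h \<le> (8 * real D * ?N / (\<tau>\<^sup>2 * real (card B))) * inner_on B ?h ?h" .
    moreover have "0 < real (card B) / 4 * \<tau>\<^sup>2 * (c\<^sup>2 + d\<^sup>2)" using n \<tau> cd0 by simp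
    ultimately show "0 < inner_on B ?h ?h \<and> energy V E ?h ?h \<le>
        8 * real D * ?N / (\<tau>\<^sup>2 * real (card B)) * inner_on B ?h ?h"
      using ge by linarith
  qed
qed

text \<open>If \<open>B\<close> meets two components the eigenvalue is at most 0. Below the
  threshold on \<open>card B\<close> the bound \<open>2 * D\<close> already has the required form,
  and this case determines the factor 16. Otherwise the separated functions of the component
  containing \<open>B\<close> apply.\<close>

lemma steklov_second_le_minor_bounded:
  fixes c1 :: nat
  defines "c1 \<equiv> 20002 * 8448\<^sup>2"
  assumes G: "simple_graph V E" and D: "max_degree_le V E D" and B: "B \<subseteq> V" "card B \<ge> 2"
    and mb: "minor_bounded (\<lambda>x y. {x, y} \<in> E) V g" "g \<ge> 1"
  shows "steklov_eigenvalue V E B 2 \<le> 16 * real D * real (c1 * (2304 * g)) / real (card B)"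
proof -
  let ?adj = "\<lambda>x y. {x, y} \<in> E"
  have fin: "finite V" using G by (simp add: simple_graph_def)
  have n: "real (card B) > 0" using B(2) by simp
  have "B \<noteq> {}" using B(2) by auto
  then obtain a where a: "a \<in> B" by blast
  define V0 where "V0 = component ?adj V a"
  have V0V: "V0 \<subseteq> V" unfolding V0_def by (rule component_subset)
  consider (disc) "\<not> B \<subseteq> V0" | (small) "card B < 8 * c1 * (2304 * g)" | (large) "B \<subseteq> V0"
      "8 * c1 * (2304 * g) \<le> card B"
    by linarith
  then show ?thesis
  proof cases
    case disc
    then obtain b where "b \<in> B" "b \<notin> V0" by blast
    then have "steklov_eigenvalue V E B 2 \<le> 0"
      using steklov_second_le_disconnected[OF G B a] unfolding V0_def by blast
    also have "0 \<le> 16 * real D * real (c1 * (2304 * g)) / real (card B)" by simp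
    finally show ?thesis .
  next
    case small
    then have "real (card B) \<le> 8 * real (c1 * (2304 * g))" by linarith
    then have "2 * real D * real (card B) \<le> 2 * real D * (8 * real (c1 * (2304 * g)))"
        by (rule mult_left_mono) simp
    then have "2 * real D \<le> 16 * real D * real (c1 * (2304 * g)) / real (card B)" using n
        by (simp add: field_simps)
    then show ?thesis using steklov_second_le_degree[OF G D B] by linarith
  next
    case large
    have "\<exists>\<nu> \<tau> F s. \<tau> \<ge> (1::nat) \<and> (\<Sum>v\<in>V0. (\<nu> v)\<^sup>2) \<le> c1 * (2304 * g) * \<tau>\<^sup>2 \<and>
       (\<forall>x\<in>V0. \<forall>y\<in>V0. {x, y} \<in> E \<longrightarrow> (if s x = s y then F x \<le> F y + (\<nu> x + \<nu> y) else F x + F y \<le> \<nu> x +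
           \<nu> y)) \<and>
       card B \<le> 4 * card {x \<in> B. s x \<and> F x = \<tau>} \<and> card B \<le> 4 * card {x \<in> B. \<not> s x \<and> F x = \<tau>}"
      unfolding c1_def
    proof (rule separated_functions[OF finite_subset[OF V0V fin] symp_edge _ large(1)
        minor_bounded_subset[OF mb(1) V0V] mb(2)])
      show "conn ?adj V0" unfolding V0_def by (rule conn_component[OF symp_edge])
      show "8 * (20002 * 8448\<^sup>2) * (2304 * g) \<le> card B" using large(2) unfolding c1_def .
    qed
    then obtain \<nu> \<tau> F s where \<tau>: "\<tau> \<ge> (1::nat)" and sq: "(\<Sum>v\<in>V0. (\<nu> v)\<^sup>2) \<le> c1 * (2304 * g) * \<tau>\<^sup>2"
      and adj: "\<forall>x\<in>V0. \<forall>y\<in>V0. {x, y} \<in> E \<longrightarrow> (if s x = s y then F x \<le> F y + (\<nu> x + \<nu> y) else F x +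
          F y \<le> \<nu> x + \<nu> y)"
      and side: "card B \<le> 4 * card {x \<in> B. s x \<and> F x = \<tau>}"
          "card B \<le> 4 * card {x \<in> B. \<not> s x \<and> F x = \<tau>}"
      by (elim exE conjE)
    \<comment> \<open>Extension by 0 keeps the edge condition, as no edge leaves the
      component.\<close>
    define F' where "F' x = (if x \<in> V0 then real (F x) else 0)" for x
    define \<nu>' where "\<nu>' x = (if x \<in> V0 then real (\<nu> x) else 0)" for x
    have FB: "F' x = real \<tau> \<longleftrightarrow> F x = \<tau>" if "x \<in> B" for x using that large(1) by (auto simp: F'_def)
    have "steklov_eigenvalue V E B 2 \<le> 8 * real D * (\<Sum>x\<in>V. (\<nu>' x)\<^sup>2) / ((real \<tau>)\<^sup>2 * real (card B))"
    proof (rule steklov_second_le_separated[OF G D B, where F = F' and s = s])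
      show "real \<tau> > 0" using \<tau> by simp
      show "F' x \<ge> 0" for x by (simp add: F'_def)
      have "{x \<in> B. s x \<and> F' x = real \<tau>} = {x \<in> B. s x \<and> F x = \<tau>}" using FB by blast
      then show "real (card B) \<le> 4 * real (card {x \<in> B. s x \<and> F' x = real \<tau>})" using side(1) by simp
      have "{x \<in> B. \<not> s x \<and> F' x = real \<tau>} = {x \<in> B. \<not> s x \<and> F x = \<tau>}" using FB by blast
      then show "real (card B) \<le> 4 * real (card {x \<in> B. \<not> s x \<and> F' x = real \<tau>})" using side(2)
          by simp
      fix x y assume e: "{x, y} \<in> E"
      have xy: "x \<in> V" "y \<in> V" using G e by (auto simp: simple_graph_def)
      have iff: "x \<in> V0 \<longleftrightarrow> y \<in> V0"
        using component_step[of x ?adj V a y] component_step[of y ?adj V a x] e xy unfolding V0_def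
            by (auto simp: insert_commute)
      show "if s x = s y then F' x \<le> F' y + (\<nu>' x + \<nu>' y) else F' x + F' y \<le> \<nu>' x + \<nu>' y"
      proof (cases "x \<in> V0")
        case True
        then have y: "y \<in> V0" using iff by simp
        have "if s x = s y then F x \<le> F y + (\<nu> x + \<nu> y) else F x + F y \<le> \<nu> x + \<nu> y"
          using adj[rule_format, OF True y e] .
        then show ?thesis using True y by (auto simp: F'_def \<nu>'_def split: if_splits)
      next
        case False
        then show ?thesis using iff by (simp add: F'_def \<nu>'_def)
      qed
    qed
    also have "(\<Sum>x\<in>V. (\<nu>' x)\<^sup>2) = (\<Sum>x\<in>V0. (\<nu>' x)\<^sup>2)"
      by (rule sum.mono_neutral_right) (use fin V0V in \<open>auto simp: \<nu>'_def\<close>)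
    also have "\<dots> = (\<Sum>x\<in>V0. (real (\<nu> x))\<^sup>2)" by (rule sum.cong) (auto simp: \<nu>'_def)
    also have "\<dots> = real (\<Sum>x\<in>V0. (\<nu> x)\<^sup>2)" by simp
    also have "8 * real D * real (\<Sum>x\<in>V0. (\<nu> x)\<^sup>2) / ((real \<tau>)\<^sup>2 * real (card B)) \<le>
        8 * real D * real (c1 * (2304 * g) * \<tau>\<^sup>2) / ((real \<tau>)\<^sup>2 * real (card B))"
      by (intro divide_right_mono mult_left_mono) (use sq in \<open>simp_all only: of_nat_le_iff,
        simp_all\<close>)
    also have "\<dots> = 8 * real D * real (c1 * (2304 * g)) / real (card B)" using \<tau> n
        by (simp add: field_simps)
    also have "\<dots> \<le> 16 * real D * real (c1 * (2304 * g)) / real (card B)"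
        by (intro divide_right_mono mult_right_mono) auto
    finally show ?thesis .
  qed
qed

theorem theorem1p2:
  fixes D :: nat
  assumes "D \<ge> 1"
  shows "\<exists>C::real. C > 0 \<and>
    (\<forall>(V :: 'a set) E B g.
       simple_graph V E \<and> max_degree_le V E D \<and> has_genus V E g \<and> g \<ge> 1 \<and>
       B \<subseteq> V \<and> card B \<ge> 2 \<longrightarrow>
       steklov_eigenvalue V E B 2 \<le> C * (real g / real (card B)))"
proof (intro exI[of _ "16 * real D * real (20002 * 8448\<^sup>2 * 2304)"] conjI allI impI)
  show "0 < 16 * real D * real (20002 * 8448\<^sup>2 * 2304)" using assms by simp
  fix V :: "'a set" and E B g
  assume "simple_graph V E \<and> max_degree_le V E D \<and> has_genus V E g \<and> g \<ge> 1 \<and> B \<subseteq> V \<and> card B \<ge> 2"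
  then have G: "simple_graph V E" and D: "max_degree_le V E D" and B: "B \<subseteq> V" "card B \<ge> 2" and g: "g \<ge> 1"
    and em: "embeds_in V E (genus_surface g)" by (auto simp: has_genus_def)
  from steklov_second_le_minor_bounded[OF G D B embeds_minor_bounded[OF G em g] g]
  show "steklov_eigenvalue V E B 2 \<le> 16 * real D * real (20002 * 8448\<^sup>2 * 2304) * (real g / real (card B))"
    by simp
qed

end
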